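(* Let $\mathbf{P}$ be an operad with $\mathbf{P}(0)=(0)$, let $V$ be a vector space, and let $\theta_{\mathbf{P}}:\mathbf{b}_\infty\to\mathbf{P}$ be an operad morphism. Through $\theta_{\mathbf{P}}$ the free $\mathbf{P}$-algebra $F_{\mathbf{P}}(V)$ is a $\mathbf{b}_\infty$ algebra; let $\star$ be the product on $A_{\mathbf{P}}(V)=S(F_{\mathbf{P}}(V))$ associated to this $\mathbf{b}_\infty$ structure. Then $(A_{\mathbf{P}}(V),\star,\Delta)$ and $D_{\mathbf{P}}(V)$ are two bialgebras in interaction, for the action $\leftarrowtail$ of $D_{\mathbf{P}}(V)$ on $A_{\mathbf{P}}(V)$.
   Context: The base field $K$ has characteristic zero; $\Delta$ is the usual coproduct of a symmetric algebra (generators primitive). $\mathbf{b}_\infty$ algebras: a vector space $W$ with a linear map $\lfloor-,-\rfloor:S(W)\otimes S(W)\to W$, with restrictions $\lfloor-,-\rfloor_{k,l}$ to $S^k(W)\otimes S^l(W)$, such that $\lfloor-,-\rfloor_{0,k}=\lfloor-,-\rfloor_{k,0}$ is $\mathrm{Id}_W$ if $k=1$ and $0$ otherwise, and such that $\star$ defined by $u\star v=\sum_{\{I_1,\ldots,I_p\}\text{ partition of }[k+l]}\lfloor u,v\rfloor_{I_1}\cdots\lfloor u,v\rfloor_{I_p}$ ($u=x_1\cdots x_k$, $v=y_1\cdots y_l$, $\lfloor u,v\rfloor_I=\lfloor\prod_{i\in I,i\le k}x_i,\prod_{j\in I,j>k}y_{j-k}\rfloor$) satisfies $\lfloor u\star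 v,w\rfloor=\lfloor u,v\star w\rfloor$. Then $(S(W),\star,\Delta)$ is a Hopf algebra. $\mathbf{b}_\infty$ also denotes the operad of these algebras, generated by the $\lfloor-,-\rfloor_{k,l}\in\mathbf{b}_\infty(k+l)$. $F_{\mathbf{P}}(V)=\bigoplus_n\mathbf{P}(n)\otimes_{\mathfrak{S}_n}V^{\otimes n}$, where $p^\sigma\otimes x_1\cdots x_n$ is identified with $p\otimes x_{\sigma^{-1}(1)}\cdots x_{\sigma^{-1}(n)}$; the class of $p\otimes x_1\cdots x_n$ is denoted $p.(x_1\cdots x_n)$. $\mathbf{C}_V$ is the operad with $\mathbf{C}_V(n)=\mathrm{End}_K(V,V^{\otimes n})$ (linear maps $V\to V^{\otimes n}$) for $n\ge1$, $f\circ_ig=(\mathrm{Id}^{\otimes(i-1)}\otimes g\otimes\mathrm{Id}^{\otimes(m-i)})\circ f$ for $f\in\mathbf{C}_V(m)$, unit $\mathrm{Id}_V$, and $f^\sigma(x)=x_{\sigma(1)}\cdots x_{\sigma(n)}$ if $f(x)=x_1\cdots x_n$ (extended linearly). $\mathbf{P}\otimes\mathbf{C}_V$ is the operad $(\mathbf{P}(n)\otimes\mathbf{C}_V(n))_n$. For an operad $\mathbf{Q}$, $\mathrm{coinv}\,\mathbf{Q}=\bigoplus_n\mathrm{coinv}\,\mathbf{Q}(n)$ ($\mathfrak{S}_n$-coinvariants) is a right pre-Lie algebra with product induced by $p\bullet q=\sum_{i=1}^np\circ_iq$, $p\in \mathbf{Q}(n)$. For a right pre-Lie algebra $(W,\bullet)$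 put $\lfloor x,1\rfloor=x$, $\lfloor x,y\rfloor=x\bullet y$, $\lfloor x,x_1\cdots x_k\rfloor=\lfloor\lfloor x,x_1\cdots x_{k-1}\rfloor,x_k\rfloor-\sum_{i<k}\lfloor x,x_1\cdots\lfloor x_i,x_k\rfloor\cdots x_{k-1}\rfloor$; the Oudom–Guin product on $S(W)$ is $x_1\cdots x_k*v=\sum\lfloor x_1,v^{(1)}\rfloor\cdots\lfloor x_k,v^{(k)}\rfloor v^{(k+1)}$. Then $D_{\mathbf{P}}(V)=(S(\mathrm{coinv}(\mathbf{P}\otimes\mathbf{C}_V)),*,\Delta)$, isomorphic to the enveloping algebra of the Lie algebra of $\mathrm{coinv}(\mathbf{P}\otimes\mathbf{C}_V)$. Action: for $p\in\mathbf{P}(k)$, $x_1,\ldots,x_k\in V$, $q\in\mathbf{P}(n)$, $f\in\mathrm{End}_K(V,V^{\otimes n})$, $p.(x_1\cdots x_k)\leftarrowtail\overline{q\otimes f}=\sum_{i=1}^k(p\circ_iq).(x_1\cdots x_{i-1}f(x_i)x_{i+1}\cdots x_k)$; this is extended to $A_{\mathbf{P}}(V)$ by derivations for the usual product, $v_1\cdots v_k\leftarrowtail q=\sum_iv_1\cdots(v_i\leftarrowtail q)\cdots v_k$, and then to a right action of the algebra $D_{\mathbf{P}}(V)$. Bialgebras $A$, $B$ are in interaction if $B$ acts on the right on $A$ by $\leftarrowtail$ and $1_A\leftarrowtail b=\varepsilon(b)1_A$, $\varepsilon(a\leftarrowtail b)=\varepsilon(a)\varepsilon(b)$, $(a_1a_2)\leftarrowtail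 b=(a_1\leftarrowtail b^{(1)})(a_2\leftarrowtail b^{(2)})$, $\Delta(a\leftarrowtail b)=a^{(1)}\leftarrowtail b^{(1)}\otimes a^{(2)}\leftarrowtail b^{(2)}$, for all $a,a_1,a_2\in A$, $b\in B$ (products in $A$ being $\star$ here). *)

theory Defs
  imports
    Complex_Main
    "HOL-Library.Poly_Mapping"
    "HOL-Library.Function_Algebras"
    "HOL-Library.Multiset"
    "HOL-Library.Disjoint_Sets"
    "HOL-Library.FuncSet"
    "HOL-Combinatorics.Permutations"
begin

section \<open>Vector spaces, quotients, tensor products, direct sums\<close>

text \<open>A vector space over \<^typ>\<open>'k\<close> is a linear subspace (the carrier) of an ambient type with
  a scalar multiplication. Every vector space is of this form.\<close>

record ('k, 'a) vs =
  car :: "'a set"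
  scl :: "'k \<Rightarrow> 'a \<Rightarrow> 'a"

definition vspace :: "('k::field, 'a::ab_group_add) vs \<Rightarrow> bool" where
  "vspace A \<longleftrightarrow> vector_space (scl A) \<and> module.subspace (scl A) (car A)"

definition hom :: "('k, 'a::ab_group_add) vs \<Rightarrow> ('k, 'b::ab_group_add) vs \<Rightarrow> ('a \<Rightarrow> 'b) set" where
  "hom A B = {f. (\<forall>x\<in>car A. f x \<in> car B) \<and>
     (\<forall>x\<in>car A. \<forall>y\<in>car A. f (x + y) = f x + f y) \<and>
     (\<forall>c. \<forall>x\<in>car A. f (scl A c x) = scl B c (f x))}"

definition bihom :: "('k, 'a::ab_group_add) vs \<Rightarrow> ('k, 'b::ab_group_add) vs \<Rightarrow>
    ('k, 'c::ab_group_add) vs \<Rightarrow> ('a \<Rightarrow> 'b \<Rightarrow> 'c) set" where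
  "bihom A B C = {f. (\<forall>x\<in>car A. f x \<in> hom B C) \<and> (\<forall>y\<in>car B. (\<lambda>x. f x y) \<in> hom A C)}"

definition ground :: "('k::field, 'k) vs" where
  "ground = \<lparr>car = UNIV, scl = (*)\<rparr>"

definition psc :: "'k::field \<Rightarrow> ('x \<Rightarrow>\<^sub>0 'k) \<Rightarrow> ('x \<Rightarrow>\<^sub>0 'k)" where
  "psc c p = Poly_Mapping.map ((*) c) p"

definition free :: "'x set \<Rightarrow> ('k::field, 'x \<Rightarrow>\<^sub>0 'k) vs" where
  "free X = \<lparr>car = {p. Poly_Mapping.keys p \<subseteq> X}, scl = psc\<rparr>"

abbreviation vec :: "'x \<Rightarrow> ('x \<Rightarrow>\<^sub>0 'k::field)" where
  "vec x \<equiv> Poly_Mapping.single x 1"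

definition lext :: "('k::field \<Rightarrow> 'c \<Rightarrow> 'c) \<Rightarrow> ('x \<Rightarrow> 'c) \<Rightarrow> ('x \<Rightarrow>\<^sub>0 'k) \<Rightarrow> 'c::ab_group_add" where
  "lext s \<phi> p = (\<Sum>x\<in>Poly_Mapping.keys p. s (Poly_Mapping.lookup p x) (\<phi> x))"

lemma lookup_psc: "Poly_Mapping.lookup (psc c p) x = c * Poly_Mapping.lookup p x"
  by (simp add: psc_def Poly_Mapping.map.rep_eq when_def)

lemma vector_space_psc: "vector_space (psc :: 'k::field \<Rightarrow> ('x \<Rightarrow>\<^sub>0 'k) \<Rightarrow> _)"
  by unfold_locales
    (auto intro!: poly_mapping_eqI simp: lookup_psc lookup_add algebra_simps)

text \<open>The quotient of \<open>A\<close> by the span of \<open>R \<subseteq> car A\<close> is realised on a linear complement of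
  that span, selected by choice: \<open>qproj A R\<close> is a linear idempotent whose kernel is exactly the
  span of \<open>R\<close>, and plays the role of the canonical projection. Thus an element of a quotient is
  in particular one of its own representatives, and a map out of the quotient is given by a formula
  applied to that representative.\<close>

definition qproj :: "('k::field, 'a::ab_group_add) vs \<Rightarrow> 'a set \<Rightarrow> 'a \<Rightarrow> 'a" where
  "qproj A R = (SOME f. Vector_Spaces.linear (scl A) (scl A) f \<and>
      (\<forall>x. f x = 0 \<longleftrightarrow> x \<in> module.span (scl A) R) \<and> (\<forall>x. f (f x) = f x))"

definition quot :: "('k::field, 'a::ab_group_add) vs \<Rightarrow> 'a set \<Rightarrow> ('k, 'a) vs" where
  "quot A R = \<lparr>car = qproj A R ` car A, scl = scl A\<rparr>"

lemma qproj_exists: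
  assumes "vector_space (s :: 'k::field \<Rightarrow> 'a::ab_group_add \<Rightarrow> 'a)"
  shows "\<exists>f. Vector_Spaces.linear s s f \<and> (\<forall>x. f x = 0 \<longleftrightarrow> x \<in> module.span s R) \<and> (\<forall>x. f (f x) = f x)"
proof -
  interpret vector_space s by fact
  interpret vector_space_pair s s by unfold_locales
  obtain B where B: "B \<subseteq> span R" "independent B" "span R \<subseteq> span B"
    using basis_exists[of "span R"] by metis
  have spanB: "span B = span R"
    using B span_mono[OF B(1)] by (simp add: span_span subset_antisym)
  define E where "E = extend_basis B"
  have E: "B \<subseteq> E" "independent E" "span E = UNIV"
    using B(2) extend_basis_superset independent_extend_basis span_extend_basis
    by (auto simp: E_def)
  define f where "f = construct E (\<lambda>b. if b \<in> B then 0 else b)"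
  have lin: "Vector_Spaces.linear s s f"
    unfolding f_def by (rule linear_construct[OF E(2)])
  interpret f: Vector_Spaces.linear s s f by (rule lin)
  have fB: "f b = 0" if "b \<in> B" for b
    using construct_basis[OF E(2), of b "\<lambda>b. if b \<in> B then 0 else b"] that E(1)
    by (auto simp: f_def)
  have fC: "f b = b" if "b \<in> E - B" for b
    using construct_basis[OF E(2), of b "\<lambda>b. if b \<in> B then 0 else b"] that
    by (auto simp: f_def)
  have fS: "f x = 0" if "x \<in> span B" for x
    using that fB f.eq_0_on_span by blast
  have fT: "f x = x" if "x \<in> span (E - B)" for x
    using linear_eq_on[OF lin linear_id[unfolded id_def] that] fC by auto
  have dec: "\<exists>a\<in>span B. \<exists>c\<in>span (E - B). x = a + c" for x
  proof -
    have "B \<union> (E - B) = E" using E(1) by auto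
    then have "x \<in> span (B \<union> (E - B))" using E(3) by simp
    then show ?thesis unfolding span_Un by auto
  qed
  have "f x = 0 \<longleftrightarrow> x \<in> span R" and "f (f x) = f x" for x
  proof -
    obtain a c where ac: "a \<in> span B" "c \<in> span (E - B)" "x = a + c" using dec by metis
    have fx: "f x = c" using ac fS fT by (simp add: f.add)
    show "f x = 0 \<longleftrightarrow> x \<in> span R" using fx ac fS spanB by auto
    show "f (f x) = f x" using fx ac fT by simp
  qed
  with lin show ?thesis by blast
qed

lemma
  assumes "vector_space (scl A)"
  shows linear_qproj: "Vector_Spaces.linear (scl A) (scl A) (qproj A R)"
    and qproj_eq_0_iff: "qproj A R x = 0 \<longleftrightarrow> x \<in> module.span (scl A) R"
    and qproj_idem: "qproj A R (qproj A R x) = qproj A R x"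
  using someI_ex[OF qproj_exists[OF assms, of R]] unfolding qproj_def by blast+

definition tens_rel :: "('k::field, 'a::ab_group_add) vs \<Rightarrow> ('k, 'b::ab_group_add) vs \<Rightarrow>
    (('a \<times> 'b) \<Rightarrow>\<^sub>0 'k) set" where
  "tens_rel A B =
     {vec (a + a', b) - vec (a, b) - vec (a', b) | a a' b. a \<in> car A \<and> a' \<in> car A \<and> b \<in> car B} \<union>
     {vec (a, b + b') - vec (a, b) - vec (a, b') | a b b'. a \<in> car A \<and> b \<in> car B \<and> b' \<in> car B} \<union>
     {vec (scl A c a, b) - psc c (vec (a, b)) | c a b. a \<in> car A \<and> b \<in> car B} \<union>
     {vec (a, scl B c b) - psc c (vec (a, b)) | c a b. a \<in> car A \<and> b \<in> car B}"

definition tens :: "('k::field, 'a::ab_group_add) vs \<Rightarrow> ('k, 'b::ab_group_add) vs \<Rightarrow>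
    ('k, ('a \<times> 'b) \<Rightarrow>\<^sub>0 'k) vs" where
  "tens A B = quot (free (car A \<times> car B)) (tens_rel A B)"

definition pure :: "('k::field, 'a::ab_group_add) vs \<Rightarrow> ('k, 'b::ab_group_add) vs \<Rightarrow>
    'a \<Rightarrow> 'b \<Rightarrow> (('a \<times> 'b) \<Rightarrow>\<^sub>0 'k)" where
  "pure A B a b = qproj (free (car A \<times> car B)) (tens_rel A B) (vec (a, b))"

definition dsum :: "(nat \<Rightarrow> ('k::field, 'a::ab_group_add) vs) \<Rightarrow> ('k, nat \<Rightarrow>\<^sub>0 'a) vs" where
  "dsum A = \<lparr>car = {w. \<forall>n. Poly_Mapping.lookup w n \<in> car (A n)},
             scl = (\<lambda>c w. Poly_Mapping.mapp (\<lambda>n. scl (A n) c) w)\<rparr>"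


section \<open>Tensor powers and symmetric algebras\<close>

text \<open>\<open>tword V [x\<^sub>1, \<dots>, x\<^sub>n]\<close> is the decomposable tensor \<open>x\<^sub>1 \<dots> x\<^sub>n\<close> of the \<open>n\<close>-th tensor power.\<close>

definition words :: "('k, 'v) vs \<Rightarrow> nat \<Rightarrow> 'v list set" where
  "words V n = {xs. length xs = n \<and> set xs \<subseteq> car V}"

definition tpow_rel :: "('k::field, 'v::ab_group_add) vs \<Rightarrow> nat \<Rightarrow> ('v list \<Rightarrow>\<^sub>0 'k) set" where
  "tpow_rel V n =
     {vec (xs[i := x + y]) - vec (xs[i := x]) - vec (xs[i := y]) | xs i x y.
        xs \<in> words V n \<and> i < n \<and> x \<in> car V \<and> y \<in> car V} \<union>
     {vec (xs[i := scl V c x]) - psc c (vec (xs[i := x])) | xs i c x.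
        xs \<in> words V n \<and> i < n \<and> x \<in> car V}"

definition tpow :: "('k::field, 'v::ab_group_add) vs \<Rightarrow> nat \<Rightarrow> ('k, 'v list \<Rightarrow>\<^sub>0 'k) vs" where
  "tpow V n = quot (free (words V n)) (tpow_rel V n)"

definition tword :: "('k::field, 'v::ab_group_add) vs \<Rightarrow> 'v list \<Rightarrow> ('v list \<Rightarrow>\<^sub>0 'k)" where
  "tword V xs = qproj (free (words V (length xs))) (tpow_rel V (length xs)) (vec xs)"

definition tperm :: "('k::field, 'v::ab_group_add) vs \<Rightarrow> nat \<Rightarrow> (nat \<Rightarrow> nat) \<Rightarrow>
    ('v list \<Rightarrow>\<^sub>0 'k) \<Rightarrow> ('v list \<Rightarrow>\<^sub>0 'k)" where
  \<comment> \<open>\<open>x\<^sub>1 \<dots> x\<^sub>n \<mapsto> x\<^bsub>\<sigma>(1)\<^esub> \<dots> x\<^bsub>\<sigma>(n)\<^esub>\<close>; places are numbered from 1, list positions from 0\<close>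
  "tperm V n \<sigma> = lext psc (\<lambda>xs. tword V (map (\<lambda>i. xs ! (\<sigma> i - 1)) [1..<Suc n]))"

definition tins :: "('k::field, 'v::ab_group_add) vs \<Rightarrow> nat \<Rightarrow> ('v \<Rightarrow> ('v list \<Rightarrow>\<^sub>0 'k)) \<Rightarrow>
    ('v list \<Rightarrow>\<^sub>0 'k) \<Rightarrow> ('v list \<Rightarrow>\<^sub>0 'k)" where
  \<comment> \<open>\<open>x\<^sub>1 \<dots> x\<^sub>k \<mapsto> x\<^sub>1 \<dots> x\<^bsub>i-1\<^esub> g(x\<^sub>i) x\<^bsub>i+1\<^esub> \<dots> x\<^sub>k\<close>\<close>
  "tins V i g = lext psc (\<lambda>xs. lext psc (\<lambda>ys. tword V (take (i - 1) xs @ ys @ drop i xs)) (g (xs ! (i - 1))))"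

fun tcat :: "('k::field, 'v::ab_group_add) vs \<Rightarrow> ('v list \<Rightarrow>\<^sub>0 'k) list \<Rightarrow> ('v list \<Rightarrow>\<^sub>0 'k)" where
  "tcat V [] = tword V []"
| "tcat V (t # ts) = lext psc (\<lambda>xs. lext psc (\<lambda>ys. tword V (xs @ ys)) (tcat V ts)) t"

text \<open>\<open>Sym W\<close> is presented by commutative monomials (multisets of elements of \<open>W\<close>) modulo
  multilinearity; \<open>smon W M\<close> is the product of the members of \<open>M\<close>.\<close>

definition sym_rel :: "('k::field, 'w::ab_group_add) vs \<Rightarrow> ('w multiset \<Rightarrow>\<^sub>0 'k) set" where
  "sym_rel W =
     {vec (add_mset (x + y) M) - vec (add_mset x M) - vec (add_mset y M) | M x y.
        set_mset M \<subseteq> car W \<and> x \<in> car W \<and> y \<in> car W} \<union>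
     {vec (add_mset (scl W c x) M) - psc c (vec (add_mset x M)) | M c x.
        set_mset M \<subseteq> car W \<and> x \<in> car W}"

definition Sym :: "('k::field, 'w::ab_group_add) vs \<Rightarrow> ('k, 'w multiset \<Rightarrow>\<^sub>0 'k) vs" where
  "Sym W = quot (free {M. set_mset M \<subseteq> car W}) (sym_rel W)"

definition smon :: "('k::field, 'w::ab_group_add) vs \<Rightarrow> 'w multiset \<Rightarrow> ('w multiset \<Rightarrow>\<^sub>0 'k)" where
  "smon W M = qproj (free {M. set_mset M \<subseteq> car W}) (sym_rel W) (vec M)"

definition sone :: "('k::field, 'w::ab_group_add) vs \<Rightarrow> ('w multiset \<Rightarrow>\<^sub>0 'k)" where
  "sone W = smon W {#}"

definition list_of :: "'a multiset \<Rightarrow> 'a list" where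
  "list_of M = (SOME xs. mset xs = M)"

text \<open>The coproduct for which the elements of \<open>W\<close> are primitive, i.e. the expansion of
  \<open>\<Delta>(x\<^sub>1 \<dots> x\<^sub>k) = \<Prod>\<^sub>i (x\<^sub>i \<otimes> 1 + 1 \<otimes> x\<^sub>i)\<close> over the set \<open>I\<close> of positions going to the left factor.
  The counit is the coefficient of the empty monomial, on which the relations do not bear.\<close>

definition scop :: "('k::field, 'w::ab_group_add) vs \<Rightarrow> ('w multiset \<Rightarrow>\<^sub>0 'k) \<Rightarrow>
    ((('w multiset \<Rightarrow>\<^sub>0 'k) \<times> ('w multiset \<Rightarrow>\<^sub>0 'k)) \<Rightarrow>\<^sub>0 'k)" where
  "scop W = lext psc (\<lambda>M. let xs = list_of M in
     \<Sum>I\<in>Pow {..<length xs}. pure (Sym W) (Sym W) (smon W (mset (nths xs I))) (smon W (mset (nths xs (- I)))))"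

definition scou :: "('w multiset \<Rightarrow>\<^sub>0 'k::field) \<Rightarrow> 'k" where
  "scou a = Poly_Mapping.lookup a {#}"


section \<open>Bialgebras in interaction\<close>

record (overloaded) ('k, 'a) bialg =
  sp :: "('k, 'a) vs"
  mul :: "'a \<Rightarrow> 'a \<Rightarrow> 'a"
  one :: 'a
  cop :: "'a \<Rightarrow> (('a \<times> 'a) \<Rightarrow>\<^sub>0 'k)"
  cou :: "'a \<Rightarrow> 'k"

definition is_bialgebra :: "('k::field, 'a::ab_group_add) bialg \<Rightarrow> bool" where
  "is_bialgebra B \<longleftrightarrow> (let A = sp B; T = tens A A in
     vspace A \<and>
     mul B \<in> bihom A A A \<and> one B \<in> car A \<and>
     (\<forall>a\<in>car A. mul B (one B) a = a \<and> mul B a (one B) = a) \<and>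
     (\<forall>a\<in>car A. \<forall>b\<in>car A. \<forall>c\<in>car A. mul B (mul B a b) c = mul B a (mul B b c)) \<and>
     cop B \<in> hom A T \<and> cou B \<in> hom A ground \<and>
     (\<forall>a\<in>car A. lext (scl A) (\<lambda>(x, y). scl A (cou B x) y) (cop B a) = a \<and>
                lext (scl A) (\<lambda>(x, y). scl A (cou B y) x) (cop B a) = a) \<and>
     (\<forall>a\<in>car A. lext psc (\<lambda>(x, y). lext psc (\<lambda>(x1, x2). pure A T x1 (pure A A x2 y)) (cop B x)) (cop B a)
              = lext psc (\<lambda>(x, y). pure A T x (cop B y)) (cop B a)) \<and>
     cop B (one B) = pure A A (one B) (one B) \<and> cou B (one B) = 1 \<and>
     (\<forall>a\<in>car A. \<forall>b\<in>car A.
        cop B (mul B a b) =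
          lext psc (\<lambda>(a1, a2). lext psc (\<lambda>(b1, b2). pure A A (mul B a1 b1) (mul B a2 b2)) (cop B b)) (cop B a) \<and>
        cou B (mul B a b) = cou B a * cou B b))"

definition right_action :: "('k::field, 'a::ab_group_add) vs \<Rightarrow> ('k, 'b::ab_group_add) bialg \<Rightarrow>
    ('a \<Rightarrow> 'b \<Rightarrow> 'a) \<Rightarrow> bool" where
  "right_action A B act \<longleftrightarrow> act \<in> bihom A (sp B) A \<and>
     (\<forall>a\<in>car A. act a (one B) = a) \<and>
     (\<forall>a\<in>car A. \<forall>b\<in>car (sp B). \<forall>c\<in>car (sp B). act a (mul B b c) = act (act a b) c)"

definition in_interaction :: "('k::field, 'a::ab_group_add) bialg \<Rightarrow> ('k, 'b::ab_group_add) bialg \<Rightarrow>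
    ('a \<Rightarrow> 'b \<Rightarrow> 'a) \<Rightarrow> bool" where
  "in_interaction A B act \<longleftrightarrow>
     is_bialgebra A \<and> is_bialgebra B \<and> right_action (sp A) B act \<and>
     (\<forall>b\<in>car (sp B). act (one A) b = scl (sp A) (cou B b) (one A)) \<and>
     (\<forall>a\<in>car (sp A). \<forall>b\<in>car (sp B). cou A (act a b) = cou A a * cou B b) \<and>
     (\<forall>a1\<in>car (sp A). \<forall>a2\<in>car (sp A). \<forall>b\<in>car (sp B).
        act (mul A a1 a2) b = lext (scl (sp A)) (\<lambda>(b1, b2). mul A (act a1 b1) (act a2 b2)) (cop B b)) \<and>
     (\<forall>a\<in>car (sp A). \<forall>b\<in>car (sp B).
        cop A (act a b) = lext psc (\<lambda>(a1, a2). lext psc (\<lambda>(b1, b2).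
          pure (sp A) (sp A) (act a1 b1) (act a2 b2)) (cop B b)) (cop A a))"


section \<open>Operads\<close>

text \<open>\<open>ocomp Q m n i p q\<close> is \<open>p \<circ>\<^sub>i q\<close> for \<open>p \<in> Q(m)\<close>, \<open>q \<in> Q(n)\<close>, \<open>1 \<le> i \<le> m\<close>; \<open>oact Q n \<sigma> p\<close> is \<open>p\<^sup>\<sigma>\<close>
  for \<open>p \<in> Q(n)\<close>. The components \<open>Q(n)\<close> may overlap in the ambient type, hence the explicit arities.\<close>

record ('k, 'p) operad =
  ocar :: "nat \<Rightarrow> ('k, 'p) vs"
  ocomp :: "nat \<Rightarrow> nat \<Rightarrow> nat \<Rightarrow> 'p \<Rightarrow> 'p \<Rightarrow> 'p"
  oact :: "nat \<Rightarrow> (nat \<Rightarrow> nat) \<Rightarrow> 'p \<Rightarrow> 'p"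
  ounit :: 'p

text \<open>Place \<open>a\<close> of \<open>p\<^sup>\<sigma>\<close> is place \<open>\<sigma>(a)\<close> of \<open>p\<close> (so that \<open>p\<^sup>\<sigma>(x\<^sub>1, \<dots>, x\<^sub>n) = p(x\<^bsub>\<sigma>\<^sup>-\<^sup>1(1)\<^esub>, \<dots>, x\<^bsub>\<sigma>\<^sup>-\<^sup>1(n)\<^esub>)\<close>), and
  \<open>(p\<^sup>\<sigma>)\<^sup>\<tau> = p\<^bsup>\<sigma>\<tau>\<^esup>\<close>. Accordingly \<open>\<rho> = pcomp m n i \<sigma> \<tau>\<close> is the permutation of \<open>{1..m+n-1}\<close> with
  \<open>p\<^sup>\<sigma> \<circ>\<^sub>i q\<^sup>\<tau> = (p \<circ>\<^bsub>\<sigma>(i)\<^esub> q)\<^sup>\<rho>\<close>.\<close>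

definition pcomp :: "nat \<Rightarrow> nat \<Rightarrow> nat \<Rightarrow> (nat \<Rightarrow> nat) \<Rightarrow> (nat \<Rightarrow> nat) \<Rightarrow> nat \<Rightarrow> nat" where
  "pcomp m n i \<sigma> \<tau> a =
     (let shift = (\<lambda>b. if b < \<sigma> i then b else b + n - 1) in
      if a < i then shift (\<sigma> a)
      else if a < i + n then \<sigma> i - 1 + \<tau> (a + 1 - i)
      else if a < m + n then shift (\<sigma> (a + 1 - n))
      else a)"

definition is_operad :: "('k::field, 'p::ab_group_add) operad \<Rightarrow> bool" where
  "is_operad Q \<longleftrightarrow>
     (\<forall>n. vspace (ocar Q n)) \<and>
     (\<forall>m n i. 1 \<le> i \<and> i \<le> m \<longrightarrow> ocomp Q m n i \<in> bihom (ocar Q m) (ocar Q n) (ocar Q (m + n - 1))) \<and>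
     (\<forall>n \<sigma>. \<sigma> permutes {1..n} \<longrightarrow> oact Q n \<sigma> \<in> hom (ocar Q n) (ocar Q n)) \<and>
     ounit Q \<in> car (ocar Q 1) \<and>
     (\<forall>n. \<forall>p\<in>car (ocar Q n). ocomp Q 1 n 1 (ounit Q) p = p \<and>
        (\<forall>i. 1 \<le> i \<and> i \<le> n \<longrightarrow> ocomp Q n 1 i p (ounit Q) = p)) \<and>
     (\<forall>l m n i j. \<forall>p\<in>car (ocar Q l). \<forall>q\<in>car (ocar Q m). \<forall>r\<in>car (ocar Q n).
        1 \<le> i \<and> i \<le> l \<and> 1 \<le> j \<and> j \<le> m \<longrightarrow>
        ocomp Q (l + m - 1) n (i - 1 + j) (ocomp Q l m i p q) r =
        ocomp Q l (m + n - 1) i p (ocomp Q m n j q r)) \<and>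
     (\<forall>l m n i j. \<forall>p\<in>car (ocar Q l). \<forall>q\<in>car (ocar Q m). \<forall>r\<in>car (ocar Q n).
        1 \<le> i \<and> i < j \<and> j \<le> l \<longrightarrow>
        ocomp Q (l + m - 1) n (j + m - 1) (ocomp Q l m i p q) r =
        ocomp Q (l + n - 1) m i (ocomp Q l n j p r) q) \<and>
     (\<forall>n. \<forall>p\<in>car (ocar Q n). oact Q n id p = p \<and>
        (\<forall>\<sigma> \<tau>. \<sigma> permutes {1..n} \<and> \<tau> permutes {1..n} \<longrightarrow>
           oact Q n \<tau> (oact Q n \<sigma> p) = oact Q n (\<sigma> \<circ> \<tau>) p)) \<and>
     (\<forall>m n i \<sigma> \<tau>. \<forall>p\<in>car (ocar Q m). \<forall>q\<in>car (ocar Q n).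
        1 \<le> i \<and> i \<le> m \<and> \<sigma> permutes {1..m} \<and> \<tau> permutes {1..n} \<longrightarrow>
        ocomp Q m n i (oact Q m \<sigma> p) (oact Q n \<tau> q) =
        oact Q (m + n - 1) (pcomp m n i \<sigma> \<tau>) (ocomp Q m n (\<sigma> i) p q))"

definition operad_morphism :: "('k::field, 'p::ab_group_add) operad \<Rightarrow> ('k, 'q::ab_group_add) operad \<Rightarrow>
    (nat \<Rightarrow> 'p \<Rightarrow> 'q) \<Rightarrow> bool" where
  "operad_morphism P Q \<theta> \<longleftrightarrow>
     (\<forall>n. \<theta> n \<in> hom (ocar P n) (ocar Q n)) \<and>
     \<theta> 1 (ounit P) = ounit Q \<and>
     (\<forall>m n i. \<forall>p\<in>car (ocar P m). \<forall>q\<in>car (ocar P n). 1 \<le> i \<and> i \<le> m \<longrightarrow>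
        \<theta> (m + n - 1) (ocomp P m n i p q) = ocomp Q m n i (\<theta> m p) (\<theta> n q)) \<and>
     (\<forall>n \<sigma>. \<forall>p\<in>car (ocar P n). \<sigma> permutes {1..n} \<longrightarrow> \<theta> n (oact P n \<sigma> p) = oact Q n \<sigma> (\<theta> n p))"

inductive opideal :: "('k::field, 'p::ab_group_add) operad \<Rightarrow> (nat \<Rightarrow> 'p set) \<Rightarrow> nat \<Rightarrow> 'p \<Rightarrow> bool"
  for Q :: "('k, 'p) operad" and R :: "nat \<Rightarrow> 'p set" where
  gen: "r \<in> R n \<Longrightarrow> opideal Q R n r"
| zero: "opideal Q R n 0"
| add: "opideal Q R n r \<Longrightarrow> opideal Q R n r' \<Longrightarrow> opideal Q R n (r + r')"
| scale: "opideal Q R n r \<Longrightarrow> opideal Q R n (scl (ocar Q n) c r)"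
| perm: "opideal Q R n r \<Longrightarrow> \<sigma> permutes {1..n} \<Longrightarrow> opideal Q R n (oact Q n \<sigma> r)"
| compl: "opideal Q R m r \<Longrightarrow> q \<in> car (ocar Q n) \<Longrightarrow> 1 \<le> i \<Longrightarrow> i \<le> m \<Longrightarrow>
            opideal Q R (m + n - 1) (ocomp Q m n i r q)"
| compr: "opideal Q R n r \<Longrightarrow> p \<in> car (ocar Q m) \<Longrightarrow> 1 \<le> i \<Longrightarrow> i \<le> m \<Longrightarrow>
            opideal Q R (m + n - 1) (ocomp Q m n i p r)"

definition operad_quot :: "('k::field, 'p::ab_group_add) operad \<Rightarrow> (nat \<Rightarrow> 'p set) \<Rightarrow> ('k, 'p) operad" where
  "operad_quot Q R = (let pr = (\<lambda>n. qproj (ocar Q n) {r. opideal Q R n r}) in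
     \<lparr>ocar = (\<lambda>n. quot (ocar Q n) {r. opideal Q R n r}),
      ocomp = (\<lambda>m n i p q. pr (m + n - 1) (ocomp Q m n i p q)),
      oact = (\<lambda>n \<sigma> p. pr n (oact Q n \<sigma> p)),
      ounit = pr 1 (ounit Q)\<rparr>)"

text \<open>Maps in \<open>\<^bold>C\<^sub>V(n)\<close> (\<open>coendo V\<close>) are normalised to
  vanish outside the carrier of \<open>V\<close>, so that equal linear maps are equal functions.\<close>

definition operad_tens :: "('k::field, 'p::ab_group_add) operad \<Rightarrow> ('k, 'q::ab_group_add) operad \<Rightarrow>
    ('k, ('p \<times> 'q) \<Rightarrow>\<^sub>0 'k) operad" where
  "operad_tens P Q = (let t = (\<lambda>n. pure (ocar P n) (ocar Q n)) in
     \<lparr>ocar = (\<lambda>n. tens (ocar P n) (ocar Q n)),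
      ocomp = (\<lambda>m n i a b. lext psc (\<lambda>(p, f). lext psc (\<lambda>(q, g).
                 t (m + n - 1) (ocomp P m n i p q) (ocomp Q m n i f g)) b) a),
      oact = (\<lambda>n \<sigma>. lext psc (\<lambda>(p, f). t n (oact P n \<sigma> p) (oact Q n \<sigma> f))),
      ounit = t 1 (ounit P) (ounit Q)\<rparr>)"

definition coendo :: "('k::field, 'v::ab_group_add) vs \<Rightarrow> ('k, 'v \<Rightarrow> ('v list \<Rightarrow>\<^sub>0 'k)) operad" where
  "coendo V =
     \<lparr>ocar = (\<lambda>n. \<lparr>car = (if n = 0 then {0} else {f \<in> hom V (tpow V n). \<forall>x. x \<notin> car V \<longrightarrow> f x = 0}),
                    scl = (\<lambda>c f x. psc c (f x))\<rparr>),
      ocomp = (\<lambda>m n i f g x. tins V i g (f x)),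
      oact = (\<lambda>n \<sigma> f x. tperm V n \<sigma> (f x)),
      ounit = (\<lambda>x. if x \<in> car V then tword V [x] else 0)\<rparr>"


section \<open>The operad of \<open>\<^bold>b\<^sub>\<infinity>\<close> algebras\<close>

subsection \<open>\<open>\<^bold>b\<^sub>\<infinity>\<close> algebras and their star product\<close>

text \<open>A bracket on \<open>W\<close> is given as a bilinear map on \<open>Sym W\<close>. Indices in \<open>[k+l]\<close> start at 0 here.\<close>

definition star :: "('k::field, 'w::ab_group_add) vs \<Rightarrow>
    (('w multiset \<Rightarrow>\<^sub>0 'k) \<Rightarrow> ('w multiset \<Rightarrow>\<^sub>0 'k) \<Rightarrow> 'w) \<Rightarrow>
    ('w multiset \<Rightarrow>\<^sub>0 'k) \<Rightarrow> ('w multiset \<Rightarrow>\<^sub>0 'k) \<Rightarrow> ('w multiset \<Rightarrow>\<^sub>0 'k)" where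
  "star W br a b = lext psc (\<lambda>M. lext psc (\<lambda>N.
     let xs = list_of M; ys = list_of N; k = length xs; l = length ys in
     \<Sum>\<pi> | partition_on {..<k + l} \<pi>.
       smon W (image_mset (\<lambda>I. br (smon W (mset (nths xs I))) (smon W (mset (nths ys {j. k + j \<in> I}))))
                 (mset_set \<pi>))) b) a"

definition binf_algebra :: "('k::field, 'w::ab_group_add) vs \<Rightarrow>
    (('w multiset \<Rightarrow>\<^sub>0 'k) \<Rightarrow> ('w multiset \<Rightarrow>\<^sub>0 'k) \<Rightarrow> 'w) \<Rightarrow> bool" where
  "binf_algebra W br \<longleftrightarrow>
     vspace W \<and> br \<in> bihom (Sym W) (Sym W) W \<and>
     (\<forall>x\<in>car W. br (sone W) (smon W {#x#}) = x \<and> br (smon W {#x#}) (sone W) = x) \<and>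
     (\<forall>M. set_mset M \<subseteq> car W \<and> size M \<noteq> 1 \<longrightarrow>
        br (sone W) (smon W M) = 0 \<and> br (smon W M) (sone W) = 0) \<and>
     (\<forall>u\<in>car (Sym W). \<forall>v\<in>car (Sym W). \<forall>w\<in>car (Sym W).
        br (star W br u v) w = br u (star W br v w))"

subsection \<open>The operad, by generators and relations\<close>

text \<open>\<open>Br us vs\<close> is the formal bracket \<open>\<lfloor>us, vs\<rfloor>\<close>, \<open>Leaf i\<close> the \<open>i\<close>-th input. The free operad on the
  brackets has as basis of its \<open>n\<close>-th component the terms in which each of \<open>1, \<dots>, n\<close> occurs
  exactly once.\<close>

datatype bterm = Leaf nat | Br "bterm list" "bterm list"

primrec leaves :: "bterm \<Rightarrow> nat list" where
  "leaves (Leaf i) = [i]"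
| "leaves (Br us vs) = concat (map leaves us) @ concat (map leaves vs)"

primrec subst :: "(nat \<Rightarrow> bterm) \<Rightarrow> bterm \<Rightarrow> bterm" where
  "subst f (Leaf i) = f i"
| "subst f (Br us vs) = Br (map (subst f) us) (map (subst f) vs)"

definition graft :: "nat \<Rightarrow> nat \<Rightarrow> bterm \<Rightarrow> bterm \<Rightarrow> bterm" where
  \<comment> \<open>\<open>graft n i t s\<close> is \<open>t \<circ>\<^sub>i s\<close> for \<open>s\<close> of arity \<open>n\<close>\<close>
  "graft n i t s = subst (\<lambda>j. if j < i then Leaf j
                              else if j = i then subst (\<lambda>a. Leaf (a + i - 1)) s
                              else Leaf (j + n - 1)) t"

definition free_bracket_operad :: "('k::field, bterm \<Rightarrow>\<^sub>0 'k) operad" where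
  "free_bracket_operad =
     \<lparr>ocar = (\<lambda>n. free {t. mset (leaves t) = mset [1..<Suc n]}),
      ocomp = (\<lambda>m n i a b. lext psc (\<lambda>t. lext psc (\<lambda>s. vec (graft n i t s)) b) a),
      oact = (\<lambda>n \<sigma>. lext psc (\<lambda>t. vec (subst (\<lambda>j. Leaf (inv \<sigma> j)) t))),
      ounit = vec (Leaf 1)\<rparr>"

definition corolla :: "nat \<Rightarrow> nat \<Rightarrow> bterm" where
  "corolla k l = Br (map Leaf [1..<Suc k]) (map Leaf [Suc k..<Suc (k + l)])"

definition block :: "nat \<Rightarrow> nat set \<Rightarrow> bterm" where
  \<comment> \<open>\<open>\<lfloor>u, v\<rfloor>\<^sub>I\<close>, where the inputs up to \<open>h\<close> belong to \<open>u\<close> and the later ones to \<open>v\<close>\<close>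
  "block h I = Br (map Leaf (sorted_list_of_set {i\<in>I. i \<le> h})) (map Leaf (sorted_list_of_set {i\<in>I. h < i}))"

text \<open>Symmetry of the brackets in each group of arguments; values of \<open>\<lfloor>-,-\<rfloor>\<^bsub>0,n\<^esub>\<close> and \<open>\<lfloor>-,-\<rfloor>\<^bsub>n,0\<^esub>\<close>;
  \<open>\<lfloor>u \<star> v, w\<rfloor> = \<lfloor>u, v \<star> w\<rfloor>\<close> for monomials \<open>u\<close>, \<open>v\<close>, \<open>w\<close> of degrees \<open>k\<close>, \<open>l\<close>, \<open>m\<close> in the inputs
  \<open>1, \<dots>, k + l + m\<close>.\<close>

definition binf_rel :: "nat \<Rightarrow> (bterm \<Rightarrow>\<^sub>0 'k::field) set" where
  "binf_rel n =
     {vec (subst (\<lambda>j. Leaf (inv \<sigma> j)) (corolla k l)) - vec (corolla k l) | k l \<sigma>.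
        k + l = n \<and> \<sigma> permutes {1..n} \<and> \<sigma> ` {1..k} = {1..k}} \<union>
     (if n = 1 then {vec (corolla 0 1) - vec (Leaf 1), vec (corolla 1 0) - vec (Leaf 1)}
      else {vec (corolla 0 n), vec (corolla n 0)}) \<union>
     {(\<Sum>\<pi> | partition_on {1..k + l} \<pi>.
         vec (Br (map (block k) (list_of (mset_set \<pi>))) (map Leaf [Suc (k + l)..<Suc (k + l + m)])))
      - (\<Sum>\<pi> | partition_on {Suc k..k + l + m} \<pi>.
         vec (Br (map Leaf [1..<Suc k]) (map (block (k + l)) (list_of (mset_set \<pi>)))))
      | k l m. k + l + m = n}"

definition binf :: "('k::field, bterm \<Rightarrow>\<^sub>0 'k) operad" where
  "binf = operad_quot free_bracket_operad binf_rel"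

definition binf_gen :: "nat \<Rightarrow> nat \<Rightarrow> (bterm \<Rightarrow>\<^sub>0 'k::field)" where
  \<comment> \<open>\<open>\<lfloor>-,-\<rfloor>\<^bsub>k,l\<^esub> \<in> \<^bold>b\<^sub>\<infinity>(k + l)\<close>\<close>
  "binf_gen k l = qproj (ocar free_bracket_operad (k + l))
     {r. opideal free_bracket_operad binf_rel (k + l) r} (vec (corolla k l))"


section \<open>Free algebras over an operad\<close>

text \<open>\<open>F\<^sub>P(V)\<close> is the direct sum of the spaces \<open>P(n) \<otimes> V\<^sup>\<otimes>\<^sup>n\<close> modulo
  \<open>p\<^sup>\<sigma> \<otimes> x\<^sub>1 \<dots> x\<^sub>n = p \<otimes> x\<^bsub>\<sigma>\<^sup>-\<^sup>1(1)\<^esub> \<dots> x\<^bsub>\<sigma>\<^sup>-\<^sup>1(n)\<^esub>\<close>; \<open>fcls P V n p t\<close> is \<open>p.t\<close>.\<close>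

type_synonym ('k, 'p, 'v) fr = "nat \<Rightarrow>\<^sub>0 (('p \<times> ('v list \<Rightarrow>\<^sub>0 'k)) \<Rightarrow>\<^sub>0 'k)"

definition fr_rel :: "('k::field, 'p::ab_group_add) operad \<Rightarrow> ('k, 'v::ab_group_add) vs \<Rightarrow> nat \<Rightarrow>
    (('p \<times> ('v list \<Rightarrow>\<^sub>0 'k)) \<Rightarrow>\<^sub>0 'k) set" where
  "fr_rel P V n =
     {pure (ocar P n) (tpow V n) (oact P n \<sigma> p) (tword V xs)
      - pure (ocar P n) (tpow V n) p (tperm V n (inv \<sigma>) (tword V xs)) | p \<sigma> xs.
        p \<in> car (ocar P n) \<and> \<sigma> permutes {1..n} \<and> xs \<in> words V n}"

definition free_alg :: "('k::field, 'p::ab_group_add) operad \<Rightarrow> ('k, 'v::ab_group_add) vs \<Rightarrow>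
    ('k, ('k, 'p, 'v) fr) vs" where
  "free_alg P V = dsum (\<lambda>n. quot (tens (ocar P n) (tpow V n)) (fr_rel P V n))"

definition fcls :: "('k::field, 'p::ab_group_add) operad \<Rightarrow> ('k, 'v::ab_group_add) vs \<Rightarrow> nat \<Rightarrow>
    'p \<Rightarrow> ('v list \<Rightarrow>\<^sub>0 'k) \<Rightarrow> ('k, 'p, 'v) fr" where
  "fcls P V n p t = Poly_Mapping.single n
     (qproj (tens (ocar P n) (tpow V n)) (fr_rel P V n) (pure (ocar P n) (tpow V n) p t))"

text \<open>The \<open>P\<close>-algebra structure: \<open>p.(q\<^sub>1.t\<^sub>1, \<dots>, q\<^sub>n.t\<^sub>n) = (p \<circ> (q\<^sub>1, \<dots>, q\<^sub>n)).(t\<^sub>1 \<dots> t\<^sub>n)\<close>, extended multilinearly.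
  \<open>rcompose\<close> grafts the operations at the inputs \<open>n, n - 1, \<dots>, 1\<close> in this order (its list is
  reversed), so that the remaining inputs keep their numbers.\<close>

fun rcompose :: "('k, 'p) operad \<Rightarrow> nat \<Rightarrow> 'p \<Rightarrow> (nat \<times> 'p) list \<Rightarrow> 'p" where
  "rcompose P N p [] = p"
| "rcompose P N p ((m, q) # rs) = rcompose P (N + m - 1) (ocomp P N m (Suc (length rs)) p q) rs"

fun mlext :: "('k::field \<Rightarrow> 'c \<Rightarrow> 'c) \<Rightarrow> ((nat \<times> 'x) list \<Rightarrow> 'c) \<Rightarrow> (nat \<Rightarrow>\<^sub>0 ('x \<Rightarrow>\<^sub>0 'k)) list \<Rightarrow>
    'c::ab_group_add" where
  "mlext s \<phi> [] = \<phi> []"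
| "mlext s \<phi> (a # as) = (\<Sum>m\<in>Poly_Mapping.keys a.
     lext s (\<lambda>x. mlext s (\<lambda>zs. \<phi> ((m, x) # zs)) as) (Poly_Mapping.lookup a m))"

definition fop :: "('k::field, 'p::ab_group_add) operad \<Rightarrow> ('k, 'v::ab_group_add) vs \<Rightarrow> 'p \<Rightarrow>
    ('k, 'p, 'v) fr list \<Rightarrow> ('k, 'p, 'v) fr" where
  "fop P V p as = mlext (scl (free_alg P V)) (\<lambda>zs.
     fcls P V (sum_list (map fst zs))
       (rcompose P (length as) p (rev (map (\<lambda>(m, q, t). (m, q)) zs)))
       (tcat V (map (\<lambda>(m, q, t). t) zs))) as"

text \<open>The \<open>\<^bold>b\<^sub>\<infinity>\<close> bracket of \<open>F\<^sub>P(V)\<close> obtained through \<open>\<theta> : \<^bold>b\<^sub>\<infinity> \<rightarrow> P\<close>.\<close>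

definition fbr :: "('k::field, 'p::ab_group_add) operad \<Rightarrow> ('k, 'v::ab_group_add) vs \<Rightarrow>
    (nat \<Rightarrow> (bterm \<Rightarrow>\<^sub>0 'k) \<Rightarrow> 'p) \<Rightarrow>
    (('k, 'p, 'v) fr multiset \<Rightarrow>\<^sub>0 'k) \<Rightarrow> (('k, 'p, 'v) fr multiset \<Rightarrow>\<^sub>0 'k) \<Rightarrow> ('k, 'p, 'v) fr" where
  "fbr P V \<theta> a b = (let s = scl (free_alg P V) in
     lext s (\<lambda>M. lext s (\<lambda>N. fop P V (\<theta> (size M + size N) (binf_gen (size M) (size N)))
                             (list_of M @ list_of N)) b) a)"

definition A_bialg :: "('k::field, 'p::ab_group_add) operad \<Rightarrow> ('k, 'v::ab_group_add) vs \<Rightarrow>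
    (nat \<Rightarrow> (bterm \<Rightarrow>\<^sub>0 'k) \<Rightarrow> 'p) \<Rightarrow> ('k, ('k, 'p, 'v) fr multiset \<Rightarrow>\<^sub>0 'k) bialg" where
  "A_bialg P V \<theta> = (let F = free_alg P V in
     \<lparr>sp = Sym F, mul = star F (fbr P V \<theta>), one = sone F, cop = scop F, cou = scou\<rparr>)"


section \<open>The bialgebra \<open>D\<^sub>P(V)\<close>\<close>

text \<open>\<open>coinv_prod Q\<close> is induced by \<open>p \<bullet> q = \<Sum>\<^sub>i p \<circ>\<^sub>i q\<close>.\<close>

definition coinv_rel :: "('k::field, 'p::ab_group_add) operad \<Rightarrow> nat \<Rightarrow> 'p set" where
  "coinv_rel Q n = {oact Q n \<sigma> q - q | q \<sigma>. q \<in> car (ocar Q n) \<and> \<sigma> permutes {1..n}}"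

definition coinv :: "('k::field, 'p::ab_group_add) operad \<Rightarrow> ('k, nat \<Rightarrow>\<^sub>0 'p) vs" where
  "coinv Q = dsum (\<lambda>n. quot (ocar Q n) (coinv_rel Q n))"

definition coinv_prod :: "('k::field, 'p::ab_group_add) operad \<Rightarrow> (nat \<Rightarrow>\<^sub>0 'p) \<Rightarrow> (nat \<Rightarrow>\<^sub>0 'p) \<Rightarrow> (nat \<Rightarrow>\<^sub>0 'p)" where
  "coinv_prod Q v w = (\<Sum>m\<in>Poly_Mapping.keys v. \<Sum>n\<in>Poly_Mapping.keys w.
     Poly_Mapping.single (m + n - 1) (qproj (ocar Q (m + n - 1)) (coinv_rel Q (m + n - 1))
       (\<Sum>i=1..m. ocomp Q m n i (Poly_Mapping.lookup v m) (Poly_Mapping.lookup w n))))"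

text \<open>\<open>og_rev b x [x\<^sub>k, \<dots>, x\<^sub>1]\<close> is the Oudom--Guin bracket \<open>\<lfloor>x, x\<^sub>1 \<dots> x\<^sub>k\<rfloor>\<close> of the pre-Lie product \<open>b\<close>.\<close>

function og_rev :: "('w \<Rightarrow> 'w \<Rightarrow> 'w) \<Rightarrow> 'w \<Rightarrow> 'w list \<Rightarrow> 'w::ab_group_add" where
  "og_rev b x [] = x"
| "og_rev b x (y # ys) = b (og_rev b x ys) y - (\<Sum>i<length ys. og_rev b x (ys[i := b (ys ! i) y]))"
  by pat_completeness auto
termination by (relation "measure (\<lambda>(b, x, ys). length ys)") auto

definition og :: "('w \<Rightarrow> 'w \<Rightarrow> 'w) \<Rightarrow> 'w \<Rightarrow> 'w list \<Rightarrow> 'w::ab_group_add" where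
  "og b x ys = og_rev b x (rev ys)"

text \<open>The Oudom--Guin product. The \<open>(k+1)\<close>-fold coproduct of \<open>v = y\<^sub>1 \<dots> y\<^sub>l\<close> is expanded over the maps
  \<open>c\<close> sending each letter of \<open>v\<close> to one of the tensor factors, numbered \<open>0, \<dots>, k\<close>.\<close>

definition og_mul :: "('k::field, 'w::ab_group_add) vs \<Rightarrow> ('w \<Rightarrow> 'w \<Rightarrow> 'w) \<Rightarrow>
    ('w multiset \<Rightarrow>\<^sub>0 'k) \<Rightarrow> ('w multiset \<Rightarrow>\<^sub>0 'k) \<Rightarrow> ('w multiset \<Rightarrow>\<^sub>0 'k)" where
  "og_mul W b u v = lext psc (\<lambda>M. lext psc (\<lambda>N.
     let xs = list_of M; ys = list_of N; k = length xs; l = length ys in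
     \<Sum>c\<in>{..<l} \<rightarrow>\<^sub>E {..k}.
       smon W (mset (map (\<lambda>j. og b (xs ! j) (nths ys {i. c i = j})) [0..<k]) + mset (nths ys {i. c i = k}))) v) u"

type_synonym ('k, 'p, 'v) ci = "nat \<Rightarrow>\<^sub>0 (('p \<times> ('v \<Rightarrow> ('v list \<Rightarrow>\<^sub>0 'k))) \<Rightarrow>\<^sub>0 'k)"

definition D_bialg :: "('k::field, 'p::ab_group_add) operad \<Rightarrow> ('k, 'v::ab_group_add) vs \<Rightarrow>
    ('k, ('k, 'p, 'v) ci multiset \<Rightarrow>\<^sub>0 'k) bialg" where
  "D_bialg P V = (let Q = operad_tens P (coendo V); W = coinv Q in
     \<lparr>sp = Sym W, mul = og_mul W (coinv_prod Q), one = sone W, cop = scop W, cou = scou\<rparr>)"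


section \<open>The action of \<open>D\<^sub>P(V)\<close> on \<open>A\<^sub>P(V)\<close>\<close>

definition fact :: "('k::field, 'p::ab_group_add) operad \<Rightarrow> ('k, 'v::ab_group_add) vs \<Rightarrow>
    ('k, 'p, 'v) fr \<Rightarrow> ('k, 'p, 'v) ci \<Rightarrow> ('k, 'p, 'v) fr" where
  "fact P V a w = (let s = scl (free_alg P V) in
     \<Sum>k\<in>Poly_Mapping.keys a. \<Sum>n\<in>Poly_Mapping.keys w.
       lext s (\<lambda>(p, t). lext s (\<lambda>(q, f).
         \<Sum>i=1..k. fcls P V (k + n - 1) (ocomp P k n i p q) (tins V i f t))
           (Poly_Mapping.lookup w n)) (Poly_Mapping.lookup a k))"

definition der_act :: "('k::field, 'p::ab_group_add) operad \<Rightarrow> ('k, 'v::ab_group_add) vs \<Rightarrow>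
    (('k, 'p, 'v) fr multiset \<Rightarrow>\<^sub>0 'k) \<Rightarrow> ('k, 'p, 'v) ci \<Rightarrow> (('k, 'p, 'v) fr multiset \<Rightarrow>\<^sub>0 'k)" where
  "der_act P V a w = lext psc (\<lambda>M. let xs = list_of M in
     \<Sum>i<length xs. smon (free_alg P V) (mset (xs[i := fact P V (xs ! i) w]))) a"

text \<open>The right action of the algebra \<open>D\<^sub>P(V)\<close> extending \<open>der_act\<close>. Since \<open>D\<^sub>P(V)\<close> is generated as an
  algebra by \<open>coinv (P \<otimes> \<^bold>C\<^sub>V)\<close>, it is determined on the carriers.\<close>

definition D_act :: "('k::field, 'p::ab_group_add) operad \<Rightarrow> ('k, 'v::ab_group_add) vs \<Rightarrow>
    (('k, 'p, 'v) fr multiset \<Rightarrow>\<^sub>0 'k) \<Rightarrow> (('k, 'p, 'v) ci multiset \<Rightarrow>\<^sub>0 'k) \<Rightarrow>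
    (('k, 'p, 'v) fr multiset \<Rightarrow>\<^sub>0 'k)" where
  "D_act P V = (let A = Sym (free_alg P V); W = coinv (operad_tens P (coendo V)) in
     SOME act. right_action A (D_bialg P V) act \<and>
       (\<forall>a\<in>car A. \<forall>w\<in>car W. act a (smon W {#w#}) = der_act P V a w))"

end

theory Submission
 imports Defs
begin

text \<open>
 For a right pre-Lie algebra \<open>W\<close> and a right module \<open>X\<close> over its Lie algebra, the Oudom--Guin recursion
 makes \<open>X\<close> a module over \<open>Sym W\<close>. The case \<open>X = Sym W\<close> yields the product of \<open>Sym W\<close>, and the case \<open>X = Sym F\<close>,
 on which \<open>W\<close> acts by derivations, yields the action; its compatibilities follow by induction on monomials
 of \<open>Sym W\<close>. The star product is the exponential of the bracket, so a derivation of the bracket extends to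
 one of the star product.

 The free algebra is the space of coinvariants of the right \<open>P \<otimes> \<^bold>C\<^sub>V\<close>-module \<open>(P(n) \<otimes> V\<^sup>\<otimes>\<^sup>n)\<^sub>n\<close>, whence its module
 structure over \<open>coinv (P \<otimes> \<^bold>C\<^sub>V)\<close>. A generator \<open>q.(x\<^sub>1 \<dots> x\<^sub>m)\<close> is the operation \<open>q\<close> applied to the letters \<open>x\<^sub>i\<close>;
 replacing generators by letters one after the other shows that \<open>coinv (P \<otimes> \<^bold>C\<^sub>V)\<close> acts by derivations of all
 operations of \<open>P\<close>, in particular of the bracket. The defining relation of \<open>\<^bold>b\<^sub>\<infinity>\<close> involves trees with two levels
 only, which are evaluated by grafting corollas one at a time.
\<close>

text \<open>The definitions sum over subsets, colourings and set partitions of the positions of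
  lists picked by \<open>list_of\<close>. Such sums do not compose, so each is rewritten as a sum
  over splittings of multisets (\<open>SS\<close>) or over single letters (\<open>DS\<close>) and
  characterised by a recursion that peels off one letter. Both products are then known through their
  recursions: the star product through the block containing a given letter, the Oudom--Guin product
  through the last letter of its right factor.

  The Oudom--Guin recursion is not visibly symmetric in the letters. That it is well defined on
  monomials is equivalent in content to the pre-Lie and module identities, so symmetry is proved
  first, degree by degree, and linearity is proved along with it.

  \<open>D_act\<close> is a choice among right actions: the module structure supplies an action, and
  letters generate the algebra, so any admissible choice obeys the recursion. The interaction is
  therefore proved for an arbitrary such action.

  In a bracket tree the inputs are distributed over the blocks in any order, whereas grafting
  numbers them from left to right; equivariance of the operations on the free algebra closes this
  gap.\<close>

abbreviation "pkeys \<equiv> Poly_Mapping.keys"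
abbreviation "plookup \<equiv> Poly_Mapping.lookup"
abbreviation "psingle \<equiv> Poly_Mapping.single"

subsection \<open>Linear algebra on carriers\<close>

lemma vspaceI:
 assumes "vector_space (scl A)" "0 \<in> car A" "!!x y. x \<in> car A ==> y \<in> car A ==> x + y \<in> car A"
  "!!c x. x \<in> car A ==> scl A c x \<in> car A"
 shows "vspace A"
proof -
 interpret vector_space "scl A" by fact
 show ?thesis using assms by (auto simp: vspace_def subspace_def)
qed

lemma vspace_vs: "vspace A ==> vector_space (scl A)"
 by (simp add: vspace_def)

lemma vspace_module: "vspace A ==> module (scl A)"
 by (simp add: vspace_def module_iff_vector_space)

lemma vspace_subspace: "vspace A ==> module.subspace (scl A) (car A)"
 by (simp add: vspace_def)

lemma
 assumes "vspace A"
 shows car_0: "0 \<in> car A"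
  and car_add: "x \<in> car A ==> y \<in> car A ==> x + y \<in> car A"
  and car_scl: "x \<in> car A ==> scl A c x \<in> car A"
  and car_diff: "x \<in> car A ==> y \<in> car A ==> x - y \<in> car A"
  and car_minus: "x \<in> car A ==> - x \<in> car A"
  and car_sum: "(!!i. i \<in> I ==> g i \<in> car A) ==> sum g I \<in> car A"
proof -
 interpret module "scl A" using assms by (rule vspace_module)
 have s: "subspace (car A)" using assms by (rule vspace_subspace)
 show "0 \<in> car A" "x \<in> car A ==> y \<in> car A ==> x + y \<in> car A" "x \<in> car A ==> scl A c x \<in> car A"
  "x \<in> car A ==> y \<in> car A ==> x - y \<in> car A" "x \<in> car A ==> - x \<in> car A"
  "(!!i. i \<in> I ==> g i \<in> car A) ==> sum g I \<in> car A"
  using s subspace_0 subspace_add subspace_scale subspace_diff subspace_neg subspace_sum by metis+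
qed

lemma
 assumes "vspace A"
 shows scl_add: "scl A c (x + y) = scl A c x + scl A c y"
  and scl_add_left: "scl A (c + d) x = scl A c x + scl A d x"
  and scl_scl: "scl A c (scl A d x) = scl A (c * d) x"
  and scl_1: "scl A 1 x = x"
  and scl_0: "scl A c 0 = 0"
  and scl_0_left: "scl A 0 x = 0"
  and scl_sum: "scl A c (sum g I) = (\<Sum>i\<in>I. scl A c (g i))"
proof -
 interpret vector_space "scl A" using assms by (rule vspace_vs)
 show "scl A c (x + y) = scl A c x + scl A c y" "scl A (c + d) x = scl A c x + scl A d x"
  "scl A c (scl A d x) = scl A (c * d) x" "scl A 1 x = x" "scl A c 0 = 0" "scl A 0 x = 0"
  "scl A c (sum g I) = (\<Sum>i\<in>I. scl A c (g i))"
  by (auto simp: scale_right_distrib scale_left_distrib scale_sum_right)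
qed

text \<open>Keys can cancel in a sum, so values of \<open>lext\<close> are compared after taking
  both sums over a common finite set, where the additional coefficients vanish.\<close>

lemma lext_superset:
 assumes "vector_space s" "finite X" "pkeys p \<subseteq> X"
 shows "lext s \<phi> p = (\<Sum>x\<in>X. s (plookup p x) (\<phi> x))"
proof -
 interpret vector_space s by fact
 show ?thesis unfolding lext_def
  by (rule sum.mono_neutral_left) (use assms in "auto simp: in_keys_iff")
qed

lemma
 assumes "vector_space s"
 shows lext_0: "lext s \<phi> 0 = 0"
  and lext_add: "lext s \<phi> (p + q) = lext s \<phi> p + lext s \<phi> q"
  and lext_psc: "lext s \<phi> (psc c p) = s c (lext s \<phi> p)"
  and lext_single: "lext s \<phi> (psingle x c) = s c (\<phi> x)"
  and lext_vec: "lext s \<phi> (vec x) = \<phi> x"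
  and lext_diff: "lext s \<phi> (p - q) = lext s \<phi> p - lext s \<phi> q"
  and lext_zero_fun: "lext s (%x. 0) p = 0"
  and lext_add_fun: "lext s (%x. \<phi> x + \<psi> x) p = lext s \<phi> p + lext s \<psi> p"
  and lext_scl_fun: "lext s (%x. s c (\<phi> x)) p = s c (lext s \<phi> p)"
proof -
 interpret vector_space s by fact
 show z: "lext s \<phi> 0 = 0" by (simp add: lext_def)
 have a: "lext s \<phi> (p + q) = lext s \<phi> p + lext s \<phi> q" for p q
 proof -
  let ?X = "pkeys p \<union> pkeys q"
  show ?thesis
   using assms keys_add[of p q]
   by (subst (1 2 3) lext_superset[where X = ?X])
    (auto simp: lookup_add scale_left_distrib sum.distrib)
 qed
 then show "lext s \<phi> (p + q) = lext s \<phi> p + lext s \<phi> q" .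
 have m: "lext s \<phi> (psc c p) = s c (lext s \<phi> p)" for c p
  using assms
  by (subst (1 2) lext_superset[where X = "pkeys p"])
   (auto simp: lookup_psc scale_sum_right in_keys_iff)
 then show "lext s \<phi> (psc c p) = s c (lext s \<phi> p)" .
 show s: "lext s \<phi> (psingle x c) = s c (\<phi> x)" for x c
  using assms by (subst lext_superset[where X = "{x}"]) auto
 show "lext s \<phi> (vec x) = \<phi> x" by (simp add: s)
 have "lext s \<phi> (p - q) + lext s \<phi> q = lext s \<phi> p" by (simp flip: a)
 then show "lext s \<phi> (p - q) = lext s \<phi> p - lext s \<phi> q" by (simp add: algebra_simps)
 show "lext s (%x. 0) p = 0" by (simp add: lext_def)
 show "lext s (%x. \<phi> x + \<psi> x) p = lext s \<phi> p + lext s \<psi> p"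
  by (simp add: lext_def scale_right_distrib sum.distrib)
 show "lext s (%x. s c (\<phi> x)) p = s c (lext s \<phi> p)"
  by (simp add: lext_def scale_sum_right mult.commute)
qed

lemma lext_cong:
 "(!!x. x \<in> pkeys p ==> \<phi> x = \<psi> x) ==> lext s \<phi> p = lext s \<psi> p"
 by (auto simp: lext_def intro!: sum.cong)

lemma sum_keys_single: "(\<Sum>x\<in>pkeys p. psingle x (plookup p x)) = p"
 by (rule poly_mapping_eqI) (auto simp: Poly_Mapping.lookup_sum lookup_single when_def in_keys_iff)

lemma lext_psc_vec: "lext psc vec p = p"
proof -
 have "lext psc vec p = (\<Sum>x\<in>pkeys p. psingle x (plookup p x))"
  unfolding lext_def
  by (rule sum.cong) (auto intro!: poly_mapping_eqI simp: lookup_psc lookup_single when_def)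
 then show ?thesis by (simp add: sum_keys_single)
qed

lemma homI:
 assumes "!!x. x \<in> car A ==> f x \<in> car B"
  "!!x y. x \<in> car A ==> y \<in> car A ==> f (x + y) = f x + f y"
  "!!c x. x \<in> car A ==> f (scl A c x) = scl B c (f x)"
 shows "f \<in> hom A B"
 using assms by (auto simp: hom_def)

lemma
 assumes "f \<in> hom A B"
 shows hom_car: "x \<in> car A ==> f x \<in> car B"
  and hom_add: "x \<in> car A ==> y \<in> car A ==> f (x + y) = f x + f y"
  and hom_scl: "x \<in> car A ==> f (scl A c x) = scl B c (f x)"
 using assms by (auto simp: hom_def)

lemma hom_0: "f \<in> hom A B ==> vspace A ==> f 0 = 0"
 using hom_add[of f A B 0 0] car_0 by fastforce

lemma hom_sum:
 assumes "f \<in> hom A B" "vspace A" "!!i. i \<in> I ==> g i \<in> car A"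
 shows "f (sum g I) = (\<Sum>i\<in>I. f (g i))"
 using assms(3)
proof (induction I rule: infinite_finite_induct)
 case (insert i I)
 then show ?case using assms(1,2) by (simp add: hom_add car_sum)
qed (use assms hom_0 in auto)

lemma hom_diff:
 assumes "f \<in> hom A B" "vspace A" "x \<in> car A" "y \<in> car A"
 shows "f (x - y) = f x - f y"
 using hom_add[OF assms(1), of "x - y" y] car_diff[OF assms(2)] assms by (simp add: algebra_simps)

lemma hom_lext:
 assumes "f \<in> hom A B" "vspace A" "!!x. x \<in> pkeys p ==> \<phi> x \<in> car A"
 shows "f (lext (scl A) \<phi> p) = lext (scl B) (%x. f (\<phi> x)) p"
 unfolding lext_def
 by (subst hom_sum[OF assms(1,2)]) (use assms car_scl[OF assms(2)] hom_scl[OF assms(1)] in auto)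

lemma lext_car:
 "vspace A ==> (!!x. x \<in> pkeys p ==> \<phi> x \<in> car A) ==> lext (scl A) \<phi> p \<in> car A"
 unfolding lext_def by (auto intro!: car_sum car_scl)

lemma hom_id: "(%x. x) \<in> hom A A"
 by (simp add: hom_def)

lemma hom_zero: "vspace B ==> (%x. 0) \<in> hom A B"
 by (simp add: hom_def car_0 scl_0)

lemma hom_comp: "g \<in> hom B C ==> f \<in> hom A B ==> (%x. g (f x)) \<in> hom A C"
 by (simp add: hom_def)

lemma hom_plus: "vspace B ==> f \<in> hom A B ==> g \<in> hom A B ==> (%x. f x + g x) \<in> hom A B"
 by (simp add: hom_def car_add scl_add algebra_simps)

lemma hom_scale: "vspace B ==> f \<in> hom A B ==> (%x. scl B c (f x)) \<in> hom A B"
 by (simp add: hom_def car_scl scl_add scl_scl mult.commute)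

lemma hom_minus: "vspace B ==> f \<in> hom A B ==> g \<in> hom A B ==> (%x. f x - g x) \<in> hom A B"
proof -
 assume a: "vspace B" "f \<in> hom A B" "g \<in> hom A B"
 interpret vector_space "scl B" using a(1) by (rule vspace_vs)
 show ?thesis using a
  by (simp add: hom_def car_diff scale_right_diff_distrib algebra_simps)
qed

lemma hom_Sum:
 "vspace B ==> (!!i. i \<in> I ==> f i \<in> hom A B) ==> (%x. \<Sum>i\<in>I. f i x) \<in> hom A B"
proof (induction I rule: infinite_finite_induct)
 case (insert i I)
 then show ?case using hom_plus[of B "f i" A "%x. \<Sum>i\<in>I. f i x"] by simp
qed (auto simp: hom_zero)

lemma hom_Sum_mset:
 "vspace B ==> (!!i. i \<in># I ==> f i \<in> hom A B) ==> (%x. \<Sum>i\<in>#I. f i x) \<in> hom A B"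
proof (induction I)
 case (add i I)
 then show ?case using hom_plus[of B "f i" A "%x. \<Sum>i\<in>#I. f i x"] by simp
qed (auto simp: hom_zero)

lemma car_sum_mset: "vspace A ==> (!!i. i \<in># I ==> g i \<in> car A) ==> (\<Sum>i\<in>#I. g i) \<in> car A"
 by (induction I) (auto simp: car_0 car_add)

lemma hom_sum_mset:
 assumes "f \<in> hom A B" "vspace A" "!!i. i \<in># I ==> g i \<in> car A"
 shows "f (\<Sum>i\<in>#I. g i) = (\<Sum>i\<in>#I. f (g i))"
 using assms(3)
 by (induction I) (use assms(1,2) in "auto simp: hom_0 hom_add car_sum_mset")

text \<open>Linearity in a parameter of the summands while the element \<open>p\<close> stays fixed.
  Together with \<open>lext_hom_free\<close> it yields the two halves of bilinearity.\<close>

lemma hom_Lext: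
 "vspace B ==> (!!i. i \<in> pkeys p ==> f i \<in> hom A B) ==> (%x. lext (scl B) (%i. f i x) p) \<in> hom A B"
 unfolding lext_def by (intro hom_Sum hom_scale) auto

lemma hom_cong: "f \<in> hom A B ==> (!!x. x \<in> car A ==> f x = g x) ==> vspace A ==> g \<in> hom A B"
 unfolding hom_def by (auto simp: car_add car_scl)

lemma
 assumes "f \<in> bihom A B C"
 shows bihom_right: "x \<in> car A ==> f x \<in> hom B C"
  and bihom_left: "y \<in> car B ==> (%x. f x y) \<in> hom A C"
  and bihom_car: "x \<in> car A ==> y \<in> car B ==> f x y \<in> car C"
 using assms by (auto simp: bihom_def hom_def)

lemma bihomI:
 "(!!x. x \<in> car A ==> f x \<in> hom B C) ==> (!!y. y \<in> car B ==> (%x. f x y) \<in> hom A C) ==> f \<in> bihom A B C"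
 by (auto simp: bihom_def)

lemma bihom_comp1: "\<phi> \<in> bihom A B C ==> f \<in> hom D A ==> b \<in> car B ==> (%x. \<phi> (f x) b) \<in> hom D C"
 by (rule hom_comp[OF bihom_left])

lemma bihom_comp2: "\<phi> \<in> bihom A B C ==> f \<in> hom D B ==> a \<in> car A ==> (%x. \<phi> a (f x)) \<in> hom D C"
 by (rule hom_comp[OF bihom_right])

lemma bihom_0_left: "f \<in> bihom A B C ==> vspace A ==> y \<in> car B ==> f 0 y = 0"
 using hom_0[OF bihom_left] .

lemma bihom_0_right: "f \<in> bihom A B C ==> vspace B ==> x \<in> car A ==> f x 0 = 0"
 using hom_0[OF bihom_right] .

lemma lext_hom_free:
 "vspace C ==> (!!x. x \<in> X ==> \<phi> x \<in> car C) ==> lext (scl C) \<phi> \<in> hom (free X) C"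
 by (rule homI) (auto simp: free_def lext_add lext_psc vspace_vs intro!: lext_car)

lemma vspace_free: "vspace (free X :: ('b::field, 'a \<Rightarrow>\<^sub>0 'b) vs)"
proof (rule vspaceI)
 fix x y :: "'a \<Rightarrow>\<^sub>0 'b" assume "x \<in> car (free X)" "y \<in> car (free X)"
 then show "x + y \<in> car (free X)" using keys_add[of x y] by (auto simp: free_def)
qed (auto simp: free_def vector_space_psc in_keys_iff lookup_psc)

lemma scl_free [simp]: "scl (free X) = psc"
 by (simp add: free_def)

lemma car_free: "p \<in> car (free X) \<longleftrightarrow> pkeys p \<subseteq> X"
 by (simp add: free_def)

lemma vec_free: "x \<in> X ==> vec x \<in> car (free X)"
 by (simp add: free_def)

subsection \<open>Quotients\<close>

lemma scl_quot [simp]: "scl (quot A R) = scl A"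
 by (simp add: quot_def)

lemma
 assumes "vspace A"
 shows qproj_add: "qproj A R (x + y) = qproj A R x + qproj A R y"
  and qproj_scl: "qproj A R (scl A c x) = scl A c (qproj A R x)"
  and qproj_diff: "qproj A R (x - y) = qproj A R x - qproj A R y"
  and qproj_0: "qproj A R 0 = 0"
  and qproj_sum: "qproj A R (sum g I) = (\<Sum>i\<in>I. qproj A R (g i))"
proof -
 interpret Vector_Spaces.linear "scl A" "scl A" "qproj A R"
  by (rule linear_qproj) (use assms vspace_vs in auto)
 show "qproj A R (x + y) = qproj A R x + qproj A R y" "qproj A R (scl A c x) = scl A c (qproj A R x)"
  "qproj A R (x - y) = qproj A R x - qproj A R y" "qproj A R 0 = 0" "qproj A R (sum g I) = (\<Sum>i\<in>I. qproj A R (g i))"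
  by (simp_all add: add scale diff zero sum)
qed

lemma span_car:
 assumes "vspace A" "R \<subseteq> car A"
 shows "module.span (scl A) R \<subseteq> car A"
 using module.span_minimal[OF vspace_module[OF assms(1)] assms(2) vspace_subspace[OF assms(1)]] .

lemma qproj_diff_span:
 assumes "vspace A"
 shows "x - qproj A R x \<in> module.span (scl A) R"
proof -
 have "qproj A R (x - qproj A R x) = 0"
  using assms by (simp add: qproj_diff qproj_idem vspace_vs)
 then show ?thesis using assms by (simp add: qproj_eq_0_iff vspace_vs)
qed

lemma qproj_car:
 assumes "vspace A" "R \<subseteq> car A" "x \<in> car A"
 shows "qproj A R x \<in> car A"
proof -
 have "x - qproj A R x \<in> car A" using span_car[OF assms(1,2)] qproj_diff_span[OF assms(1)] by blast
 then have "x - (x - qproj A R x) \<in> car A" using assms car_diff by blast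
 then show ?thesis by simp
qed

lemma hom_eq_0_span:
 assumes "f \<in> hom A C" "vspace A" "vspace C" "R \<subseteq> car A" "!!r. r \<in> R ==> f r = 0"
  and "x \<in> module.span (scl A) R"
 shows "f x = 0"
proof -
 interpret module "scl A" using assms(2) by (rule vspace_module)
 have "x \<in> car A \<and> f x = 0"
  using assms(6)
 proof (induction rule: span_induct_alt)
  case base
  then show ?case using assms hom_0 car_0 by auto
 next
  case (step c a b)
  then have "a \<in> car A" using assms by auto
  then show ?case using step assms(1-3,5) car_add[OF assms(2)] car_scl[OF assms(2)]
   by (auto simp: hom_add hom_scl scl_0)
 qed
 then show ?thesis by simp
qed

text \<open>A class is one of its own representatives, so a map killing \<open>R\<close> descends to
  the quotient as itself. This is the form the universal property takes: such a map does not see the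
  projection.\<close>

lemma quot_lift:
 assumes "f \<in> hom A C" "vspace A" "vspace C" "R \<subseteq> car A" "!!r. r \<in> R ==> f r = 0" "x \<in> car A"
 shows "f (qproj A R x) = f x"
proof -
 have "f (x - qproj A R x) = 0"
  by (rule hom_eq_0_span[OF assms(1-5)]) (use qproj_diff_span[OF assms(2)] in auto)
 then show ?thesis
  using hom_diff[OF assms(1,2) assms(6) qproj_car[OF assms(2,4,6)]] by simp
qed

lemma qproj_rel: "vspace A ==> r \<in> R ==> qproj A R r = 0"
 by (simp add: qproj_eq_0_iff vspace_vs module.span_base vspace_module)

lemma qproj_eqI: "vspace A ==> x - y \<in> module.span (scl A) R ==> qproj A R x = qproj A R y"
 by (metis eq_iff_diff_eq_0 qproj_diff qproj_eq_0_iff vspace_vs)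

lemma quot_car_sub: "vspace A ==> R \<subseteq> car A ==> x \<in> car (quot A R) ==> x \<in> car A"
 by (auto simp: quot_def qproj_car)

lemma qproj_quot: "vspace A ==> x \<in> car (quot A R) ==> qproj A R x = x"
 by (auto simp: quot_def qproj_idem vspace_vs)

lemma qproj_in_quot: "x \<in> car A ==> qproj A R x \<in> car (quot A R)"
 by (auto simp: quot_def)

lemma vspace_quot:
 assumes "vspace A"
 shows "vspace (quot A R)"
proof (rule vspaceI)
 show "vector_space (scl (quot A R))" using assms by (simp add: vspace_vs)
 show "0 \<in> car (quot A R)" using qproj_in_quot[OF car_0[OF assms]] by (metis assms qproj_0)
next
 fix x y assume "x \<in> car (quot A R)" "y \<in> car (quot A R)"
 then show "x + y \<in> car (quot A R)"
  using assms by (auto simp: quot_def car_add simp flip: qproj_add)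
next
 fix c x assume "x \<in> car (quot A R)"
 then show "scl (quot A R) c x \<in> car (quot A R)"
  using assms by (auto simp: quot_def car_scl simp flip: qproj_scl)
qed

lemma qproj_hom: "vspace A ==> qproj A R \<in> hom A (quot A R)"
 by (rule homI) (auto simp: qproj_in_quot qproj_add qproj_scl)

lemma quot_hom: "vspace A ==> R \<subseteq> car A ==> f \<in> hom A C ==> f \<in> hom (quot A R) C"
 by (rule homI) (simp_all add: quot_car_sub hom_car hom_add hom_scl)

text \<open>The choice inside \<open>qproj\<close> depends on \<open>R\<close> only through its
  span. Two sets of relations with the same span thus give equal quotients, not merely isomorphic
  ones; \<open>free_alg_eq\<close> relies on this.\<close>

lemma qproj_span_cong:
 "module.span (scl A) R = module.span (scl A) R' ==> qproj A R = qproj A R'"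
 by (simp add: qproj_def)

lemma quot_span_cong:
 "module.span (scl A) R = module.span (scl A) R' ==> quot A R = quot A R'"
 by (simp only: quot_def qproj_span_cong[of A R R'])

subsection \<open>Spaces presented by generators and relations\<close>

lemma pres_lext:
 assumes "vspace C" "!!x. x \<in> X ==> \<phi> x \<in> car C" "R \<subseteq> car (free X)"
  "!!r. r \<in> R ==> lext (scl C) \<phi> r = 0" "x \<in> X"
 shows "lext (scl C) \<phi> (qproj (free X) R (vec x)) = \<phi> x"
 using quot_lift[OF lext_hom_free[OF assms(1,2)] vspace_free assms(1,3,4) vec_free[OF assms(5)]] assms
 by (simp add: lext_vec vspace_vs)

lemma pres_keys:
 assumes "R \<subseteq> car (free X)" "t \<in> car (quot (free X) R)" "x \<in> pkeys t"
 shows "x \<in> X"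
 using quot_car_sub[OF vspace_free assms(1,2)] assms(3) by (auto simp: car_free)

lemma pres_lext_hom:
 assumes "vspace C" "!!x. x \<in> X ==> \<phi> x \<in> car C" "R \<subseteq> car (free X)"
 shows "lext (scl C) \<phi> \<in> hom (quot (free X) R) C"
 using quot_hom[OF vspace_free assms(3) lext_hom_free[OF assms(1,2)]] .

text \<open>An element of the quotient represents itself, so its own coefficients express it through
  the classes of the generators. Linear maps on the quotient are therefore determined on
  generators.\<close>

lemma pres_eq:
 assumes "t \<in> car (quot (free X) R)"
 shows "t = lext psc (%x. qproj (free X) R (vec x)) t"
proof -
 \<comment> \<open>Nothing places the keys of \<open>t\<close> inside \<open>X\<close> at this
   point, but \<open>qproj\<close> is linear on the whole ambient type.\<close>
 have h: "qproj (free X) R \<in> hom (free UNIV) (free UNIV)"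
  using qproj_add[OF vspace_free, of X R] qproj_scl[OF vspace_free, of X R]
  by (intro homI) (auto simp: car_free)
 have "t = qproj (free X) R (lext psc vec t)"
  using qproj_quot[OF vspace_free assms] by (simp add: lext_psc_vec)
 also have "\<dots> = lext psc (%x. qproj (free X) R (vec x)) t"
  using hom_lext[OF h vspace_free, of t vec] by (simp add: car_free)
 finally show ?thesis .
qed

lemma pres_hom_eqI:
 assumes "f \<in> hom (quot (free X) R) C" "g \<in> hom (quot (free X) R) C" "R \<subseteq> car (free X)"
  "!!x. x \<in> X ==> f (qproj (free X) R (vec x)) = g (qproj (free X) R (vec x))"
  "t \<in> car (quot (free X) R)"
 shows "f t = g t"
proof -
 have *: "h t = lext (scl C) (%x. h (qproj (free X) R (vec x))) t" if "h \<in> hom (quot (free X) R) C" for h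
  using pres_eq[OF assms(5)] hom_lext[OF that vspace_quot[OF vspace_free], of t "%x. qproj (free X) R (vec x)"]
   pres_keys[OF assms(3,5)] by (simp add: qproj_in_quot vec_free)
 show ?thesis
  unfolding *[OF assms(1)] *[OF assms(2)] using pres_keys[OF assms(3,5)] assms(4)
  by (intro lext_cong) auto
qed

subsection \<open>Tensor products\<close>

lemma tens_rel_car:
 assumes "vspace A" "vspace B"
 shows "tens_rel A B \<subseteq> car (free (car A \<times> car B))"
 unfolding tens_rel_def
 using assms
 by (auto intro!: car_diff[OF vspace_free] vec_free car_add
   car_scl[OF vspace_free, simplified] car_scl)

lemma vspace_tens: "vspace (tens A B)"
 by (simp add: tens_def vspace_quot vspace_free)

lemma scl_tens [simp]: "scl (tens A B) = psc"
 by (simp add: tens_def)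

lemma pure_bihom:
 assumes "vspace A" "vspace B"
 shows "pure A B \<in> bihom A B (tens A B)"
proof -
 let ?X = "car A \<times> car B" and ?q = "qproj (free (car A \<times> car B)) (tens_rel A B)"
 have z: "?q (r - s - t) = 0 ==> ?q r = ?q s + ?q t" for r s t
  by (simp add: qproj_diff[OF vspace_free] diff_diff_eq qproj_add[OF vspace_free])
 have y: "?q (r - psc c s) = 0 ==> ?q r = psc c (?q s)" for r s c
  using qproj_scl[OF vspace_free, of ?X "tens_rel A B" c s] by (simp add: qproj_diff vspace_free)
 have rel: "r \<in> tens_rel A B ==> ?q r = 0" for r by (simp add: qproj_rel vspace_free)
 show ?thesis
 proof (rule bihomI; rule homI)
  fix x y assume "x \<in> car A" "y \<in> car B"
  then show "pure A B x y \<in> car (tens A B)" "pure A B x y \<in> car (tens A B)"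
   by (simp_all add: pure_def tens_def qproj_in_quot vec_free)
 next
  fix x y y' assume "x \<in> car A" "y \<in> car B" "y' \<in> car B"
  then show "pure A B x (y + y') = pure A B x y + pure A B x y'"
   unfolding pure_def tens_def by (intro z rel) (auto simp: tens_rel_def)
 next
  fix c x y assume "x \<in> car A" "y \<in> car B"
  then show "pure A B x (scl B c y) = scl (tens A B) c (pure A B x y)"
   "pure A B (scl A c x) y = scl (tens A B) c (pure A B x y)"
   unfolding pure_def scl_tens
   by (intro y rel; auto simp: tens_rel_def)+
 next
  fix x x' y assume "y \<in> car B" "x \<in> car A" "x' \<in> car A"
  then show "pure A B (x + x') y = pure A B x y + pure A B x' y"
   unfolding pure_def tens_def by (intro z rel) (auto simp: tens_rel_def)
 qed
qed

lemmas pure_car = bihom_car[OF pure_bihom]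

text \<open>Universal property of the tensor product: bilinearity of \<open>\<phi>\<close> says
  precisely that its linear extension kills the four families of \<open>tens_rel\<close>.\<close>

lemma
 assumes "vspace A" "vspace B" "vspace C" "\<phi> \<in> bihom A B C"
 shows lext_pure: "a \<in> car A ==> b \<in> car B ==> lext (scl C) (%(x, y). \<phi> x y) (pure A B a b) = \<phi> a b"
  and lext_tens_hom: "lext (scl C) (%(x, y). \<phi> x y) \<in> hom (tens A B) C"
proof -
 have c: "(%(x, y). \<phi> x y) z \<in> car C" if "z \<in> car A \<times> car B" for z
  using that bihom_car[OF assms(4)] by auto
 have vs: "vector_space (scl C)" using assms(3) by (rule vspace_vs)
 have h: "\<phi> (x + x') y = \<phi> x y + \<phi> x' y" "\<phi> (scl A k x) y = scl C k (\<phi> x y)"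
  if "x \<in> car A" "x' \<in> car A" "y \<in> car B" for x x' y k
  using that hom_add[OF bihom_left[OF assms(4)]] hom_scl[OF bihom_left[OF assms(4)]] by blast+
 have h': "\<phi> x (y + y') = \<phi> x y + \<phi> x y'" "\<phi> x (scl B k y) = scl C k (\<phi> x y)"
  if "x \<in> car A" "y' \<in> car B" "y \<in> car B" for x y' y k
  using that hom_add[OF bihom_right[OF assms(4)]] hom_scl[OF bihom_right[OF assms(4)]] by blast+
 have r: "lext (scl C) (%(x, y). \<phi> x y) r = 0" if "r \<in> tens_rel A B" for r
  using that unfolding tens_rel_def
  by (auto simp: lext_diff[OF vs] lext_psc[OF vs] lext_vec[OF vs] h h')
 show "lext (scl C) (%(x, y). \<phi> x y) (pure A B a b) = \<phi> a b" if "a \<in> car A" "b \<in> car B"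
  using pres_lext[OF assms(3) c tens_rel_car[OF assms(1,2)] r, of "(a, b)"] that by (simp add: pure_def)
 show "lext (scl C) (%(x, y). \<phi> x y) \<in> hom (tens A B) C"
  unfolding tens_def by (rule pres_lext_hom[OF assms(3) c tens_rel_car[OF assms(1,2)]])
qed

lemma tens_hom_eqI:
 assumes "vspace A" "vspace B" "f \<in> hom (tens A B) C" "g \<in> hom (tens A B) C"
  "!!a b. a \<in> car A ==> b \<in> car B ==> f (pure A B a b) = g (pure A B a b)" "t \<in> car (tens A B)"
 shows "f t = g t"
 by (rule pres_hom_eqI[OF assms(3,4)[unfolded tens_def] tens_rel_car[OF assms(1,2)] _ assms(6)[unfolded tens_def]])
  (use assms(5) in "auto simp: pure_def")

lemma tens_eq: "t \<in> car (tens A B) ==> t = lext psc (%(a, b). pure A B a b) t"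
 using pres_eq[of t "car A \<times> car B" "tens_rel A B"] by (simp add: tens_def pure_def case_prod_beta')

lemma tens_keys:
 "vspace A ==> vspace B ==> t \<in> car (tens A B) ==> x \<in> pkeys t ==> x \<in> car A \<times> car B"
 using pres_keys[OF tens_rel_car] by (metis tens_def)

subsection \<open>Direct sums\<close>

lemma vspace_dsum:
 assumes "!!n. vspace (A n)"
 shows "vspace (dsum A)"
proof -
 have l: "plookup (scl (dsum A) c w) n = scl (A n) c (plookup w n)" for c w n
  using scl_0[OF assms] by (auto simp: dsum_def mapp.rep_eq when_def in_keys_iff)
 show ?thesis
 proof (rule vspaceI)
  show "vector_space (scl (dsum A))"
   by unfold_locales
    (auto intro!: poly_mapping_eqI simp: l lookup_add scl_add[OF assms] scl_add_left[OF assms]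
     scl_scl[OF assms] scl_1[OF assms])
  show "0 \<in> car (dsum A)" by (simp add: dsum_def car_0 assms)
 next
  fix x y assume "x \<in> car (dsum A)" "y \<in> car (dsum A)"
  then show "x + y \<in> car (dsum A)" by (simp add: dsum_def lookup_add car_add assms)
 next
  fix c x assume "x \<in> car (dsum A)"
  then show "scl (dsum A) c x \<in> car (dsum A)"
   using l[of c x] by (simp add: dsum_def car_scl assms)
 qed
qed

lemma lookup_scl_dsum:
 assumes "!!n. vspace (A n)"
 shows "plookup (scl (dsum A) c w) n = scl (A n) c (plookup w n)"
 using scl_0[OF assms] by (auto simp: dsum_def mapp.rep_eq when_def in_keys_iff)

lemma single_dsum:
 assumes "!!n. vspace (A n)"
 shows "psingle n \<in> hom (A n) (dsum A)"
proof (rule homI)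
 fix x assume "x \<in> car (A n)"
 then show "psingle n x \<in> car (dsum A)"
  by (auto simp: dsum_def lookup_single when_def car_0 assms)
next
 fix c x assume "x \<in> car (A n)"
 show "psingle n (scl (A n) c x) = scl (dsum A) c (psingle n x)"
  by (rule poly_mapping_eqI)
   (auto simp: lookup_scl_dsum[OF assms] lookup_single when_def scl_0[OF assms])
qed (simp add: single_add)

lemma lookup_dsum: "(%w. plookup w n) \<in> hom (dsum A) (A n)" if "!!n. vspace (A n)"
 by (rule homI) (simp_all add: lookup_add lookup_scl_dsum[OF that], simp add: dsum_def)

lemma dsum_eq: "w = (\<Sum>n\<in>pkeys w. psingle n (plookup w n))"
 by (simp add: sum_keys_single)

lemma dsum_hom_eqI:
 assumes v: "!!n. vspace (A n)" and "f \<in> hom (dsum A) C" "g \<in> hom (dsum A) C"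
  "!!n x. x \<in> car (A n) ==> f (psingle n x) = g (psingle n x)" "w \<in> car (dsum A)"
 shows "f w = g w"
proof -
 have l: "plookup w n \<in> car (A n)" for n using assms(5) by (simp add: dsum_def)
 have s: "psingle n (plookup w n) \<in> car (dsum A)" for n
  using hom_car[OF single_dsum[of A n, OF v] l] .
 show ?thesis
  by (subst (1 2) dsum_eq)
   (simp add: hom_sum[OF assms(2) vspace_dsum[OF v] s] hom_sum[OF assms(3) vspace_dsum[OF v] s] assms(4)[OF l])
qed

subsection \<open>Sums over the splittings of a multiset\<close>

definition ins_split :: "'a => ('a multiset \<times> 'a multiset) multiset => ('a multiset \<times> 'a multiset) multiset" where
 "ins_split x S = image_mset (%(A, B). (add_mset x A, B)) S + image_mset (%(A, B). (A, add_mset x B)) S"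

text \<open>Equal letters are split as if they were distinct, so a monomial of degree n has 2^n
  splittings, one for each subset of positions in the expansion of the coproduct.\<close>

definition splitm :: "'a multiset => ('a multiset \<times> 'a multiset) multiset" where
 "splitm M = fold_mset ins_split {#({#}, {#})#} M"

text \<open>Sweedler notation on monomials: \<open>f\<close> is applied to the two tensor factors of
  the coproduct of \<open>M\<close>. No order of the letters enters.\<close>

definition SS :: "'a multiset => ('a multiset => 'a multiset => 'c) => 'c::comm_monoid_add" where
 "SS M f = (\<Sum>(A, B)\<in>#splitm M. f A B)"

lemma splitm_empty: "splitm {#} = {#({#}, {#})#}"
 by (simp add: splitm_def)

lemma splitm_add: "splitm (add_mset x M) = ins_split x (splitm M)"
proof -
 interpret comp_fun_commute ins_split
  by unfold_locales
   (auto simp: ins_split_def fun_eq_iff multiset.map_comp comp_def case_prod_beta' add_mset_commute ac_simps)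
 show ?thesis by (simp add: splitm_def)
qed

lemma SS_empty [simp]: "SS {#} f = f {#} {#}"
 by (simp add: SS_def splitm_empty)

lemma SS_plus: "SS M (%A B. f A B + g A B) = SS M f + SS M g"
 by (simp add: SS_def sum_mset.distrib case_prod_beta')

lemma SS_zero: "SS M (%A B. 0) = 0"
 by (simp add: SS_def case_prod_beta')

lemma SS_minus: "SS M (%A B. f A B - g A B) = SS M f - SS M (g :: _ => _ => 'c::ab_group_add)"
 using SS_plus[of M "%A B. f A B - g A B" g] by (simp add: algebra_simps)

lemma SS_add2: "SS (add_mset x M) f = SS M (%A B. f (add_mset x A) B) + SS M (%A B. f A (add_mset x B))"
 by (simp add: SS_def splitm_add ins_split_def multiset.map_comp comp_def case_prod_beta')

lemma SS_add: "SS (add_mset x M) f = SS M (%A B. f (add_mset x A) B + f A (add_mset x B))"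
 by (simp add: SS_add2 SS_plus)

lemma splitm_sum: "(A, B) \<in># splitm M ==> A + B = M"
 by (induction M arbitrary: A B) (auto simp: splitm_empty splitm_add ins_split_def)

lemma SS_cong: "(!!A B. A + B = M ==> f A B = g A B) ==> SS M f = SS M g"
 by (auto simp: SS_def splitm_sum intro!: arg_cong[where f = sum_mset] image_mset_cong)

lemma SS_SS_swap: "SS M (%A B. SS N (%C D. f A B C D)) = SS N (%C D. SS M (%A B. f A B C D))"
 by (induction M arbitrary: f) (simp_all add: SS_add SS_plus)

text \<open>Cocommutativity on monomials. Likewise \<open>SS_assoc\<close> is coassociativity,
  \<open>SS_union\<close> is compatibility with the usual product, and \<open>SS_delta_left\<close>
  and \<open>SS_delta_right\<close> are the counit laws.\<close>

lemma SS_comm: "SS M f = SS M (%A B. f B A)"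
proof (induction M arbitrary: f)
 case (add x M)
 show ?case
  using add[of "%A. f (add_mset x A)"] add[of "%A B. f A (add_mset x B)"] by (simp add: SS_add2 add.commute)
qed simp

lemma SS_assoc: "SS M (%A B. SS A (%A1 A2. f A1 A2 B)) = SS M (%A B. SS B (%B1 B2. f A B1 B2))"
 by (induction M arbitrary: f) (simp_all add: SS_add SS_plus add.assoc)

lemma SS_union: "SS (M + N) f = SS M (%A B. SS N (%C D. f (A + C) (B + D)))"
 by (induction M arbitrary: f) (simp_all add: SS_add SS_plus)

lemma SS_image: "SS (image_mset h M) f = SS M (%A B. f (image_mset h A) (image_mset h B))"
 by (induction M arbitrary: f) (simp_all add: SS_add)

lemma SS_delta_left: "SS M (%A B. if A = {#} then f B else 0) = f M"
 by (induction M arbitrary: f) (simp_all add: SS_add SS_zero)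

lemma SS_delta_right: "SS M (%A B. if B = {#} then f A else 0) = f M"
 by (subst SS_comm) (rule SS_delta_left)

text \<open>Bridge from the subsets of positions used in the definitions to \<open>SS\<close>. The
  labels \<open>h\<close> may repeat, since the summand sees only multisets of labels.\<close>

lemma SS_index:
 "finite S ==> (\<Sum>A\<in>Pow S. f (image_mset h (mset_set A)) (image_mset h (mset_set (S - A))))
   = SS (image_mset h (mset_set S)) f"
proof (induction S arbitrary: f rule: finite_induct)
 case (insert a S)
 have i: "inj_on (insert a) (Pow S)" using insert(2) by (auto simp: inj_on_def)
 have fin: "A \<subseteq> S ==> finite A" for A using insert(1) finite_subset by auto
 have n: "A \<subseteq> S ==> a \<notin> A" for A using insert(2) by auto
 have d: "A \<subseteq> S ==> insert a S - A = insert a (S - A)" "insert a S - insert a A = S - A" for A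
  using insert(2) by auto
 have "(\<Sum>A\<in>Pow (insert a S). f (image_mset h (mset_set A)) (image_mset h (mset_set (insert a S - A))))
  = (\<Sum>A\<in>Pow S. f (image_mset h (mset_set A)) (image_mset h (mset_set (insert a S - A))))
   + (\<Sum>A\<in>Pow S. f (image_mset h (mset_set (insert a A))) (image_mset h (mset_set (insert a S - insert a A))))"
  unfolding Pow_insert using insert(1,2)
  by (subst sum.union_disjoint) (auto simp: sum.reindex[OF i])
 also have "\<dots> = (\<Sum>A\<in>Pow S. f (image_mset h (mset_set A)) (add_mset (h a) (image_mset h (mset_set (S - A)))))
   + (\<Sum>A\<in>Pow S. f (add_mset (h a) (image_mset h (mset_set A))) (image_mset h (mset_set (S - A))))"
  using insert(1,2) fin n d
  by (intro arg_cong2[where f = plus] sum.cong refl) (auto simp: Diff_insert_absorb)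
 finally show ?case
  using insert.IH[of "%A B. f A (add_mset (h a) B)"] insert.IH[of "%A B. f (add_mset (h a) A) B"] insert(1,2)
  by (simp add: SS_add2 add.commute)
qed simp

lemma mset_nths: "mset (nths xs I) = image_mset (nth xs) (mset_set (I \<inter> {..<length xs}))"
proof (induction xs rule: rev_induct)
 case (snoc x xs)
 have e: "I \<inter> {..<length (xs @ [x])} = (if length xs \<in> I then insert (length xs) else id) (I \<inter> {..<length xs})"
  by (auto simp: less_Suc_eq)
 have "image_mset ((!) (xs @ [x])) (mset_set (I \<inter> {..<length xs})) = image_mset ((!) xs) (mset_set (I \<inter> {..<length xs}))"
  by (rule image_mset_cong) (auto simp: nth_append)
 with snoc show ?case unfolding e by (auto simp: nths_append)
qed simp

lemma SS_nths: "(\<Sum>I\<in>Pow {..<length xs}. f (mset (nths xs I)) (mset (nths xs (- I)))) = SS (mset xs) f"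
proof -
 have "mset (nths xs I) = image_mset (nth xs) (mset_set I)"
  "mset (nths xs (- I)) = image_mset (nth xs) (mset_set ({..<length xs} - I))" if "I \<in> Pow {..<length xs}" for I
  using that by (auto simp: mset_nths Int_absorb2 Diff_eq Int_commute)
 then have "(\<Sum>I\<in>Pow {..<length xs}. f (mset (nths xs I)) (mset (nths xs (- I))))
  = SS (image_mset (nth xs) (mset_set {..<length xs})) f"
  by (simp flip: SS_index)
 also have "image_mset (nth xs) (mset_set {..<length xs}) = mset xs"
  using mset_nths[of xs UNIV] by (simp add: nths_all)
 finally show ?thesis .
qed

subsection \<open>Sums over the letters of a multiset\<close>

text \<open>The Leibniz sum of the derivation extending \<open>h\<close>, composed with
  \<open>f\<close>.\<close>

definition DS :: "('a => 'a) => 'a multiset => ('a multiset => 'c) => 'c::comm_monoid_add" where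
 "DS h M f = (\<Sum>x\<in>#M. f (add_mset (h x) (M - {#x#})))"

lemma DS_empty [simp]: "DS h {#} f = 0"
 by (simp add: DS_def)

lemma DS_add: "DS h (add_mset x M) f = f (add_mset (h x) M) + DS h M (%N. f (add_mset x N))"
proof -
 have "image_mset (%y. f (add_mset (h y) (add_mset x M - {#y#}))) M =
   image_mset (%y. f (add_mset x (add_mset (h y) (M - {#y#})))) M"
 proof (rule image_mset_cong)
  fix y assume "y \<in># M"
  then have "add_mset x M - {#y#} = add_mset x (M - {#y#})"
   by (metis add_mset_commute add_mset_remove_trivial insert_DiffM)
  then show "f (add_mset (h y) (add_mset x M - {#y#})) = f (add_mset x (add_mset (h y) (M - {#y#})))"
   by (simp add: add_mset_commute)
 qed
 then show ?thesis by (simp add: DS_def)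
qed

lemma DS_cong: "(!!x N. M = add_mset x N ==> f (add_mset (h x) N) = g (add_mset (h x) N)) ==> DS h M f = DS h M g"
 unfolding DS_def by (auto intro!: arg_cong[where f = sum_mset] image_mset_cong)

lemma DS_cong_fun: "(!!x. x \<in># M ==> h x = k x) ==> DS h M f = DS k M f"
 unfolding DS_def by (auto intro!: arg_cong[where f = sum_mset] image_mset_cong)

lemma DS_plus: "DS h M (%N. f N + g N) = DS h M f + DS h M g"
 by (simp add: DS_def sum_mset.distrib)

lemma DS_zero: "DS h M (%N. 0) = 0"
 by (simp add: DS_def)

text \<open>On monomials, a derivation that maps letters to letters is a coderivation: the letter it
  changes lies in exactly one of the two factors.\<close>

lemma DS_SS: "DS h M (%N. SS N f) = SS M (%A B. DS h A (%X. f X B) + DS h B (%X. f A X))"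
 by (induction M arbitrary: f) (simp_all add: DS_add SS_add SS_plus DS_plus ac_simps)

lemma DS_union: "DS h (M + N) f = DS h M (%X. f (X + N)) + DS h N (%X. f (M + X))"
 by (induction M arbitrary: f) (simp_all add: DS_add ac_simps)

lemma DS_image:
 "(!!x. x \<in># M ==> k (h x) = h (k' x)) ==> DS k (image_mset h M) f = DS k' M (%X. f (image_mset h X))"
 by (induction M arbitrary: f) (simp_all add: DS_add)

text \<open>Two successive replacements either concern different letters, which is symmetric in
  \<open>h\<close> and \<open>k\<close>, or the same letter. This is the commutator formula for
  derivations, written with sums only.\<close>

lemma DS_DS:
 "DS h M (%N. DS k N f) + DS (%x. h (k x)) M f = DS k M (%N. DS h N f) + DS (%x. k (h x)) M f"
proof (induction M arbitrary: f)
 case (add x M)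
 let ?g = "%N. f (add_mset x N)"
 have e: "DS h (add_mset x M) (%N. DS k N f) + DS (%x. h (k x)) (add_mset x M) f =
  (f (add_mset (k (h x)) M) + f (add_mset (h (k x)) M) + DS k M (%N. f (add_mset (h x) N)) + DS h M (%N. f (add_mset (k x) N)))
  + (DS h M (%N. DS k N ?g) + DS (%x. h (k x)) M ?g)" for h k
  by (simp add: DS_add DS_plus add.assoc add.left_commute)
 show ?case unfolding e add[of ?g] by (simp add: ac_simps)
qed simp

lemma sum_list_update: "(\<Sum>i<length ys. f (mset (ys[i := h (ys ! i)]))) = DS h (mset ys) f"
proof (induction ys arbitrary: f)
 case (Cons y ys)
 then show ?case
  using Cons[of "%N. f (add_mset y N)"] by (simp add: sum.lessThan_Suc_shift DS_add del: sum.lessThan_Suc)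
qed simp

lemma mset_list_of [simp]: "mset (list_of M) = M"
 unfolding list_of_def by (rule someI_ex) (rule ex_mset)

lemma length_list_of [simp]: "length (list_of M) = size M"
 by (metis mset_list_of size_mset)

lemma set_list_of [simp]: "set (list_of M) = set_mset M"
 by (metis mset_list_of set_mset_mset)

subsection \<open>Linearity of these sums\<close>

lemma SS_car: "vspace C ==> (!!A B. A + B = M ==> f A B \<in> car C) ==> SS M f \<in> car C"
 unfolding SS_def by (rule car_sum_mset) (auto simp: splitm_sum)

lemma DS_car: "vspace C ==> (!!x N. M = add_mset x N ==> f (add_mset (h x) N) \<in> car C) ==> DS h M f \<in> car C"
 unfolding DS_def by (rule car_sum_mset) auto

lemma hom_of_SS:
 "g \<in> hom B C ==> vspace B ==> (!!X Y. X + Y = M ==> f X Y \<in> car B) ==> g (SS M f) = SS M (%X Y. g (f X Y))"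
 unfolding SS_def by (subst hom_sum_mset) (auto simp: splitm_sum case_prod_beta')

lemma hom_of_DS:
 "g \<in> hom B C ==> vspace B ==> (!!x N. M = add_mset x N ==> f (add_mset (h x) N) \<in> car B) ==>
  g (DS h M f) = DS h M (%N. g (f N))"
 unfolding DS_def by (subst hom_sum_mset) auto

lemma hom_SS:
 "vspace C ==> (!!X Y. X + Y = M ==> (%x. f x X Y) \<in> hom B C) ==> (%x. SS M (f x)) \<in> hom B C"
 unfolding SS_def case_prod_beta' by (rule hom_Sum_mset) (auto simp: splitm_sum)

lemma hom_DS:
 "vspace C ==> (!!y N. M = add_mset y N ==> (%x. f x (add_mset (h x y) N)) \<in> hom B C) ==> (%x. DS (h x) M (f x)) \<in> hom B C"
 unfolding DS_def by (rule hom_Sum_mset) (auto dest: multi_member_split)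

subsection \<open>Symmetric algebras\<close>

definition mcar :: "('k, 'w) vs => 'w multiset set" where
 "mcar W = {M. set_mset M \<subseteq> car W}"

lemma mcar_simps [simp]:
 "{#} \<in> mcar W" "add_mset x M \<in> mcar W \<longleftrightarrow> x \<in> car W \<and> M \<in> mcar W"
 "M + N \<in> mcar W \<longleftrightarrow> M \<in> mcar W \<and> N \<in> mcar W"
 by (auto simp: mcar_def)

lemma mcarD: "M \<in> mcar W ==> x \<in># M ==> x \<in> car W"
 by (auto simp: mcar_def)

text \<open>A function of multisets is symmetric from the outset, so linearity in one added letter
  amounts to full multilinearity.\<close>

definition symfun :: "('k, 'w::ab_group_add) vs => ('k, 'c::ab_group_add) vs => ('w multiset => 'c) => bool" where
 "symfun W C \<phi> \<longleftrightarrow> (\<forall>M\<in>mcar W. \<phi> M \<in> car C \<and> (%x. \<phi> (add_mset x M)) \<in> hom W C)"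

lemma
 assumes "symfun W C \<phi>" "M \<in> mcar W"
 shows symfun_car: "\<phi> M \<in> car C"
  and symfun_hom: "(%x. \<phi> (add_mset x M)) \<in> hom W C"
 using assms by (auto simp: symfun_def)

lemma symfunI:
 "(!!M. M \<in> mcar W ==> \<phi> M \<in> car C) ==> (!!M. M \<in> mcar W ==> (%x. \<phi> (add_mset x M)) \<in> hom W C) ==> symfun W C \<phi>"
 by (auto simp: symfun_def)

lemma symfun_cong: "symfun W C \<phi> ==> vspace W ==> (!!M. M \<in> mcar W ==> \<phi> M = \<psi> M) ==> symfun W C \<psi>"
 by (rule symfunI, metis symfun_car, rule hom_cong[of "%x. \<phi> (add_mset x _)"]) (auto intro: symfun_hom)

lemma scl_Sym [simp]: "scl (Sym W) = psc"
 by (simp add: Sym_def)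

lemma vspace_Sym: "vspace (Sym W)"
 by (simp add: Sym_def vspace_quot vspace_free)

lemma Sym_mcar: "Sym W = quot (free (mcar W)) (sym_rel W)"
 by (simp add: Sym_def mcar_def)

lemma smon_mcar: "smon W M = qproj (free (mcar W)) (sym_rel W) (vec M)"
 by (simp add: smon_def mcar_def)

lemma sym_rel_car: "vspace W ==> sym_rel W \<subseteq> car (free (mcar W))"
 unfolding sym_rel_def
 by (auto intro!: car_diff[OF vspace_free] vec_free car_add
   car_scl[OF vspace_free, simplified] car_scl simp: mcar_def)

lemma smon_car: "M \<in> mcar W ==> smon W M \<in> car (Sym W)"
 by (simp add: smon_mcar Sym_mcar qproj_in_quot vec_free)

lemma sone_car: "sone W \<in> car (Sym W)"
 by (simp add: sone_def smon_car)

lemma smon_symfun: "symfun W (Sym W) (smon W)"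
proof (rule symfunI)
 fix M assume M: "M \<in> mcar W"
 let ?q = "qproj (free (mcar W)) (sym_rel W)"
 have z: "?q (r - s - t) = 0 ==> ?q r = ?q s + ?q t" for r s t
  by (simp add: qproj_diff[OF vspace_free] diff_diff_eq qproj_add[OF vspace_free])
 have y: "?q (r - psc c s) = 0 ==> ?q r = psc c (?q s)" for r s c
  using qproj_scl[OF vspace_free, of "mcar W" "sym_rel W" c s] by (simp add: qproj_diff vspace_free)
 have rel: "r \<in> sym_rel W ==> ?q r = 0" for r by (simp add: qproj_rel vspace_free)
 show "(%x. smon W (add_mset x M)) \<in> hom W (Sym W)"
 proof (rule homI)
  fix x y assume "x \<in> car W" "y \<in> car W"
  then show "smon W (add_mset (x + y) M) = smon W (add_mset x M) + smon W (add_mset y M)"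
   unfolding smon_mcar using M by (intro z rel) (auto simp: sym_rel_def mcar_def)
 next
  fix c x assume "x \<in> car W"
  then show "smon W (add_mset (scl W c x) M) = scl (Sym W) c (smon W (add_mset x M))"
   unfolding smon_mcar scl_Sym using M by (intro y rel) (auto simp: sym_rel_def mcar_def)
 qed (use M in "simp add: smon_car")
qed (simp add: smon_car)

lemma
 assumes "vspace W" "vspace C" "symfun W C \<phi>"
 shows Sym_lext: "M \<in> mcar W ==> lext (scl C) \<phi> (smon W M) = \<phi> M"
  and Sym_lext_hom: "lext (scl C) \<phi> \<in> hom (Sym W) C"
proof -
 have vs: "vector_space (scl C)" using assms(2) by (rule vspace_vs)
 have r: "lext (scl C) \<phi> r = 0" if "r \<in> sym_rel W" for r
  using that hom_add[OF symfun_hom[OF assms(3)]] hom_scl[OF symfun_hom[OF assms(3)]] unfolding sym_rel_def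
  by (auto simp: lext_diff[OF vs] lext_psc[OF vs] lext_vec[OF vs] mcar_def)
 show "lext (scl C) \<phi> (smon W M) = \<phi> M" if "M \<in> mcar W"
  unfolding smon_mcar by (rule pres_lext[OF assms(2) symfun_car[OF assms(3)] sym_rel_car[OF assms(1)] r that])
 show "lext (scl C) \<phi> \<in> hom (Sym W) C"
  unfolding Sym_mcar by (rule pres_lext_hom[OF assms(2) symfun_car[OF assms(3)] sym_rel_car[OF assms(1)]])
qed

lemma Sym_hom_eqI:
 assumes "vspace W" "f \<in> hom (Sym W) C" "g \<in> hom (Sym W) C"
  "!!M. M \<in> mcar W ==> f (smon W M) = g (smon W M)" "a \<in> car (Sym W)"
 shows "f a = g a"
 by (rule pres_hom_eqI[OF assms(2,3)[unfolded Sym_mcar] sym_rel_car[OF assms(1)] _ assms(5)[unfolded Sym_mcar]])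
  (use assms(4) in "auto simp: smon_mcar")

lemma Sym_keys: "vspace W ==> a \<in> car (Sym W) ==> M \<in> pkeys a ==> M \<in> mcar W"
 using pres_keys[OF sym_rel_car] by (metis Sym_mcar)

lemma Sym_eq: "a \<in> car (Sym W) ==> a = lext psc (smon W) a"
 using pres_eq[of a "mcar W" "sym_rel W"] by (simp add: Sym_mcar smon_mcar[abs_def])

lemma symfun_add_mset: "symfun W C \<phi> ==> y \<in> car W ==> symfun W C (%M. \<phi> (add_mset y M))"
 by (rule symfunI) (auto simp: symfun_car add_mset_commute[of y] intro: symfun_hom)

lemma symfun_hom_comp: "g \<in> hom B C ==> symfun W B \<phi> ==> symfun W C (%M. g (\<phi> M))"
 by (rule symfunI) (auto simp: symfun_car hom_car intro: hom_comp symfun_hom)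

lemma symfun_SS:
 assumes "vspace C" "!!B. B \<in> mcar W ==> symfun W C (%A. f A B)" "!!A. A \<in> mcar W ==> symfun W C (f A)"
 shows "symfun W C (%M. SS M f)"
proof (rule symfunI)
 fix M assume M: "M \<in> mcar W"
 show "SS M f \<in> car C" using M by (auto intro!: SS_car assms(1) symfun_car[OF assms(3)])
 show "(%x. SS (add_mset x M) f) \<in> hom W C"
  unfolding SS_add
  by (rule hom_SS[OF assms(1)], rule hom_plus[OF assms(1)])
   (use M symfun_hom[OF assms(3)] symfun_hom[OF assms(2)] in auto)
qed

lemma symfun_DS:
 assumes "vspace C" "symfun W C \<phi>" "h \<in> hom W W"
 shows "symfun W C (%M. DS h M \<phi>)"
proof (rule symfunI)
 fix M assume M: "M \<in> mcar W"
 show "DS h M \<phi> \<in> car C"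
  using M by (auto intro!: DS_car assms(1) symfun_car[OF assms(2)] simp: hom_car[OF assms(3)])
 have "(%x. DS h M (%N. \<phi> (add_mset x N))) \<in> hom W C"
  by (rule hom_DS[OF assms(1), where h = "%_. h"]) (use M in "auto simp: hom_car[OF assms(3)] intro!: symfun_hom[OF assms(2)]")
 then show "(%x. DS h (add_mset x M) \<phi>) \<in> hom W C"
  unfolding DS_add
  by (rule hom_plus[OF assms(1) hom_comp[OF symfun_hom[OF assms(2) M] assms(3)]])
qed

lemma hom_DS_var:
 assumes "vspace C" "symfun W C \<phi>" "M \<in> mcar W" "!!y. y \<in> car W ==> (%x. h x y) \<in> hom B W"
 shows "(%x. DS (h x) M \<phi>) \<in> hom B C"
 by (rule hom_DS[OF assms(1), where f = "%_. \<phi>"])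
  (use assms(3) in "auto intro!: hom_comp[OF symfun_hom[OF assms(2)]] assms(4)")

section \<open>Multiplication by a letter and derivations of the symmetric algebra\<close>

definition vm :: "('k::field, 'w::ab_group_add) vs => 'w => ('w multiset \<Rightarrow>\<^sub>0 'k) => ('w multiset \<Rightarrow>\<^sub>0 'k)" where
 "vm W x a = lext psc (%M. smon W (add_mset x M)) a"

text \<open>The derivation of the usual product that extends \<open>h\<close>. It gives
  \<open>der_act\<close> on the free algebra side and one of the two summands of right Oudom--Guin
  multiplication by a letter.\<close>

definition DD :: "('k::field, 'w::ab_group_add) vs => ('w => 'w) => ('w multiset \<Rightarrow>\<^sub>0 'k) => ('w multiset \<Rightarrow>\<^sub>0 'k)" where
 "DD W h a = lext psc (%M. DS h M (smon W)) a"

lemma lext_hom_fun: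
 assumes "vspace W" "a \<in> car (Sym W)" "vspace C" "!!M. M \<in> mcar W ==> (%x. f x M) \<in> hom B C"
 shows "(%x. lext (scl C) (f x) a) \<in> hom B C"
 by (rule hom_Lext[OF assms(3)]) (use assms Sym_keys in auto)

lemma
 assumes "vspace W"
 shows vm_smon: "x \<in> car W ==> M \<in> mcar W ==> vm W x (smon W M) = smon W (add_mset x M)"
  and vm_bihom: "vm W \<in> bihom W (Sym W) (Sym W)"
proof -
 have s: "symfun W (Sym W) (%M. smon W (add_mset x M))" if "x \<in> car W" for x
  using symfun_add_mset[OF smon_symfun that] .
 show "vm W x (smon W M) = smon W (add_mset x M)" if "x \<in> car W" "M \<in> mcar W"
  using Sym_lext[OF assms vspace_Sym s that(2)] that(1) by (simp add: vm_def)
 show "vm W \<in> bihom W (Sym W) (Sym W)"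
 proof (rule bihomI)
  show "vm W x \<in> hom (Sym W) (Sym W)" if "x \<in> car W" for x
   using Sym_lext_hom[OF assms vspace_Sym s[OF that]] by (simp add: vm_def[abs_def])
  show "(%x. vm W x a) \<in> hom W (Sym W)" if "a \<in> car (Sym W)" for a
   using lext_hom_fun[OF assms that vspace_Sym[of W], of "%x M. smon W (add_mset x M)" W] symfun_hom[OF smon_symfun[of W]]
   by (simp add: vm_def[abs_def])
 qed
qed

lemma vm_car: "vspace W ==> x \<in> car W ==> a \<in> car (Sym W) ==> vm W x a \<in> car (Sym W)"
 by (rule bihom_car[OF vm_bihom])

lemma vm_comm:
 assumes "vspace W" "x \<in> car W" "y \<in> car W" "a \<in> car (Sym W)"
 shows "vm W x (vm W y a) = vm W y (vm W x a)"
 by (rule Sym_hom_eqI[OF assms(1) _ _ _ assms(4)])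
  (use assms in \<open>auto intro!: hom_comp[OF bihom_right[OF vm_bihom]] bihom_right[OF vm_bihom]
   simp: vm_smon add_mset_commute\<close>)

lemma
 assumes "vspace W" "h \<in> hom W W"
 shows DD_smon: "M \<in> mcar W ==> DD W h (smon W M) = DS h M (smon W)"
  and DD_hom: "DD W h \<in> hom (Sym W) (Sym W)"
 using Sym_lext[OF assms(1) vspace_Sym symfun_DS[OF vspace_Sym smon_symfun assms(2)]]
  Sym_lext_hom[OF assms(1) vspace_Sym symfun_DS[OF vspace_Sym smon_symfun assms(2)]]
 by (simp_all add: DD_def[abs_def])

lemma DD_vm:
 assumes "vspace W" "h \<in> hom W W" "x \<in> car W" "a \<in> car (Sym W)"
 shows "DD W h (vm W x a) = vm W (h x) a + vm W x (DD W h a)"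
proof (rule Sym_hom_eqI[OF assms(1) _ _ _ assms(4)])
 note v = bihom_right[OF vm_bihom[OF assms(1)]]
 show "(%a. DD W h (vm W x a)) \<in> hom (Sym W) (Sym W)"
  using assms by (intro hom_comp[OF DD_hom] v) auto
 show "(%a. vm W (h x) a + vm W x (DD W h a)) \<in> hom (Sym W) (Sym W)"
  using assms by (intro hom_plus vspace_Sym v hom_comp[OF v DD_hom]) (auto simp: hom_car)
 fix M assume M: "M \<in> mcar W"
 have "vm W x (DS h M (smon W)) = DS h M (%N. vm W x (smon W N))"
  using M assms by (intro hom_of_DS[OF v vspace_Sym]) (auto intro!: smon_car simp: hom_car)
 also have "\<dots> = DS h M (%N. smon W (add_mset x N))"
  using M assms by (intro DS_cong vm_smon) (auto simp: hom_car)
 finally show "DD W h (vm W x (smon W M)) = vm W (h x) (smon W M) + vm W x (DD W h (smon W M))"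
  using M assms by (simp add: vm_smon DD_smon hom_car DS_add)
qed

lemma DD_bihom:
 assumes "vspace W" "b \<in> bihom W W' W"
 shows "(%a y. DD W (%x. b x y) a) \<in> bihom (Sym W) W' (Sym W)"
proof (rule bihomI)
 show "(%a. DD W (%x. b x y) a) \<in> hom (Sym W) (Sym W)" if "y \<in> car W'" for y
  using DD_hom[OF assms(1) bihom_left[OF assms(2) that]] .
 show "(%y. DD W (%x. b x y) a) \<in> hom W' (Sym W)" if "a \<in> car (Sym W)" for a
  using lext_hom_fun[OF assms(1) that vspace_Sym[of W], of "%y M. DS (%x. b x y) M (smon W)" W']
   hom_DS_var[OF vspace_Sym smon_symfun[of W] _ bihom_right[OF assms(2)]]
  by (simp add: DD_def[abs_def])
qed

subsection \<open>The coproduct of a symmetric algebra\<close>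

abbreviation "ST W \<equiv> tens (Sym W) (Sym W)"
abbreviation "spure W \<equiv> pure (Sym W) (Sym W)"

lemma spure_bihom: "spure W \<in> bihom (Sym W) (Sym W) (ST W)"
 by (rule pure_bihom[OF vspace_Sym vspace_Sym])

text \<open>Removes the list chosen by \<open>list_of\<close> from the coproduct.\<close>

lemma scop_eq: "scop W = lext psc (%M. SS M (%A B. spure W (smon W A) (smon W B)))"
 unfolding scop_def Let_def SS_nths[where f = "%A B. spure W (smon W A) (smon W B)"] mset_list_of ..

lemma
 assumes "vspace W"
 shows scop_smon: "M \<in> mcar W ==> scop W (smon W M) = SS M (%A B. spure W (smon W A) (smon W B))"
  and scop_hom: "scop W \<in> hom (Sym W) (ST W)"
proof -
 have s: "symfun W (ST W) (%M. SS M (%A B. spure W (smon W A) (smon W B)))"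
  by (intro symfun_SS vspace_tens symfun_hom_comp[OF _ smon_symfun] bihom_left[OF spure_bihom] bihom_right[OF spure_bihom] smon_car)
 show "M \<in> mcar W ==> scop W (smon W M) = SS M (%A B. spure W (smon W A) (smon W B))"
  using Sym_lext[OF assms vspace_tens s] by (simp add: scop_eq)
 show "scop W \<in> hom (Sym W) (ST W)"
  using Sym_lext_hom[OF assms vspace_tens s] by (simp add: scop_eq)
qed

abbreviation "cosum C \<phi> t \<equiv> lext (scl C) (%(x, y). \<phi> x y) t"

text \<open>The representative of a coproduct in the quotient tensor product is unknown, but a
  bilinear map is insensitive to it. Sweedler sums thereby become sums over splittings, and
  identities can be checked on monomials.\<close>

lemma cosum_scop_smon:
 assumes "vspace W" "vspace C" "\<phi> \<in> bihom (Sym W) (Sym W) C" "M \<in> mcar W"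
 shows "cosum C \<phi> (scop W (smon W M)) = SS M (%A B. \<phi> (smon W A) (smon W B))"
proof -
 have "cosum C \<phi> (scop W (smon W M)) = SS M (%A B. cosum C \<phi> (spure W (smon W A) (smon W B)))"
  unfolding scop_smon[OF assms(1,4)]
  by (rule hom_of_SS[OF lext_tens_hom[OF vspace_Sym vspace_Sym assms(2,3)] vspace_tens])
   (use assms(4) in "auto intro!: bihom_car[OF spure_bihom] smon_car")
 also have "\<dots> = SS M (%A B. \<phi> (smon W A) (smon W B))"
  by (rule SS_cong, rule lext_pure[OF vspace_Sym vspace_Sym assms(2,3)])
   (use assms(4) in "auto intro!: smon_car")
 finally show ?thesis .
qed

lemma cosum_scop_hom:
 assumes "vspace W" "vspace C" "\<phi> \<in> bihom (Sym W) (Sym W) C"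
 shows "(%a. cosum C \<phi> (scop W a)) \<in> hom (Sym W) C"
 by (rule hom_comp[OF lext_tens_hom[OF vspace_Sym vspace_Sym assms(2,3)] scop_hom[OF assms(1)]])

lemma cosum_scop_hom_param:
 assumes "vspace W" "vspace C" "!!x y. x \<in> car (Sym W) ==> y \<in> car (Sym W) ==> (%z. \<phi> z x y) \<in> hom D C" "a \<in> car (Sym W)"
 shows "(%z. cosum C (\<phi> z) (scop W a)) \<in> hom D C"
 by (rule hom_Lext[OF assms(2)])
  (use tens_keys[OF vspace_Sym vspace_Sym hom_car[OF scop_hom[OF assms(1)] assms(4)]] assms(3) in auto)

lemma scou_hom: "scou \<in> hom (Sym W) ground"
 by (rule homI) (simp_all add: ground_def scou_def lookup_add lookup_psc)

lemma vspace_ground: "vspace ground"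
 by (rule vspaceI) (auto simp: ground_def vector_space_def algebra_simps)

lemma scou_smon: "vspace W ==> M \<in> mcar W ==> scou (smon W M) = (if M = {#} then 1 else 0)"
proof -
 assume a: "vspace W" "M \<in> mcar W"
 have h: "scou \<in> hom (free (mcar W)) ground"
  by (rule homI) (simp_all add: ground_def scou_def lookup_add lookup_psc)
 have "scou r = 0" if "r \<in> sym_rel W" for r :: "_ \<Rightarrow>\<^sub>0 'a"
  using that by (auto simp: sym_rel_def scou_def lookup_minus lookup_psc lookup_single)
 then have "scou (smon W M) = scou (vec M)"
  unfolding smon_mcar by (rule quot_lift[OF h vspace_free vspace_ground sym_rel_car[OF a(1)] _ vec_free[OF a(2)]])
 then show ?thesis by (auto simp: scou_def lookup_single)
qed

lemma scou_vm: "vspace W ==> x \<in> car W ==> a \<in> car (Sym W) ==> scou (vm W x a) = 0"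
 by (rule Sym_hom_eqI[where f = "%a. scou (vm W x a)" and g = "%a. 0" and C = ground])
  (auto intro!: hom_comp[OF scou_hom] hom_zero vspace_ground bihom_right[OF vm_bihom] simp: vm_smon scou_smon)

text \<open>The letter \<open>x\<close> is primitive and the coproduct is multiplicative for the
  usual product, so one multiplies either tensor factor by \<open>x\<close>.\<close>

lemma scop_vm:
 assumes "vspace W" "x \<in> car W" "a \<in> car (Sym W)"
 shows "scop W (vm W x a) = cosum (ST W) (%a b. spure W (vm W x a) b + spure W a (vm W x b)) (scop W a)"
proof (rule Sym_hom_eqI[OF assms(1) _ _ _ assms(3)])
 note v = bihom_right[OF vm_bihom[OF assms(1)] assms(2)]
 have b: "(%a b. spure W (vm W x a) b + spure W a (vm W x b)) \<in> bihom (Sym W) (Sym W) (ST W)"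
  by (intro bihomI hom_plus vspace_tens bihom_comp1[OF spure_bihom] bihom_comp2[OF spure_bihom]
    bihom_left[OF spure_bihom] bihom_right[OF spure_bihom] v vm_car assms)
 show "(%a. cosum (ST W) (%a b. spure W (vm W x a) b + spure W a (vm W x b)) (scop W a)) \<in> hom (Sym W) (ST W)"
  by (rule cosum_scop_hom[OF assms(1) vspace_tens b])
 show "(%a. scop W (vm W x a)) \<in> hom (Sym W) (ST W)" by (rule hom_comp[OF scop_hom[OF assms(1)] v])
 fix M assume M: "M \<in> mcar W"
 then show "scop W (vm W x (smon W M)) = cosum (ST W) (%a b. spure W (vm W x a) b + spure W a (vm W x b)) (scop W (smon W M))"
  unfolding cosum_scop_smon[OF assms(1) vspace_tens b M]
  using assms by (auto simp: vm_smon scop_smon SS_add intro!: SS_cong)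
qed

text \<open>A derivation sending letters to letters is a coderivation; on monomials this is
  \<open>DS_SS\<close>.\<close>

lemma scop_DD:
 assumes "vspace W" "h \<in> hom W W" "a \<in> car (Sym W)"
 shows "scop W (DD W h a) = cosum (ST W) (%a b. spure W (DD W h a) b + spure W a (DD W h b)) (scop W a)"
proof (rule Sym_hom_eqI[OF assms(1) _ _ _ assms(3)])
 note v = DD_hom[OF assms(1,2)]
 have b: "(%a b. spure W (DD W h a) b + spure W a (DD W h b)) \<in> bihom (Sym W) (Sym W) (ST W)"
  by (intro bihomI hom_plus vspace_tens bihom_comp1[OF spure_bihom] bihom_comp2[OF spure_bihom]
    bihom_left[OF spure_bihom] bihom_right[OF spure_bihom] v hom_car[OF v] assms)
 show "(%a. cosum (ST W) (%a b. spure W (DD W h a) b + spure W a (DD W h b)) (scop W a)) \<in> hom (Sym W) (ST W)"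
  by (rule cosum_scop_hom[OF assms(1) vspace_tens b])
 show "(%a. scop W (DD W h a)) \<in> hom (Sym W) (ST W)" by (rule hom_comp[OF scop_hom[OF assms(1)] v])
 fix M assume M: "M \<in> mcar W"
 have "scop W (DD W h (smon W M)) = DS h M (%N. scop W (smon W N))"
  unfolding DD_smon[OF assms(1,2) M]
  by (rule hom_of_DS[OF scop_hom[OF assms(1)] vspace_Sym]) (use M in "auto intro!: smon_car simp: hom_car[OF assms(2)]")
 also have "\<dots> = DS h M (%N. SS N (%A B. spure W (smon W A) (smon W B)))"
  by (rule DS_cong, rule scop_smon[OF assms(1)]) (use M in "auto simp: hom_car[OF assms(2)]")
 also have "\<dots> = SS M (%A B. spure W (DD W h (smon W A)) (smon W B) + spure W (smon W A) (DD W h (smon W B)))"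
  unfolding DS_SS
 proof (rule SS_cong)
  fix A B assume "A + B = M"
  then have AB: "A \<in> mcar W" "B \<in> mcar W" using M by auto
  have "spure W (DS h A (smon W)) (smon W B) = DS h A (%X. spure W (smon W X) (smon W B))"
   by (rule hom_of_DS[OF bihom_left[OF spure_bihom] vspace_Sym])
    (use AB in "auto intro!: smon_car simp: hom_car[OF assms(2)]")
  moreover have "spure W (smon W A) (DS h B (smon W)) = DS h B (%X. spure W (smon W A) (smon W X))"
   by (rule hom_of_DS[OF bihom_right[OF spure_bihom] vspace_Sym])
    (use AB in "auto intro!: smon_car simp: hom_car[OF assms(2)]")
  ultimately show "DS h A (%X. spure W (smon W X) (smon W B)) + DS h B (%X. spure W (smon W A) (smon W X)) =
   spure W (DD W h (smon W A)) (smon W B) + spure W (smon W A) (DD W h (smon W B))"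
   by (simp add: DD_smon[OF assms(1,2)] AB)
 qed
 also have "\<dots> = cosum (ST W) (%a b. spure W (DD W h a) b + spure W a (DD W h b)) (scop W (smon W M))"
  by (rule cosum_scop_smon[OF assms(1) vspace_tens b M, symmetric])
 finally show "scop W (DD W h (smon W M)) = \<dots>" .
qed

text \<open>Both bialgebras of the theorem have a symmetric algebra with its usual coproduct as
  coalgebra. The axioms of the coalgebra are settled here once, and those involving the product are
  reduced to monomials.\<close>

lemma Sym_bialgebra:
 assumes W: "vspace W" and mu: "mu \<in> bihom (Sym W) (Sym W) (Sym W)"
  and unit: "!!M. M \<in> mcar W ==> mu (sone W) (smon W M) = smon W M \<and> mu (smon W M) (sone W) = smon W M"
  and assoc: "!!K M N. K \<in> mcar W ==> M \<in> mcar W ==> N \<in> mcar W ==>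
   mu (mu (smon W K) (smon W M)) (smon W N) = mu (smon W K) (mu (smon W M) (smon W N))"
  and cop: "!!M N. M \<in> mcar W ==> N \<in> mcar W ==> scop W (mu (smon W M) (smon W N)) =
   SS M (%A B. SS N (%C D. spure W (mu (smon W A) (smon W C)) (mu (smon W B) (smon W D))))"
  and cou: "!!M N. M \<in> mcar W ==> N \<in> mcar W ==>
   scou (mu (smon W M) (smon W N)) = scou (smon W M) * scou (smon W N)"
 shows "is_bialgebra \<lparr>sp = Sym W, mul = mu, one = sone W, cop = scop W, cou = scou\<rparr>"
proof -
 let ?S = "Sym W"
 note vS = vspace_Sym[of W] and vT = vspace_tens and so = sone_car[of W]
 note mr = bihom_right[OF mu] and ml = bihom_left[OF mu] and mc = bihom_car[OF mu]
 note eqI = Sym_hom_eqI[OF W]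
 note sc = scop_hom[OF W]
 have u1: "mu (sone W) a = a" if "a \<in> car ?S" for a
  by (rule eqI[OF mr[OF so] hom_id _ that]) (use unit in auto)
 have u2: "mu a (sone W) = a" if "a \<in> car ?S" for a
  by (rule eqI[OF ml[OF so] hom_id _ that]) (use unit in auto)
 \<comment> \<open>Associativity passes from monomials to all elements one argument at a time: the
   third, then the second, then the first.\<close>
 have as1: "mu (mu (smon W K) (smon W M)) c = mu (smon W K) (mu (smon W M) c)"
  if "K \<in> mcar W" "M \<in> mcar W" "c \<in> car ?S" for K M c
  by (rule eqI[OF _ _ _ that(3)]) (use assoc that in "auto intro!: hom_comp[OF mr mr] mr smon_car mc")
 have as2: "mu (mu (smon W K) b) c = mu (smon W K) (mu b c)"
  if "K \<in> mcar W" "b \<in> car ?S" "c \<in> car ?S" for K b c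
  by (rule eqI[OF _ _ _ that(2)])
   (use as1 that in "auto intro!: hom_comp[OF ml mr] hom_comp[OF mr ml] smon_car")
 have as3: "mu (mu a b) c = mu a (mu b c)"
  if "a \<in> car ?S" "b \<in> car ?S" "c \<in> car ?S" for a b c
  by (rule eqI[OF _ _ _ that(1)])
   (use as2 that in "auto intro!: hom_comp[OF ml ml] ml mc")
 have b1: "(%x y. psc (scou x) y) \<in> bihom ?S ?S ?S"
  by (rule bihomI; rule homI)
   (auto simp: hom_add[OF scou_hom] hom_scl[OF scou_hom, simplified] ground_def
    scl_add[OF vS, simplified] scl_scl[OF vS, simplified] scl_add_left[OF vS, simplified] mult.commute
    intro: car_scl[OF vS, simplified])
 have b2: "(%y x. psc (scou x) y) \<in> bihom ?S ?S ?S"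
  using b1 by (auto simp: bihom_def)
 have cu1: "cosum ?S (%x y. psc (scou x) y) (scop W a) = a" if "a \<in> car ?S" for a
 proof (rule eqI[OF cosum_scop_hom[OF W vS b1] hom_id _ that])
  fix M assume M: "M \<in> mcar W"
  have "SS M (%A B. psc (scou (smon W A)) (smon W B)) = SS M (%A B. if A = {#} then smon W B else 0)"
   by (rule SS_cong) (use M in "auto simp: scou_smon[OF W] scl_1[OF vS, simplified] scl_0_left[OF vS, simplified]")
  then show "cosum ?S (%x y. psc (scou x) y) (scop W (smon W M)) = smon W M"
   unfolding cosum_scop_smon[OF W vS b1 M] by (simp add: SS_delta_left)
 qed
 have cu2: "cosum ?S (%y x. psc (scou x) y) (scop W a) = a" if "a \<in> car ?S" for a
 proof (rule eqI[OF cosum_scop_hom[OF W vS b2] hom_id _ that])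
  fix M assume M: "M \<in> mcar W"
  have "SS M (%A B. psc (scou (smon W B)) (smon W A)) = SS M (%A B. if B = {#} then smon W A else 0)"
   by (rule SS_cong) (use M in "auto simp: scou_smon[OF W] scl_1[OF vS, simplified] scl_0_left[OF vS, simplified]")
  then show "cosum ?S (%y x. psc (scou x) y) (scop W (smon W M)) = smon W M"
   unfolding cosum_scop_smon[OF W vS b2 M] by (simp add: SS_delta_right)
 qed
 let ?T3 = "tens ?S (ST W)" and ?p3 = "pure ?S (ST W)"
 note p3 = pure_bihom[OF vS vT, of ?S ?S] and p2 = spure_bihom[of W]
 have b3: "(%x1 x2. ?p3 x1 (spure W x2 y)) \<in> bihom ?S ?S ?T3" if "y \<in> car ?S" for y
  by (intro bihomI bihom_left[OF p3] hom_comp[OF bihom_right[OF p3] bihom_left[OF p2]] bihom_car[OF p2] that)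
 have b4: "(%x y. cosum ?T3 (%x1 x2. ?p3 x1 (spure W x2 y)) (scop W x)) \<in> bihom ?S ?S ?T3"
  by (intro bihomI cosum_scop_hom[OF W vT b3] cosum_scop_hom_param[OF W vT] hom_comp[OF bihom_right[OF p3] bihom_right[OF p2]])
 have b5: "(%x y. ?p3 x (scop W y)) \<in> bihom ?S ?S ?T3"
  by (intro bihomI bihom_left[OF p3] hom_comp[OF bihom_right[OF p3] sc] hom_car[OF sc])
 have coas: "cosum ?T3 (%x y. cosum ?T3 (%x1 x2. ?p3 x1 (spure W x2 y)) (scop W x)) (scop W a)
   = cosum ?T3 (%x y. ?p3 x (scop W y)) (scop W a)" if "a \<in> car ?S" for a
 proof (rule eqI[OF cosum_scop_hom[OF W vT b4] cosum_scop_hom[OF W vT b5] _ that])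
  fix M assume M: "M \<in> mcar W"
  have "SS M (%A B. cosum ?T3 (%x1 x2. ?p3 x1 (spure W x2 (smon W B))) (scop W (smon W A)))
   = SS M (%A B. SS A (%A1 A2. ?p3 (smon W A1) (spure W (smon W A2) (smon W B))))"
   by (rule SS_cong, rule cosum_scop_smon[OF W vT b3]) (use M in "auto intro!: smon_car")
  also have "\<dots> = SS M (%A B. SS B (%B1 B2. ?p3 (smon W A) (spure W (smon W B1) (smon W B2))))"
   by (rule SS_assoc)
  also have "\<dots> = SS M (%A B. ?p3 (smon W A) (scop W (smon W B)))"
  proof (rule SS_cong)
   fix A B assume "A + B = M"
   then have AB: "A \<in> mcar W" "B \<in> mcar W" using M by auto
   show "SS B (%B1 B2. ?p3 (smon W A) (spure W (smon W B1) (smon W B2))) = ?p3 (smon W A) (scop W (smon W B))"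
    unfolding scop_smon[OF W AB(2)]
    by (rule hom_of_SS[OF bihom_right[OF p3] vT, symmetric]) (use AB in "auto intro!: smon_car bihom_car[OF p2]")
  qed
  finally show "cosum ?T3 (%x y. cosum ?T3 (%x1 x2. ?p3 x1 (spure W x2 y)) (scop W x)) (scop W (smon W M))
   = cosum ?T3 (%x y. ?p3 x (scop W y)) (scop W (smon W M))"
   by (simp only: cosum_scop_smon[OF W vT b4 M] cosum_scop_smon[OF W vT b5 M])
 qed
 have b6: "(%b1 b2. spure W (mu a1 b1) (mu a2 b2)) \<in> bihom ?S ?S (ST W)" if "a1 \<in> car ?S" "a2 \<in> car ?S" for a1 a2
  by (intro bihomI hom_comp[OF bihom_left[OF p2] mr] hom_comp[OF bihom_right[OF p2] mr] mc that)
 have b7: "(%a1 a2. cosum (ST W) (%b1 b2. spure W (mu a1 b1) (mu a2 b2)) (scop W b)) \<in> bihom ?S ?S (ST W)"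
  if "b \<in> car ?S" for b
  by (intro bihomI cosum_scop_hom_param[OF W vT _ that] hom_comp[OF bihom_left[OF p2] ml] hom_comp[OF bihom_right[OF p2] ml] mc)
 have b8: "(%b. cosum (ST W) (%a1 a2. cosum (ST W) (%b1 b2. spure W (mu a1 b1) (mu a2 b2)) (scop W b)) (scop W a)) \<in> hom ?S (ST W)"
  if "a \<in> car ?S" for a
  by (intro cosum_scop_hom_param[OF W vT _ that] cosum_scop_hom[OF W vT] b6)
 have cm: "scop W (mu (smon W M) b) =
   cosum (ST W) (%a1 a2. cosum (ST W) (%b1 b2. spure W (mu a1 b1) (mu a2 b2)) (scop W b)) (scop W (smon W M))"
  if "M \<in> mcar W" "b \<in> car ?S" for M b
 proof (rule eqI[OF _ b8 _ that(2)])
  show "(%b. scop W (mu (smon W M) b)) \<in> hom ?S (ST W)"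
   by (rule hom_comp[OF sc mr]) (simp add: that smon_car)
  show "smon W M \<in> car ?S" by (simp add: that smon_car)
  fix N assume N: "N \<in> mcar W"
  show "scop W (mu (smon W M) (smon W N)) =
   cosum (ST W) (%a1 a2. cosum (ST W) (%b1 b2. spure W (mu a1 b1) (mu a2 b2)) (scop W (smon W N))) (scop W (smon W M))"
   unfolding cosum_scop_smon[OF W vT b7[OF smon_car[OF N]] that(1)] cop[OF that(1) N]
   by (rule SS_cong, rule cosum_scop_smon[OF W vT b6 N, symmetric]) (use that(1) in "auto intro!: smon_car")
 qed
 have cm2: "scop W (mu a b) =
   cosum (ST W) (%a1 a2. cosum (ST W) (%b1 b2. spure W (mu a1 b1) (mu a2 b2)) (scop W b)) (scop W a)"
  if "a \<in> car ?S" "b \<in> car ?S" for a b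
  by (rule eqI[OF hom_comp[OF sc ml[OF that(2)]] cosum_scop_hom[OF W vT b7[OF that(2)]] cm[OF _ that(2)] that(1)])
 have cg: "(%x. k * f x) \<in> hom ?S ground" "(%x. f x * k) \<in> hom ?S ground" if "f \<in> hom ?S ground" for f k
  using that hom_add[OF that] hom_scl[OF that] by (auto intro!: homI simp: ground_def algebra_simps)
 have ce1: "scou (mu (smon W M) b) = scou (smon W M) * scou b" if "M \<in> mcar W" "b \<in> car ?S" for M b
  by (rule eqI[OF hom_comp[OF scou_hom mr] cg(1)[OF scou_hom] _ that(2)]) (use cou that in "auto intro!: smon_car")
 have ce2: "scou (mu a b) = scou a * scou b" if "a \<in> car ?S" "b \<in> car ?S" for a b
  by (rule eqI[OF hom_comp[OF scou_hom ml] cg(2)[OF scou_hom] _ that(1)]) (use ce1 that in auto)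
 show ?thesis
  unfolding is_bialgebra_def Let_def
  using W mu so u1 u2 as3 sc cu1 cu2 coas cm2 ce2 scou_hom[of W]
  by (auto simp: vS sone_def scop_smon[OF W] scou_smon[OF W])
qed

subsection \<open>Modules over a right pre-Lie algebra\<close>

lemma DS_fun_plus:
 assumes "!!x N. M = add_mset x N ==> f (add_mset (u x + v x) N) = f (add_mset (u x) N) + f (add_mset (v x) N)"
 shows "DS (%x. u x + v x) M f = DS u M f + DS v M f"
proof -
 have "DS (%x. u x + v x) M f = (\<Sum>x\<in>#M. f (add_mset (u x) (M - {#x#})) + f (add_mset (v x) (M - {#x#})))"
  unfolding DS_def by (auto intro!: arg_cong[where f = sum_mset] image_mset_cong assms)
 then show ?thesis by (simp add: DS_def sum_mset.distrib)
qed

lemma DS_minus: "DS h M (%N. f N - g N) = DS h M f - DS h M (g :: _ => 'c::ab_group_add)"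
 using DS_plus[of h M "%N. f N - g N" g] by (simp add: algebra_simps)

text \<open>The recursion of \<open>og_rev\<close> with the acted-on element in a module instead of
  the pre-Lie algebra. The head of the list is the letter acting last, and the subtracted terms are
  those in which it acts on the earlier letters.\<close>

fun gactl :: "('x => 'w => 'x) => ('w => 'w => 'w) => 'x => 'w list => 'x::ab_group_add" where
 "gactl bm b m [] = m"
| "gactl bm b m (y # ys) = bm (gactl bm b m ys) y - (\<Sum>i<length ys. gactl bm b m (ys[i := b (ys ! i) y]))"

lemma og_rev_eq: "og_rev b x ys = gactl b b x ys"
 by (induction b x ys rule: og_rev.induct) auto

definition gm :: "('x => 'w => 'x) => ('w => 'w => 'w) => 'x => 'w multiset => 'x::ab_group_add" where
 "gm bm b m M = gactl bm b m (list_of M)"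

text \<open>\<open>prelie\<close> and \<open>module\<close> are the same identity for
  \<open>b\<close> and for \<open>bm\<close>: the commutator \<open>b y z - b z y\<close> acts as
  the commutator of the actions of \<open>y\<close> and \<open>z\<close>, with the subtractions
  cleared. In particular \<open>W\<close> is a module over itself.\<close>

locale prelie_module =
 fixes W :: "('k::field, 'w::ab_group_add) vs" and X :: "('k, 'x::ab_group_add) vs"
  and b :: "'w => 'w => 'w" and bm :: "'x => 'w => 'x"
 assumes vW: "vspace W" and vX: "vspace X"
  and b_bihom: "b \<in> bihom W W W" and bm_bihom: "bm \<in> bihom X W X"
  and prelie: "!!x y z. x \<in> car W ==> y \<in> car W ==> z \<in> car W ==>
   b (b x y) z + b x (b z y) = b (b x z) y + b x (b y z)"
  and module: "!!m y z. m \<in> car X ==> y \<in> car W ==> z \<in> car W ==>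
   bm (bm m y) z + bm m (b z y) = bm (bm m z) y + bm m (b y z)"
begin

lemmas b_car = bihom_car[OF b_bihom] and bm_car = bihom_car[OF bm_bihom]
 and b_left = bihom_left[OF b_bihom] and bm_left = bihom_left[OF bm_bihom]
 and b_right = bihom_right[OF b_bihom] and bm_right = bihom_right[OF bm_bihom]

abbreviation "G \<equiv> gm bm b"
abbreviation "rder y x \<equiv> b x y"

lemma gm_empty [simp]: "G m {#} = m"
 using mset_list_of[of "{#} :: 'w multiset"] by (simp add: gm_def del: mset_list_of)

text \<open>Independence of the order of at most \<open>n\<close> letters. The recursion can be
  unfolded at an arbitrary letter only where this is known, so closure and linearity are proved
  relative to the bound and feed the induction that raises it.\<close>

definition "sym_upto m n \<longleftrightarrow> (\<forall>ys. length ys \<le> n \<and> set ys \<subseteq> car W \<longrightarrow> gactl bm b m ys = G m (mset ys))"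

lemma sym_upto_rec:
 assumes "sym_upto m n" "set (y # ys) \<subseteq> car W" "length ys \<le> n"
 shows "gactl bm b m (y # ys) = bm (G m (mset ys)) y - DS (rder y) (mset ys) (G m)"
proof -
 have "gactl bm b m (ys[i := b (ys ! i) y]) = G m (mset (ys[i := b (ys ! i) y]))" if "i < length ys" for i
 proof -
  have "set (ys[i := b (ys ! i) y]) \<subseteq> car W"
   using assms(2) that by (intro set_update_subsetI) (auto intro!: b_car)
  then show ?thesis using assms by (simp add: sym_upto_def)
 qed
 then have "(\<Sum>i<length ys. gactl bm b m (ys[i := b (ys ! i) y])) = DS (rder y) (mset ys) (G m)"
  using sum_list_update[where h = "rder y" and f = "G m" and ys = ys] by simp
 moreover have "gactl bm b m ys = G m (mset ys)" using assms by (simp add: sym_upto_def)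
 ultimately show ?thesis by simp
qed

lemma sym_upto_gm:
 assumes "sym_upto m n" "add_mset y M \<in> mcar W" "size M < n"
 shows "G m (add_mset y M) = bm (G m M) y - DS (rder y) M (G m)"
proof -
 have "G m (mset (y # list_of M)) = gactl bm b m (y # list_of M)"
  using assms mcarD[OF assms(2)] unfolding sym_upto_def by (metis Suc_leI length_Cons length_list_of mset.simps(2)
    mset_list_of set_mset_mset subsetI)
 also have "\<dots> = bm (G m (mset (list_of M))) y - DS (rder y) (mset (list_of M)) (G m)"
  by (rule sym_upto_rec[OF assms(1)]) (use assms mcarD[OF assms(2)] in auto)
 finally show ?thesis by simp
qed

lemma sym_upto_car:
 assumes "sym_upto m n" "m \<in> car X" "M \<in> mcar W" "size M \<le> n"
 shows "G m M \<in> car X"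
 using assms(3,4)
proof (induction "size M" arbitrary: M)
 case (Suc k)
 then obtain y N where M: "M = add_mset y N" by (metis size_eq_Suc_imp_eq_union)
 show ?case
  using Suc(2-) unfolding M by (subst sym_upto_gm[OF assms(1)])
   (auto intro!: car_diff[OF vX] bm_car DS_car[OF vX] b_car Suc(1))
qed (use assms(2) in simp)

lemma sym_upto_hom:
 assumes "sym_upto m n" "m \<in> car X" "M \<in> mcar W" "size M < n"
 shows "(%x. G m (add_mset x M)) \<in> hom W X"
 using assms(3,4)
proof (induction "size M" arbitrary: M rule: less_induct)
 case less
 have "(%x. bm (G m M) x - DS (rder x) M (G m)) \<in> hom W X"
 proof (rule hom_minus[OF vX bm_right])
  show "G m M \<in> car X" by (rule sym_upto_car[OF assms(1,2)]) (use less in auto)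
  show "(%x. DS (rder x) M (G m)) \<in> hom W X"
   by (rule hom_DS[OF vX, where f = "%_. G m"], rule hom_comp[OF less.hyps b_right])
    (use less in auto)
 qed
 then show ?case
  by (rule hom_cong[OF _ _ vW]) (use less in "auto simp: sym_upto_gm[OF assms(1)]")
qed

text \<open>Expanding two levels of the recursion leaves two groups of terms that are not evidently
  symmetric in \<open>y\<close> and \<open>z\<close>. Those outside the derivations agree by
  \<open>module\<close>; those inside agree by \<open>prelie\<close>, applied to each letter of
  \<open>T\<close>, together with \<open>DS_DS\<close>.\<close>

lemma sym_upto_swap:
 assumes s: "sym_upto m (Suc (size T))" and m: "m \<in> car X" and T: "T \<in> mcar W" and y: "y \<in> car W" and z: "z \<in> car W"
 shows "bm (G m (add_mset z T)) y - DS (rder y) (add_mset z T) (G m) =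
     bm (G m (add_mset y T)) z - DS (rder z) (add_mset y T) (G m)"
proof -
 let ?D = "%y f. DS (rder y) T f"
 have g: "G m T \<in> car X" by (rule sym_upto_car[OF s m T]) simp
 have e: "bm (G m (add_mset z T)) y - DS (rder y) (add_mset z T) (G m) =
  bm (bm (G m T) z) y - bm (G m T) (b z y) - (?D z (%N. bm (G m N) y) + ?D y (%N. bm (G m N) z))
   + (DS (rder (b z y)) T (G m) + ?D y (%N. DS (rder z) N (G m)))"
  if y: "y \<in> car W" and z: "z \<in> car W" for y z
 proof -
  have 1: "bm (?D z (G m)) y = ?D z (%N. bm (G m N) y)"
   by (rule hom_of_DS[OF bm_left[OF y] vX], rule sym_upto_car[OF s m]) (use T z in "auto intro!: b_car")
  have 2: "?D y (%N. G m (add_mset z N)) = ?D y (%N. bm (G m N) z - DS (rder z) N (G m))"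
   by (rule DS_cong, rule sym_upto_gm[OF s]) (use T y z in "auto intro!: b_car")
  have 3: "?D z (G m) \<in> car X"
   by (rule DS_car[OF vX], rule sym_upto_car[OF s m]) (use T z in "auto intro!: b_car")
  have 4: "G m (add_mset z T) = bm (G m T) z - ?D z (G m)"
   "G m (add_mset (b z y) T) = bm (G m T) (b z y) - DS (rder (b z y)) T (G m)"
   by (rule sym_upto_gm[OF s]; use T y z in "auto intro!: b_car")+
  have 5: "bm (bm (G m T) z - ?D z (G m)) y = bm (bm (G m T) z) y - ?D z (%N. bm (G m N) y)"
   using hom_diff[OF bm_left[OF y] vX bm_car[OF g z] 3] by (simp add: 1)
  show ?thesis unfolding DS_add 2 4 5 DS_minus by (simp add: algebra_simps)
 qed
 have plus: "DS (%x. u x + v x) T (G m) = DS u T (G m) + DS v T (G m)"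
  if "!!x. x \<in> car W ==> u x \<in> car W" "!!x. x \<in> car W ==> v x \<in> car W" for u v
  by (rule DS_fun_plus, rule hom_add[OF sym_upto_hom[OF s m]]) (use that T in auto)
 have f: "DS (rder (b z y)) T (G m) + DS (%x. b (b x y) z) T (G m) =
   DS (rder (b y z)) T (G m) + DS (%x. b (b x z) y) T (G m)"
 proof -
  have "DS (%x. b x (b z y) + b (b x y) z) T (G m) = DS (%x. b x (b y z) + b (b x z) y) T (G m)"
   by (rule DS_cong_fun) (use prelie[OF mcarD[OF T] y z] in "auto simp: add.commute")
  then show ?thesis by (subst (asm) (1 2) plus) (auto intro!: b_car y z)
 qed
 have d: "?D y (%N. DS (rder z) N (G m)) + DS (%x. b (b x z) y) T (G m) =
  ?D z (%N. DS (rder y) N (G m)) + DS (%x. b (b x y) z) T (G m)"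
  by (rule DS_DS)
 from f d have h: "DS (rder (b z y)) T (G m) + ?D y (%N. DS (rder z) N (G m)) =
  DS (rder (b y z)) T (G m) + ?D z (%N. DS (rder y) N (G m))"
  by (smt (verit, ccfv_threshold) add.assoc add.commute add_right_cancel)
 have k: "bm (bm (G m T) z) y - bm (G m T) (b z y) = bm (bm (G m T) y) z - bm (G m T) (b y z)"
  using module[OF g y z] by (simp add: algebra_simps)
 show ?thesis unfolding e[OF y z] e[OF z y] h k by (simp add: add.commute)
qed

text \<open>Two orders of the same letters are compared through their heads. If the heads differ,
  each occurs in the tail of the other list, and both values are recomputed from the common rest
  \<open>T\<close> by \<open>sym_upto_swap\<close>.\<close>

lemma sym_upto_all:
 assumes m: "m \<in> car X"
 shows "sym_upto m n"
proof (induction n)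
 case 0
 then show ?case by (simp add: sym_upto_def)
next
 case (Suc n)
 have "gactl bm b m us = gactl bm b m vs"
  if us: "length us = Suc n" "set us \<subseteq> car W" and uv: "mset us = mset vs" for us vs
 proof -
  obtain y ys where [simp]: "us = y # ys" using us by (cases us) auto
  have vs: "set vs \<subseteq> car W" "length vs = Suc n" using us uv by (metis mset_eq_setD, metis mset_eq_length)
  obtain z zs where [simp]: "vs = z # zs" using vs by (cases vs) auto
  have r: "gactl bm b m us = bm (G m (mset ys)) y - DS (rder y) (mset ys) (G m)"
   "gactl bm b m vs = bm (G m (mset zs)) z - DS (rder z) (mset zs) (G m)"
   unfolding \<open>us = y # ys\<close> \<open>vs = z # zs\<close>
   by (rule sym_upto_rec[OF Suc]; use us vs in simp)+
  show ?thesis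
  proof (cases "y = z")
   case True
   then have "mset ys = mset zs" using uv by simp
   then show ?thesis using r True by simp
  next
   case False
   then obtain T where T: "mset ys = add_mset z T" "mset zs = add_mset y T"
    using uv by (auto simp: add_eq_conv_ex)
   have 1: "size T < n" using us T by (metis Suc_inject length_Cons lessI size_add_mset size_mset \<open>us = y # ys\<close>)
   have 2: "T \<in> mcar W" using us T by (metis mcar_simps(2) mcar_def mem_Collect_eq set_mset_mset set_subset_Cons
     subset_trans \<open>us = y # ys\<close>)
   have n: "n = Suc (size T)"
    using us T by (metis Suc_inject length_Cons size_add_mset size_mset \<open>us = y # ys\<close>)
   show ?thesis unfolding r T
    by (rule sym_upto_swap) (use Suc 2 n m us vs in auto)
  qed
 qed
 then have "gactl bm b m us = G m (mset us)" if "length us = Suc n" "set us \<subseteq> car W" for us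
  using that unfolding gm_def by (metis mset_list_of)
 with Suc show ?case by (auto simp: sym_upto_def le_Suc_eq)
qed

lemma gactl_eq: "m \<in> car X ==> set ys \<subseteq> car W ==> gactl bm b m ys = G m (mset ys)"
 using sym_upto_all[of m "length ys"] by (simp add: sym_upto_def)

lemma gm_add: "m \<in> car X ==> y \<in> car W ==> M \<in> mcar W ==> G m (add_mset y M) = bm (G m M) y - DS (rder y) M (G m)"
 by (rule sym_upto_gm[OF sym_upto_all]) auto

lemma gm_car: "m \<in> car X ==> M \<in> mcar W ==> G m M \<in> car X"
 by (rule sym_upto_car[OF sym_upto_all]) auto

lemma gm_symfun: "m \<in> car X ==> symfun W X (G m)"
 by (rule symfunI[OF gm_car sym_upto_hom[OF sym_upto_all]]) auto

text \<open>The correction terms replace a letter \<open>x\<close> of \<open>M\<close> by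
  \<open>b x y\<close> without changing the degree, so the induction is on size and the hypothesis
  covers these modified monomials as well.\<close>

lemma DS_mcar_induct [consumes 1, case_names empty add]:
 assumes "M \<in> mcar W" "P {#}"
  "!!y M. y \<in> car W ==> M \<in> mcar W ==> P M ==> (!!x N. M = add_mset x N ==> P (add_mset (b x y) N)) ==> P (add_mset y M)"
 shows "P M"
 using assms(1)
proof (induction "size M" arbitrary: M rule: less_induct)
 case less
 show ?case
 proof (cases M)
  case (add y N)
  show ?thesis unfolding add
   by (rule assms(3)) (use less add in "auto intro!: less.hyps b_car")
 qed (use assms(2) in simp)
qed

lemma gm_hom: "M \<in> mcar W ==> (%m. G m M) \<in> hom X X"
proof (induction M rule: DS_mcar_induct)
 case (add y M)
 have "(%m. bm (G m M) y - DS (rder y) M (G m)) \<in> hom X X"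
  by (intro hom_minus[OF vX] hom_comp[OF bm_left] hom_DS[OF vX, where h = "%_. rder y"] add)
 then show ?case by (rule hom_cong[OF _ _ vX]) (use add in "auto simp: gm_add")
qed (simp add: hom_id)

definition act :: "'x => ('w multiset \<Rightarrow>\<^sub>0 'k) => 'x" where
 "act m U = lext (scl X) (G m) U"

lemma act_smon: "m \<in> car X ==> M \<in> mcar W ==> act m (smon W M) = G m M"
 unfolding act_def by (rule Sym_lext[OF vW vX gm_symfun])

lemma act_bihom: "act \<in> bihom X (Sym W) X"
proof (rule bihomI)
 show "act m \<in> hom (Sym W) X" if "m \<in> car X" for m
  using Sym_lext_hom[OF vW vX gm_symfun[OF that]] by (simp add: act_def[abs_def])
 show "(%m. act m U) \<in> hom X X" if "U \<in> car (Sym W)" for U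
  unfolding act_def by (rule lext_hom_fun[OF vW that vX gm_hom])
qed

lemma act_sone: "m \<in> car X ==> act m (sone W) = m"
 by (simp add: sone_def act_smon)

text \<open>The argument on the left is the Oudom--Guin product of \<open>U\<close> with the letter
  \<open>y\<close>. The recursion defining the action was made so that acting by this product is
  acting by \<open>U\<close> and then by \<open>y\<close>.\<close>

lemma act_step:
 assumes "m \<in> car X" "y \<in> car W" "U \<in> car (Sym W)"
 shows "act m (vm W y U + DD W (rder y) U) = bm (act m U) y"
proof (rule Sym_hom_eqI[OF vW _ _ _ assms(3)])
 note ah = bihom_right[OF act_bihom assms(1)] and dh = b_left[OF assms(2)]
 note vh = bihom_right[OF vm_bihom[OF vW] assms(2)]
 show "(%U. act m (vm W y U + DD W (rder y) U)) \<in> hom (Sym W) X"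
  by (rule hom_comp[OF ah hom_plus[OF vspace_Sym vh DD_hom[OF vW dh]]])
 show "(%U. bm (act m U) y) \<in> hom (Sym W) X"
  by (rule hom_comp[OF bm_left[OF assms(2)] ah])
 fix M assume M: "M \<in> mcar W"
 have "act m (DS (rder y) M (smon W)) = DS (rder y) M (%N. act m (smon W N))"
  by (rule hom_of_DS[OF ah vspace_Sym]) (use M assms in "auto intro!: smon_car b_car")
 also have "\<dots> = DS (rder y) M (G m)"
  by (rule DS_cong, rule act_smon) (use M assms in "auto intro!: b_car")
 finally have "act m (smon W (add_mset y M) + DS (rder y) M (smon W)) = G m (add_mset y M) + DS (rder y) M (G m)"
  using M assms
  by (subst hom_add[OF ah]) (auto intro!: smon_car DS_car[OF vspace_Sym] b_car simp: act_smon)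
 also have "\<dots> = bm (G m M) y" using M assms by (simp add: gm_add)
 finally show "act m (vm W y (smon W M) + DD W (rder y) (smon W M)) = bm (act m (smon W M)) y"
  using M assms by (simp add: vm_smon[OF vW] DD_smon[OF vW dh] act_smon)
qed

text \<open>The commutator of two derivations is the derivation of the commutator
  (\<open>DS_DS\<close>), so the module identity passes from \<open>X\<close> to
  \<open>Sym X\<close>. With the free algebra as \<open>X\<close> this is the source of the action
  in the theorem.\<close>

lemma DD_module: "prelie_module W (Sym X) b (%U y. DD X (%x. bm x y) U)"
proof
 show "(%U y. DD X (%x. bm x y) U) \<in> bihom (Sym X) W (Sym X)" by (rule DD_bihom[OF vX bm_bihom])
next
 fix U y z assume U: "U \<in> car (Sym X)" and y: "y \<in> car W" and z: "z \<in> car W"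
 let ?D = "%y. DD X (%x. bm x y)"
 have h: "?D y \<in> hom (Sym X) (Sym X)" if "y \<in> car W" for y
  by (rule DD_hom[OF vX bm_left[OF that]])
 have d: "?D y (smon X M) = DS (%x. bm x y) M (smon X)" if "y \<in> car W" "M \<in> mcar X" for y M
  by (rule DD_smon[OF vX bm_left[OF that(1)] that(2)])
 have dd: "?D z (?D y (smon X M)) = DS (%x. bm x y) M (%N. DS (%x. bm x z) N (smon X))"
  if "y \<in> car W" "z \<in> car W" "M \<in> mcar X" for y z M
 proof -
  have "?D z (?D y (smon X M)) = DS (%x. bm x y) M (%N. ?D z (smon X N))"
   unfolding d[OF that(1,3)]
   by (rule hom_of_DS[OF h vspace_Sym]) (use that in "auto intro!: smon_car bm_car")
  also have "\<dots> = DS (%x. bm x y) M (%N. DS (%x. bm x z) N (smon X))"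
   by (rule DS_cong, rule d) (use that in "auto intro!: bm_car")
  finally show ?thesis .
 qed
 show "?D z (?D y U) + ?D (b z y) U = ?D y (?D z U) + ?D (b y z) U"
 proof (rule Sym_hom_eqI[OF vX _ _ _ U])
  show "(%U. ?D z (?D y U) + ?D (b z y) U) \<in> hom (Sym X) (Sym X)"
   "(%U. ?D y (?D z U) + ?D (b y z) U) \<in> hom (Sym X) (Sym X)"
   by (intro hom_plus[OF vspace_Sym] hom_comp[OF h h] h b_car y z)+
  fix M assume M: "M \<in> mcar X"
  let ?s = "smon X"
  have plus: "DS (%x. u x + v x) M ?s = DS u M ?s + DS v M ?s"
   if "!!x. x \<in> car X ==> u x \<in> car X" "!!x. x \<in> car X ==> v x \<in> car X" for u v
   by (rule DS_fun_plus, rule hom_add[OF symfun_hom[OF smon_symfun]]) (use that M in auto)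
  have f: "DS (%x. bm x (b z y)) M ?s + DS (%x. bm (bm x y) z) M ?s =
    DS (%x. bm x (b y z)) M ?s + DS (%x. bm (bm x z) y) M ?s"
  proof -
   have "DS (%x. bm x (b z y) + bm (bm x y) z) M ?s = DS (%x. bm x (b y z) + bm (bm x z) y) M ?s"
    by (rule DS_cong_fun) (use module[OF mcarD[OF M] y z] in "auto simp: add.commute")
   then show ?thesis by (subst (asm) (1 2) plus) (auto intro!: b_car bm_car y z)
  qed
  have e: "DS (%x. bm x y) M (%N. DS (%x. bm x z) N ?s) + DS (%x. bm (bm x z) y) M ?s =
   DS (%x. bm x z) M (%N. DS (%x. bm x y) N ?s) + DS (%x. bm (bm x y) z) M ?s"
   by (rule DS_DS)
  from e f show "?D z (?D y (smon X M)) + ?D (b z y) (smon X M) = ?D y (?D z (smon X M)) + ?D (b y z) (smon X M)"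
   unfolding dd[OF y z M] dd[OF z y M] d[OF b_car[OF z y] M] d[OF b_car[OF y z] M]
   by (smt (verit, ccfv_threshold) add.assoc add.commute add_right_cancel)
 qed
qed (use vW b_bihom prelie vspace_Sym in auto)

text \<open>The correction terms again have positive degree, so they vanish by induction along with
  the leading term.\<close>

lemma gm_vanish:
 assumes "m \<in> car X" "!!w. w \<in> car W ==> bm m w = 0" "N \<in> mcar W" "N \<noteq> {#}"
 shows "G m N = 0"
 using assms(3,4)
proof (induction N rule: DS_mcar_induct)
 case (add y M)
 have "DS (rder y) M (G m) = DS (rder y) M (%_. 0)" by (rule DS_cong) (use add in auto)
 moreover have "bm (G m M) y = 0"
  by (cases "M = {#}") (use add assms bihom_0_left[OF bm_bihom vX] in auto)
 ultimately show ?case using add assms(1) by (simp add: gm_add DS_zero)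
qed simp

end

text \<open>The operator of \<open>y\<close> on the symmetric algebra is right multiplication by \<open>y\<close> for the Oudom--Guin product.\<close>

definition og_op :: "('k::field, 'w::ab_group_add) vs => ('w => 'w => 'w) =>
  ('w multiset \<Rightarrow>\<^sub>0 'k) => 'w => ('w multiset \<Rightarrow>\<^sub>0 'k)" where
 "og_op W b U y = vm W y U + DD W (%x. b x y) U"

section \<open>The symmetric algebra of \<open>W\<close> as a module over \<open>W\<close>\<close>

context prelie_module
begin

lemma self_module: "prelie_module W W b b"
 by unfold_locales (use vW b_bihom prelie in auto)

text \<open>Multiplications by letters commute and derivations satisfy the module identity by
  \<open>DD_module\<close>. The Leibniz rule contributes multiplication by \<open>b y z\<close>,
  which pairs with the multiplication by \<open>b z y\<close> coming from the other summand.\<close>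

lemma og_op_module: "prelie_module W (Sym W) b (og_op W b)"
proof -
 interpret D: prelie_module W "Sym W" b "%U y. DD W (%x. b x y) U"
  by (rule prelie_module.DD_module[OF self_module])
 note vb = vm_bihom[OF vW]
 have vb': "(%U y. vm W y U) \<in> bihom (Sym W) W (Sym W)" using vb by (auto simp: bihom_def)
 show ?thesis
 proof
  show "og_op W b \<in> bihom (Sym W) W (Sym W)"
   unfolding og_op_def[abs_def]
   by (intro bihomI hom_plus[OF vspace_Sym] bihom_left[OF vb'] bihom_right[OF vb'] D.bm_left D.bm_right)
 next
  fix U y z assume U: "U \<in> car (Sym W)" and y: "y \<in> car W" and z: "z \<in> car W"
  have e: "og_op W b (og_op W b U y) z + og_op W b U (b z y) =
   vm W z (vm W y U) + (vm W z (DD W (%x. b x y) U) + vm W y (DD W (%x. b x z) U))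
    + (vm W (b y z) U + vm W (b z y) U)
    + (DD W (%x. b x z) (DD W (%x. b x y) U) + DD W (%x. b x (b z y)) U)"
   if y: "y \<in> car W" and z: "z \<in> car W" for y z
   unfolding og_op_def
   using hom_add[OF bihom_right[OF vb z], of "vm W y U" "DD W (%x. b x y) U"]
    hom_add[OF DD_hom[OF vW b_left[OF z]], of "vm W y U" "DD W (%x. b x y) U"]
    DD_vm[OF vW b_left[OF z] y U] vm_car[OF vW y U] D.bm_car[OF U y]
   by (simp add: ac_simps)
  show "og_op W b (og_op W b U y) z + og_op W b U (b z y) = og_op W b (og_op W b U z) y + og_op W b U (b y z)"
   unfolding e[OF y z] e[OF z y] D.module[OF U y z] vm_comm[OF vW y z U] by (simp add: ac_simps)
 qed (use vW b_bihom prelie vspace_Sym in auto)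
qed

interpretation OG: prelie_module W "Sym W" b "og_op W b"
 by (rule og_op_module)

text \<open>Both sides obey the same recursion in the letters of \<open>u\<close>: on the right the
  letter acts through \<open>og_op\<close>, which \<open>act_step\<close> exchanges for
  \<open>bm\<close>. With \<open>X = Sym W\<close> this is associativity of the product.\<close>

lemma act_act:
 assumes m: "m \<in> car X" and v: "v \<in> car (Sym W)" and u: "u \<in> car (Sym W)"
 shows "act (act m v) u = act m (OG.act v u)"
proof (rule Sym_hom_eqI[OF vW _ _ _ u])
 note ah = bihom_right[OF act_bihom m] and ac = bihom_car[OF act_bihom]
 show "(%u. act (act m v) u) \<in> hom (Sym W) X" by (rule bihom_right[OF act_bihom ac[OF m v]])
 show "(%u. act m (OG.act v u)) \<in> hom (Sym W) X" by (rule hom_comp[OF ah bihom_right[OF OG.act_bihom v]])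
 have "G (act m v) N = act m (OG.G v N)" if "N \<in> mcar W" for N
  using that
 proof (induction N rule: DS_mcar_induct)
  case (add y N)
  have gc: "OG.G v N \<in> car (Sym W)" by (rule OG.gm_car[OF v add(2)])
  have dc: "DS (rder y) N (OG.G v) \<in> car (Sym W)"
   using add by (auto intro!: DS_car[OF vspace_Sym] OG.gm_car[OF v] b_car)
  have "G (act m v) (add_mset y N) = bm (act m (OG.G v N)) y - DS (rder y) N (%N. act m (OG.G v N))"
   using add m v by (auto simp: gm_add ac intro!: DS_cong)
  also have "bm (act m (OG.G v N)) y = act m (og_op W b (OG.G v N) y)"
   using act_step[OF m add(1) gc] by (simp add: og_op_def)
  also have "DS (rder y) N (%N. act m (OG.G v N)) = act m (DS (rder y) N (OG.G v))"
   by (rule hom_of_DS[OF ah vspace_Sym, symmetric]) (use add in "auto intro!: OG.gm_car[OF v] b_car")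
  also have "act m (og_op W b (OG.G v N) y) - act m (DS (rder y) N (OG.G v)) = act m (OG.G v (add_mset y N))"
   using hom_diff[OF ah vspace_Sym OG.bm_car[OF gc add(1)] dc] add v by (simp add: OG.gm_add)
  finally show ?case .
 qed simp
 then show "act (act m v) (smon W N) = act m (OG.act v (smon W N))" if "N \<in> mcar W" for N
  using that m v ac by (simp add: act_smon OG.act_smon)
qed

end

subsection \<open>Modules and bilinear maps\<close>

text \<open>Formulated with a linear map \<open>T\<close> obeying a Leibniz rule on the values of
  \<open>\<mu>\<close>, rather than with a module structure on \<open>X3\<close>, so that the tensor
  square in \<open>scop_gm\<close> is covered too.\<close>

lemma tensor_step:
 assumes M1: "prelie_module W X1 b bm1" and M2: "prelie_module W X2 b bm2" and v3: "vspace X3"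
  and \<mu>: "\<mu> \<in> bihom X1 X2 X3" and T: "T \<in> hom X3 X3"
  and T_mu: "!!a c. a \<in> car X1 ==> c \<in> car X2 ==> T (\<mu> a c) = \<mu> (bm1 a y) c + \<mu> a (bm2 c y)"
  and a: "a \<in> car X1" and c: "c \<in> car X2" and y: "y \<in> car W" and N: "N \<in> mcar W"
 shows "SS (add_mset y N) (%A B. \<mu> (gm bm1 b a A) (gm bm2 b c B)) =
  T (SS N (%A B. \<mu> (gm bm1 b a A) (gm bm2 b c B)))
  - DS (%x. b x y) N (%N'. SS N' (%A B. \<mu> (gm bm1 b a A) (gm bm2 b c B)))"
proof -
 interpret M1: prelie_module W X1 b bm1 by fact
 interpret M2: prelie_module W X2 b bm2 by fact
 let ?f = "%A B. \<mu> (M1.G a A) (M2.G c B)"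
 have "SS (add_mset y N) ?f = SS N (%A B. T (?f A B) - (DS (%x. b x y) A (%X. ?f X B) + DS (%x. b x y) B (%X. ?f A X)))"
  unfolding SS_add
 proof (rule SS_cong)
  fix A B assume "A + B = N"
  then have AB: "A \<in> mcar W" "B \<in> mcar W" using N by auto
  have g: "M1.G a A \<in> car X1" "M2.G c B \<in> car X2" using AB a c M1.gm_car M2.gm_car by auto
  have d: "DS (%x. b x y) A (M1.G a) \<in> car X1" "DS (%x. b x y) B (M2.G c) \<in> car X2"
   using AB y by (auto intro!: DS_car M1.vX M2.vX M1.gm_car M2.gm_car a c M1.b_car)
  have 1: "?f (add_mset y A) B = \<mu> (bm1 (M1.G a A) y) (M2.G c B) - DS (%x. b x y) A (%X. ?f X B)"
  proof -
   have "\<mu> (DS (%x. b x y) A (M1.G a)) (M2.G c B) = DS (%x. b x y) A (%X. ?f X B)"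
    by (rule hom_of_DS[OF bihom_left[OF \<mu> g(2)] M1.vX]) (use AB y in "auto intro!: M1.gm_car a M1.b_car")
   then show ?thesis
    using hom_diff[OF bihom_left[OF \<mu> g(2)] M1.vX M1.bm_car[OF g(1) y] d(1)] AB a y by (simp add: M1.gm_add)
  qed
  have 2: "?f A (add_mset y B) = \<mu> (M1.G a A) (bm2 (M2.G c B) y) - DS (%x. b x y) B (%X. ?f A X)"
  proof -
   have "\<mu> (M1.G a A) (DS (%x. b x y) B (M2.G c)) = DS (%x. b x y) B (%X. ?f A X)"
    by (rule hom_of_DS[OF bihom_right[OF \<mu> g(1)] M2.vX]) (use AB y in "auto intro!: M2.gm_car c M1.b_car")
   then show ?thesis
    using hom_diff[OF bihom_right[OF \<mu> g(1)] M2.vX M2.bm_car[OF g(2) y] d(2)] AB c y by (simp add: M2.gm_add)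
  qed
  show "?f (add_mset y A) B + ?f A (add_mset y B) =
   T (?f A B) - (DS (%x. b x y) A (%X. ?f X B) + DS (%x. b x y) B (%X. ?f A X))"
   unfolding 1 2 T_mu[OF g] by simp
 qed
 also have "\<dots> = SS N (%A B. T (?f A B)) - DS (%x. b x y) N (%N'. SS N' ?f)"
  by (simp only: SS_minus DS_SS)
 also have "SS N (%A B. T (?f A B)) = T (SS N ?f)"
  by (rule hom_of_SS[OF T v3, symmetric]) (use N in \<open>auto intro!: bihom_car[OF \<mu>] M1.gm_car M2.gm_car a c\<close>)
 finally show ?thesis .
qed

text \<open>Letters acting by the Leibniz rule are primitive operators, so a monomial acts on
  \<open>\<mu> a c\<close> through its coproduct.\<close>

lemma tensor_gm:
 assumes M1: "prelie_module W X1 b bm1" and M2: "prelie_module W X2 b bm2" and M3: "prelie_module W X3 b bm3"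
  and \<mu>: "\<mu> \<in> bihom X1 X2 X3"
  and mu: "!!a c y. a \<in> car X1 ==> c \<in> car X2 ==> y \<in> car W ==> bm3 (\<mu> a c) y = \<mu> (bm1 a y) c + \<mu> a (bm2 c y)"
  and a: "a \<in> car X1" and c: "c \<in> car X2" and N: "N \<in> mcar W"
 shows "gm bm3 b (\<mu> a c) N = SS N (%A B. \<mu> (gm bm1 b a A) (gm bm2 b c B))"
proof -
 interpret M1: prelie_module W X1 b bm1 by fact
 interpret M2: prelie_module W X2 b bm2 by fact
 interpret M3: prelie_module W X3 b bm3 by fact
 show ?thesis
  using N
 proof (induction N rule: M3.DS_mcar_induct)
  case (add y N)
  have "DS (%x. b x y) N (M3.G (\<mu> a c)) = DS (%x. b x y) N (%N'. SS N' (%A B. \<mu> (M1.G a A) (M2.G c B)))"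
   by (rule DS_cong) (use add in auto)
  then show ?case
   using M3.gm_add[OF bihom_car[OF \<mu> a c] add(1,2)]
    tensor_step[OF M1 M2 M3.vX \<mu> M3.bm_left[OF add(1)] mu[OF _ _ add(1)] a c add(1,2)] add
   by simp
 qed simp
qed

text \<open>If every letter acts by a coderivation, every monomial acts compatibly with the
  coproducts; the induction is that of \<open>tensor_gm\<close> with values in the tensor
  square.\<close>

lemma scop_gm:
 assumes M: "prelie_module W (Sym Y) b bm" and vY: "vspace Y"
  and bm: "!!a y. a \<in> car (Sym Y) ==> y \<in> car W ==>
   scop Y (bm a y) = cosum (ST Y) (%c d. spure Y (bm c y) d + spure Y c (bm d y)) (scop Y a)"
  and a: "a \<in> car (Sym Y)" and N: "N \<in> mcar W"
 shows "scop Y (gm bm b a N) =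
  cosum (ST Y) (%c d. SS N (%A B. spure Y (gm bm b c A) (gm bm b d B))) (scop Y a)"
proof -
 interpret prelie_module W "Sym Y" b bm by fact
 note sb = spure_bihom[of Y]
 let ?\<phi> = "%N c d. SS N (%A B. spure Y (G c A) (G d B))"
 have phi: "?\<phi> N \<in> bihom (Sym Y) (Sym Y) (ST Y)" if "N \<in> mcar W" for N
  by (intro bihomI hom_SS vspace_tens hom_comp[OF bihom_left[OF sb] gm_hom] hom_comp[OF bihom_right[OF sb] gm_hom] gm_car)
   (use that in auto)
 have hphi: "cosum (ST Y) (?\<phi> N) \<in> hom (ST Y) (ST Y)" if "N \<in> mcar W" for N
  by (rule lext_tens_hom[OF vspace_Sym vspace_Sym vspace_tens phi[OF that]])
 show ?thesis
  using N
 proof (induction N rule: DS_mcar_induct)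
  case empty
  then show ?case using tens_eq[OF hom_car[OF scop_hom[OF vY] a]] by simp
 next
  case (add y N)
  let ?t = "%c d. spure Y (bm c y) d + spure Y c (bm d y)"
  let ?T = "cosum (ST Y) ?t"
  have t: "?t \<in> bihom (Sym Y) (Sym Y) (ST Y)"
   by (intro bihomI hom_plus vspace_tens hom_comp[OF bihom_left[OF sb] bm_left] hom_comp[OF bihom_right[OF sb] bm_left]
     bihom_left[OF sb] bihom_right[OF sb] bm_car add(1))
  have T: "?T \<in> hom (ST Y) (ST Y)" by (rule lext_tens_hom[OF vspace_Sym vspace_Sym vspace_tens t])
  have T_mu: "?T (spure Y c d) = ?t c d" if "c \<in> car (Sym Y)" "d \<in> car (Sym Y)" for c d
   by (rule lext_pure[OF vspace_Sym vspace_Sym vspace_tens t that])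
  have mc: "add_mset (b x y) N' \<in> mcar W" if "N = add_mset x N'" for x N'
   using add that by (auto intro!: b_car)
  \<comment> \<open>The recursion is established for every tensor by checking pure ones; the
    representative of \<open>scop Y a\<close> to which it is applied is not under control.\<close>
  have step: "cosum (ST Y) (?\<phi> (add_mset y N)) s =
   ?T (cosum (ST Y) (?\<phi> N) s) - DS (rder y) N (%N'. cosum (ST Y) (?\<phi> N') s)" if "s \<in> car (ST Y)" for s
  proof (rule tens_hom_eqI[OF vspace_Sym vspace_Sym _ _ _ that])
   show "cosum (ST Y) (?\<phi> (add_mset y N)) \<in> hom (ST Y) (ST Y)" by (rule hphi) (use add in simp)
   show "(%s. ?T (cosum (ST Y) (?\<phi> N) s) - DS (rder y) N (%N'. cosum (ST Y) (?\<phi> N') s)) \<in> hom (ST Y) (ST Y)"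
    by (intro hom_minus vspace_tens hom_comp[OF T hphi] add hom_DS[where h = "%_. rder y"] hphi mc)
   fix c d assume cd: "c \<in> car (Sym Y)" "d \<in> car (Sym Y)"
   have lp: "cosum (ST Y) (?\<phi> N) (spure Y c d) = ?\<phi> N c d" if "N \<in> mcar W" for N
    by (rule lext_pure[OF vspace_Sym vspace_Sym vspace_tens phi[OF that] cd])
   have "DS (rder y) N (%N'. cosum (ST Y) (?\<phi> N') (spure Y c d)) = DS (rder y) N (%N'. ?\<phi> N' c d)"
    by (rule DS_cong, rule lp, rule mc)
   then show "cosum (ST Y) (?\<phi> (add_mset y N)) (spure Y c d) =
    ?T (cosum (ST Y) (?\<phi> N) (spure Y c d)) - DS (rder y) N (%N'. cosum (ST Y) (?\<phi> N') (spure Y c d))"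
    using tensor_step[OF M M vspace_tens sb T T_mu cd add(1,2)] add lp by simp
  qed
  have "scop Y (G a (add_mset y N)) = scop Y (bm (G a N) y) - scop Y (DS (rder y) N (G a))"
   unfolding gm_add[OF a add(1,2)]
   by (rule hom_diff[OF scop_hom[OF vY] vspace_Sym])
    (use add in "auto intro!: bm_car gm_car a DS_car[OF vspace_Sym] b_car")
  also have "scop Y (bm (G a N) y) = ?T (scop Y (G a N))"
   by (rule bm[OF gm_car[OF a add(2)] add(1)])
  also have "scop Y (DS (rder y) N (G a)) = DS (rder y) N (%N'. scop Y (G a N'))"
   by (rule hom_of_DS[OF scop_hom[OF vY] vspace_Sym]) (use add in "auto intro!: gm_car a b_car")
  also have "\<dots> = DS (rder y) N (%N'. cosum (ST Y) (?\<phi> N') (scop Y a))"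
   by (rule DS_cong) (use add in auto)
  finally show ?case using step[OF hom_car[OF scop_hom[OF vY] a]] add by simp
 qed
qed

lemma scou_gm:
 assumes M: "prelie_module W (Sym Y) b bm" and vY: "vspace Y"
  and bm: "!!a y. a \<in> car (Sym Y) ==> y \<in> car W ==> scou (bm a y) = 0"
  and a: "a \<in> car (Sym Y)" and N: "N \<in> mcar W"
 shows "scou (gm bm b a N) = (if N = {#} then scou a else 0)"
proof -
 interpret prelie_module W "Sym Y" b bm by fact
 show ?thesis
  using N
 proof (induction N rule: DS_mcar_induct)
  case (add y N)
  have "scou (G a (add_mset y N)) = scou (bm (G a N) y) - scou (DS (rder y) N (G a))"
   unfolding gm_add[OF a add(1,2)]
   by (rule hom_diff[OF scou_hom vspace_Sym])
    (use add in "auto intro!: bm_car gm_car a DS_car[OF vspace_Sym] b_car")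
  also have "scou (DS (rder y) N (G a)) = DS (rder y) N (%N'. scou (G a N'))"
   by (rule hom_of_DS[OF scou_hom vspace_Sym]) (use add in "auto intro!: gm_car a b_car")
  also have "\<dots> = DS (rder y) N (%N'. 0)"
   by (rule DS_cong) (use add in auto)
  finally show ?case using bm[OF gm_car[OF a add(2)] add(1)] by (simp add: DS_zero)
 qed simp
qed

lemma scou_DD:
 assumes "vspace Y" "h \<in> hom Y Y" "a \<in> car (Sym Y)"
 shows "scou (DD Y h a) = 0"
proof (rule Sym_hom_eqI[OF assms(1) hom_comp[OF scou_hom DD_hom[OF assms(1,2)]] hom_zero[OF vspace_ground] _ assms(3)])
 fix M assume M: "M \<in> mcar Y"
 have "scou (DS h M (smon Y)) = DS h M (%N. scou (smon Y N))"
  by (rule hom_of_DS[OF scou_hom vspace_Sym]) (use M in "auto intro!: smon_car hom_car[OF assms(2)]")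
 also have "\<dots> = DS h M (%N. 0)"
  by (rule DS_cong) (use M in "auto simp: scou_smon[OF assms(1)] hom_car[OF assms(2)]")
 finally show "scou (DD Y h (smon Y M)) = 0" using M by (simp add: DD_smon[OF assms(1,2)] DS_zero)
qed

subsection \<open>The Oudom--Guin product\<close>

text \<open>A colouring is the fibre \<open>A\<close> over the colour \<open>j\<close> together with
  a colouring of the complement by the other colours. This separates one factor in the definition of
  \<open>og_mul\<close>.\<close>

lemma sum_PiE_fibre:
 assumes S: "finite S" and j: "j \<notin> K" and K: "finite K"
 shows "(\<Sum>c\<in>S \<rightarrow>\<^sub>E insert j K. f c) = (\<Sum>A\<in>Pow S. \<Sum>c\<in>(S - A) \<rightarrow>\<^sub>E K. f (%i. if i \<in> A then j else c i))"
proof -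
 have fin: "finite ((S - A) \<rightarrow>\<^sub>E K)" for A using S K by (auto intro!: finite_PiE)
 have "(\<Sum>A\<in>Pow S. \<Sum>c\<in>(S - A) \<rightarrow>\<^sub>E K. f (%i. if i \<in> A then j else c i)) =
  (\<Sum>(A, c)\<in>(SIGMA A:Pow S. (S - A) \<rightarrow>\<^sub>E K). f (%i. if i \<in> A then j else c i))"
  using S fin by (subst sum.Sigma) auto
 also have "\<dots> = (\<Sum>c\<in>S \<rightarrow>\<^sub>E insert j K. f c)"
 proof (rule sum.reindex_bij_witness[where
    i = "%c. ({i\<in>S. c i = j}, restrict c (S - {i\<in>S. c i = j}))" and
    j = "%(A, c) i. if i \<in> A then j else c i"], goal_cases)
  case (1 a)
  then obtain A c where a: "a = (A, c)" "A \<subseteq> S" "c \<in> (S - A) \<rightarrow>\<^sub>E K" by auto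
  have "{i\<in>S. (if i \<in> A then j else c i) = j} = A" using a(2,3) j by auto
  moreover have "restrict (%i. if i \<in> A then j else c i) (S - A) = c"
   using a(3) by (auto simp: fun_eq_iff restrict_def PiE_def extensional_def)
  ultimately show ?case using a(1) by simp
 next
  case (2 a)
  then show ?case by (cases a) (auto simp: PiE_iff extensional_def)
 next
  case (3 c)
  then show ?case by (auto simp: fun_eq_iff PiE_def extensional_def)
 next
  case (4 c)
  then show ?case by (auto simp: PiE_iff restrict_def extensional_def)
 qed auto
 finally show ?thesis by simp
qed

context prelie_module
begin

interpretation WW: prelie_module W W b b by (rule self_module)
interpretation OG: prelie_module W "Sym W" b "og_op W b" by (rule og_op_module)

lemma og_eq: "x \<in> car W ==> set ys \<subseteq> car W ==> og b x ys = WW.G x (mset ys)"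
 by (simp add: og_def og_rev_eq WW.gactl_eq)

text \<open>Right multiplication by a letter \<open>y\<close> acts on a usual product
  \<open>x M\<close> by \<open>b\<close> on \<open>x\<close> and by right multiplication on
  \<open>M\<close>, the multiplication term being attributed to \<open>M\<close>. The formula
  follows by the same recursion as \<open>tensor_step\<close>.\<close>

lemma OG_first_factor:
 assumes x: "x \<in> car W" and M: "M \<in> mcar W" and N: "N \<in> mcar W"
 shows "OG.G (smon W (add_mset x M)) N = SS N (%A B. vm W (WW.G x A) (OG.G (smon W M) B))"
 using N
proof (induction N rule: DS_mcar_induct)
 case (add y N)
 note vb = vm_bihom[OF vW]
 have sM: "smon W M \<in> car (Sym W)" "smon W (add_mset x M) \<in> car (Sym W)" using x M by (auto intro!: smon_car)
 let ?f = "%A B. vm W (WW.G x A) (OG.G (smon W M) B)"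
 have fc: "?f A B \<in> car (Sym W)" if "A \<in> mcar W" "B \<in> mcar W" for A B
  by (intro vm_car vW WW.gm_car OG.gm_car sM x that)
 have "SS (add_mset y N) ?f = SS N (%A B. og_op W b (?f A B) y
   - (DS (rder y) A (%X. ?f X B) + DS (rder y) B (%X. ?f A X)))"
  unfolding SS_add
 proof (rule SS_cong)
  fix A B assume "A + B = N"
  then have AB: "A \<in> mcar W" "B \<in> mcar W" using add by auto
  have g: "WW.G x A \<in> car W" "OG.G (smon W M) B \<in> car (Sym W)" using AB x sM WW.gm_car OG.gm_car by auto
  have d: "DS (rder y) A (WW.G x) \<in> car W" "DS (rder y) B (OG.G (smon W M)) \<in> car (Sym W)"
   using AB add by (auto intro!: DS_car vW vspace_Sym WW.gm_car OG.gm_car x sM b_car)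
  have 1: "?f (add_mset y A) B = vm W (b (WW.G x A) y) (OG.G (smon W M) B) - DS (rder y) A (%X. ?f X B)"
  proof -
   have "vm W (DS (rder y) A (WW.G x)) (OG.G (smon W M) B) = DS (rder y) A (%X. ?f X B)"
    by (rule hom_of_DS[OF bihom_left[OF vb g(2)] vW]) (use AB add in "auto intro!: WW.gm_car x b_car")
   then show ?thesis
    using hom_diff[OF bihom_left[OF vb g(2)] vW b_car[OF g(1) add(1)] d(1)] AB x add by (simp add: WW.gm_add)
  qed
  have 2: "?f A (add_mset y B) = vm W (WW.G x A) (og_op W b (OG.G (smon W M) B) y) - DS (rder y) B (%X. ?f A X)"
  proof -
   have "vm W (WW.G x A) (DS (rder y) B (OG.G (smon W M))) = DS (rder y) B (%X. ?f A X)"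
    by (rule hom_of_DS[OF bihom_right[OF vb g(1)] vspace_Sym]) (use AB add in "auto intro!: OG.gm_car sM b_car")
   then show ?thesis
    using hom_diff[OF bihom_right[OF vb g(1)] vspace_Sym OG.bm_car[OF g(2) add(1)] d(2)] AB sM add by (simp add: OG.gm_add)
  qed
  have 3: "og_op W b (?f A B) y = vm W (b (WW.G x A) y) (OG.G (smon W M) B)
   + vm W (WW.G x A) (og_op W b (OG.G (smon W M) B) y)"
   unfolding og_op_def[of W b "?f A B" y] og_op_def[of W b "OG.G (smon W M) B" y]
    DD_vm[OF vW b_left[OF add(1)] g] vm_comm[OF vW add(1) g]
   using hom_add[OF bihom_right[OF vb g(1)], of "vm W y (OG.G (smon W M) B)" "DD W (rder y) (OG.G (smon W M) B)"]
    hom_car[OF DD_hom[OF vW b_left[OF add(1)]] g(2)] vm_car[OF vW add(1) g(2)] by simp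
  show "?f (add_mset y A) B + ?f A (add_mset y B) =
   og_op W b (?f A B) y - (DS (rder y) A (%X. ?f X B) + DS (rder y) B (%X. ?f A X))"
   unfolding 1 2 3 by simp
 qed
 also have "\<dots> = SS N (%A B. og_op W b (?f A B) y) - DS (rder y) N (%N'. SS N' ?f)"
  by (simp only: SS_minus DS_SS)
 also have "SS N (%A B. og_op W b (?f A B) y) = og_op W b (SS N ?f) y"
  by (rule hom_of_SS[OF OG.bm_left[OF add(1)] vspace_Sym, symmetric]) (use add in "auto intro!: fc")
 also have "SS N ?f = OG.G (smon W (add_mset x M)) N" using add by simp
 also have "DS (rder y) N (%N'. SS N' ?f) = DS (rder y) N (OG.G (smon W (add_mset x M)))"
  by (rule DS_cong) (use add in auto)
 finally show ?case using OG.gm_add[OF sM(2) add(1,2)] by simp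
next
 case empty
 then show ?case using vm_smon[OF vW x M] by simp
qed

text \<open>Multiplying the monomial \<open>N\<close> by \<open>y\<close> yields \<open>y N\<close>
  plus the derivation terms, and the recursion subtracts exactly the latter.\<close>

lemma OG_sone:
 assumes "N \<in> mcar W"
 shows "OG.G (sone W) N = smon W N"
 using assms
proof (induction N rule: DS_mcar_induct)
 case (add y N)
 have "DS (rder y) N (OG.G (sone W)) = DS (rder y) N (smon W)"
  by (rule DS_cong) (use add in auto)
 then show ?case
  using add by (simp add: OG.gm_add sone_car og_op_def[of W b "smon W N" y] vm_smon[OF vW] DD_smon[OF vW b_left])
qed (simp add: sone_def)

text \<open>The defining sum of the product for labelled index sets, a generality that lets the
  induction on \<open>K\<close> remove one factor by \<open>OG_first_factor\<close>. The colour
  \<open>r\<close> marks the letters left to the last tensor factor, which stay as they are.\<close>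

lemma og_colourings:
 assumes K: "finite K" and r: "r \<notin> K" and S: "finite S"
  and x: "!!j. j \<in> K ==> x j \<in> car W" and l: "!!i. i \<in> S ==> l i \<in> car W"
 shows "(\<Sum>c\<in>S \<rightarrow>\<^sub>E insert r K. smon W (image_mset (%j. WW.G (x j) (image_mset l (mset_set {i\<in>S. c i = j}))) (mset_set K)
   + image_mset l (mset_set {i\<in>S. c i = r})))
  = OG.G (smon W (image_mset x (mset_set K))) (image_mset l (mset_set S))"
 using K r x S l
proof (induction K arbitrary: S rule: finite_induct)
 case empty
 have "S \<rightarrow>\<^sub>E {r} = {%i. if i \<in> S then r else undefined}"
  by (auto simp: PiE_def extensional_def fun_eq_iff)
 moreover have "image_mset l (mset_set S) \<in> mcar W" using empty by (auto simp: mcar_def)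
 ultimately show ?case using OG_sone[of "image_mset l (mset_set S)"] by (simp add: sone_def)
next
 case (insert j K S)
 let ?l = "%A. image_mset l (mset_set A)"
 let ?M = "image_mset x (mset_set K)"
 have lm: "?l A \<in> mcar W" if "A \<subseteq> S" for A
  using that insert.prems finite_subset by (fastforce simp: mcar_def)
 have Mm: "?M \<in> mcar W" using insert by (auto simp: mcar_def)
 have jc: "x j \<in> car W" using insert by auto
 have "(\<Sum>c\<in>S \<rightarrow>\<^sub>E insert r (insert j K). smon W (image_mset (%j. WW.G (x j) (?l {i\<in>S. c i = j})) (mset_set (insert j K))
   + ?l {i\<in>S. c i = r}))
  = (\<Sum>A\<in>Pow S. \<Sum>c\<in>(S - A) \<rightarrow>\<^sub>E insert r K. vm W (WW.G (x j) (?l A))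
    (smon W (image_mset (%j. WW.G (x j) (?l {i\<in>S - A. c i = j})) (mset_set K) + ?l {i\<in>S - A. c i = r})))"
  (is "_ = (\<Sum>A\<in>Pow S. \<Sum>c\<in>_ A. vm W _ (smon W (?Q A c)))")
  unfolding insert_commute[of r j]
 proof (subst sum_PiE_fibre, goal_cases)
  case 4
  show ?case
  proof (intro sum.cong refl)
   fix A c assume A: "A \<in> Pow S" and c: "c \<in> (S - A) \<rightarrow>\<^sub>E insert r K"
   let ?c = "%i. if i \<in> A then j else c i"
   have 1: "{i\<in>S. ?c i = j} = A" using A c insert by (auto simp: PiE_def Pi_def)
   have 2: "{i\<in>S. ?c i = k} = {i\<in>S - A. c i = k}" if "k \<noteq> j" for k using that by auto
   have 3: "image_mset (%k. WW.G (x k) (?l {i\<in>S. ?c i = k})) (mset_set (insert j K)) =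
    add_mset (WW.G (x j) (?l A)) (image_mset (%k. WW.G (x k) (?l {i\<in>S - A. c i = k})) (mset_set K))"
   proof -
    have "image_mset (%k. WW.G (x k) (?l {i\<in>S. ?c i = k})) (mset_set K) =
     image_mset (%k. WW.G (x k) (?l {i\<in>S - A. c i = k})) (mset_set K)"
     by (rule image_mset_cong, subst 2) (use insert(1,2) in auto)
    then show ?thesis
     unfolding mset_set.insert[OF insert(1,2)] image_mset_add_mset 1 by simp
   qed
   have 4: "?Q A c \<in> mcar W"
    using A insert.prems insert.hyps by (auto simp: mcar_def intro!: WW.gm_car lm[unfolded mcar_def])
   show "smon W (image_mset (%k. WW.G (x k) (?l {i\<in>S. ?c i = k})) (mset_set (insert j K)) + ?l {i\<in>S. ?c i = r})
    = vm W (WW.G (x j) (?l A)) (smon W (?Q A c))"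
    unfolding 3 using 2[of r] insert.prems(1) A jc
    by (subst vm_smon[OF vW _ 4]) (auto intro!: WW.gm_car lm)
  qed
 qed (use insert in auto)
 also have "\<dots> = (\<Sum>A\<in>Pow S. vm W (WW.G (x j) (?l A)) (OG.G (smon W ?M) (?l (S - A))))"
 proof (intro sum.cong refl)
  fix A assume A: "A \<in> Pow S"
  have Q: "?Q A c \<in> mcar W" for c
   using A insert.prems insert.hyps by (auto simp: mcar_def intro!: WW.gm_car lm[unfolded mcar_def])
  have "(\<Sum>c\<in>(S - A) \<rightarrow>\<^sub>E insert r K. vm W (WW.G (x j) (?l A)) (smon W (?Q A c)))
   = vm W (WW.G (x j) (?l A)) (\<Sum>c\<in>(S - A) \<rightarrow>\<^sub>E insert r K. smon W (?Q A c))"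
   by (rule hom_sum[OF bihom_right[OF vm_bihom[OF vW]] vspace_Sym, symmetric],
     (use A jc in "auto intro!: WW.gm_car lm")[1], rule smon_car[OF Q])
  also have "(\<Sum>c\<in>(S - A) \<rightarrow>\<^sub>E insert r K. smon W (?Q A c)) = OG.G (smon W ?M) (?l (S - A))"
   by (rule insert.IH) (use insert.prems in auto)
  finally show "(\<Sum>c\<in>(S - A) \<rightarrow>\<^sub>E insert r K. vm W (WW.G (x j) (?l A)) (smon W (?Q A c))) =
   vm W (WW.G (x j) (?l A)) (OG.G (smon W ?M) (?l (S - A)))" .
 qed
 also have "\<dots> = SS (?l S) (%A B. vm W (WW.G (x j) A) (OG.G (smon W ?M) B))"
  by (rule SS_index[OF insert.prems(3)])
 also have "\<dots> = OG.G (smon W (image_mset x (mset_set (insert j K)))) (?l S)"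
  using OG_first_factor[OF jc Mm lm[OF subset_refl]] insert(1,2) by simp
 finally show ?case .
qed

lemma og_mul_smon:
 assumes "set xs \<subseteq> car W" "set ys \<subseteq> car W"
 shows "(\<Sum>c\<in>{..<length ys} \<rightarrow>\<^sub>E {..length xs}.
    smon W (mset (map (%j. og b (xs ! j) (nths ys {i. c i = j})) [0..<length xs]) + mset (nths ys {i. c i = length xs})))
  = OG.G (smon W (mset xs)) (mset ys)"
proof -
 let ?k = "length xs" and ?l = "length ys"
 have n: "mset (nths ys {i. c i = j}) = image_mset (nth ys) (mset_set {i\<in>{..<?l}. c i = j})" for c :: "nat => nat" and j
  by (simp add: mset_nths Collect_conj_eq Int_commute lessThan_def)
 have e: "mset (map (%j. og b (xs ! j) (nths ys {i. c i = j})) [0..<?k]) =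
  image_mset (%j. WW.G (xs ! j) (image_mset (nth ys) (mset_set {i\<in>{..<?l}. c i = j}))) (mset_set {..<?k})" for c :: "nat => nat"
 proof -
  have "mset (map (%j. og b (xs ! j) (nths ys {i. c i = j})) [0..<?k]) =
   image_mset (%j. og b (xs ! j) (nths ys {i. c i = j})) (mset_set {..<?k})"
   by (simp add: atLeast0LessThan)
  also have "\<dots> = image_mset (%j. WW.G (xs ! j) (image_mset (nth ys) (mset_set {i\<in>{..<?l}. c i = j}))) (mset_set {..<?k})"
  proof (rule image_mset_cong)
   fix j assume "j \<in># mset_set {..<?k}"
   then have "xs ! j \<in> car W" using assms by auto
   moreover have "set (nths ys {i. c i = j}) \<subseteq> car W" by (rule subset_trans[OF set_nths_subset assms(2)])
   ultimately show "og b (xs ! j) (nths ys {i. c i = j}) =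
    WW.G (xs ! j) (image_mset (nth ys) (mset_set {i\<in>{..<?l}. c i = j}))"
    by (simp only: og_eq n)
  qed
  finally show ?thesis .
 qed
 have m: "image_mset (nth zs) (mset_set {..<length zs}) = mset zs" for zs :: "'w list"
  using mset_nths[of zs UNIV] by (simp add: nths_all)
 have i: "{..?k} = insert ?k {..<?k}" by auto
 show ?thesis
  unfolding e n i
  by (subst og_colourings) (use assms in "auto simp: m")
qed

text \<open>Identifies the product with the action of \<open>Sym W\<close> on itself, which turns
  its associativity into \<open>act_act\<close>.\<close>

lemma og_mul_eq:
 assumes u: "u \<in> car (Sym W)" and v: "v \<in> car (Sym W)"
 shows "og_mul W b u v = OG.act u v"
proof -
 have "og_mul W b u v = lext psc (%M. lext psc (%N. OG.act (smon W M) (smon W N)) v) u"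
  unfolding og_mul_def Let_def
 proof (intro lext_cong)
  fix M N assume "M \<in> pkeys u" "N \<in> pkeys v"
  then have MN: "M \<in> mcar W" "N \<in> mcar W" using Sym_keys[OF vW] u v by auto
  then show "(\<Sum>c\<in>{..<length (list_of N)} \<rightarrow>\<^sub>E {..length (list_of M)}.
    smon W (mset (map (%j. og b (list_of M ! j) (nths (list_of N) {i. c i = j})) [0..<length (list_of M)])
     + mset (nths (list_of N) {i. c i = length (list_of M)}))) = OG.act (smon W M) (smon W N)"
   by (subst og_mul_smon) (auto simp: OG.act_smon smon_car dest: mcarD)
 qed
 also have "\<dots> = lext psc (%M. OG.act (smon W M) v) u"
 proof (rule lext_cong)
  fix M assume "M \<in> pkeys u"
  then have M: "smon W M \<in> car (Sym W)" using Sym_keys[OF vW u] by (auto intro!: smon_car)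
  show "lext psc (%N. OG.act (smon W M) (smon W N)) v = OG.act (smon W M) v"
   using hom_lext[OF bihom_right[OF OG.act_bihom M] vspace_Sym, of v "smon W"] Sym_eq[OF v] Sym_keys[OF vW v]
   by (auto simp: smon_car)
 qed
 also have "\<dots> = OG.act u v"
  using hom_lext[OF bihom_left[OF OG.act_bihom v] vspace_Sym, of u "smon W"] Sym_eq[OF u] Sym_keys[OF vW u]
  by (auto simp: smon_car)
 finally show ?thesis .
qed

lemma og_mul_bihom: "og_mul W b \<in> bihom (Sym W) (Sym W) (Sym W)"
proof (rule bihomI)
 show "og_mul W b u \<in> hom (Sym W) (Sym W)" if "u \<in> car (Sym W)" for u
  by (rule hom_cong[OF bihom_right[OF OG.act_bihom that]]) (simp_all add: og_mul_eq that vspace_Sym)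
 show "(%u. og_mul W b u v) \<in> hom (Sym W) (Sym W)" if "v \<in> car (Sym W)" for v
  by (rule hom_cong[OF bihom_left[OF OG.act_bihom that]]) (simp_all add: og_mul_eq that vspace_Sym)
qed

lemma og_op_scop:
 assumes a: "a \<in> car (Sym W)" and y: "y \<in> car W"
 shows "scop W (og_op W b a y) =
  cosum (ST W) (%c d. spure W (og_op W b c y) d + spure W c (og_op W b d y)) (scop W a)"
proof -
 have h: "(%x. b x y) \<in> hom W W" by (rule b_left[OF y])
 let ?D = "DD W (%x. b x y)"
 have "cosum (ST W) (%c d. spure W (og_op W b c y) d + spure W c (og_op W b d y)) (scop W a)
  = cosum (ST W) (%c d. (spure W (vm W y c) d + spure W c (vm W y d)) + (spure W (?D c) d + spure W c (?D d))) (scop W a)"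
 proof (rule lext_cong)
  fix z assume "z \<in> pkeys (scop W a)"
  then obtain c d where z: "z = (c, d)" "c \<in> car (Sym W)" "d \<in> car (Sym W)"
   using tens_keys[OF vspace_Sym vspace_Sym hom_car[OF scop_hom[OF vW] a], of z] by auto
  have "spure W (vm W y c + ?D c) d = spure W (vm W y c) d + spure W (?D c) d"
   "spure W c (vm W y d + ?D d) = spure W c (vm W y d) + spure W c (?D d)"
   using hom_add[OF bihom_left[OF spure_bihom z(3)]] hom_add[OF bihom_right[OF spure_bihom z(2)]]
    z hom_car[OF DD_hom[OF vW h]] vm_car[OF vW y] by auto
  then show "(case z of (c, d) => spure W (og_op W b c y) d + spure W c (og_op W b d y)) =
   (case z of (c, d) => (spure W (vm W y c) d + spure W c (vm W y d)) + (spure W (?D c) d + spure W c (?D d)))"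
   by (simp add: z og_op_def)
 qed
 also have "\<dots> = scop W (vm W y a) + scop W (?D a)"
  unfolding scop_vm[OF vW y a] scop_DD[OF vW h a]
  by (subst lext_add_fun[OF vspace_vs[OF vspace_tens], symmetric]) (simp add: case_prod_beta')
 also have "\<dots> = scop W (og_op W b a y)"
  unfolding og_op_def
  by (rule hom_add[OF scop_hom[OF vW], symmetric]) (use vm_car[OF vW y a] hom_car[OF DD_hom[OF vW h] a] in auto)
 finally show ?thesis by simp
qed

lemma og_op_scou: "a \<in> car (Sym W) ==> y \<in> car W ==> scou (og_op W b a y) = 0"
 unfolding og_op_def
 by (subst hom_add[OF scou_hom[of W]]) (auto simp: vm_car vW scou_vm scou_DD[OF vW b_left] hom_car[OF DD_hom[OF vW b_left]])

lemma og_bialgebra: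
 "is_bialgebra \<lparr>sp = Sym W, mul = og_mul W b, one = sone W, cop = scop W, cou = scou\<rparr>"
proof (rule Sym_bialgebra[OF vW og_mul_bihom])
 note oc = bihom_car[OF OG.act_bihom]
 fix M assume M: "M \<in> mcar W"
 then show "og_mul W b (sone W) (smon W M) = smon W M \<and> og_mul W b (smon W M) (sone W) = smon W M"
  by (simp add: og_mul_eq sone_car smon_car OG.act_smon OG_sone OG.act_sone)
next
 note oc = bihom_car[OF OG.act_bihom]
 fix K M N assume "K \<in> mcar W" "M \<in> mcar W" "N \<in> mcar W"
 then show "og_mul W b (og_mul W b (smon W K) (smon W M)) (smon W N) =
  og_mul W b (smon W K) (og_mul W b (smon W M) (smon W N))"
  by (simp add: og_mul_eq smon_car oc OG.act_act)
next
 fix M N assume M: "M \<in> mcar W" and N: "N \<in> mcar W"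
 have "scop W (OG.G (smon W M) N) =
  cosum (ST W) (%c d. SS N (%A B. spure W (OG.G c A) (OG.G d B))) (scop W (smon W M))"
  by (rule scop_gm[OF og_op_module vW og_op_scop smon_car[OF M] N])
 also have "\<dots> = SS M (%A B. SS N (%C D. spure W (OG.G (smon W A) C) (OG.G (smon W B) D)))"
 proof (rule cosum_scop_smon[OF vW vspace_tens _ M])
  show "(%c d. SS N (%A B. spure W (OG.G c A) (OG.G d B))) \<in> bihom (Sym W) (Sym W) (ST W)"
   by (intro bihomI hom_SS vspace_tens hom_comp[OF bihom_left[OF spure_bihom] OG.gm_hom]
     hom_comp[OF bihom_right[OF spure_bihom] OG.gm_hom] OG.gm_car) (use N in auto)
 qed
 also have "\<dots> = SS M (%A B. SS N (%C D. spure W (og_mul W b (smon W A) (smon W C)) (og_mul W b (smon W B) (smon W D))))"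
  by (intro SS_cong) (use M N in "auto simp: og_mul_eq smon_car OG.act_smon")
 finally show "scop W (og_mul W b (smon W M) (smon W N)) = \<dots>"
  using M N by (simp add: og_mul_eq smon_car OG.act_smon)
 show "scou (og_mul W b (smon W M) (smon W N)) = scou (smon W M) * scou (smon W N)"
  using M N scou_gm[OF og_op_module vW og_op_scou smon_car[OF M] N]
  by (auto simp: og_mul_eq smon_car OG.act_smon scou_smon[OF vW])
qed

abbreviation "OGB \<equiv> \<lparr>sp = Sym W, mul = og_mul W b, one = sone W, cop = scop W, cou = scou\<rparr>"

lemma act_right_action: "right_action X OGB act"
 unfolding right_action_def using act_bihom act_sone act_act by (simp add: og_mul_eq)

text \<open>The monomial \<open>y N\<close> is the product of \<open>N\<close> and \<open>y\<close>
  minus terms of the degree of \<open>N\<close>. Any right action with the prescribed values on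
  letters therefore satisfies the recursion of \<open>gm\<close>, whichever action a choice operator
  returns.\<close>

lemma right_action_unique:
 assumes ra: "right_action X OGB a"
  and gen: "!!m w. m \<in> car X ==> w \<in> car W ==> a m (smon W {#w#}) = bm m w"
  and m: "m \<in> car X" and N: "N \<in> mcar W"
 shows "a m (smon W N) = G m N"
proof -
 have ab: "a \<in> bihom X (Sym W) X" and a1: "!!m. m \<in> car X ==> a m (sone W) = m"
  and am: "!!m u v. m \<in> car X ==> u \<in> car (Sym W) ==> v \<in> car (Sym W) ==> a m (og_mul W b u v) = a (a m u) v"
  using ra by (auto simp: right_action_def)
 note ah = bihom_right[OF ab m] and ac = bihom_car[OF ab]
 show ?thesis
  using N
 proof (induction N rule: DS_mcar_induct)
  case (add y N)
  have sc: "smon W N \<in> car (Sym W)" "smon W {#y#} \<in> car (Sym W)" "smon W (add_mset y N) \<in> car (Sym W)"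
   using add by (auto intro!: smon_car)
  have "og_mul W b (smon W N) (smon W {#y#}) = og_op W b (smon W N) y"
   using add sc by (simp add: og_mul_eq OG.act_smon OG.gm_add[of _ _ "{#}"])
  also have "\<dots> = smon W (add_mset y N) + DS (rder y) N (smon W)"
   using add by (simp add: og_op_def[of W b "smon W N" y] vm_smon[OF vW] DD_smon[OF vW b_left])
  finally have "a (a m (smon W N)) (smon W {#y#}) = a m (smon W (add_mset y N) + DS (rder y) N (smon W))"
   using am[OF m sc(1,2)] by simp
  also have "\<dots> = a m (smon W (add_mset y N)) + a m (DS (rder y) N (smon W))"
   by (rule hom_add[OF ah sc(3)]) (use add in "auto intro!: DS_car[OF vspace_Sym] smon_car b_car")
  also have "a m (DS (rder y) N (smon W)) = DS (rder y) N (%N'. a m (smon W N'))"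
   by (rule hom_of_DS[OF ah vspace_Sym]) (use add in "auto intro!: smon_car b_car")
  also have "\<dots> = DS (rder y) N (G m)"
   by (rule DS_cong) (use add in auto)
  finally show ?case
   using add gen[OF ac[OF m sc(1)] add(1)] m by (simp add: gm_add algebra_simps)
 qed (use a1[OF m] in "simp add: sone_def")
qed

end

subsection \<open>Sums over set partitions\<close>

lemma finite_partitions: "finite S ==> finite {\<pi>. partition_on S \<pi>}"
 by (rule finite_subset[of _ "Pow (Pow S)"]) (auto simp: partition_on_def)

text \<open>A partition is determined by the block of \<open>a\<close>, with \<open>A\<close> its
  other elements, and a partition of what remains.\<close>

lemma sum_partition_insert:
 assumes S: "finite S" and a: "a \<notin> S"
 shows "(\<Sum>\<pi> | partition_on (insert a S) \<pi>. f \<pi>) =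
  (\<Sum>A\<in>Pow S. \<Sum>\<pi> | partition_on (S - A) \<pi>. f (insert (insert a A) \<pi>))"
proof -
 have fin: "finite {\<pi>. partition_on (S - A) \<pi>}" for A using S by (auto intro: finite_partitions)
 have "(\<Sum>A\<in>Pow S. \<Sum>\<pi> | partition_on (S - A) \<pi>. f (insert (insert a A) \<pi>)) =
  (\<Sum>(A, \<pi>)\<in>(SIGMA A:Pow S. {\<pi>. partition_on (S - A) \<pi>}). f (insert (insert a A) \<pi>))"
  using S fin by (subst sum.Sigma) auto
 also have "\<dots> = (\<Sum>\<pi> | partition_on (insert a S) \<pi>. f \<pi>)"
 proof (rule sum.reindex_bij_witness[where
    i = "%\<pi>. (\<Union>{B\<in>\<pi>. a \<in> B} - {a}, \<pi> - {B\<in>\<pi>. a \<in> B})" and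
    j = "%(A, \<pi>). insert (insert a A) \<pi>"], goal_cases)
  case (1 x)
  then obtain A \<pi> where x: "x = (A, \<pi>)" "A \<subseteq> S" "partition_on (S - A) \<pi>" by auto
  have n: "a \<notin> B" if "B \<in> \<pi>" for B
   using partition_onD1[OF x(3)] that a by blast
  have "{B\<in>insert (insert a A) \<pi>. a \<in> B} = {insert a A}" using n by blast
  moreover have "insert a A \<notin> \<pi>" using n by blast
  moreover have "insert a A - {a} = A" using x(2) a by blast
  ultimately show ?case using x(1) by simp
 next
  case (2 x)
  then obtain A \<pi> where x: "x = (A, \<pi>)" "A \<subseteq> S" "partition_on (S - A) \<pi>" by auto
  have u: "\<Union>\<pi> = S - A" using partition_onD1[OF x(3)] by simp
  have "partition_on (insert a S) (insert (insert a A) \<pi>)"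
  proof (rule partition_onI)
   show "\<Union>(insert (insert a A) \<pi>) = insert a S" using u x(2) by auto
   show "{} \<notin> insert (insert a A) \<pi>" using partition_onD3[OF x(3)] by auto
   have d: "p \<inter> insert a A = {}" if "p \<in> \<pi>" for p
    using that u a by blast
   show "disjnt p p'" if "p \<in> insert (insert a A) \<pi>" "p' \<in> insert (insert a A) \<pi>" "p \<noteq> p'" for p p'
   proof (cases "p = insert a A \<or> p' = insert a A")
    case True
    then show ?thesis using that d by (auto simp: disjnt_def)
   next
    case False
    then show ?thesis using that partition_onD2[OF x(3)] by (auto simp: disjnt_def disjoint_def)
   qed
  qed
  then show ?case using x(1) by simp
 next
  case (3 \<pi>)
  then have p: "partition_on (insert a S) \<pi>" by simp
  obtain B where B: "B \<in> \<pi>" "a \<in> B" using partition_onD1[OF p] by blast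
  have e: "{B\<in>\<pi>. a \<in> B} = {B}" using partition_onD2[OF p] B by (auto simp: disjoint_def)
  have "insert a (B - {a}) = B" "insert B (\<pi> - {B}) = \<pi>" using B by blast+
  then show ?case by (simp add: e)
 next
  case (4 \<pi>)
  then have p: "partition_on (insert a S) \<pi>" by simp
  obtain B where B: "B \<in> \<pi>" "a \<in> B" using partition_onD1[OF p] by blast
  have e: "{B\<in>\<pi>. a \<in> B} = {B}" using partition_onD2[OF p] B by (auto simp: disjoint_def)
  have un: "\<Union>\<pi> = insert a S" using partition_onD1[OF p] by simp
  have d: "C \<inter> B = {}" if "C \<in> \<pi> - {B}" for C
   using that B partition_onD2[OF p] by (auto simp: disjoint_def)
  have "partition_on (S - (B - {a})) (\<pi> - {B})"
  proof (rule partition_onI)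
   have "\<Union>(\<pi> - {B}) = \<Union>\<pi> - B" using d B by blast
   moreover have "insert a S - B = S - (B - {a})" using B(2) a by blast
   ultimately show "\<Union>(\<pi> - {B}) = S - (B - {a})" using un by simp
   show "{} \<notin> \<pi> - {B}" using partition_onD3[OF p] by auto
   show "disjnt p p'" if "p \<in> \<pi> - {B}" "p' \<in> \<pi> - {B}" "p \<noteq> p'" for p p'
    using that partition_onD2[OF p] by (auto simp: disjnt_def disjoint_def)
  qed
  moreover have "B - {a} \<subseteq> S" using un B by blast
  ultimately show ?case by (simp add: e)
 qed auto
 finally show ?thesis by simp
qed

lemma SS_swap12: "SS T (%A B. SS B (%C D. f A C D)) = SS T (%A B. SS B (%C D. f C A D))"
proof -
 have "SS T (%A B. SS B (%C D. f A C D)) = SS T (%E D. SS E (%A C. f A C D))"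
  by (rule SS_assoc[symmetric])
 also have "\<dots> = SS T (%E D. SS E (%A C. f C A D))"
  by (subst (2) SS_comm) (rule refl)
 also have "\<dots> = SS T (%A B. SS B (%C D. f C A D))" by (rule SS_assoc)
 finally show ?thesis .
qed

text \<open>Abstracts the exponential behind the star product: \<open>\<beta>\<close> is the value
  of a block, and a monomial is sent to the sum over its partitions of the products of block values.
  \<open>H\<close> is the coalgebra map cogenerated by \<open>\<beta>\<close>. Letters are
  restricted to \<open>L\<close>, on which \<open>\<beta>\<close> takes values in the
  carrier.\<close>

locale blocks =
 fixes W :: "('k::field, 'w::ab_group_add) vs" and \<beta> :: "'a multiset => 'w" and L :: "'a set"
 assumes vW: "vspace W" and \<beta>_car: "!!T. set_mset T \<subseteq> L ==> \<beta> T \<in> car W"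
begin

definition pG :: "(nat => 'a) => nat set => ('w multiset \<Rightarrow>\<^sub>0 'k)" where
 "pG h S = (\<Sum>\<pi> | partition_on S \<pi>. smon W (image_mset (%I. \<beta> (image_mset h (mset_set I))) (mset_set \<pi>)))"

definition H :: "'a multiset => ('w multiset \<Rightarrow>\<^sub>0 'k)" where
 "H T = pG (nth (list_of T)) {..<size T}"

lemma pG_empty: "pG h {} = sone W"
 by (simp add: pG_def partition_on_empty sone_def)

lemma pG_insert:
 assumes S: "finite S" and a: "a \<notin> S" and h: "h ` insert a S \<subseteq> L"
 shows "pG h (insert a S) =
  (\<Sum>A\<in>Pow S. vm W (\<beta> (add_mset (h a) (image_mset h (mset_set A)))) (pG h (S - A)))"
 unfolding pG_def sum_partition_insert[OF S a]
proof (rule sum.cong[OF refl])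
 fix A assume A: "A \<in> Pow S"
 let ?\<beta> = "%I. \<beta> (image_mset h (mset_set I))"
 have fA: "finite A" "a \<notin> A" using A S a by (auto intro: finite_subset)
 have bc: "?\<beta> I \<in> car W" if "I \<subseteq> insert a S" for I
 proof -
  have "finite I" using that S finite_subset by blast
  then show ?thesis using that h by (intro \<beta>_car) auto
 qed
 have m: "image_mset ?\<beta> (mset_set \<pi>) \<in> mcar W" if "partition_on (S - A) \<pi>" for \<pi>
 proof -
  have "finite \<pi>" by (rule finite_elements[OF finite_Diff[OF S] that])
  moreover have "I \<subseteq> insert a S" if "I \<in> \<pi>" for I
   using partition_onD1[OF \<open>partition_on (S - A) \<pi>\<close>] that by blast
  ultimately show ?thesis by (auto simp: mcar_def intro!: bc)
 qed
 have b: "\<beta> (add_mset (h a) (image_mset h (mset_set A))) \<in> car W"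
  using bc[of "insert a A"] A fA by auto
 have "(\<Sum>\<pi> | partition_on (S - A) \<pi>. smon W (image_mset ?\<beta> (mset_set (insert (insert a A) \<pi>))))
  = (\<Sum>\<pi> | partition_on (S - A) \<pi>. vm W (\<beta> (add_mset (h a) (image_mset h (mset_set A)))) (smon W (image_mset ?\<beta> (mset_set \<pi>))))"
 proof (rule sum.cong[OF refl])
  fix \<pi> assume "\<pi> \<in> {\<pi>. partition_on (S - A) \<pi>}"
  then have p: "partition_on (S - A) \<pi>" by simp
  have "insert a A \<notin> \<pi>" using partition_onD1[OF p] a by blast
  moreover have "finite \<pi>" by (rule finite_elements[OF finite_Diff[OF S] p])
  ultimately show "smon W (image_mset ?\<beta> (mset_set (insert (insert a A) \<pi>))) =
   vm W (\<beta> (add_mset (h a) (image_mset h (mset_set A)))) (smon W (image_mset ?\<beta> (mset_set \<pi>)))"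
   using vm_smon[OF vW b m[OF p]] fA by simp
 qed
 also have "\<dots> = vm W (\<beta> (add_mset (h a) (image_mset h (mset_set A)))) (\<Sum>\<pi> | partition_on (S - A) \<pi>. smon W (image_mset ?\<beta> (mset_set \<pi>)))"
  by (rule hom_sum[OF bihom_right[OF vm_bihom[OF vW] b] vspace_Sym, symmetric]) (use m in "auto intro!: smon_car")
 finally show "(\<Sum>\<pi> | partition_on (S - A) \<pi>. smon W (image_mset ?\<beta> (mset_set (insert (insert a A) \<pi>)))) = \<dots>" .
qed

lemma list_labels: "image_mset (nth (list_of T)) (mset_set {..<size T}) = T"
 using mset_nths[of "list_of T" UNIV] by (simp add: nths_all)

text \<open>Instead of transporting partitions along a bijection, both sides are unfolded at equally
  labelled elements; the recursion turns them into the same sum over splittings of a multiset of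
  labels.\<close>

lemma pG_cong:
 assumes "finite S" "h ` S \<subseteq> L" "finite S'" "image_mset h (mset_set S) = image_mset h' (mset_set S')"
 shows "pG h S = pG h' S'"
 using assms
proof (induction "card S" arbitrary: S h S' h' rule: less_induct)
 case less
 show ?case
 proof (cases "S = {}")
  case True
  then show ?thesis using less by (auto simp: pG_empty mset_set_empty_iff)
 next
  case False
  then obtain a where a: "a \<in> S" by auto
  then have "h a \<in># image_mset h' (mset_set S')" using less by (simp flip: less(5))
  then obtain a' where a': "a' \<in> S'" "h' a' = h a" using less by auto
  define S0 S0' where "S0 = S - {a}" and "S0' = S' - {a'}"
  have S: "S = insert a S0" "a \<notin> S0" "finite S0" "S' = insert a' S0'" "a' \<notin> S0'" "finite S0'"
   using a a' less by (auto simp: S0_def S0'_def)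
  have hL: "h ` insert a S0 \<subseteq> L" using less S by auto
  have "h' ` S' = h ` S"
   using arg_cong[OF less(5), of set_mset] less(2,4) by simp
  then have hL': "h' ` insert a' S0' \<subseteq> L" using less S by auto
  have e: "image_mset h (mset_set S0) = image_mset h' (mset_set S0')"
   using less(5) S a'(2) by simp
  let ?F = "%A B. vm W (\<beta> (add_mset (h a) A)) (H B)"
  have *: "pG g (insert b R) = SS (image_mset g (mset_set R)) ?F"
   if R: "finite R" "b \<notin> R" "g ` insert b R \<subseteq> L" "g b = h a" "card R < card S" for g b R
  proof -
   have "pG g (insert b R) = (\<Sum>A\<in>Pow R. ?F (image_mset g (mset_set A)) (image_mset g (mset_set (R - A))))"
    unfolding pG_insert[OF R(1-3)] R(4)
   proof (rule sum.cong[OF refl])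
    fix A assume "A \<in> Pow R"
    \<comment> \<open>The induction hypothesis replaces the smaller labelled set by the standard
      labelling used in \<open>H\<close>, so only its multiset of labels matters.\<close>
    have "pG g (R - A) = H (image_mset g (mset_set (R - A)))"
     unfolding H_def
    proof (rule less.hyps)
     show "card (R - A) < card S" using R card_mono[of R "R - A"] by auto
     show "g ` (R - A) \<subseteq> L" using R by auto
     show "image_mset g (mset_set (R - A)) = image_mset ((!) (list_of (image_mset g (mset_set (R - A)))))
      (mset_set {..<size (image_mset g (mset_set (R - A)))})"
      by (simp only: list_labels)
    qed (use R in auto)
    then show "vm W (\<beta> (add_mset (h a) (image_mset g (mset_set A)))) (pG g (R - A)) =
     ?F (image_mset g (mset_set A)) (image_mset g (mset_set (R - A)))" by simp
   qed
   also have "\<dots> = SS (image_mset g (mset_set R)) ?F" by (rule SS_index[OF R(1)])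
   finally show ?thesis .
  qed
  have cd: "card S0 < card S" using S by simp
  have "card S0' = card S0" using arg_cong[OF e, of size] by simp
  then show ?thesis
   using *[OF S(3,2) hL refl cd] *[OF S(6,5) hL' a'(2)] cd e S by simp
 qed
qed

lemma pG_H:
 assumes "finite S" "h ` S \<subseteq> L"
 shows "pG h S = H (image_mset h (mset_set S))"
 unfolding H_def by (rule pG_cong[OF assms]) (simp_all only: list_labels finite_lessThan)

lemma H_empty [simp]: "H {#} = sone W"
 by (simp add: H_def pG_empty)

lemma H_add:
 assumes "set_mset (add_mset z T) \<subseteq> L"
 shows "H (add_mset z T) = SS T (%A B. vm W (\<beta> (add_mset z A)) (H B))"
proof -
 \<comment> \<open>Position 0 carries \<open>z\<close> and position \<open>Suc i\<close> the
   \<open>i\<close>-th letter of \<open>T\<close>; \<open>pG_insert\<close> then isolates the block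
   of \<open>z\<close>.\<close>
 define h where "h = (%i. (z # list_of T) ! i)"
 let ?S = "Suc ` {..<size T}"
 have i: "image_mset h (mset_set (Suc ` A)) = image_mset (nth (list_of T)) (mset_set A)" for A
  by (simp add: h_def flip: image_mset_mset_set add: multiset.map_comp comp_def)
 have hS: "image_mset h (mset_set ?S) = T" by (simp only: i list_labels)
 have h0: "h 0 = z" by (simp add: h_def)
 have hL: "h ` insert 0 ?S \<subseteq> L"
  using assms hS h0 by (metis finite_imageI finite_lessThan finite_set_mset_mset_set image_insert insert_subset
    set_image_mset set_mset_add_mset_insert)
 have "H (add_mset z T) = pG h (insert 0 ?S)"
  by (subst pG_H[OF _ hL]) (simp_all add: hS h0)
 also have "\<dots> = (\<Sum>A\<in>Pow ?S. vm W (\<beta> (add_mset z (image_mset h (mset_set A)))) (H (image_mset h (mset_set (?S - A)))))"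
 proof -
  have "pG h (insert 0 ?S) = (\<Sum>A\<in>Pow ?S. vm W (\<beta> (add_mset z (image_mset h (mset_set A)))) (pG h (?S - A)))"
   using pG_insert[OF _ _ hL] h0 by auto
  also have "\<dots> = (\<Sum>A\<in>Pow ?S. vm W (\<beta> (add_mset z (image_mset h (mset_set A)))) (H (image_mset h (mset_set (?S - A)))))"
   by (intro sum.cong refl arg_cong[where f = "vm W _"] pG_H) (use hL in auto)
  finally show ?thesis .
 qed
 also have "\<dots> = SS T (%A B. vm W (\<beta> (add_mset z A)) (H B))"
  by (subst SS_index) (simp_all add: hS)
 finally show ?thesis .
qed

lemma H_car: "set_mset T \<subseteq> L ==> H T \<in> car (Sym W)"
proof (induction "size T" arbitrary: T rule: less_induct)
 case less
 show ?case
 proof (cases T)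
  case (add z T')
  show ?thesis unfolding add
   by (subst H_add) (use less.prems add in \<open>auto intro!: SS_car[OF vspace_Sym] vm_car[OF vW] \<beta>_car less.hyps\<close>)
 qed (simp add: sone_car)
qed

text \<open>The recursion \<open>H_add\<close> refers to \<open>H\<close> on the part outside the
  new block, so the hypothesis is needed for every submultiset of \<open>T\<close>.\<close>

lemma L_induct [consumes 1, case_names empty add]:
 assumes "set_mset T \<subseteq> L" "P {#}"
  "!!z T. z \<in> L ==> set_mset T \<subseteq> L ==> (!!A B. A + B = T ==> P B) ==> P (add_mset z T)"
 shows "P T"
 using assms(1)
proof (induction "size T" arbitrary: T rule: less_induct)
 case less
 show ?case
 proof (cases T)
  case (add z T')
  show ?thesis unfolding add
   by (rule assms(3)) (use less.prems add in "auto intro!: less.hyps")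
 qed (use assms(2) in simp)
qed

text \<open>Block values are primitive, so a product of blocks is split by distributing whole
  blocks. Summing over all partitions amounts to splitting the letters first and partitioning each
  part afterwards.\<close>

lemma scop_H:
 assumes "set_mset T \<subseteq> L"
 shows "scop W (H T) = SS T (%A B. spure W (H A) (H B))"
 using assms
proof (induction T rule: L_induct)
 case empty
 then show ?case using scop_smon[OF vW, of "{#}"] by (simp add: sone_def)
next
 case (add z T)
 let ?p = "spure W"
 note pb = spure_bihom[of W]
 have zL: "set_mset A \<subseteq> L ==> \<beta> (add_mset z A) \<in> car W" for A using add by (intro \<beta>_car) auto
 have "scop W (H (add_mset z T)) = SS T (%A B. scop W (vm W (\<beta> (add_mset z A)) (H B)))"
  using add by (subst H_add, simp, intro hom_of_SS[OF scop_hom[OF vW] vspace_Sym])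
   (auto intro!: vm_car vW zL H_car)
 also have "\<dots> = SS T (%A B. SS B (%C D. ?p (vm W (\<beta> (add_mset z A)) (H C)) (H D) + ?p (H C) (vm W (\<beta> (add_mset z A)) (H D))))"
 proof (rule SS_cong)
  fix A B assume AB: "A + B = T"
  then have L: "set_mset A \<subseteq> L" "set_mset B \<subseteq> L" using add by auto
  let ?x = "\<beta> (add_mset z A)"
  let ?t = "%c d. ?p (vm W ?x c) d + ?p c (vm W ?x d)"
  note v = bihom_right[OF vm_bihom[OF vW] zL[OF L(1)]]
  have t: "?t \<in> bihom (Sym W) (Sym W) (ST W)"
   by (intro bihomI hom_plus vspace_tens bihom_comp1[OF pb] bihom_comp2[OF pb]
     bihom_left[OF pb] bihom_right[OF pb] v vm_car vW zL L)
  have "scop W (vm W ?x (H B)) = cosum (ST W) ?t (SS B (%C D. ?p (H C) (H D)))"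
   using scop_vm[OF vW zL[OF L(1)] H_car[OF L(2)]] add.IH[OF AB] by simp
  also have "\<dots> = SS B (%C D. cosum (ST W) ?t (?p (H C) (H D)))"
   by (rule hom_of_SS[OF lext_tens_hom[OF vspace_Sym vspace_Sym vspace_tens t] vspace_tens])
    (use L in "auto intro!: bihom_car[OF pb] H_car")
  also have "\<dots> = SS B (%C D. ?t (H C) (H D))"
   by (rule SS_cong, rule lext_pure[OF vspace_Sym vspace_Sym vspace_tens t]) (use L in "auto intro!: H_car")
  finally show "scop W (vm W ?x (H B)) = SS B (%C D. ?t (H C) (H D))" .
 qed
 \<comment> \<open>In the second family the block of \<open>z\<close> goes to the right factor;
   \<open>SS_swap12\<close> moves it past the letters that go left.\<close>
 also have "\<dots> = SS T (%A B. SS B (%C D. ?p (vm W (\<beta> (add_mset z A)) (H C)) (H D)))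
   + SS T (%A B. SS B (%C D. ?p (H A) (vm W (\<beta> (add_mset z C)) (H D))))"
  unfolding SS_plus SS_swap12[of T "%A C D. ?p (H C) (vm W (\<beta> (add_mset z A)) (H D))"] ..
 also have "\<dots> = SS T (%A B. SS A (%C D. ?p (vm W (\<beta> (add_mset z C)) (H D)) (H B)))
   + SS T (%A B. SS B (%C D. ?p (H A) (vm W (\<beta> (add_mset z C)) (H D))))"
  by (subst SS_assoc) (rule refl)
 also have "\<dots> = SS T (%A B. ?p (H (add_mset z A)) (H B)) + SS T (%A B. ?p (H A) (H (add_mset z B)))"
 proof (intro arg_cong2[where f = plus] SS_cong)
  fix A B assume AB: "A + B = T"
  then have L: "set_mset A \<subseteq> L" "set_mset B \<subseteq> L" using add by auto
  show "SS A (%C D. ?p (vm W (\<beta> (add_mset z C)) (H D)) (H B)) = ?p (H (add_mset z A)) (H B)"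
   using add L
   by (subst H_add, simp, intro hom_of_SS[OF bihom_left[OF pb H_car[OF L(2)]] vspace_Sym, symmetric])
    (auto intro!: vm_car vW zL H_car)
  show "SS B (%C D. ?p (H A) (vm W (\<beta> (add_mset z C)) (H D))) = ?p (H A) (H (add_mset z B))"
  proof -
   have "H (add_mset z B) = SS B (%C D. vm W (\<beta> (add_mset z C)) (H D))"
    by (rule H_add) (use add L in auto)
   moreover have "?p (H A) (SS B (%C D. vm W (\<beta> (add_mset z C)) (H D))) = SS B (%C D. ?p (H A) (vm W (\<beta> (add_mset z C)) (H D)))"
    by (rule hom_of_SS[OF bihom_right[OF pb H_car[OF L(1)]] vspace_Sym]) (use L in "auto intro!: vm_car vW zL H_car")
   ultimately show ?thesis by simp
  qed
 qed
 also have "\<dots> = SS (add_mset z T) (%A B. ?p (H A) (H B))" by (simp add: SS_add2)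
 finally show ?case .
qed

lemma scou_H: "set_mset T \<subseteq> L ==> scou (H T) = (if T = {#} then 1 else 0)"
proof (cases T)
 case (add z T')
 assume L: "set_mset T \<subseteq> L"
 have "scou (H T) = SS T' (%A B. scou (vm W (\<beta> (add_mset z A)) (H B)))"
  unfolding add using L add
  by (subst H_add, simp, intro hom_of_SS[OF scou_hom vspace_Sym[of W]]) (auto intro!: vm_car vW \<beta>_car H_car)
 also have "\<dots> = SS T' (%A B. 0)"
  by (rule SS_cong, rule scou_vm[OF vW]) (use L add in \<open>auto intro!: \<beta>_car H_car\<close>)
 finally show ?thesis using add by (simp add: SS_zero)
qed (simp add: sone_def scou_smon[OF vW])

text \<open>A derivation of a product of blocks changes one block, and by assumption changing a
  block means changing one of its letters. Summed over partitions, this changes one letter of the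
  whole monomial.\<close>

lemma DD_H:
 assumes h: "h \<in> hom W W" and \<delta>: "!!z. z \<in> L ==> \<delta> z \<in> L"
  and \<beta>: "!!T. set_mset T \<subseteq> L ==> h (\<beta> T) = DS \<delta> T \<beta>"
  and T: "set_mset T \<subseteq> L"
 shows "DD W h (H T) = DS \<delta> T H"
 using T
proof (induction T rule: L_induct)
 case empty
 then show ?case using DD_smon[OF vW h, of "{#}"] by (simp add: sone_def)
next
 case (add z T)
 note vb = vm_bihom[OF vW]
 have zL: "set_mset A \<subseteq> L ==> \<beta> (add_mset z A) \<in> car W" for A using add by (intro \<beta>_car) auto
 have dzL: "set_mset A \<subseteq> L ==> \<beta> (add_mset (\<delta> z) A) \<in> car W" for A using add \<delta> by (intro \<beta>_car) auto
 let ?f = "%A B. vm W (\<beta> (add_mset z A)) (H B)"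
 have "DD W h (H (add_mset z T)) = SS T (%A B. DD W h (?f A B))"
  using add by (subst H_add, simp, intro hom_of_SS[OF DD_hom[OF vW h] vspace_Sym])
   (auto intro!: vm_car vW zL H_car)
 also have "\<dots> = SS T (%A B. vm W (\<beta> (add_mset (\<delta> z) A)) (H B) + (DS \<delta> A (%X. ?f X B) + DS \<delta> B (%X. ?f A X)))"
 proof (rule SS_cong)
  fix A B assume AB: "A + B = T"
  then have L: "set_mset A \<subseteq> L" "set_mset B \<subseteq> L" using add by auto
  have "DD W h (?f A B) = vm W (h (\<beta> (add_mset z A))) (H B) + vm W (\<beta> (add_mset z A)) (DD W h (H B))"
   by (rule DD_vm[OF vW h zL[OF L(1)] H_car[OF L(2)]])
  also have "h (\<beta> (add_mset z A)) = \<beta> (add_mset (\<delta> z) A) + DS \<delta> A (%X. \<beta> (add_mset z X))"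
   using \<beta>[of "add_mset z A"] add L by (simp add: DS_add)
  also have "vm W (\<beta> (add_mset (\<delta> z) A) + DS \<delta> A (%X. \<beta> (add_mset z X))) (H B) =
   vm W (\<beta> (add_mset (\<delta> z) A)) (H B) + vm W (DS \<delta> A (%X. \<beta> (add_mset z X))) (H B)"
   by (rule hom_add[OF bihom_left[OF vb H_car[OF L(2)]] dzL[OF L(1)]])
    (use L \<delta> in "auto intro!: DS_car[OF vW] zL")
  also have "vm W (DS \<delta> A (%X. \<beta> (add_mset z X))) (H B) = DS \<delta> A (%X. ?f X B)"
   by (rule hom_of_DS[OF bihom_left[OF vb H_car[OF L(2)]] vW]) (use L \<delta> in "auto intro!: zL")
  also have "DD W h (H B) = DS \<delta> B H" by (rule add.IH[OF AB])
  also have "vm W (\<beta> (add_mset z A)) (DS \<delta> B H) = DS \<delta> B (%X. ?f A X)"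
   by (rule hom_of_DS[OF bihom_right[OF vb zL[OF L(1)]] vspace_Sym]) (use L \<delta> in "auto intro!: H_car")
  finally show "DD W h (?f A B) = vm W (\<beta> (add_mset (\<delta> z) A)) (H B) + (DS \<delta> A (%X. ?f X B) + DS \<delta> B (%X. ?f A X))"
   by (simp add: add.assoc)
 qed
 also have "\<dots> = H (add_mset (\<delta> z) T) + DS \<delta> T (%N. SS N ?f)"
  unfolding DS_SS using add \<delta> by (subst H_add) (auto simp: SS_plus)
 also have "DS \<delta> T (%N. SS N ?f) = DS \<delta> T (%N. H (add_mset z N))"
  by (rule DS_cong, rule H_add[symmetric]) (use add \<delta> in auto)
 finally show ?case by (simp add: DS_add)
qed

end

subsection \<open>The star product\<close>

text \<open>Letters of the left and right factor of a star product are tagged by \<open>Inl\<close>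
  and \<open>Inr\<close>. A pair of monomials thus becomes a single multiset, to which
  \<open>blocks\<close> applies with the bracket of the two sides as block value.\<close>

definition lefts :: "('a + 'b) multiset => 'a multiset" where
 "lefts T = image_mset projl (filter_mset isl T)"

definition rights :: "('a + 'b) multiset => 'b multiset" where
 "rights T = image_mset projr (filter_mset (%z. \<not> isl z) T)"

lemma lefts_simps [simp]:
 "lefts {#} = {#}" "lefts (add_mset (Inl x) T) = add_mset x (lefts T)" "lefts (add_mset (Inr y) T) = lefts T"
 "lefts (T + T') = lefts T + lefts T'" "lefts (image_mset Inl M) = M" "lefts (image_mset Inr N) = {#}"
 by (simp_all add: lefts_def filter_mset_image_mset multiset.map_comp comp_def)

lemma rights_simps [simp]:
 "rights {#} = {#}" "rights (add_mset (Inl x) T) = rights T" "rights (add_mset (Inr y) T) = add_mset y (rights T)"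
 "rights (T + T') = rights T + rights T'" "rights (image_mset Inl M) = {#}" "rights (image_mset Inr N) = N"
 by (simp_all add: rights_def filter_mset_image_mset multiset.map_comp comp_def)

abbreviation lrsum :: "'a multiset => 'b multiset => ('a + 'b) multiset" (infixl "\<uplus>" 65) where
 "M \<uplus> N \<equiv> image_mset Inl M + image_mset Inr N"

lemma lefts_rights: "lefts T \<uplus> rights T = T"
proof (induction T)
 case (add z T)
 then show ?case by (cases z) auto
qed simp

lemma SS_lr: "SS (M \<uplus> N) f = SS M (%A B. SS N (%C D. f (A \<uplus> C) (B \<uplus> D)))"
 by (simp add: SS_union SS_image)

lemma DS_lr: "DS (map_sum h h) (M \<uplus> N) f = DS h M (%X. f (X \<uplus> N)) + DS h N (%X. f (M \<uplus> X))"
 by (simp add: DS_union DS_image[where k' = h])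

definition lrcar :: "('k, 'w) vs => ('w + 'w) set" where
 "lrcar W = Inl ` car W \<union> Inr ` car W"

lemma lrcar_image [simp]:
 "Inl ` set_mset M \<subseteq> lrcar W \<longleftrightarrow> M \<in> mcar W" "Inr ` set_mset M \<subseteq> lrcar W \<longleftrightarrow> M \<in> mcar W"
 by (auto simp: lrcar_def mcar_def)

lemma lrcar_mset: "set_mset (M \<uplus> N) \<subseteq> lrcar W \<longleftrightarrow> M \<in> mcar W \<and> N \<in> mcar W"
 by simp

lemma lrcar_lr: "set_mset T \<subseteq> lrcar W ==> lefts T \<in> mcar W \<and> rights T \<in> mcar W"
 using lrcar_mset[of "lefts T" "rights T" W] by (simp add: lefts_rights)

definition lrbr :: "('k::field, 'w::ab_group_add) vs =>
  (('w multiset \<Rightarrow>\<^sub>0 'k) => ('w multiset \<Rightarrow>\<^sub>0 'k) => 'w) => ('w + 'w) multiset => 'w" where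
 "lrbr W br T = br (smon W (lefts T)) (smon W (rights T))"

locale bracket =
 fixes W :: "('k::field, 'w::ab_group_add) vs" and br
 assumes vW: "vspace W" and br_bihom: "br \<in> bihom (Sym W) (Sym W) W"
begin

sublocale blocks W "lrbr W br" "lrcar W"
 by unfold_locales (auto simp: vW lrbr_def intro!: bihom_car[OF br_bihom] smon_car dest: lrcar_lr)

abbreviation "St M N \<equiv> H (M \<uplus> N)"
abbreviation "\<beta> \<equiv> lrbr W br"
abbreviation "S \<equiv> Sym W"

lemmas br_car = bihom_car[OF br_bihom]

lemma St_add_left:
 "x \<in> car W ==> M \<in> mcar W ==> N \<in> mcar W ==>
  St (add_mset x M) N = SS M (%A B. SS N (%C D. vm W (br (smon W (add_mset x A)) (smon W C)) (St B D)))"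
 using H_add[of "Inl x" "M \<uplus> N"] lrcar_mset[of "add_mset x M" N W]
 by (simp add: SS_lr lrbr_def)

lemma St_add_right:
 "x \<in> car W ==> M \<in> mcar W ==> N \<in> mcar W ==>
  St M (add_mset x N) = SS M (%A B. SS N (%C D. vm W (br (smon W A) (smon W (add_mset x C))) (St B D)))"
 using H_add[of "Inr x" "M \<uplus> N"] lrcar_mset[of M "add_mset x N" W]
 by (simp add: SS_lr lrbr_def)

lemma St_car: "M \<in> mcar W ==> N \<in> mcar W ==> St M N \<in> car S"
 by (rule H_car) simp

lemma vm_hom_left: "f \<in> hom B W ==> a \<in> car S ==> (%x. vm W (f x) a) \<in> hom B S"
 by (rule hom_comp[OF bihom_left[OF vm_bihom[OF vW]]])

lemma St_symfun_left: "N \<in> mcar W ==> symfun W S (%M. St M N)"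
proof (rule symfunI)
 fix M assume M: "M \<in> mcar W" and N: "N \<in> mcar W"
 have "(%x. SS M (%A B. SS N (%C D. vm W (br (smon W (add_mset x A)) (smon W C)) (St B D)))) \<in> hom W S"
  by (intro hom_SS vspace_Sym vm_hom_left hom_comp[OF bihom_left[OF br_bihom] symfun_hom[OF smon_symfun]])
   (use M N in "auto intro!: St_car smon_car")
 then show "(%x. St (add_mset x M) N) \<in> hom W S"
  by (rule hom_cong) (use M N vW in "simp_all add: St_add_left del: image_mset_add_mset")
qed (rule St_car)

lemma St_symfun_right: "M \<in> mcar W ==> symfun W S (St M)"
proof (rule symfunI)
 fix N assume M: "M \<in> mcar W" and N: "N \<in> mcar W"
 have "(%x. SS M (%A B. SS N (%C D. vm W (br (smon W A) (smon W (add_mset x C))) (St B D)))) \<in> hom W S"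
  by (intro hom_SS vspace_Sym vm_hom_left hom_comp[OF bihom_right[OF br_bihom] symfun_hom[OF smon_symfun]])
   (use M N in "auto intro!: St_car smon_car")
 then show "(%x. St M (add_mset x N)) \<in> hom W S"
  by (rule hom_cong) (use M N vW in "simp_all add: St_add_right del: image_mset_add_mset")
qed (rule St_car)

lemma partition_sum_St:
 fixes I :: "nat set"
 assumes I: "finite I" and h: "h ` I \<subseteq> lrcar W"
 shows "(\<Sum>\<pi> | partition_on I \<pi>. smon W (image_mset (%J. br (smon W (lefts (image_mset h (mset_set J))))
   (smon W (rights (image_mset h (mset_set J))))) (mset_set \<pi>)))
  = St (lefts (image_mset h (mset_set I))) (rights (image_mset h (mset_set I)))"
 using pG_H[OF I h] by (simp add: pG_def lrbr_def lefts_rights)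

text \<open>Bridge from the partitions of positions in the definition of \<open>star\<close> to the
  exponential \<open>H\<close> of the bracket.\<close>

lemma star_formula:
 assumes "set xs \<subseteq> car W" "set ys \<subseteq> car W"
 shows "(\<Sum>\<pi> | partition_on {..<length xs + length ys} \<pi>.
    smon W (image_mset (%I. br (smon W (mset (nths xs I))) (smon W (mset (nths ys {j. length xs + j \<in> I}))))
         (mset_set \<pi>))) = St (mset xs) (mset ys)"
proof -
 let ?k = "length xs" and ?l = "length ys"
 \<comment> \<open>Positions below \<open>?k\<close> carry letters of \<open>xs\<close>, and
   position \<open>?k + j\<close> carries the \<open>j\<close>-th letter of
   \<open>ys\<close>.\<close>
 let ?h = "%i. if i < ?k then Inl (xs ! i) else Inr (ys ! (i - ?k))"
 have l: "lefts (image_mset ?h (mset_set I)) = mset (nths xs I)"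
  and r: "rights (image_mset ?h (mset_set I)) = mset (nths ys {j. ?k + j \<in> I})"
  if I: "I \<subseteq> {..<?k + ?l}" for I
 proof -
  have f: "finite I" using I finite_subset by blast
  let ?J = "{j. ?k + j \<in> I} \<inter> {..<?l}"
  have J: "finite ?J" by simp
  have d: "I = (I \<inter> {..<?k}) \<union> (+) ?k ` ?J"
  proof -
   have "i \<in> (+) ?k ` ?J" if "i \<in> I" "\<not> i < ?k" for i
    using that I by (intro image_eqI[of _ _ "i - ?k"]) auto
   then show ?thesis by auto
  qed
  have "mset_set I = mset_set (I \<inter> {..<?k}) + mset_set ((+) ?k ` ?J)"
   by (subst d, rule mset_set_Union) (use f J in auto)
  also have "mset_set ((+) ?k ` ?J) = image_mset ((+) ?k) (mset_set ?J)"
   by (rule image_mset_mset_set[symmetric]) simp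
  finally have "image_mset ?h (mset_set I) =
   image_mset ?h (mset_set (I \<inter> {..<?k})) + image_mset (%j. ?h (?k + j)) (mset_set ?J)"
   by (simp add: multiset.map_comp comp_def)
  also have "image_mset ?h (mset_set (I \<inter> {..<?k})) = image_mset Inl (mset (nths xs I))"
   unfolding mset_nths multiset.map_comp using f by (intro image_mset_cong) auto
  also have "image_mset (%j. ?h (?k + j)) (mset_set ?J) = image_mset Inr (mset (nths ys {j. ?k + j \<in> I}))"
   unfolding mset_nths multiset.map_comp by (intro image_mset_cong) auto
  finally have e: "image_mset ?h (mset_set I) = mset (nths xs I) \<uplus> mset (nths ys {j. ?k + j \<in> I})" .
  show "lefts (image_mset ?h (mset_set I)) = mset (nths xs I)"
   "rights (image_mset ?h (mset_set I)) = mset (nths ys {j. ?k + j \<in> I})"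
   unfolding e by simp_all
 qed
 have hL: "?h ` {..<?k + ?l} \<subseteq> lrcar W"
  using assms by (auto simp: lrcar_def subset_iff)
 have "(\<Sum>\<pi> | partition_on {..<?k + ?l} \<pi>.
    smon W (image_mset (%I. br (smon W (mset (nths xs I))) (smon W (mset (nths ys {j. ?k + j \<in> I})))) (mset_set \<pi>)))
  = (\<Sum>\<pi> | partition_on {..<?k + ?l} \<pi>. smon W (image_mset (%J. br (smon W (lefts (image_mset ?h (mset_set J))))
   (smon W (rights (image_mset ?h (mset_set J))))) (mset_set \<pi>)))"
 proof (intro sum.cong refl arg_cong[where f = "smon W"] image_mset_cong)
  fix \<pi> I assume p: "\<pi> \<in> {\<pi>. partition_on {..<?k + ?l} \<pi>}" and I: "I \<in># mset_set \<pi>"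
  then have "I \<in> \<pi>" by (metis elem_mset_set infinite_set_mset_mset_set set_mset_empty empty_iff finite_set_mset_mset_set)
  then have "I \<subseteq> {..<?k + ?l}" using partition_onD1[of "{..<?k + ?l}" \<pi>] p by blast
  then show "br (smon W (mset (nths xs I))) (smon W (mset (nths ys {j. ?k + j \<in> I}))) =
   br (smon W (lefts (image_mset ?h (mset_set I)))) (smon W (rights (image_mset ?h (mset_set I))))"
   by (simp only: l r)
 qed
 also have "\<dots> = St (lefts (image_mset ?h (mset_set {..<?k + ?l}))) (rights (image_mset ?h (mset_set {..<?k + ?l})))"
  by (rule partition_sum_St[OF _ hL]) simp
 also have "\<dots> = St (mset xs) (mset ys)"
 proof -
  have "nths xs {..<?k + ?l} = xs" "nths ys {j. ?k + j \<in> {..<?k + ?l}} = ys"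
   by (auto intro!: nths_all)
  then show ?thesis by (simp only: l r subset_refl)
 qed
 finally show ?thesis .
qed

lemma star_eq:
 assumes a: "a \<in> car S" and c: "c \<in> car S"
 shows "star W br a c = lext psc (%M. lext psc (St M) c) a"
 unfolding star_def Let_def
proof (intro lext_cong)
 fix M N assume "M \<in> pkeys a" "N \<in> pkeys c"
 then have "M \<in> mcar W" "N \<in> mcar W" using Sym_keys[OF vW] a c by auto
 then show "(\<Sum>\<pi> | partition_on {..<length (list_of M) + length (list_of N)} \<pi>.
   smon W (image_mset (%I. br (smon W (mset (nths (list_of M) I)))
    (smon W (mset (nths (list_of N) {j. length (list_of M) + j \<in> I})))) (mset_set \<pi>))) = St M N"
  by (subst star_formula) (auto dest: mcarD)
qed

lemma star_bihom: "star W br \<in> bihom S S S"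
proof (rule bihomI)
 fix c assume c: "c \<in> car S"
 have "symfun W S (%M. lext (scl S) (St M) c)"
  by (intro symfunI lext_hom_fun[OF vW c vspace_Sym] symfun_hom[OF St_symfun_left] lext_car[OF vspace_Sym] St_car)
   (use Sym_keys[OF vW c] in auto)
 then have "lext psc (%M. lext psc (St M) c) \<in> hom S S"
  using Sym_lext_hom[OF vW vspace_Sym] by simp
 then show "(%a. star W br a c) \<in> hom S S"
  by (rule hom_cong) (simp_all add: star_eq c vspace_Sym)
next
 fix a assume a: "a \<in> car S"
 have "lext (scl S) (St M) \<in> hom S S" if "M \<in> mcar W" for M
  by (rule Sym_lext_hom[OF vW vspace_Sym St_symfun_right[OF that]])
 then have "(%c. lext (scl S) (%M. lext (scl S) (St M) c) a) \<in> hom S S"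
  by (intro hom_Lext[OF vspace_Sym]) (use Sym_keys[OF vW a] in auto)
 then show "star W br a \<in> hom S S"
  by (rule hom_cong) (simp_all add: star_eq a vspace_Sym)
qed

lemmas star_car = bihom_car[OF star_bihom]

lemma star_smon:
 assumes M: "M \<in> mcar W" and N: "N \<in> mcar W"
 shows "star W br (smon W M) (smon W N) = St M N"
proof -
 have s: "symfun W S (%M. lext (scl S) (St M) (smon W N))"
  by (rule symfun_cong[OF St_symfun_left[OF N] vW]) (rule Sym_lext[OF vW vspace_Sym St_symfun_right N, symmetric])
 show ?thesis
  using Sym_lext[OF vW vspace_Sym s M] Sym_lext[OF vW vspace_Sym St_symfun_right[OF M] N]
  by (simp add: star_eq smon_car M N)
qed

text \<open>This is \<open>DD_H\<close> with \<open>map_sum h h\<close> on the tagged letters; the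
  Leibniz rule for the bracket is its hypothesis on blocks.\<close>

lemma DD_star:
 assumes h: "h \<in> hom W W"
  and der: "!!a c. a \<in> car S ==> c \<in> car S ==> h (br a c) = br (DD W h a) c + br a (DD W h c)"
  and a: "a \<in> car S" and c: "c \<in> car S"
 shows "DD W h (star W br a c) = star W br (DD W h a) c + star W br a (DD W h c)"
proof -
 note dh = DD_hom[OF vW h] and sl = bihom_left[OF star_bihom] and sr = bihom_right[OF star_bihom]
 have \<beta>: "h (\<beta> T) = DS (map_sum h h) T \<beta>" if "set_mset T \<subseteq> lrcar W" for T
 proof -
  define M N where "M = lefts T" and "N = rights T"
  have MN: "M \<in> mcar W" "N \<in> mcar W" and T: "T = M \<uplus> N"
   using lrcar_lr[OF that] by (auto simp: M_def N_def lefts_rights)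
  have "br (DS h M (smon W)) (smon W N) = DS h M (%X. br (smon W X) (smon W N))"
   by (rule hom_of_DS[OF bihom_left[OF br_bihom] vspace_Sym]) (use MN in "auto intro!: smon_car hom_car[OF h]")
  moreover have "br (smon W M) (DS h N (smon W)) = DS h N (%X. br (smon W M) (smon W X))"
   by (rule hom_of_DS[OF bihom_right[OF br_bihom] vspace_Sym]) (use MN in "auto intro!: smon_car hom_car[OF h]")
  ultimately show ?thesis
   unfolding T DS_lr using MN der[OF smon_car smon_car] by (simp add: lrbr_def DD_smon[OF vW h])
 qed
 have \<delta>: "map_sum h h z \<in> lrcar W" if "z \<in> lrcar W" for z
  using that by (auto simp: lrcar_def intro: hom_car[OF h])
 have mono: "DD W h (star W br (smon W M) (smon W N)) =
   star W br (DD W h (smon W M)) (smon W N) + star W br (smon W M) (DD W h (smon W N))"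
  if MN: "M \<in> mcar W" "N \<in> mcar W" for M N
 proof -
  have "star W br (DS h M (smon W)) (smon W N) = DS h M (%X. star W br (smon W X) (smon W N))"
   by (rule hom_of_DS[OF sl vspace_Sym]) (use MN in "auto intro!: smon_car hom_car[OF h]")
  also have "\<dots> = DS h M (%X. St X N)"
   by (rule DS_cong, rule star_smon) (use MN in "auto intro!: hom_car[OF h]")
  finally have 1: "star W br (DS h M (smon W)) (smon W N) = \<dots>" .
  have "star W br (smon W M) (DS h N (smon W)) = DS h N (%X. star W br (smon W M) (smon W X))"
   by (rule hom_of_DS[OF sr vspace_Sym]) (use MN in "auto intro!: smon_car hom_car[OF h]")
  also have "\<dots> = DS h N (%X. St M X)"
   by (rule DS_cong, rule star_smon) (use MN in "auto intro!: hom_car[OF h]")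
  finally have 2: "star W br (smon W M) (DS h N (smon W)) = \<dots>" .
  show ?thesis
   using DD_H[OF h \<delta> \<beta>, of "M \<uplus> N"] MN
   by (simp add: star_smon DD_smon[OF vW h] 1 2 DS_lr)
 qed
 have "DD W h (star W br (smon W M) c) = star W br (DD W h (smon W M)) c + star W br (smon W M) (DD W h c)"
  if M: "M \<in> mcar W" for M
  by (rule Sym_hom_eqI[OF vW, where C = S and f = "%c. DD W h (star W br (smon W M) c)", OF _ _ mono[OF M] c])
   (intro hom_comp[OF dh sr] hom_plus[OF vspace_Sym] sr hom_comp[OF sr dh] hom_car[OF dh] smon_car M)+
 then show ?thesis
  by (intro Sym_hom_eqI[OF vW _ _ _ a, of "%a. DD W h (star W br a c)" S])
   (auto intro!: hom_comp[OF dh sl] hom_plus[OF vspace_Sym] sl hom_comp[OF sl dh] hom_car[OF dh] c)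
qed

lemma cosum_scop_H:
 assumes "vspace C" "\<phi> \<in> bihom S S C" "set_mset T \<subseteq> lrcar W"
 shows "cosum C \<phi> (scop W (H T)) = SS T (%A B. \<phi> (H A) (H B))"
proof -
 have "cosum C \<phi> (scop W (H T)) = SS T (%A B. cosum C \<phi> (spure W (H A) (H B)))"
  unfolding scop_H[OF assms(3)]
  by (rule hom_of_SS[OF lext_tens_hom[OF vspace_Sym vspace_Sym assms(1,2)] vspace_tens])
   (use assms(3) in "auto intro!: bihom_car[OF spure_bihom] H_car")
 also have "\<dots> = SS T (%A B. \<phi> (H A) (H B))"
  by (rule SS_cong, rule lext_pure[OF vspace_Sym vspace_Sym assms(1,2)])
   (use assms(3) in "auto intro!: H_car")
 finally show ?thesis .
qed

end

locale binf_alg = bracket +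
 assumes unit_one: "!!x. x \<in> car W ==> br (sone W) (smon W {#x#}) = x \<and> br (smon W {#x#}) (sone W) = x"
  and unit_other: "!!M. M \<in> mcar W ==> size M \<noteq> 1 ==> br (sone W) (smon W M) = 0 \<and> br (smon W M) (sone W) = 0"
  and assoc: "!!u v w. u \<in> car (Sym W) ==> v \<in> car (Sym W) ==> w \<in> car (Sym W) ==>
   br (star W br u v) w = br u (star W br v w)"
begin

lemma unit_add: "x \<in> car W ==> M \<in> mcar W ==> a \<in> car S ==>
  vm W (br (sone W) (smon W (add_mset x M))) a = (if M = {#} then vm W x a else 0)
 \<and> vm W (br (smon W (add_mset x M)) (sone W)) a = (if M = {#} then vm W x a else 0)"
 using unit_one[of x] unit_other[of "add_mset x M"] bihom_0_left[OF vm_bihom[OF vW] vW]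
 by (auto simp: size_eq_0_iff_empty[symmetric] simp del: size_eq_0_iff_empty)

text \<open>A bracket with the unit vanishes outside degree one, so in the recursion the block of
  \<open>x\<close> is \<open>x\<close> alone.\<close>

lemma St_unit: "M \<in> mcar W ==> St {#} M = smon W M \<and> St M {#} = smon W M"
proof (induction M)
 case (add x M)
 have "St {#} (add_mset x M) = SS M (%C D. vm W (br (sone W) (smon W (add_mset x C))) (St {#} D))"
  using St_add_right[of x "{#}" M] add by (simp add: sone_def del: image_mset_add_mset)
 also have "\<dots> = SS M (%C D. if C = {#} then vm W x (St {#} D) else 0)"
  by (rule SS_cong, rule unit_add[THEN conjunct1]) (use add St_car[of "{#}"] in auto)
 also have "\<dots> = smon W (add_mset x M)"
  using add vm_smon[OF vW] unfolding SS_delta_left by simp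
 finally have 1: "St {#} (add_mset x M) = smon W (add_mset x M)" .
 have "St (add_mset x M) {#} = SS M (%C D. vm W (br (smon W (add_mset x C)) (sone W)) (St D {#}))"
  using St_add_left[of x M "{#}"] add by (simp add: sone_def del: image_mset_add_mset)
 also have "\<dots> = SS M (%C D. if C = {#} then vm W x (St D {#}) else 0)"
  by (rule SS_cong, rule unit_add[THEN conjunct2]) (use add St_car[of _ "{#}"] in auto)
 also have "\<dots> = smon W (add_mset x M)"
  using add vm_smon[OF vW] unfolding SS_delta_left by simp
 finally show ?case using 1 by simp
qed (simp add: sone_def)

lemma star_sone_left: "c \<in> car S ==> star W br (sone W) c = c"
 by (rule Sym_hom_eqI[OF vW bihom_right[OF star_bihom sone_car] hom_id])
  (use St_unit star_smon[of "{#}"] in "auto simp: sone_def")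

text \<open>The block recursion with a left factor that is a letter of \<open>W\<close> times an
  arbitrary element. It is needed when the left factor is itself a star product;
  \<open>star_add_left\<close> does the same for the right factor.\<close>

lemma star_vm_left:
 assumes x: "x \<in> car W" and a: "a \<in> car S" and N: "N \<in> mcar W"
 shows "star W br (vm W x a) (smon W N) =
  cosum S (%a1 a2. SS N (%C D. vm W (br (vm W x a1) (smon W C)) (star W br a2 (smon W D)))) (scop W a)"
proof (rule Sym_hom_eqI[OF vW _ _ _ a])
 note v = bihom_right[OF vm_bihom[OF vW] x]
 let ?f = "%a1 a2. SS N (%C D. vm W (br (vm W x a1) (smon W C)) (star W br a2 (smon W D)))"
 have b: "?f \<in> bihom S S S"
  by (intro bihomI hom_SS vspace_Sym vm_hom_left hom_comp[OF bihom_left[OF br_bihom] v]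
    hom_comp[OF bihom_right[OF vm_bihom[OF vW]] bihom_left[OF star_bihom]])
   (use N in "auto intro!: smon_car star_car br_car vm_car vW x")
 show "(%a. cosum S ?f (scop W a)) \<in> hom S S" by (rule cosum_scop_hom[OF vW vspace_Sym b])
 show "(%a. star W br (vm W x a) (smon W N)) \<in> hom S S"
  by (rule hom_comp[OF bihom_left[OF star_bihom smon_car[OF N]] v])
 fix M assume M: "M \<in> mcar W"
 have "star W br (vm W x (smon W M)) (smon W N) =
  SS M (%A B. SS N (%C D. vm W (br (smon W (add_mset x A)) (smon W C)) (St B D)))"
  using M N x St_add_left by (simp add: vm_smon[OF vW] star_smon del: image_mset_add_mset)
 also have "\<dots> = SS M (%A B. ?f (smon W A) (smon W B))"
  by (intro SS_cong) (use M N x in "auto simp: vm_smon[OF vW] star_smon")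
 also have "\<dots> = cosum S ?f (scop W (smon W M))"
  by (rule cosum_scop_smon[OF vW vspace_Sym b M, symmetric])
 finally show "star W br (vm W x (smon W M)) (smon W N) = \<dots>" .
qed

lemma star_add_left:
 assumes x: "x \<in> car W" and M: "M \<in> mcar W" and c: "c \<in> car S"
 shows "star W br (smon W (add_mset x M)) c =
  SS M (%A B. cosum S (%c1 c2. vm W (br (smon W (add_mset x A)) c1) (star W br (smon W B) c2)) (scop W c))"
proof (rule Sym_hom_eqI[OF vW _ _ _ c])
 have b: "(%c1 c2. vm W (br (smon W (add_mset x A)) c1) (star W br (smon W B) c2)) \<in> bihom S S S"
  if "A + B = M" for A B
  by (intro bihomI vm_hom_left bihom_right[OF br_bihom]
    hom_comp[OF bihom_right[OF vm_bihom[OF vW]] bihom_right[OF star_bihom]])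
   (use M x that in "auto intro!: smon_car star_car br_car")
 show "(%c. SS M (%A B. cosum S (%c1 c2. vm W (br (smon W (add_mset x A)) c1) (star W br (smon W B) c2)) (scop W c))) \<in> hom S S"
  by (intro hom_SS vspace_Sym cosum_scop_hom[OF vW] b)
 show "star W br (smon W (add_mset x M)) \<in> hom S S"
  by (rule bihom_right[OF star_bihom]) (use x M in "auto intro!: smon_car")
 fix N assume N: "N \<in> mcar W"
 show "star W br (smon W (add_mset x M)) (smon W N) =
  SS M (%A B. cosum S (%c1 c2. vm W (br (smon W (add_mset x A)) c1) (star W br (smon W B) c2)) (scop W (smon W N)))"
  using M N x St_add_left
  by (auto simp: star_smon cosum_scop_smon[OF vW vspace_Sym b N, simplified] simp del: image_mset_add_mset intro!: SS_cong)
qed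

text \<open>Both sides are expanded by the outer block containing a letter \<open>x\<close> of
  \<open>U\<close>. That block is a bracket one of whose arguments is a star product, where the
  axiom \<open>assoc\<close> applies; the remaining factor involves fewer letters of
  \<open>U\<close> and is covered by induction.\<close>

lemma star_assoc_smon:
 assumes "U \<in> mcar W" "V \<in> mcar W" "N \<in> mcar W"
 shows "star W br (star W br (smon W U) (smon W V)) (smon W N) =
  star W br (smon W U) (star W br (smon W V) (smon W N))"
 using assms
proof (induction "size U" arbitrary: U V N rule: less_induct)
 case less
 note V = less.prems(2) and N = less.prems(3)
 note sc = smon_car[where W = W]
 show ?case
 proof (cases U)
  case empty
  then show ?thesis
   using star_sone_left[OF smon_car[OF less.prems(2)]] star_sone_left[OF star_car[OF smon_car smon_car], of V N] less.prems empty
   by (simp add: sone_def)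
 next
  case (add x U')
  have x: "x \<in> car W" and U': "U' \<in> mcar W" using less add by auto
  let ?T = "U' \<uplus> V" and ?s = "star W br" and ?m = "smon W" and ?z = "Inl x"
  have TL: "set_mset ?T \<subseteq> lrcar W" using U' V by simp
  have zL: "set_mset (add_mset ?z A) \<subseteq> lrcar W" if "set_mset A \<subseteq> lrcar W" for A
   using that x by (auto simp: lrcar_def)
  have bc: "\<beta> (add_mset ?z A) \<in> car W" if "set_mset A \<subseteq> lrcar W" for A by (rule \<beta>_car[OF zL[OF that]])
  let ?F = "%y a1 a2. SS N (%C D. vm W (br (vm W y a1) (?m C)) (?s a2 (?m D)))"
  have F: "?F y \<in> bihom S S S" if "y \<in> car W" for y
   by (intro bihomI hom_SS vspace_Sym vm_hom_left hom_comp[OF bihom_left[OF br_bihom] bihom_right[OF vm_bihom[OF vW]]]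
     hom_comp[OF bihom_right[OF vm_bihom[OF vW]] bihom_left[OF star_bihom]])
    (use N that in "auto intro!: sc star_car br_car vm_car vW")
  have "?s (?m U) (?m V) = SS ?T (%A B. vm W (\<beta> (add_mset ?z A)) (H B))"
   using star_smon[OF less.prems(1) V] H_add[OF zL[OF TL]] add by simp
  then have "?s (?s (?m U) (?m V)) (?m N) = SS ?T (%A B. ?s (vm W (\<beta> (add_mset ?z A)) (H B)) (?m N))"
   using hom_of_SS[OF bihom_left[OF star_bihom sc[OF N]] vspace_Sym, of ?T "%A B. vm W (\<beta> (add_mset ?z A)) (H B)"] TL
   by (metis (no_types, lifting) H_car bc le_sup_iff set_mset_union vW vm_car)
  also have "\<dots> = SS ?T (%A B. SS B (%P Q. ?F (\<beta> (add_mset ?z A)) (H P) (H Q)))"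
  proof (rule SS_cong)
   fix A B assume "A + B = ?T"
   then have L: "set_mset A \<subseteq> lrcar W" "set_mset B \<subseteq> lrcar W" using TL by (metis le_sup_iff set_mset_union)+
   show "?s (vm W (\<beta> (add_mset ?z A)) (H B)) (?m N) = SS B (%P Q. ?F (\<beta> (add_mset ?z A)) (H P) (H Q))"
    unfolding star_vm_left[OF bc[OF L(1)] H_car[OF L(2)] N]
    by (rule cosum_scop_H[OF vspace_Sym F[OF bc[OF L(1)]] L(2)])
  qed
  \<comment> \<open>\<open>E\<close> collects all letters of \<open>U'\<close> and \<open>V\<close>
    that enter the outer block of \<open>x\<close>; the inner sum over its splittings then
    reassembles \<open>H (add_mset ?z E)\<close>.\<close>
  also have "\<dots> = SS ?T (%E Q. SS E (%A P. ?F (\<beta> (add_mset ?z A)) (H P) (H Q)))"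
   by (rule SS_assoc[symmetric])
  also have "\<dots> = SS ?T (%E Q. SS N (%C D. vm W (br (H (add_mset ?z E)) (?m C)) (?s (H Q) (?m D))))"
  proof (rule SS_cong)
   fix E Q assume "E + Q = ?T"
   then have L: "set_mset E \<subseteq> lrcar W" "set_mset Q \<subseteq> lrcar W" using TL by (metis le_sup_iff set_mset_union)+
   have "SS E (%A P. ?F (\<beta> (add_mset ?z A)) (H P) (H Q)) =
    SS N (%C D. SS E (%A P. vm W (br (vm W (\<beta> (add_mset ?z A)) (H P)) (?m C)) (?s (H Q) (?m D))))"
    by (rule SS_SS_swap)
   also have "\<dots> = SS N (%C D. vm W (br (SS E (%A P. vm W (\<beta> (add_mset ?z A)) (H P))) (?m C)) (?s (H Q) (?m D)))"
   proof (rule SS_cong)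
    fix C D assume "C + D = N"
    then have CD: "C \<in> mcar W" "D \<in> mcar W" using N by auto
    have h: "(%a. vm W (br a (?m C)) (?s (H Q) (?m D))) \<in> hom S S"
     by (intro vm_hom_left bihom_left[OF br_bihom] sc star_car H_car CD L)
    show "SS E (%A P. vm W (br (vm W (\<beta> (add_mset ?z A)) (H P)) (?m C)) (?s (H Q) (?m D))) =
     vm W (br (SS E (%A P. vm W (\<beta> (add_mset ?z A)) (H P))) (?m C)) (?s (H Q) (?m D))"
     by (rule hom_of_SS[OF h vspace_Sym, symmetric]) (use L in "auto intro!: vm_car vW bc H_car")
   qed
   finally show "SS E (%A P. ?F (\<beta> (add_mset ?z A)) (H P) (H Q)) =
    SS N (%C D. vm W (br (H (add_mset ?z E)) (?m C)) (?s (H Q) (?m D)))"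
    unfolding H_add[OF zL[OF L(1)]] .
  qed
  also have "\<dots> = SS U' (%A B. SS V (%A' B'. SS N (%C D.
   vm W (br (?s (?m (add_mset x A)) (?m A')) (?m C)) (?s (?s (?m B) (?m B')) (?m D)))))"
   unfolding SS_lr by (intro SS_cong) (use U' V x in "auto simp: star_smon")
  \<comment> \<open>The bracket is reassociated by the axiom, the cofactor by induction:
    \<open>B\<close> lacks the letter \<open>x\<close>, hence is smaller than
    \<open>U\<close>.\<close>
  also have "\<dots> = SS U' (%A B. SS V (%A' B'. SS N (%C D.
   vm W (br (?m (add_mset x A)) (?s (?m A') (?m C))) (?s (?m B) (?s (?m B') (?m D))))))"
  proof (intro SS_cong)
   fix A B A' B' C D assume "A + B = U'" "A' + B' = V" "C + D = N"
   then have m: "A \<in> mcar W" "B \<in> mcar W" "A' \<in> mcar W" "B' \<in> mcar W" "C \<in> mcar W" "D \<in> mcar W" "size B < size U"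
    using U' V N add by auto
   show "vm W (br (?s (?m (add_mset x A)) (?m A')) (?m C)) (?s (?s (?m B) (?m B')) (?m D)) =
    vm W (br (?m (add_mset x A)) (?s (?m A') (?m C))) (?s (?m B) (?s (?m B') (?m D)))"
    using m x less.hyps[OF m(7,2,4,6)] by (simp add: assoc sc)
  qed
  also have "\<dots> = SS U' (%A B. SS (V \<uplus> N) (%P Q. vm W (br (?m (add_mset x A)) (H P)) (?s (?m B) (H Q))))"
   unfolding SS_lr by (intro SS_cong) (use V N in "auto simp: star_smon")
  also have "\<dots> = SS U' (%A B. cosum S (%c1 c2. vm W (br (?m (add_mset x A)) c1) (?s (?m B) c2)) (scop W (St V N)))"
  proof (rule SS_cong, rule cosum_scop_H[symmetric, OF vspace_Sym])
   fix A B assume "A + B = U'"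
   then show "(%c1 c2. vm W (br (?m (add_mset x A)) c1) (?s (?m B) c2)) \<in> bihom S S S"
    by (intro bihomI vm_hom_left bihom_right[OF br_bihom]
      hom_comp[OF bihom_right[OF vm_bihom[OF vW]] bihom_right[OF star_bihom]])
     (use U' x in "auto intro!: sc star_car br_car")
  qed (use V N in simp)
  also have "\<dots> = ?s (?m U) (?s (?m V) (?m N))"
   using star_add_left[OF x U' St_car[OF V N]] add star_smon[OF V N] by simp
  finally show ?thesis .
 qed
qed

lemma star_bialgebra:
 "is_bialgebra \<lparr>sp = S, mul = star W br, one = sone W, cop = scop W, cou = scou\<rparr>"
proof (rule Sym_bialgebra[OF vW star_bihom])
 show "star W br (sone W) (smon W M) = smon W M \<and> star W br (smon W M) (sone W) = smon W M" if "M \<in> mcar W" for M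
  using star_smon[of "{#}" M] star_smon[of M "{#}"] St_unit[OF that] that by (simp add: sone_def)
 show "scop W (star W br (smon W M) (smon W N)) =
   SS M (%A B. SS N (%C D. spure W (star W br (smon W A) (smon W C)) (star W br (smon W B) (smon W D))))"
  if "M \<in> mcar W" "N \<in> mcar W" for M N
  using that scop_H[of "M \<uplus> N"] by (auto simp: star_smon SS_lr intro!: SS_cong)
 show "scou (star W br (smon W M) (smon W N)) = scou (smon W M) * scou (smon W N)"
  if "M \<in> mcar W" "N \<in> mcar W" for M N
  using that scou_H[of "M \<uplus> N"] by (auto simp: star_smon scou_smon[OF vW])
qed (rule star_assoc_smon)

text \<open>By \<open>right_action_unique\<close> the given action is computed by the recursion
  \<open>gm\<close>. The compatibilities then follow from the behaviour of single letters: they kill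
  the unit, are derivations of the star product (\<open>DD_star\<close>) and coderivations of the
  coproduct, and have vanishing counit.\<close>

lemma interaction:
 assumes M: "prelie_module W' W b bm"
  and der: "!!w a c. w \<in> car W' ==> a \<in> car S ==> c \<in> car S ==>
   bm (br a c) w = br (DD W (%x. bm x w) a) c + br a (DD W (%x. bm x w) c)"
  and ra: "right_action S \<lparr>sp = Sym W', mul = og_mul W' b, one = sone W', cop = scop W', cou = scou\<rparr> act"
  and gen: "!!a w. a \<in> car S ==> w \<in> car W' ==> act a (smon W' {#w#}) = DD W (%x. bm x w) a"
 shows "in_interaction \<lparr>sp = S, mul = star W br, one = sone W, cop = scop W, cou = scou\<rparr>
  \<lparr>sp = Sym W', mul = og_mul W' b, one = sone W', cop = scop W', cou = scou\<rparr> act"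
proof -
 interpret M: prelie_module W' W b bm by fact
 let ?D = "%U y. DD W (%x. bm x y) U"
 have DM: "prelie_module W' S b ?D" by (rule M.DD_module)
 interpret D: prelie_module W' S b ?D by (rule DM)
 let ?B = "Sym W'"
 note eqI = Sym_hom_eqI[OF M.vW]
 have act_G: "act a (smon W' N) = D.G a N" if "a \<in> car S" "N \<in> mcar W'" for a N
  by (rule D.right_action_unique[OF ra gen that])
 have ab: "act \<in> bihom S ?B S" using ra by (simp add: right_action_def)
 note ar = bihom_right[OF ab] and al = bihom_left[OF ab] and ac = bihom_car[OF ab]
 note so = sone_car[of W]
 have D1: "?D (sone W) w = 0" if "w \<in> car W'" for w
  using DD_smon[OF vW M.bm_left[OF that], of "{#}"] by (simp add: sone_def)
 have 1: "act (sone W) u = psc (scou u) (sone W)" if "u \<in> car ?B" for u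
 proof (rule eqI[OF ar[OF so] _ _ that])
  show "(%u. psc (scou u) (sone W)) \<in> hom ?B S"
   by (rule homI)
    (auto simp: hom_add[OF scou_hom] hom_scl[OF scou_hom, simplified] ground_def so
     scl_scl[OF vspace_Sym, simplified] scl_add_left[OF vspace_Sym, simplified] intro!: car_scl[OF vspace_Sym, simplified])
  fix N assume N: "N \<in> mcar W'"
  show "act (sone W) (smon W' N) = psc (scou (smon W' N)) (sone W)"
   using D.gm_vanish[OF so D1 N]
   by (cases "N = {#}") (auto simp: act_G so N scou_smon[OF M.vW] scl_1[OF vspace_Sym, simplified] scl_0_left[OF vspace_Sym, simplified])
 qed
 have 2: "scou (act a u) = scou a * scou u" if "a \<in> car S" "u \<in> car ?B" for a u
 proof (rule eqI[OF hom_comp[OF scou_hom ar[OF that(1)]] _ _ that(2)])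
  show "(%u. scou a * scou u) \<in> hom ?B ground"
   by (rule homI) (auto simp: hom_add[OF scou_hom] hom_scl[OF scou_hom, simplified] ground_def algebra_simps)
  fix N assume N: "N \<in> mcar W'"
  show "scou (act a (smon W' N)) = scou a * scou (smon W' N)"
   using scou_gm[OF DM vW _ that(1) N] scou_DD[OF vW M.bm_left]
   by (simp add: act_G that N scou_smon[OF M.vW])
 qed
 have b3: "(%b1 b2. star W br (act a1 b1) (act a2 b2)) \<in> bihom ?B ?B S" if "a1 \<in> car S" "a2 \<in> car S" for a1 a2
  by (intro bihomI hom_comp[OF bihom_left[OF star_bihom] ar] hom_comp[OF bihom_right[OF star_bihom] ar] ac that)
 have 3: "act (star W br a1 a2) u = cosum S (%b1 b2. star W br (act a1 b1) (act a2 b2)) (scop W' u)"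
  if "a1 \<in> car S" "a2 \<in> car S" "u \<in> car ?B" for a1 a2 u
 proof (rule eqI[where C = S and f = "act (star W br a1 a2)" and
    g = "%u. cosum S (%b1 b2. star W br (act a1 b1) (act a2 b2)) (scop W' u)"])
  show "act (star W br a1 a2) \<in> hom ?B S" by (rule ar[OF star_car[OF that(1,2)]])
  show "(%u. cosum S (%b1 b2. star W br (act a1 b1) (act a2 b2)) (scop W' u)) \<in> hom ?B S"
   by (rule cosum_scop_hom[OF M.vW vspace_Sym b3[OF that(1,2)]])
  show "u \<in> car ?B" by (rule that(3))
  fix N assume N: "N \<in> mcar W'"
  have "D.G (star W br a1 a2) N = SS N (%A B. star W br (D.G a1 A) (D.G a2 B))"
  proof (rule tensor_gm[OF DM DM DM star_bihom _ that(1,2) N])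
   fix a c w assume "a \<in> car S" "c \<in> car S" and w: "w \<in> car W'"
   then show "?D (star W br a c) w = star W br (?D a w) c + star W br a (?D c w)"
    using der[OF w] by (intro DD_star M.bm_left[OF w]) auto
  qed
  also have "\<dots> = SS N (%A B. star W br (act a1 (smon W' A)) (act a2 (smon W' B)))"
   by (rule SS_cong) (use N that in "auto simp: act_G")
  finally show "act (star W br a1 a2) (smon W' N) = cosum S (%b1 b2. star W br (act a1 b1) (act a2 b2)) (scop W' (smon W' N))"
   unfolding cosum_scop_smon[OF M.vW vspace_Sym b3[OF that(1,2)] N]
   using act_G[OF star_car[OF that(1,2)] N] by simp
 qed
 note sb = spure_bihom[of W]
 have b4: "(%b1 b2. spure W (act a1 b1) (act a2 b2)) \<in> bihom ?B ?B (ST W)" if "a1 \<in> car S" "a2 \<in> car S" for a1 a2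
  by (intro bihomI hom_comp[OF bihom_left[OF sb] ar] hom_comp[OF bihom_right[OF sb] ar] ac that)
 have 4: "scop W (act a u) = cosum (ST W) (%a1 a2. cosum (ST W) (%b1 b2. spure W (act a1 b1) (act a2 b2)) (scop W' u)) (scop W a)"
  if a: "a \<in> car S" and "u \<in> car ?B" for a u
 proof (rule eqI[OF hom_comp[OF scop_hom[OF vW] ar[OF that(1)]] _ _ that(2)])
  show "(%u. cosum (ST W) (%a1 a2. cosum (ST W) (%b1 b2. spure W (act a1 b1) (act a2 b2)) (scop W' u)) (scop W a)) \<in> hom ?B (ST W)"
   by (intro cosum_scop_hom_param[OF vW vspace_tens _ that(1)] cosum_scop_hom[OF M.vW vspace_tens] b4)
  fix N assume N: "N \<in> mcar W'"
  have "scop W (act a (smon W' N)) = cosum (ST W) (%c d. SS N (%A B. spure W (D.G c A) (D.G d B))) (scop W a)"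
   using scop_gm[OF DM vW _ that(1) N] scop_DD[OF vW M.bm_left] by (simp add: act_G that N)
  also have "\<dots> = cosum (ST W) (%a1 a2. cosum (ST W) (%b1 b2. spure W (act a1 b1) (act a2 b2)) (scop W' (smon W' N))) (scop W a)"
  proof (rule lext_cong)
   fix z assume "z \<in> pkeys (scop W a)"
   then obtain c d where z: "z = (c, d)" "c \<in> car S" "d \<in> car S"
    using tens_keys[OF vspace_Sym vspace_Sym hom_car[OF scop_hom[OF vW] a], of z] by auto
   have "SS N (%A B. spure W (D.G c A) (D.G d B)) = SS N (%A B. spure W (act c (smon W' A)) (act d (smon W' B)))"
    by (rule SS_cong) (use N z in "auto simp: act_G")
   then show "(case z of (c, d) => SS N (%A B. spure W (D.G c A) (D.G d B))) =
    (case z of (a1, a2) => cosum (ST W) (%b1 b2. spure W (act a1 b1) (act a2 b2)) (scop W' (smon W' N)))"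
    unfolding z(1) prod.case cosum_scop_smon[OF M.vW vspace_tens b4[OF z(2,3)] N] .
  qed
  finally show "scop W (act a (smon W' N)) = \<dots>" .
 qed
 show ?thesis
  unfolding in_interaction_def using star_bialgebra M.og_bialgebra ra 1 2 3 4 by simp
qed

end

subsection \<open>Permutations of inputs under partial composition\<close>

text \<open>The places of the composite are the block from \<open>i\<close> to
  \<open>i + n - 1\<close> and the outer places. The former go to the block at
  \<open>\<sigma> i\<close> by \<open>\<tau>\<close>, the latter around it by
  \<open>\<sigma>\<close>, so injectivity may be checked within each kind.\<close>

lemma pcomp_permutes:
 assumes i: "1 \<le> i" "i \<le> m" and s: "\<sigma> permutes {1..m}" and t: "\<tau> permutes {1..n}"
 shows "pcomp m n i \<sigma> \<tau> permutes {1..m + n - 1}"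
proof -
 let ?\<rho> = "pcomp m n i \<sigma> \<tau>" and ?N = "m + n - 1"
 let ?sh = "%c. if c < \<sigma> i then c else c + n - 1"
 have sm: "1 \<le> \<sigma> a \<and> \<sigma> a \<le> m" if "1 \<le> a" "a \<le> m" for a
  using permutes_in_image[OF s, of a] that by auto
 have tm: "1 \<le> \<tau> a \<and> \<tau> a \<le> n" if "1 \<le> a" "a \<le> n" for a
  using permutes_in_image[OF t, of a] that by auto
 have sinj: "\<sigma> a = \<sigma> b \<longleftrightarrow> a = b" for a b using permutes_inj[OF s] by (auto simp: inj_def)
 have tinj: "\<tau> a = \<tau> b \<longleftrightarrow> a = b" for a b using permutes_inj[OF t] by (auto simp: inj_def)
 have si: "1 \<le> \<sigma> i" "\<sigma> i \<le> m" using sm[OF i] by auto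
 \<comment> \<open>The place of the outer operation from which an outer place \<open>a\<close> of
   the composite comes.\<close>
 define outer where "outer a = (if a < i then a else a + 1 - n)" for a
 have A: "?\<rho> a = ?sh (\<sigma> (outer a)) \<and> 1 \<le> outer a \<and> outer a \<le> m \<and> outer a \<noteq> i \<and>
   (a < i \<longrightarrow> outer a < i) \<and> (\<not> a < i \<longrightarrow> i < outer a)"
  if "1 \<le> a" "a \<le> ?N" "a < i \<or> i + n \<le> a" for a
  using that i by (auto simp: pcomp_def outer_def Let_def)
 have B: "?\<rho> a = \<sigma> i - 1 + \<tau> (a + 1 - i) \<and> 1 \<le> a + 1 - i \<and> a + 1 - i \<le> n"
  if "i \<le> a" "a < i + n" for a
  using that by (auto simp: pcomp_def Let_def)
 have Ar: "(?\<rho> a < \<sigma> i \<or> \<sigma> i + n \<le> ?\<rho> a) \<and> 1 \<le> ?\<rho> a \<and> ?\<rho> a \<le> ?N"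
  if a: "1 \<le> a" "a \<le> ?N" "a < i \<or> i + n \<le> a" for a
 proof -
  have "\<sigma> (outer a) \<noteq> \<sigma> i" using A[OF a] sinj by blast
  then show ?thesis using A[OF a] sm[of "outer a"] si by auto
 qed
 have Br: "\<sigma> i \<le> ?\<rho> a \<and> ?\<rho> a < \<sigma> i + n" if "i \<le> a" "a < i + n" for a
  using B[OF that] tm[of "a + 1 - i"] si by auto
 have inj: "inj_on ?\<rho> {1..?N}"
 proof (rule inj_onI)
  fix a b assume ab: "a \<in> {1..?N}" "b \<in> {1..?N}" and e: "?\<rho> a = ?\<rho> b"
  consider "a < i \<or> i + n \<le> a" "b < i \<or> i + n \<le> b" | "i \<le> a" "a < i + n" "b < i \<or> i + n \<le> b"
   | "a < i \<or> i + n \<le> a" "i \<le> b" "b < i + n" | "i \<le> a" "a < i + n" "i \<le> b" "b < i + n"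
   by linarith
  then show "a = b"
  proof cases
   case 1
   have A': "1 \<le> a" "a \<le> ?N" "1 \<le> b" "b \<le> ?N" using ab by auto
   have "\<sigma> (outer a) \<noteq> \<sigma> i" "\<sigma> (outer b) \<noteq> \<sigma> i"
    using A[OF A'(1,2) 1(1)] A[OF A'(3,4) 1(2)] sinj by blast+
   moreover have "?sh (\<sigma> (outer a)) = ?sh (\<sigma> (outer b))"
    using A[OF A'(1,2) 1(1)] A[OF A'(3,4) 1(2)] e by simp
   ultimately have "\<sigma> (outer a) = \<sigma> (outer b)" using si by (auto split: if_splits)
   then have o: "outer a = outer b" using sinj by blast
   have "a < i \<longleftrightarrow> b < i" using A[OF A'(1,2) 1(1)] A[OF A'(3,4) 1(2)] o by linarith
   then show ?thesis using o 1 i by (auto simp: outer_def split: if_splits)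
  next
   case 2
   then show ?thesis using Br[of a] Ar[of b] ab e by auto
  next
   case 3
   then show ?thesis using Ar[of a] Br[of b] ab e by auto
  next
   case 4
   then have "\<tau> (a + 1 - i) = \<tau> (b + 1 - i)" using B[of a] B[of b] e by simp
   then show ?thesis using tinj 4 by simp
  qed
 qed
 have sub: "?\<rho> ` {1..?N} \<subseteq> {1..?N}"
 proof
  fix c assume "c \<in> ?\<rho> ` {1..?N}"
  then obtain a where a: "1 \<le> a" "a \<le> ?N" "c = ?\<rho> a" by auto
  show "c \<in> {1..?N}"
  proof (cases "i \<le> a \<and> a < i + n")
   case True
   then show ?thesis using Br[of a] a si by auto
  next
   case False
   then show ?thesis using Ar[of a] a by auto
  qed
 qed
 have "bij_betw ?\<rho> {1..?N} {1..?N}"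
  using inj sub endo_inj_surj[of "{1..?N}" ?\<rho>] by (auto simp: bij_betw_def)
 moreover have "?\<rho> a = a" if "a \<notin> {1..?N}" for a
 proof (cases "a = 0")
  \<comment> \<open>Place 0 falls under the branch \<open>a < i\<close> of \<open>pcomp\<close>,
    where \<open>\<sigma>\<close> fixes it.\<close>
  case True
  have "\<sigma> 0 = 0" using permutes_not_in[OF s, of 0] by simp
  then show ?thesis using True i si by (simp add: pcomp_def)
 next
  case False
  then have "m + n \<le> a" using that by auto
  then show ?thesis using i by (simp add: pcomp_def Let_def)
 qed
 ultimately show ?thesis by (rule bij_imp_permutes)
qed

subsection \<open>Right modules over an operad and their coinvariants\<close>

definition crel :: "(nat => ('k::field, 'm::ab_group_add) vs) => (nat => (nat => nat) => 'm => 'm) => nat => 'm set" where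
 "crel M ma n = {ma n \<sigma> x - x | x \<sigma>. x \<in> car (M n) \<and> \<sigma> permutes {1..n}}"

definition cinv :: "(nat => ('k::field, 'm::ab_group_add) vs) => (nat => (nat => nat) => 'm => 'm) => ('k, nat \<Rightarrow>\<^sub>0 'm) vs" where
 "cinv M ma = dsum (%n. quot (M n) (crel M ma n))"

definition cpr :: "(nat => ('k::field, 'm::ab_group_add) vs) => (nat => (nat => nat) => 'm => 'm) =>
  (nat => nat => nat => 'm => 'q => 'm) => (nat \<Rightarrow>\<^sub>0 'm) => (nat \<Rightarrow>\<^sub>0 'q::ab_group_add) => (nat \<Rightarrow>\<^sub>0 'm)" where
 "cpr M ma mc v w = (\<Sum>m\<in>pkeys v. \<Sum>n\<in>pkeys w.
   psingle (m + n - 1) (qproj (M (m + n - 1)) (crel M ma (m + n - 1))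
    (\<Sum>i=1..m. mc m n i (plookup v m) (plookup w n))))"

definition ccl :: "(nat => ('k::field, 'm::ab_group_add) vs) => (nat => (nat => nat) => 'm => 'm) => nat => 'm => (nat \<Rightarrow>\<^sub>0 'm)" where
 "ccl M ma n x = psingle n (qproj (M n) (crel M ma n) x)"

lemma coinv_rel_eq: "coinv_rel Q = crel (ocar Q) (oact Q)"
 by (auto simp: coinv_rel_def crel_def fun_eq_iff)

lemma coinv_eq: "coinv Q = cinv (ocar Q) (oact Q)"
 by (simp add: coinv_def cinv_def coinv_rel_eq)

lemma coinv_prod_eq: "coinv_prod Q = cpr (ocar Q) (oact Q) (ocomp Q)"
 by (simp add: coinv_prod_def cpr_def coinv_rel_eq fun_eq_iff)

text \<open>A common frame for two uses: the operad as a module over itself gives the pre-Lie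
  identity of \<open>coinv Q\<close>, and the spaces P(n) \<otimes> V^n give the action on the free
  algebra. Both are the same computation \<open>module_law\<close>.\<close>

locale right_module =
 fixes M :: "nat => ('k::field, 'm::ab_group_add) vs" and mc :: "nat => nat => nat => 'm => 'q::ab_group_add => 'm"
  and ma :: "nat => (nat => nat) => 'm => 'm" and Q :: "('k, 'q::ab_group_add) operad"
 assumes vM: "!!n. vspace (M n)" and vQ: "!!n. vspace (ocar Q n)"
  and mc_bihom: "!!m n i. 1 \<le> i ==> i \<le> m ==> mc m n i \<in> bihom (M m) (ocar Q n) (M (m + n - 1))"
  and qc_bihom: "!!m n i. 1 \<le> i ==> i \<le> m ==> ocomp Q m n i \<in> bihom (ocar Q m) (ocar Q n) (ocar Q (m + n - 1))"
  and ma_hom: "!!n \<sigma>. \<sigma> permutes {1..n} ==> ma n \<sigma> \<in> hom (M n) (M n)"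
  and qa_hom: "!!n \<sigma>. \<sigma> permutes {1..n} ==> oact Q n \<sigma> \<in> hom (ocar Q n) (ocar Q n)"
  and ma_id: "!!n x. x \<in> car (M n) ==> ma n id x = x"
  and qa_id: "!!n q. q \<in> car (ocar Q n) ==> oact Q n id q = q"
  and seq: "!!l m n i j x q r. x \<in> car (M l) ==> q \<in> car (ocar Q m) ==> r \<in> car (ocar Q n) ==>
   1 \<le> i ==> i \<le> l ==> 1 \<le> j ==> j \<le> m ==>
   mc (l + m - 1) n (i - 1 + j) (mc l m i x q) r = mc l (m + n - 1) i x (ocomp Q m n j q r)"
  and par: "!!l m n i j x q r. x \<in> car (M l) ==> q \<in> car (ocar Q m) ==> r \<in> car (ocar Q n) ==>
   1 \<le> i ==> i < j ==> j \<le> l ==>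
   mc (l + m - 1) n (j + m - 1) (mc l m i x q) r = mc (l + n - 1) m i (mc l n j x r) q"
  and equiv: "!!m n i \<sigma> \<tau> x q. x \<in> car (M m) ==> q \<in> car (ocar Q n) ==> 1 \<le> i ==> i \<le> m ==>
   \<sigma> permutes {1..m} ==> \<tau> permutes {1..n} ==>
   mc m n i (ma m \<sigma> x) (oact Q n \<tau> q) = ma (m + n - 1) (pcomp m n i \<sigma> \<tau>) (mc m n (\<sigma> i) x q)"
begin

abbreviation "R \<equiv> crel M ma"
abbreviation "X \<equiv> cinv M ma"
abbreviation "cl \<equiv> ccl M ma"
abbreviation "W \<equiv> coinv Q"
abbreviation "clQ \<equiv> ccl (ocar Q) (oact Q)"
abbreviation "pr n \<equiv> qproj (M n) (R n)"
abbreviation "bm \<equiv> cpr M ma mc"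

definition "SM m n x q = (\<Sum>i=1..m. mc m n i x q)"

lemma R_car: "R n \<subseteq> car (M n)"
 using hom_car[OF ma_hom] car_diff[OF vM] by (auto simp: crel_def)

lemma RQ_car: "crel (ocar Q) (oact Q) n \<subseteq> car (ocar Q n)"
 using hom_car[OF qa_hom] car_diff[OF vQ] by (auto simp: crel_def)

lemma vX: "vspace X"
 by (simp add: cinv_def vspace_dsum vspace_quot vM)

lemma vW: "vspace W"
 by (simp add: coinv_eq cinv_def vspace_dsum vspace_quot vQ)

lemma cl_hom: "cl n \<in> hom (M n) X"
 unfolding ccl_def[abs_def] cinv_def
 by (rule hom_comp[OF single_dsum[of "%n. quot (M n) (R n)"] qproj_hom]) (simp_all add: vspace_quot vM)

lemma clQ_hom: "clQ n \<in> hom (ocar Q n) W"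
 unfolding ccl_def[abs_def] coinv_eq cinv_def
 by (rule hom_comp[OF single_dsum[of "%n. quot (ocar Q n) (crel (ocar Q) (oact Q) n)"] qproj_hom])
  (simp_all add: vspace_quot vQ)

lemma X_eqI:
 assumes "f \<in> hom X C" "g \<in> hom X C" "!!n x. x \<in> car (M n) ==> f (cl n x) = g (cl n x)" "v \<in> car X"
 shows "f v = g v"
proof (rule dsum_hom_eqI[OF _ assms(1,2)[unfolded cinv_def] _ assms(4)[unfolded cinv_def]])
 show "vspace (quot (M n) (R n))" for n by (simp add: vspace_quot vM)
 fix n x assume x: "x \<in> car (quot (M n) (R n))"
 show "f (psingle n x) = g (psingle n x)"
  using assms(3)[OF quot_car_sub[OF vM R_car x]] qproj_quot[OF vM x] by (simp add: ccl_def)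
qed

lemma W_eqI:
 assumes "f \<in> hom W C" "g \<in> hom W C" "!!n x. x \<in> car (ocar Q n) ==> f (clQ n x) = g (clQ n x)" "v \<in> car W"
 shows "f v = g v"
proof (rule dsum_hom_eqI[OF _ assms(1,2)[unfolded coinv_eq cinv_def] _ assms(4)[unfolded coinv_eq cinv_def]])
 show "vspace (quot (ocar Q n) (crel (ocar Q) (oact Q) n))" for n by (simp add: vspace_quot vQ)
 fix n x assume x: "x \<in> car (quot (ocar Q n) (crel (ocar Q) (oact Q) n))"
 show "f (psingle n x) = g (psingle n x)"
  using assms(3)[OF quot_car_sub[OF vQ RQ_car x]] qproj_quot[OF vQ x] by (simp add: ccl_def)
qed

lemma SM_bihom: "SM m n \<in> bihom (M m) (ocar Q n) (M (m + n - 1))"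
 unfolding SM_def[abs_def]
 by (intro bihomI hom_Sum vM bihom_left[OF mc_bihom] bihom_right[OF mc_bihom]) auto

lemma pr_ma: "x \<in> car (M n) ==> \<sigma> permutes {1..n} ==> pr n (ma n \<sigma> x) = pr n x"
 by (rule qproj_eqI[OF vM], rule module.span_base[OF vspace_module[OF vM]]) (auto simp: crel_def)

text \<open>A single partial composition is not defined on coinvariants: permuting the inputs moves
  the place of grafting. The sum over all places absorbs this by reindexing along
  \<open>\<sigma>\<close>.\<close>

lemma SM_left_rel:
 assumes y: "y \<in> car (ocar Q n)" and z: "z \<in> car (M m)" and s: "\<sigma> permutes {1..m}"
 shows "pr (m + n - 1) (SM m n (ma m \<sigma> z) y) = pr (m + n - 1) (SM m n z y)"
proof -
 let ?N = "m + n - 1"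
 have si: "1 \<le> \<sigma> i \<and> \<sigma> i \<le> m" if "i \<in> {1..m}" for i
  using permutes_in_image[OF s, of i] that by auto
 have mcc: "mc m n i z y \<in> car (M ?N)" if "i \<in> {1..m}" for i
  using that by (intro bihom_car[OF mc_bihom] y z) auto
 have "pr ?N (SM m n (ma m \<sigma> z) y) = (\<Sum>i=1..m. pr ?N (mc m n i (ma m \<sigma> z) y))"
  unfolding SM_def by (rule qproj_sum[OF vM])
 also have "\<dots> = (\<Sum>i=1..m. pr ?N (mc m n (\<sigma> i) z y))"
 proof (rule sum.cong[OF refl])
  fix i assume i: "i \<in> {1..m}"
  have "mc m n i (ma m \<sigma> z) y = ma ?N (pcomp m n i \<sigma> id) (mc m n (\<sigma> i) z y)"
   using equiv[OF z y _ _ s permutes_id, of i] i by (simp add: qa_id y)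
  then show "pr ?N (mc m n i (ma m \<sigma> z) y) = pr ?N (mc m n (\<sigma> i) z y)"
   using pr_ma[OF mcc pcomp_permutes[OF _ _ s permutes_id]] si[OF i] i by auto
 qed
 also have "\<dots> = (\<Sum>i=1..m. pr ?N (mc m n i z y))"
  by (rule sum.reindex_bij_betw[OF permutes_imp_bij[OF s]])
 also have "\<dots> = pr ?N (SM m n z y)"
  unfolding SM_def by (rule qproj_sum[OF vM, symmetric])
 finally show ?thesis .
qed

lemma SM_right_rel:
 assumes y: "y \<in> car (ocar Q n)" and z: "z \<in> car (M m)" and s: "\<sigma> permutes {1..n}"
 shows "pr (m + n - 1) (SM m n z (oact Q n \<sigma> y)) = pr (m + n - 1) (SM m n z y)"
proof -
 let ?N = "m + n - 1"
 have "pr ?N (mc m n i z (oact Q n \<sigma> y)) = pr ?N (mc m n i z y)" if i: "i \<in> {1..m}" for i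
 proof -
  have "mc m n i z (oact Q n \<sigma> y) = ma ?N (pcomp m n i id \<sigma>) (mc m n i z y)"
   using equiv[OF z y _ _ permutes_id s, of i] i by (simp add: ma_id z)
  then show ?thesis
   using pr_ma[OF bihom_car[OF mc_bihom z y] pcomp_permutes[OF _ _ permutes_id s]] i by auto
 qed
 then show ?thesis unfolding SM_def qproj_sum[OF vM] by (rule sum.cong[OF refl])
qed

lemma pr_SM_left: "x \<in> car (M m) ==> y \<in> car (ocar Q n) ==> pr (m + n - 1) (SM m n (pr m x) y) = pr (m + n - 1) (SM m n x y)"
proof (rule quot_lift[OF hom_comp[OF qproj_hom[OF vM] bihom_left[OF SM_bihom]] vM vspace_quot[OF vM] R_car])
 fix r assume y: "y \<in> car (ocar Q n)" and r: "r \<in> R m"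
 then obtain z \<sigma> where z: "r = ma m \<sigma> z - z" "z \<in> car (M m)" "\<sigma> permutes {1..m}" by (auto simp: crel_def)
 have "SM m n r y = SM m n (ma m \<sigma> z) y - SM m n z y"
  unfolding z(1) by (rule hom_diff[OF bihom_left[OF SM_bihom y] vM]) (use z hom_car[OF ma_hom] in auto)
 then show "pr (m + n - 1) (SM m n r y) = 0"
  using SM_left_rel[OF y z(2,3)] by (simp add: qproj_diff vM)
qed

lemma pr_SM_right:
 "x \<in> car (M m) ==> y \<in> car (ocar Q n) ==>
  pr (m + n - 1) (SM m n x (qproj (ocar Q n) (crel (ocar Q) (oact Q) n) y)) = pr (m + n - 1) (SM m n x y)"
proof (rule quot_lift[OF hom_comp[OF qproj_hom[OF vM] bihom_right[OF SM_bihom]] vQ vspace_quot[OF vM] RQ_car])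
 fix r assume x: "x \<in> car (M m)" and r: "r \<in> crel (ocar Q) (oact Q) n"
 then obtain z \<sigma> where z: "r = oact Q n \<sigma> z - z" "z \<in> car (ocar Q n)" "\<sigma> permutes {1..n}" by (auto simp: crel_def)
 have "SM m n x r = SM m n x (oact Q n \<sigma> z) - SM m n x z"
  unfolding z(1) by (rule hom_diff[OF bihom_right[OF SM_bihom x] vQ]) (use z hom_car[OF qa_hom] in auto)
 then show "pr (m + n - 1) (SM m n x r) = 0"
  using SM_right_rel[OF z(2) x z(3)] by (simp add: qproj_diff vM)
qed

lemma X_lookup: "v \<in> car X ==> plookup v n \<in> car (M n)"
 unfolding cinv_def dsum_def using quot_car_sub[OF vM R_car] by auto

lemma W_lookup: "v \<in> car W ==> plookup v n \<in> car (ocar Q n)"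
 unfolding coinv_eq cinv_def dsum_def using quot_car_sub[OF vQ RQ_car] by auto

text \<open>Components outside the keys contribute the class of 0, so the sums may run over any
  larger finite sets; on common index sets bilinearity becomes visible.\<close>

lemma bm_superset:
 assumes v: "v \<in> car X" and w: "w \<in> car W" and A: "finite A" "pkeys v \<subseteq> A"
  and B: "finite B" "pkeys w \<subseteq> B"
 shows "bm v w = (\<Sum>m\<in>A. \<Sum>n\<in>B. cl (m + n - 1) (SM m n (plookup v m) (plookup w n)))"
proof -
 have z: "cl (m + n - 1) 0 = 0" for m n by (simp add: ccl_def qproj_0 vM)
 have z1: "SM m n 0 (plookup w n) = 0" for m n
  by (rule bihom_0_left[OF SM_bihom vM W_lookup[OF w]])
 have z2: "SM m n (plookup v m) 0 = 0" for m n
  by (rule bihom_0_right[OF SM_bihom vQ X_lookup[OF v]])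
 have "bm v w = (\<Sum>m\<in>pkeys v. \<Sum>n\<in>pkeys w.
   cl (m + n - 1) (SM m n (plookup v m) (plookup w n)))"
  by (simp add: cpr_def ccl_def SM_def)
 also have "\<dots> = (\<Sum>m\<in>pkeys v. \<Sum>n\<in>B.
   cl (m + n - 1) (SM m n (plookup v m) (plookup w n)))"
  by (intro sum.cong refl sum.mono_neutral_left) (use B z z2 in "auto simp: in_keys_iff")
 also have "\<dots> = (\<Sum>m\<in>A. \<Sum>n\<in>B. cl (m + n - 1) (SM m n (plookup v m) (plookup w n)))"
  by (intro sum.mono_neutral_left) (use A z z1 in "auto simp: in_keys_iff")
 finally show ?thesis .
qed

lemma bm_bihom: "bm \<in> bihom X W X"
proof (rule bihomI)
 let ?f = "%v w m n. cl (m + n - 1) (SM m n (plookup v m) (plookup w n))"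
 have lX: "(%v. plookup v m) \<in> hom X (M m)" for m
  using lookup_dsum[of "%n. quot (M n) (R n)" m] by (auto simp: hom_def cinv_def[symmetric] vspace_quot vM X_lookup)
 have lW: "(%v. plookup v m) \<in> hom W (ocar Q m)" for m
  using lookup_dsum[of "%n. quot (ocar Q n) (crel (ocar Q) (oact Q) n)" m]
  by (auto simp: hom_def cinv_def[symmetric] coinv_eq[symmetric] vspace_quot vQ W_lookup)
 have h1: "(%v. ?f v w m n) \<in> hom X X" if "w \<in> car W" for w m n
  by (rule hom_comp[OF cl_hom hom_comp[OF bihom_left[OF SM_bihom W_lookup[OF that]] lX]])
 have h2: "(%w. ?f v w m n) \<in> hom W X" if "v \<in> car X" for v m n
  by (rule hom_comp[OF cl_hom hom_comp[OF bihom_right[OF SM_bihom X_lookup[OF that]] lW]])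
 show "(%v. bm v w) \<in> hom X X" if w: "w \<in> car W" for w
 proof (rule homI)
  fix v v' assume v: "v \<in> car X" "v' \<in> car X"
  let ?A = "pkeys v \<union> pkeys v'" and ?B = "pkeys w"
  show "bm (v + v') w = bm v w + bm v' w"
   using bm_superset[OF v(1) w, of ?A ?B] bm_superset[OF v(2) w, of ?A ?B]
    bm_superset[OF car_add[OF vX v] w, of ?A ?B] keys_add[of v v'] hom_add[OF h1[OF w] v]
   by (simp add: sum.distrib)
 next
  fix c v assume v: "v \<in> car X"
  have k: "pkeys (scl X c v) \<subseteq> pkeys v"
   by (auto simp: in_keys_iff cinv_def lookup_scl_dsum[of "%n. quot (M n) (R n)"] vspace_quot vM scl_0[OF vM])
  show "bm (scl X c v) w = scl X c (bm v w)"
   using bm_superset[OF v w, of "pkeys v" "pkeys w"]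
    bm_superset[OF car_scl[OF vX v] w _ k, of "pkeys w"] hom_scl[OF h1[OF w] v]
   by (simp add: scl_sum[OF vX])
 next
  fix v assume v: "v \<in> car X"
  show "bm v w \<in> car X"
   using bm_superset[OF v w, of "pkeys v" "pkeys w"] hom_car[OF h1[OF w] v]
   by (auto intro!: car_sum[OF vX])
 qed
 show "bm v \<in> hom W X" if v: "v \<in> car X" for v
 proof (rule homI)
  fix w w' assume w: "w \<in> car W" "w' \<in> car W"
  let ?A = "pkeys w \<union> pkeys w'" and ?B = "pkeys v"
  show "bm v (w + w') = bm v w + bm v w'"
   using bm_superset[OF v w(1), of ?B ?A] bm_superset[OF v w(2), of ?B ?A]
    bm_superset[OF v car_add[OF vW w], of ?B ?A] keys_add[of w w'] hom_add[OF h2[OF v] w]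
   by (simp add: sum.distrib)
 next
  fix c w assume w: "w \<in> car W"
  have k: "pkeys (scl W c w) \<subseteq> pkeys w"
   by (auto simp: in_keys_iff coinv_eq cinv_def lookup_scl_dsum[of "%n. quot (ocar Q n) (crel (ocar Q) (oact Q) n)"]
     vspace_quot vQ scl_0[OF vQ])
  show "bm v (scl W c w) = scl X c (bm v w)"
   using bm_superset[OF v w, of "pkeys v" "pkeys w"]
    bm_superset[OF v car_scl[OF vW w] _ _ _ k, of "pkeys v"] hom_scl[OF h2[OF v] w]
   by (simp add: scl_sum[OF vX])
 next
  fix w assume w: "w \<in> car W"
  show "bm v w \<in> car X"
   using bm_superset[OF v w, of "pkeys v" "pkeys w"] hom_car[OF h1[OF w] v]
   by (auto intro!: car_sum[OF vX])
 qed
qed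

lemma bm_cl:
 assumes x: "x \<in> car (M m)" and y: "y \<in> car (ocar Q n)"
 shows "bm (cl m x) (clQ n y) = cl (m + n - 1) (SM m n x y)"
proof -
 have "bm (cl m x) (clQ n y) = cl (m + n - 1) (SM m n (pr m x) (qproj (ocar Q n) (crel (ocar Q) (oact Q) n) y))"
  using bm_superset[OF hom_car[OF cl_hom x] hom_car[OF clQ_hom y], of "{m}" "{n}"] by (simp add: ccl_def)
 also have "\<dots> = cl (m + n - 1) (SM m n x y)"
  unfolding ccl_def pr_SM_right[OF qproj_car[OF vM R_car x] y] pr_SM_left[OF x y] ..
 finally show ?thesis .
qed

text \<open>The terms in which \<open>y\<close> and \<open>z\<close> are grafted at two different
  inputs of \<open>x\<close>, \<open>y\<close> to the left of \<open>z\<close>.\<close>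

definition "PM l m n x y z = (\<Sum>i=1..l. \<Sum>j=Suc i..l. mc (l + m - 1) n (j + m - 1) (mc l m i x y) z)"

text \<open>\<open>z\<close> is grafted either onto an input of \<open>y\<close>, which gives the
  nested sum, or onto another input of \<open>x\<close>. The latter terms are symmetric in
  \<open>y\<close> and \<open>z\<close>, and this is the pre-Lie identity.\<close>

lemma SM_SM:
 assumes x: "x \<in> car (M l)" and y: "y \<in> car (ocar Q m)" and z: "z \<in> car (ocar Q n)"
 shows "SM (l + m - 1) n (SM l m x y) z =
  (\<Sum>i=1..l. \<Sum>j=1..m. mc l (m + n - 1) i x (ocomp Q m n j y z)) + (PM l m n x y z + PM l n m x z y)"
proof -
 have a: "mc (l + m - 1) n j (SM l m x y) z = (\<Sum>i=1..l. mc (l + m - 1) n j (mc l m i x y) z)"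
  if "j \<in> {1..l + m - 1}" for j
  unfolding SM_def
  by (rule hom_sum[OF bihom_left[OF mc_bihom z] vM]) (use that in "auto intro!: bihom_car[OF mc_bihom x y, simplified]")
 have "SM (l + m - 1) n (SM l m x y) z = (\<Sum>j=1..l + m - 1. \<Sum>i=1..l. mc (l + m - 1) n j (mc l m i x y) z)"
  unfolding SM_def[of "l + m - 1" n "SM l m x y" z] by (rule sum.cong[OF refl a])
 also have "\<dots> = (\<Sum>i=1..l. \<Sum>j=1..l + m - 1. mc (l + m - 1) n j (mc l m i x y) z)"
  by (rule sum.swap)
 also have "\<dots> = (\<Sum>i=1..l. (\<Sum>j=1..m. mc l (m + n - 1) i x (ocomp Q m n j y z)) +
   ((\<Sum>j=Suc i..l. mc (l + m - 1) n (j + m - 1) (mc l m i x y) z) +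
    (\<Sum>j=1..<i. mc (l + n - 1) m (i + n - 1) (mc l n j x z) y)))"
 proof (rule sum.cong[OF refl])
  fix i assume i: "i \<in> {1..l}"
  let ?f = "%j. mc (l + m - 1) n j (mc l m i x y) z"
  have "{1..l + m - 1} = {i..<i + m} \<union> ({i + m..l + m - 1} \<union> {1..<i})" using i by auto
  then have "sum ?f {1..l + m - 1} = sum ?f {i..<i + m} + (sum ?f {i + m..l + m - 1} + sum ?f {1..<i})"
   by (simp only:, subst sum.union_disjoint, simp_all, auto, subst sum.union_disjoint, simp_all, auto)
  also have "sum ?f {i..<i + m} = (\<Sum>j=1..m. ?f (i - 1 + j))"
   by (rule sum.reindex_bij_witness[of _ "%j. i - 1 + j" "%j. j + 1 - i"]) (use i in auto)
  also have "\<dots> = (\<Sum>j=1..m. mc l (m + n - 1) i x (ocomp Q m n j y z))"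
   by (rule sum.cong[OF refl], rule seq[OF x y z]) (use i in auto)
  also have "sum ?f {i + m..l + m - 1} = (\<Sum>j=Suc i..l. ?f (j + m - 1))"
   by (rule sum.reindex_bij_witness[of _ "%j. j + m - 1" "%j. j + 1 - m"]) (use i in auto)
  \<comment> \<open>If \<open>z\<close> lands to the left of \<open>y\<close>, the parallel axiom
    grafts \<open>z\<close> first; the input reserved for \<open>y\<close> then moves to place
    \<open>i + n - 1\<close>.\<close>
  also have "sum ?f {1..<i} = (\<Sum>j=1..<i. mc (l + n - 1) m (i + n - 1) (mc l n j x z) y)"
   by (rule sum.cong[OF refl], rule par[symmetric]) (use i x y z in auto)
  finally show "sum ?f {1..l + m - 1} = (\<Sum>j=1..m. mc l (m + n - 1) i x (ocomp Q m n j y z)) +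
   ((\<Sum>j=Suc i..l. mc (l + m - 1) n (j + m - 1) (mc l m i x y) z) +
    (\<Sum>j=1..<i. mc (l + n - 1) m (i + n - 1) (mc l n j x z) y))" .
 qed
 also have "\<dots> = (\<Sum>i=1..l. \<Sum>j=1..m. mc l (m + n - 1) i x (ocomp Q m n j y z)) +
   (PM l m n x y z + (\<Sum>i=1..l. \<Sum>j=1..<i. mc (l + n - 1) m (i + n - 1) (mc l n j x z) y))"
  by (simp add: sum.distrib PM_def)
 also have "(\<Sum>i=1..l. \<Sum>j=1..<i. mc (l + n - 1) m (i + n - 1) (mc l n j x z) y) = PM l n m x z y"
  unfolding PM_def
  by (subst (1 2) sum.Sigma, simp, simp, simp, simp,
    rule sum.reindex_bij_witness[of _ prod.swap prod.swap]) auto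
 finally show ?thesis .
qed

text \<open>By \<open>SM_SM\<close> each iterated action is a nested term plus a part symmetric in
  \<open>y\<close> and \<open>z\<close>. The added products on both sides are exactly the two nested
  terms.\<close>

lemma module_law:
 assumes Qm: "right_module (ocar Q) (ocomp Q) (oact Q) Q" and x: "x \<in> car (M l)" and y: "y \<in> car (ocar Q m)" and z: "z \<in> car (ocar Q n)"
 shows "bm (bm (cl l x) (clQ m y)) (clQ n z) + bm (cl l x) (coinv_prod Q (clQ n z) (clQ m y)) =
  bm (bm (cl l x) (clQ n z)) (clQ m y) + bm (cl l x) (coinv_prod Q (clQ m y) (clQ n z))"
proof -
 interpret Q: right_module "ocar Q" "ocomp Q" "oact Q" Q by (rule Qm)
 have e: "bm (bm (cl l x) (clQ m y)) (clQ n z) =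
   cl (l + (m + n - 1) - 1) (SM l (m + n - 1) x (Q.SM m n y z))
   + cl (l + m - 1 + n - 1) (PM l m n x y z + PM l n m x z y)"
  if y: "y \<in> car (ocar Q m)" and z: "z \<in> car (ocar Q n)" for m n y z
 proof -
  have c: "(\<Sum>i=1..l. \<Sum>j=1..m. mc l (m + n - 1) i x (ocomp Q m n j y z)) = SM l (m + n - 1) x (Q.SM m n y z)"
   unfolding SM_def Q.SM_def
   by (rule sum.cong[OF refl], rule hom_sum[OF bihom_right[OF mc_bihom x] vQ, symmetric])
    (auto intro!: bihom_car[OF qc_bihom y z, simplified])
  \<comment> \<open>Subtraction is truncated: the two arities agree for nonzero \<open>l\<close> and
    \<open>m\<close>, and in the other cases the elements in question vanish.\<close>
  have ar: "l + (m + n - 1) - 1 = l + m - 1 + n - 1" if "l \<noteq> 0" "m \<noteq> 0" using that by auto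
  have P: "PM l m n x y z \<in> car (M (l + m - 1 + n - 1))"
   if y: "y \<in> car (ocar Q m)" and z: "z \<in> car (ocar Q n)" for m n y z
   unfolding PM_def
   by (intro car_sum[OF vM] bihom_car[OF mc_bihom] bihom_car[OF mc_bihom] x y z) auto
  have ar2: "l + n - 1 + m - 1 = l + m - 1 + n - 1" if "l \<noteq> 0" using that by auto
  have PP: "PM l m n x y z + PM l n m x z y \<in> car (M (l + m - 1 + n - 1))"
  proof (cases "l = 0")
   case True
   then show ?thesis by (simp add: PM_def car_0 vM)
  next
   case False
   then have "PM l n m x z y \<in> car (M (l + m - 1 + n - 1))" using P[OF z y] ar2 by metis
   then show ?thesis by (rule car_add[OF vM P[OF y z]])
  qed
  have "bm (bm (cl l x) (clQ m y)) (clQ n z) = cl (l + m - 1 + n - 1) (SM (l + m - 1) n (SM l m x y) z)"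
   using bm_cl[OF x y] bm_cl[OF bihom_car[OF SM_bihom x y] z] by simp
  also have "\<dots> = cl (l + m - 1 + n - 1) (SM l (m + n - 1) x (Q.SM m n y z) + (PM l m n x y z + PM l n m x z y))"
   unfolding SM_SM[OF x y z] c ..
  also have "\<dots> = cl (l + m - 1 + n - 1) (SM l (m + n - 1) x (Q.SM m n y z)) + cl (l + m - 1 + n - 1) (PM l m n x y z + PM l n m x z y)"
   by (simp add: ccl_def qproj_add[OF vM] single_add)
  also have "cl (l + m - 1 + n - 1) (SM l (m + n - 1) x (Q.SM m n y z)) = cl (l + (m + n - 1) - 1) (SM l (m + n - 1) x (Q.SM m n y z))"
  proof (cases "l = 0 \<or> m = 0")
   case True
   then have "SM l (m + n - 1) x (Q.SM m n y z) = 0"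
    using bihom_0_right[OF SM_bihom vQ x] by (auto simp: SM_def Q.SM_def)
   then show ?thesis by (simp add: ccl_def qproj_0 vM)
  qed (metis ar)
  finally show ?thesis .
 qed
 have q: "bm (cl l x) (coinv_prod Q (clQ n z) (clQ m y)) = cl (l + (n + m - 1) - 1) (SM l (n + m - 1) x (Q.SM n m z y))"
  if y: "y \<in> car (ocar Q m)" and z: "z \<in> car (ocar Q n)" for m n y z
  using Q.bm_cl[OF z y] bm_cl[OF x bihom_car[OF Q.SM_bihom z y]] by (simp add: coinv_prod_eq)
 have s: "cl (l + m - 1 + n - 1) (PM l m n x y z + PM l n m x z y) = cl (l + n - 1 + m - 1) (PM l n m x z y + PM l m n x y z)"
 proof (cases "l = 0")
  case True
  then show ?thesis by (simp add: PM_def ccl_def qproj_0 vM)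
 next
  case False
  then have "l + m - 1 + n - 1 = l + n - 1 + m - 1" by auto
  then show ?thesis by (simp add: add.commute)
 qed
 show ?thesis unfolding e[OF y z] e[OF z y] q[OF y z] q[OF z y] s by (simp add: algebra_simps)
qed

lemma cinv_law:
 assumes Qm: "right_module (ocar Q) (ocomp Q) (oact Q) Q"
  and v: "v \<in> car X" and y: "y \<in> car W" and z: "z \<in> car W"
 shows "bm (bm v y) z + bm v (coinv_prod Q z y) = bm (bm v z) y + bm v (coinv_prod Q y z)"
proof -
 interpret Q: right_module "ocar Q" "ocomp Q" "oact Q" Q by (rule Qm)
 note cb = Q.bm_bihom[folded coinv_prod_eq coinv_eq]
 note bl = bihom_left[OF bm_bihom] and br = bihom_right[OF bm_bihom] and bc = bihom_car[OF bm_bihom]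
 note cq = hom_car[OF clQ_hom] and cx = hom_car[OF cl_hom]
 have 1: "bm (bm (cl l x) (clQ m y)) z + bm (cl l x) (coinv_prod Q z (clQ m y)) =
   bm (bm (cl l x) z) (clQ m y) + bm (cl l x) (coinv_prod Q (clQ m y) z)"
  if x: "x \<in> car (M l)" and y: "y \<in> car (ocar Q m)" for l x m y
  by (rule W_eqI[where C = X and f = "%z. bm (bm (cl l x) (clQ m y)) z + bm (cl l x) (coinv_prod Q z (clQ m y))",
     OF _ _ module_law[OF Qm x y] z])
   (intro hom_plus[OF vX] br bc cx cq x y hom_comp[OF br bihom_left[OF cb]] hom_comp[OF bl br] hom_comp[OF br bihom_right[OF cb]])+
 have 2: "bm (bm (cl l x) y) z + bm (cl l x) (coinv_prod Q z y) =
   bm (bm (cl l x) z) y + bm (cl l x) (coinv_prod Q y z)"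
  if x: "x \<in> car (M l)" for l x
  by (rule W_eqI[where C = X and f = "%y. bm (bm (cl l x) y) z + bm (cl l x) (coinv_prod Q z y)", OF _ _ 1[OF x] y])
   (intro hom_plus[OF vX] br bc cx x z hom_comp[OF br bihom_left[OF cb]] hom_comp[OF bl br] hom_comp[OF br bihom_right[OF cb]])+
 show ?thesis
  by (rule X_eqI[where C = X and f = "%v. bm (bm v y) z + bm v (coinv_prod Q z y)", OF _ _ 2 v])
   (intro hom_plus[OF vX] hom_comp[OF bl bl] bl bihom_car[OF cb] y z)+
qed

lemma cinv_prelie_module:
 assumes Qm: "right_module (ocar Q) (ocomp Q) (oact Q) Q"
 shows "prelie_module W X (coinv_prod Q) bm"
proof -
 interpret Q: right_module "ocar Q" "ocomp Q" "oact Q" Q by (rule Qm)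
 show ?thesis
  by unfold_locales
   (use vX vW bm_bihom Q.bm_bihom[folded coinv_prod_eq coinv_eq] cinv_law[OF Qm]
    Q.cinv_law[OF Qm, folded coinv_prod_eq coinv_eq] in auto)
qed

end

subsection \<open>Tensor products of right modules\<close>

definition tmap2 :: "('k::field, 'c::ab_group_add) vs => ('k, 'd::ab_group_add) vs =>
  ('a1 => 'b1 => 'c) => ('a2 => 'b2 => 'd) => (('a1 \<times> 'a2) \<Rightarrow>\<^sub>0 'k) => (('b1 \<times> 'b2) \<Rightarrow>\<^sub>0 'k) => (('c \<times> 'd) \<Rightarrow>\<^sub>0 'k)" where
 "tmap2 C1 C2 \<phi> \<psi> a b = lext psc (%(p, f). lext psc (%(q, g). pure C1 C2 (\<phi> p q) (\<psi> f g)) b) a"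

lemma
 assumes v: "vspace A1" "vspace A2" "vspace B1" "vspace B2" "vspace C1" "vspace C2"
  and \<phi>: "\<phi> \<in> bihom A1 B1 C1" and \<psi>: "\<psi> \<in> bihom A2 B2 C2"
 shows tmap2_bihom: "tmap2 C1 C2 \<phi> \<psi> \<in> bihom (tens A1 A2) (tens B1 B2) (tens C1 C2)"
  and tmap2_pure: "p \<in> car A1 ==> f \<in> car A2 ==> q \<in> car B1 ==> g \<in> car B2 ==>
   tmap2 C1 C2 \<phi> \<psi> (pure A1 A2 p f) (pure B1 B2 q g) = pure C1 C2 (\<phi> p q) (\<psi> f g)"
proof -
 let ?C = "tens C1 C2" and ?B = "tens B1 B2" and ?A = "tens A1 A2"
 note pb = pure_bihom[OF v(5,6)]
 let ?\<chi> = "%b p f. cosum ?C (%q g. pure C1 C2 (\<phi> p q) (\<psi> f g)) b"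
 have i: "(%q g. pure C1 C2 (\<phi> p q) (\<psi> f g)) \<in> bihom B1 B2 ?C" if "p \<in> car A1" "f \<in> car A2" for p f
  by (intro bihomI hom_comp[OF bihom_left[OF pb] bihom_right[OF \<phi>]] hom_comp[OF bihom_right[OF pb] bihom_right[OF \<psi>]]
    bihom_car[OF \<phi>] bihom_car[OF \<psi>] that)
 have o: "?\<chi> b \<in> bihom A1 A2 ?C" if b: "b \<in> car ?B" for b
 proof (rule bihomI)
  show "?\<chi> b p \<in> hom A2 ?C" if "p \<in> car A1" for p
   by (rule hom_Lext[OF vspace_tens])
    (use tens_keys[OF v(3,4) b] that in \<open>auto intro!: hom_comp[OF bihom_right[OF pb] bihom_left[OF \<psi>]] bihom_car[OF \<phi>]\<close>)
  show "(%p. ?\<chi> b p f) \<in> hom A1 ?C" if "f \<in> car A2" for f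
   by (rule hom_Lext[OF vspace_tens])
    (use tens_keys[OF v(3,4) b] that in \<open>auto intro!: hom_comp[OF bihom_left[OF pb] bihom_left[OF \<phi>]] bihom_car[OF \<psi>]\<close>)
 qed
 have e: "tmap2 C1 C2 \<phi> \<psi> a b = cosum ?C (?\<chi> b) a" for a b by (simp add: tmap2_def)
 show "tmap2 C1 C2 \<phi> \<psi> \<in> bihom ?A ?B ?C"
  unfolding e[abs_def]
 proof (rule bihomI)
  show "(%a. cosum ?C (?\<chi> b) a) \<in> hom ?A ?C" if "b \<in> car ?B" for b
   by (rule lext_tens_hom[OF v(1,2) vspace_tens o[OF that]])
  show "(%b. cosum ?C (?\<chi> b) a) \<in> hom ?B ?C" if a: "a \<in> car ?A" for a
   by (rule hom_Lext[OF vspace_tens])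
    (use tens_keys[OF v(1,2) a] lext_tens_hom[OF v(3,4) vspace_tens i] in auto)
 qed
 show "tmap2 C1 C2 \<phi> \<psi> (pure A1 A2 p f) (pure B1 B2 q g) = pure C1 C2 (\<phi> p q) (\<psi> f g)"
  if "p \<in> car A1" "f \<in> car A2" "q \<in> car B1" "g \<in> car B2"
  unfolding e lext_pure[OF v(1,2) vspace_tens o[OF pure_car[OF v(3,4) that(3,4)]] that(1,2)]
  by (rule lext_pure[OF v(3,4) vspace_tens i[OF that(1,2)] that(3,4)])
qed

definition tmap :: "('k::field, 'c::ab_group_add) vs => ('k, 'd::ab_group_add) vs =>
  ('a => 'c) => ('b => 'd) => (('a \<times> 'b) \<Rightarrow>\<^sub>0 'k) => (('c \<times> 'd) \<Rightarrow>\<^sub>0 'k)" where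
 "tmap C D f g = lext psc (%(a, b). pure C D (f a) (g b))"

lemma
 assumes v: "vspace A" "vspace B" "vspace C" "vspace D" and f: "f \<in> hom A C" and g: "g \<in> hom B D"
 shows tmap_hom: "tmap C D f g \<in> hom (tens A B) (tens C D)"
  and tmap_pure: "a \<in> car A ==> b \<in> car B ==> tmap C D f g (pure A B a b) = pure C D (f a) (g b)"
proof -
 note pb = pure_bihom[OF v(3,4)]
 have b: "(%a b. pure C D (f a) (g b)) \<in> bihom A B (tens C D)"
  by (intro bihomI hom_comp[OF bihom_left[OF pb] f] hom_comp[OF bihom_right[OF pb] g] hom_car[OF f] hom_car[OF g])
 show "tmap C D f g \<in> hom (tens A B) (tens C D)"
  using lext_tens_hom[OF v(1,2) vspace_tens b] by (simp add: tmap_def)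
 show "tmap C D f g (pure A B a b) = pure C D (f a) (g b)" if "a \<in> car A" "b \<in> car B"
  using lext_pure[OF v(1,2) vspace_tens b that] by (simp add: tmap_def)
qed

lemma operad_tens_simps:
 "ocar (operad_tens P Q) = (%n. tens (ocar P n) (ocar Q n))"
 "ocomp (operad_tens P Q) = (%m n i. tmap2 (ocar P (m + n - 1)) (ocar Q (m + n - 1)) (ocomp P m n i) (ocomp Q m n i))"
 "oact (operad_tens P Q) = (%n \<sigma>. tmap (ocar P n) (ocar Q n) (oact P n \<sigma>) (oact Q n \<sigma>))"
 by (simp_all add: operad_tens_def Let_def tmap2_def[abs_def] tmap_def[abs_def])

lemma tens_eqI2:
 assumes v: "vspace A" "vspace B" "vspace A'" "vspace B'"
  and "F \<in> bihom (tens A B) (tens A' B') D" "G \<in> bihom (tens A B) (tens A' B') D"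
  and "!!a b a' b'. a \<in> car A ==> b \<in> car B ==> a' \<in> car A' ==> b' \<in> car B' ==>
   F (pure A B a b) (pure A' B' a' b') = G (pure A B a b) (pure A' B' a' b')"
  and s: "s \<in> car (tens A B)" and t: "t \<in> car (tens A' B')"
 shows "F s t = G s t"
proof (rule tens_hom_eqI[OF v(1,2) bihom_left[OF assms(5) t] bihom_left[OF assms(6) t] _ s])
 fix a b assume ab: "a \<in> car A" "b \<in> car B"
 show "F (pure A B a b) t = G (pure A B a b) t"
  by (rule tens_hom_eqI[OF v(3,4) bihom_right[OF assms(5)] bihom_right[OF assms(6)] _ t])
   (use ab assms(7) pure_car[OF v(1,2)] in auto)
qed

text \<open>Every law is an equality of maps multilinear in tensors, so it is checked on pure
  tensors, where it splits into the laws of the two factors.\<close>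

lemma tens_right_module:
 assumes A: "right_module M1 c1 a1 P" and B: "right_module M2 c2 a2 Q"
 shows "right_module (%n. tens (M1 n) (M2 n))
  (%m n i. tmap2 (M1 (m + n - 1)) (M2 (m + n - 1)) (c1 m n i) (c2 m n i))
  (%n \<sigma>. tmap (M1 n) (M2 n) (a1 n \<sigma>) (a2 n \<sigma>)) (operad_tens P Q)"
proof -
 interpret A: right_module M1 c1 a1 P by fact
 interpret B: right_module M2 c2 a2 Q by fact
 let ?M = "%n. tens (M1 n) (M2 n)" and ?Q = "%n. tens (ocar P n) (ocar Q n)"
 let ?c = "%m n i. tmap2 (M1 (m + n - 1)) (M2 (m + n - 1)) (c1 m n i) (c2 m n i)"
 let ?d = "%m n i. tmap2 (ocar P (m + n - 1)) (ocar Q (m + n - 1)) (ocomp P m n i) (ocomp Q m n i)"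
 let ?a = "%n \<sigma>. tmap (M1 n) (M2 n) (a1 n \<sigma>) (a2 n \<sigma>)"
 let ?b = "%n \<sigma>. tmap (ocar P n) (ocar Q n) (oact P n \<sigma>) (oact Q n \<sigma>)"
 note vM = A.vM B.vM and vQ = A.vQ B.vQ
 have c: "?c m n i \<in> bihom (?M m) (?Q n) (?M (m + n - 1))" if "1 \<le> i" "i \<le> m" for m n i
  by (rule tmap2_bihom[OF vM vQ vM A.mc_bihom[OF that] B.mc_bihom[OF that]])
 have d: "?d m n i \<in> bihom (?Q m) (?Q n) (?Q (m + n - 1))" if "1 \<le> i" "i \<le> m" for m n i
  by (rule tmap2_bihom[OF vQ vQ vQ A.qc_bihom[OF that] B.qc_bihom[OF that]])
 have a: "?a n \<sigma> \<in> hom (?M n) (?M n)" if "\<sigma> permutes {1..n}" for n \<sigma>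
  by (rule tmap_hom[OF vM vM A.ma_hom[OF that] B.ma_hom[OF that]])
 have b: "?b n \<sigma> \<in> hom (?Q n) (?Q n)" if "\<sigma> permutes {1..n}" for n \<sigma>
  by (rule tmap_hom[OF vQ vQ A.qa_hom[OF that] B.qa_hom[OF that]])
 have cp: "?c m n i (pure (M1 m) (M2 m) p f) (pure (ocar P n) (ocar Q n) q g) =
   pure (M1 (m + n - 1)) (M2 (m + n - 1)) (c1 m n i p q) (c2 m n i f g)"
  if "1 \<le> i" "i \<le> m" "p \<in> car (M1 m)" "f \<in> car (M2 m)" "q \<in> car (ocar P n)" "g \<in> car (ocar Q n)" for m n i p f q g
  by (rule tmap2_pure[OF vM vQ vM A.mc_bihom[OF that(1,2)] B.mc_bihom[OF that(1,2)] that(3-)])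
 have dp: "?d m n i (pure (ocar P m) (ocar Q m) p f) (pure (ocar P n) (ocar Q n) q g) =
   pure (ocar P (m + n - 1)) (ocar Q (m + n - 1)) (ocomp P m n i p q) (ocomp Q m n i f g)"
  if "1 \<le> i" "i \<le> m" "p \<in> car (ocar P m)" "f \<in> car (ocar Q m)" "q \<in> car (ocar P n)" "g \<in> car (ocar Q n)" for m n i p f q g
  by (rule tmap2_pure[OF vQ vQ vQ A.qc_bihom[OF that(1,2)] B.qc_bihom[OF that(1,2)] that(3-)])
 have ap: "?a n \<sigma> (pure (M1 n) (M2 n) p f) = pure (M1 n) (M2 n) (a1 n \<sigma> p) (a2 n \<sigma> f)"
  if "\<sigma> permutes {1..n}" "p \<in> car (M1 n)" "f \<in> car (M2 n)" for n \<sigma> p f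
  by (rule tmap_pure[OF vM vM A.ma_hom[OF that(1)] B.ma_hom[OF that(1)] that(2-)])
 have bp: "?b n \<sigma> (pure (ocar P n) (ocar Q n) p f) = pure (ocar P n) (ocar Q n) (oact P n \<sigma> p) (oact Q n \<sigma> f)"
  if "\<sigma> permutes {1..n}" "p \<in> car (ocar P n)" "f \<in> car (ocar Q n)" for n \<sigma> p f
  by (rule tmap_pure[OF vQ vQ A.qa_hom[OF that(1)] B.qa_hom[OF that(1)] that(2-)])
 note pc = pure_car[OF vM] and qc = pure_car[OF vQ]
 note A1 = bihom_car[OF A.mc_bihom] bihom_car[OF A.qc_bihom] and B1 = bihom_car[OF B.mc_bihom] bihom_car[OF B.qc_bihom]
 show ?thesis
  unfolding right_module_def operad_tens_simps
 proof (intro conjI allI impI)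
  fix n and x assume x: "x \<in> car (?M n)"
  show "?a n id x = x"
   by (rule tens_hom_eqI[OF vM a[OF permutes_id] hom_id _ x]) (simp add: ap[OF permutes_id] A.ma_id B.ma_id)
 next
  fix n and x assume x: "x \<in> car (?Q n)"
  show "?b n id x = x"
   by (rule tens_hom_eqI[OF vQ b[OF permutes_id] hom_id _ x]) (simp add: bp[OF permutes_id] A.qa_id B.qa_id)
 next
  fix l m n i j :: nat and x q r
  assume x: "x \<in> car (?M l)" and q: "q \<in> car (?Q m)" and r: "r \<in> car (?Q n)"
   and i: "1 \<le> i" "i \<le> l" and j: "1 \<le> j" "j \<le> m"
  have k: "1 \<le> i - 1 + j" "i - 1 + j \<le> l + m - 1" using i j by auto
  have ar: "l + m - 1 + n - 1 = l + (m + n - 1) - 1" using i j by auto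
  note ck = c[OF k, of n] and ci = c[OF i, of m] and ci' = c[OF i, of "m + n - 1"] and dj = d[OF j, of n]
  have 1: "?c (l + m - 1) n (i - 1 + j) (?c l m i (pure (M1 l) (M2 l) p f) q) (pure (ocar P n) (ocar Q n) p'' f'')
   = ?c l (m + n - 1) i (pure (M1 l) (M2 l) p f) (?d m n j q (pure (ocar P n) (ocar Q n) p'' f''))"
   if "p \<in> car (M1 l)" "f \<in> car (M2 l)" "p'' \<in> car (ocar P n)" "f'' \<in> car (ocar Q n)" for p f p'' f''
  proof (rule tens_hom_eqI[OF vQ _ _ _ q])
   show "(%q. ?c (l + m - 1) n (i - 1 + j) (?c l m i (pure (M1 l) (M2 l) p f) q) (pure (ocar P n) (ocar Q n) p'' f''))
     \<in> hom (?Q m) (?M (l + m - 1 + n - 1))"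
    by (intro hom_comp[OF bihom_left[OF ck] bihom_right[OF ci]] pc qc that)
   show "(%q. ?c l (m + n - 1) i (pure (M1 l) (M2 l) p f) (?d m n j q (pure (ocar P n) (ocar Q n) p'' f'')))
     \<in> hom (?Q m) (?M (l + m - 1 + n - 1))"
    unfolding ar by (intro hom_comp[OF bihom_right[OF ci'] bihom_left[OF dj]] pc qc that)
   fix p' f' assume q': "p' \<in> car (ocar P m)" "f' \<in> car (ocar Q m)"
   show "?c (l + m - 1) n (i - 1 + j) (?c l m i (pure (M1 l) (M2 l) p f) (pure (ocar P m) (ocar Q m) p' f')) (pure (ocar P n) (ocar Q n) p'' f'')
   = ?c l (m + n - 1) i (pure (M1 l) (M2 l) p f) (?d m n j (pure (ocar P m) (ocar Q m) p' f') (pure (ocar P n) (ocar Q n) p'' f''))"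
    unfolding cp[OF i that(1,2) q'] dp[OF j q' that(3,4)]
     cp[OF k A1(1)[OF i that(1) q'(1)] B1(1)[OF i that(2) q'(2)] that(3,4)]
     cp[OF i that(1,2) A1(2)[OF j q'(1) that(3)] B1(2)[OF j q'(2) that(4)]]
     A.seq[OF that(1) q'(1) that(3) i j] B.seq[OF that(2) q'(2) that(4) i j] unfolding ar ..
  qed
  show "?c (l + m - 1) n (i - 1 + j) (?c l m i x q) r = ?c l (m + n - 1) i x (?d m n j q r)"
  proof (rule tens_eqI2[OF vM vQ, where D = "?M (l + m - 1 + n - 1)" and F = "%x r. ?c (l + m - 1) n (i - 1 + j) (?c l m i x q) r"
      and G = "%x r. ?c l (m + n - 1) i x (?d m n j q r)", OF _ _ 1 x r])
   show "(%x r. ?c (l + m - 1) n (i - 1 + j) (?c l m i x q) r) \<in> bihom (?M l) (?Q n) (?M (l + m - 1 + n - 1))"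
    by (intro bihomI hom_comp[OF bihom_left[OF ck] bihom_left[OF ci]] bihom_right[OF ck] bihom_car[OF ci] q)
   show "(%x r. ?c l (m + n - 1) i x (?d m n j q r)) \<in> bihom (?M l) (?Q n) (?M (l + m - 1 + n - 1))"
    unfolding ar
    by (intro bihomI bihom_left[OF ci'] hom_comp[OF bihom_right[OF ci'] bihom_right[OF dj]] bihom_car[OF dj] q)
  qed
 next
  fix l m n i j :: nat and x q r
  assume x: "x \<in> car (?M l)" and q: "q \<in> car (?Q m)" and r: "r \<in> car (?Q n)"
   and ij: "1 \<le> i" "i < j" "j \<le> l"
  have i: "1 \<le> i" "i \<le> l" "1 \<le> j" "j \<le> l" "1 \<le> j + m - 1" "j + m - 1 \<le> l + m - 1" "i \<le> l + n - 1" using ij by auto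
  have ar: "l + m - 1 + n - 1 = l + n - 1 + m - 1" using ij by auto
  note ci = c[OF i(1,2), of m] and cj = c[OF i(3,4), of n] and cjm = c[OF i(5,6), of n] and cin = c[OF i(1,7), of m]
  have 1: "?c (l + m - 1) n (j + m - 1) (?c l m i (pure (M1 l) (M2 l) p f) q) (pure (ocar P n) (ocar Q n) p'' f'')
   = ?c (l + n - 1) m i (?c l n j (pure (M1 l) (M2 l) p f) (pure (ocar P n) (ocar Q n) p'' f'')) q"
   if "p \<in> car (M1 l)" "f \<in> car (M2 l)" "p'' \<in> car (ocar P n)" "f'' \<in> car (ocar Q n)" for p f p'' f''
  proof (rule tens_hom_eqI[OF vQ _ _ _ q])
   show "(%q. ?c (l + m - 1) n (j + m - 1) (?c l m i (pure (M1 l) (M2 l) p f) q) (pure (ocar P n) (ocar Q n) p'' f''))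
     \<in> hom (?Q m) (?M (l + m - 1 + n - 1))"
    by (intro hom_comp[OF bihom_left[OF cjm] bihom_right[OF ci]] pc qc that)
   show "(%q. ?c (l + n - 1) m i (?c l n j (pure (M1 l) (M2 l) p f) (pure (ocar P n) (ocar Q n) p'' f'')) q)
     \<in> hom (?Q m) (?M (l + m - 1 + n - 1))"
    unfolding ar by (intro bihom_right[OF cin] bihom_car[OF cj] pc qc that)
   fix p' f' assume q': "p' \<in> car (ocar P m)" "f' \<in> car (ocar Q m)"
   show "?c (l + m - 1) n (j + m - 1) (?c l m i (pure (M1 l) (M2 l) p f) (pure (ocar P m) (ocar Q m) p' f')) (pure (ocar P n) (ocar Q n) p'' f'')
   = ?c (l + n - 1) m i (?c l n j (pure (M1 l) (M2 l) p f) (pure (ocar P n) (ocar Q n) p'' f'')) (pure (ocar P m) (ocar Q m) p' f')"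
    unfolding cp[OF i(1,2) that(1,2) q'] cp[OF i(3,4) that(1,2) that(3,4)]
     cp[OF i(5,6) A1(1)[OF i(1,2) that(1) q'(1)] B1(1)[OF i(1,2) that(2) q'(2)] that(3,4)]
     cp[OF i(1,7) A1(1)[OF i(3,4) that(1,3)] B1(1)[OF i(3,4) that(2,4)] q']
     A.par[OF that(1) q'(1) that(3) ij] B.par[OF that(2) q'(2) that(4) ij] unfolding ar ..
  qed
  show "?c (l + m - 1) n (j + m - 1) (?c l m i x q) r = ?c (l + n - 1) m i (?c l n j x r) q"
  proof (rule tens_eqI2[OF vM vQ, where D = "?M (l + m - 1 + n - 1)" and F = "%x r. ?c (l + m - 1) n (j + m - 1) (?c l m i x q) r"
      and G = "%x r. ?c (l + n - 1) m i (?c l n j x r) q", OF _ _ 1 x r])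
   show "(%x r. ?c (l + m - 1) n (j + m - 1) (?c l m i x q) r) \<in> bihom (?M l) (?Q n) (?M (l + m - 1 + n - 1))"
    by (intro bihomI hom_comp[OF bihom_left[OF cjm] bihom_left[OF ci]] bihom_right[OF cjm] bihom_car[OF ci] q)
   show "(%x r. ?c (l + n - 1) m i (?c l n j x r) q) \<in> bihom (?M l) (?Q n) (?M (l + m - 1 + n - 1))"
    unfolding ar
    by (intro bihomI hom_comp[OF bihom_left[OF cin] bihom_right[OF cj]] hom_comp[OF bihom_left[OF cin] bihom_left[OF cj]] q)
  qed
 next
  fix m n i :: nat and \<sigma> \<tau> x q
  assume x: "x \<in> car (?M m)" and q: "q \<in> car (?Q n)" and i: "1 \<le> i" "i \<le> m"
   and s: "\<sigma> permutes {1..m}" and t: "\<tau> permutes {1..n}"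
  have si: "1 \<le> \<sigma> i" "\<sigma> i \<le> m" using permutes_in_image[OF s, of i] i by auto
  note p = pcomp_permutes[OF i s t]
  show "?c m n i (?a m \<sigma> x) (?b n \<tau> q) = ?a (m + n - 1) (pcomp m n i \<sigma> \<tau>) (?c m n (\<sigma> i) x q)"
  proof (rule tens_eqI2[OF vM vQ, where D = "?M (m + n - 1)" and F = "%x q. ?c m n i (?a m \<sigma> x) (?b n \<tau> q)"
     and G = "%x q. ?a (m + n - 1) (pcomp m n i \<sigma> \<tau>) (?c m n (\<sigma> i) x q)", OF _ _ _ x q])
   show "(%x q. ?c m n i (?a m \<sigma> x) (?b n \<tau> q)) \<in> bihom (?M m) (?Q n) (?M (m + n - 1))"
    by (intro bihomI hom_comp[OF bihom_left[OF c[OF i]] a[OF s]] hom_comp[OF bihom_right[OF c[OF i]] b[OF t]]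
      hom_car[OF a[OF s]] hom_car[OF b[OF t]])
   show "(%x q. ?a (m + n - 1) (pcomp m n i \<sigma> \<tau>) (?c m n (\<sigma> i) x q)) \<in> bihom (?M m) (?Q n) (?M (m + n - 1))"
    by (intro bihomI hom_comp[OF a[OF p] bihom_left[OF c[OF si]]] hom_comp[OF a[OF p] bihom_right[OF c[OF si]]])
   fix p1 f1 p2 f2 assume z: "p1 \<in> car (M1 m)" "f1 \<in> car (M2 m)" "p2 \<in> car (ocar P n)" "f2 \<in> car (ocar Q n)"
   note h = hom_car[OF A.ma_hom[OF s] z(1)] hom_car[OF B.ma_hom[OF s] z(2)]
    hom_car[OF A.qa_hom[OF t] z(3)] hom_car[OF B.qa_hom[OF t] z(4)]
   show "?c m n i (?a m \<sigma> (pure (M1 m) (M2 m) p1 f1)) (?b n \<tau> (pure (ocar P n) (ocar Q n) p2 f2)) =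
    ?a (m + n - 1) (pcomp m n i \<sigma> \<tau>) (?c m n (\<sigma> i) (pure (M1 m) (M2 m) p1 f1) (pure (ocar P n) (ocar Q n) p2 f2))"
    unfolding ap[OF s z(1,2)] bp[OF t z(3,4)] cp[OF i h] cp[OF si z]
     ap[OF p A1(1)[OF si z(1,3)] B1(1)[OF si z(2,4)]]
     A.equiv[OF z(1,3) i s t] B.equiv[OF z(2,4) i s t] ..
  qed
 qed ((rule vspace_tens c d a b; assumption)+)
qed

subsection \<open>Words\<close>

definition ins :: "nat => 'a list => 'a list => 'a list" where
 "ins i xs ys = take (i - 1) xs @ ys @ drop i xs"

definition lperm :: "(nat => nat) => 'a list => 'a list" where
 "lperm \<sigma> xs = map (%i. xs ! (\<sigma> i - 1)) [1..<Suc (length xs)]"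

lemma length_lperm [simp]: "length (lperm \<sigma> xs) = length xs"
 by (simp add: lperm_def del: upt_Suc)

lemma nth_lperm: "k < length xs ==> lperm \<sigma> xs ! k = xs ! (\<sigma> (Suc k) - 1)"
 by (simp add: lperm_def del: upt_Suc)

lemma length_ins: "1 \<le> i ==> i \<le> length xs ==> length (ins i xs ys) = length xs + length ys - 1"
 by (simp add: ins_def)

lemma set_ins: "set (ins i xs ys) \<subseteq> set xs \<union> set ys"
 using set_take_subset[of "i - 1" xs] set_drop_subset[of i xs] by (auto simp: ins_def)

lemma nth_ins:
 assumes "1 \<le> i" "i \<le> length xs" "p < length xs + length ys - 1"
 shows "ins i xs ys ! p = (if p < i - 1 then xs ! p else if p < i - 1 + length ys then ys ! (p - (i - 1))
  else xs ! (p + 1 - length ys))"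
proof -
 have "min (length xs) (i - 1) = i - 1" using assms by simp
 moreover have "i + (p - (i - 1) - length ys) = p + 1 - length ys" if "\<not> p < i - 1 + length ys"
  using that assms by arith
 ultimately show ?thesis using assms by (auto simp: ins_def nth_append)
qed

lemma permutes_bounds: "\<sigma> permutes {1..n} ==> 1 \<le> a ==> a \<le> n ==> 1 \<le> \<sigma> a \<and> \<sigma> a \<le> n"
 using permutes_in_image[of \<sigma> "{1..n}" a] by auto

lemma set_lperm: "\<sigma> permutes {1..length xs} ==> set (lperm \<sigma> xs) \<subseteq> set xs"
 unfolding lperm_def using permutes_bounds[of \<sigma> "length xs"] by (fastforce intro!: nth_mem)

lemma lperm_lperm:
 assumes "\<tau> permutes {1..length xs}"
 shows "lperm \<tau> (lperm \<sigma> xs) = lperm (\<sigma> \<circ> \<tau>) xs"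
proof (rule nth_equalityI)
 fix k assume "k < length (lperm \<tau> (lperm \<sigma> xs))"
 then have k: "k < length xs" by simp
 then have "1 \<le> \<tau> (Suc k) \<and> \<tau> (Suc k) \<le> length xs" using permutes_bounds[OF assms, of "Suc k"] by simp
 moreover from this have "\<tau> (Suc k) - 1 < length xs" by linarith
 ultimately have "lperm \<sigma> xs ! (\<tau> (Suc k) - 1) = xs ! (\<sigma> (\<tau> (Suc k)) - 1)"
  using nth_lperm[of "\<tau> (Suc k) - 1" xs \<sigma>] by simp
 then show "lperm \<tau> (lperm \<sigma> xs) ! k = lperm (\<sigma> \<circ> \<tau>) xs ! k" using k by (simp add: nth_lperm)
qed simp

lemma lperm_id [simp]: "lperm id xs = xs"
 by (rule nth_equalityI) (simp_all add: nth_lperm)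

lemma lperm_inv: "\<sigma> permutes {1..length xs} ==> lperm \<sigma> (lperm (inv \<sigma>) xs) = xs"
 by (simp add: lperm_lperm permutes_inv_o)

lemma lperm_inv': "\<sigma> permutes {1..length xs} ==> lperm (inv \<sigma>) (lperm \<sigma> xs) = xs"
 by (simp add: lperm_lperm permutes_inv_o permutes_inv)

text \<open>The combinatorial content of equivariance: it confirms that \<open>pcomp\<close> is the
  permutation induced on a word when a permuted word is inserted into a permuted word. The places
  before, inside and after the inserted word are treated separately.\<close>

lemma lperm_ins:
 assumes i: "1 \<le> i" "i \<le> length xs" and s: "\<sigma> permutes {1..length xs}" and t: "\<tau> permutes {1..length ys}"
 shows "lperm (pcomp (length xs) (length ys) i \<sigma> \<tau>) (ins (\<sigma> i) xs ys) = ins i (lperm \<sigma> xs) (lperm \<tau> ys)"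
proof (rule nth_equalityI)
 let ?m = "length xs" and ?n = "length ys"
 have si: "1 \<le> \<sigma> i" "\<sigma> i \<le> ?m" using permutes_bounds[OF s i] by auto
 show len: "length (lperm (pcomp ?m ?n i \<sigma> \<tau>) (ins (\<sigma> i) xs ys)) = length (ins i (lperm \<sigma> xs) (lperm \<tau> ys))"
  using si i by (simp add: length_ins)
 fix k assume "k < length (lperm (pcomp ?m ?n i \<sigma> \<tau>) (ins (\<sigma> i) xs ys))"
 then have k: "k < ?m + ?n - 1" using si by (simp add: length_ins)
 let ?r = "pcomp ?m ?n i \<sigma> \<tau> (Suc k)"
 have p: "1 \<le> ?r" "?r \<le> ?m + ?n - 1"
  using permutes_bounds[OF pcomp_permutes[OF i s t], of "Suc k"] k by auto
 have L: "lperm (pcomp ?m ?n i \<sigma> \<tau>) (ins (\<sigma> i) xs ys) ! k = ins (\<sigma> i) xs ys ! (?r - 1)"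
  using k si by (subst nth_lperm) (simp_all add: length_ins)
 have M: "ins (\<sigma> i) xs ys ! (?r - 1) = (if ?r - 1 < \<sigma> i - 1 then xs ! (?r - 1)
   else if ?r - 1 < \<sigma> i - 1 + ?n then ys ! (?r - 1 - (\<sigma> i - 1)) else xs ! (?r - 1 + 1 - ?n))"
  by (rule nth_ins) (use si p k in auto)
 have N: "ins i (lperm \<sigma> xs) (lperm \<tau> ys) ! k = (if k < i - 1 then lperm \<sigma> xs ! k
   else if k < i - 1 + ?n then lperm \<tau> ys ! (k - (i - 1)) else lperm \<sigma> xs ! (k + 1 - ?n))"
  using nth_ins[of i "lperm \<sigma> xs" k "lperm \<tau> ys"] i k by simp
 have sinj: "\<sigma> a = \<sigma> b \<longleftrightarrow> a = b" for a b using permutes_inj[OF s] by (auto simp: inj_def)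
 \<comment> \<open>A place \<open>q\<close> outside the inserted word that comes from place
   \<open>c\<close> of \<open>xs\<close> is read back correctly; this serves both before and after
   the insertion.\<close>
 have key: "(if q - 1 < \<sigma> i - 1 then xs ! (q - 1) else if q - 1 < \<sigma> i - 1 + ?n then ys ! (q - 1 - (\<sigma> i - 1))
   else xs ! (q - 1 + 1 - ?n)) = xs ! (c - 1)"
  if q: "q = (if c < \<sigma> i then c else c + ?n - 1)" and c: "1 \<le> c" "c \<noteq> \<sigma> i" for c q
 proof (cases "c < \<sigma> i")
  case True
  then have "q - 1 < \<sigma> i - 1" using q c by auto
  then show ?thesis using q True by simp
 next
  case False
  then have "q - 1 + 1 - ?n = c - 1" "\<not> q - 1 < \<sigma> i - 1" "\<not> q - 1 < \<sigma> i - 1 + ?n"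
   using q c si by auto
  then show ?thesis by presburger
 qed
 consider "k < i - 1" | "i - 1 \<le> k" "k < i - 1 + ?n" | "i - 1 + ?n \<le> k" by linarith
 then show "lperm (pcomp ?m ?n i \<sigma> \<tau>) (ins (\<sigma> i) xs ys) ! k = ins i (lperm \<sigma> xs) (lperm \<tau> ys) ! k"
 proof cases
  case 1
  have b: "1 \<le> \<sigma> (Suc k)" "\<sigma> (Suc k) \<noteq> \<sigma> i" using permutes_bounds[OF s, of "Suc k"] 1 i sinj by auto
  have r: "?r = (if \<sigma> (Suc k) < \<sigma> i then \<sigma> (Suc k) else \<sigma> (Suc k) + ?n - 1)"
   using 1 by (auto simp: pcomp_def)
  have "lperm \<sigma> xs ! k = xs ! (\<sigma> (Suc k) - 1)" using 1 i by (intro nth_lperm) auto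
  then show ?thesis unfolding L unfolding M N using key[OF r b] 1 by simp
 next
  case 2
  have b: "1 \<le> \<tau> (Suc k + 1 - i)" "\<tau> (Suc k + 1 - i) \<le> ?n" using permutes_bounds[OF t, of "Suc k + 1 - i"] 2 i by auto
  have r: "?r = \<sigma> i - 1 + \<tau> (Suc k + 1 - i)"
   using 2 i by (auto simp: pcomp_def)
  have e: "Suc (k - (i - 1)) = Suc k + 1 - i" using 2 i by auto
  have "lperm \<tau> ys ! (k - (i - 1)) = ys ! (\<tau> (Suc k + 1 - i) - 1)" 
  proof -
   have "k - (i - 1) < ?n" using 2 i by auto
   then show ?thesis by (rule nth_lperm[of "k - (i - 1)" ys \<tau>, unfolded e])
  qed
  then show ?thesis unfolding L unfolding M N unfolding r using 2 b si by (auto simp: diff_diff_eq)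
 next
  case 3
  let ?b = "Suc k + 1 - ?n"
  have bb: "1 \<le> ?b" "?b \<le> ?m" "?b \<noteq> i" using 3 i k by auto
  have b: "1 \<le> \<sigma> ?b" "\<sigma> ?b \<noteq> \<sigma> i" using permutes_bounds[OF s bb(1,2)] bb sinj by auto
  have r: "?r = (if \<sigma> ?b < \<sigma> i then \<sigma> ?b else \<sigma> ?b + ?n - 1)"
   using 3 i k by (auto simp: pcomp_def Let_def)
  have e: "Suc (k + 1 - ?n) = ?b" using 3 i by auto
  have "lperm \<sigma> xs ! (k + 1 - ?n) = xs ! (\<sigma> ?b - 1)" 
  proof -
   have "k + 1 - ?n < ?m" using 3 i k by auto
   then show ?thesis by (rule nth_lperm[of "k + 1 - ?n" xs \<sigma>, unfolded e])
  qed
  then show ?thesis unfolding L unfolding M N using key[OF r b] 3 by simp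
 qed
qed

lemma ins_ins_seq:
 "1 \<le> i ==> i \<le> length xs ==> 1 \<le> j ==> j \<le> length ys ==> ins (i - 1 + j) (ins i xs ys) zs = ins i xs (ins j ys zs)"
 by (simp add: ins_def)

lemma ins_ins_par:
 "1 \<le> i ==> i < j ==> j \<le> length xs ==> ins (j + length ys - 1) (ins i xs ys) zs = ins i (ins j xs zs) ys"
proof -
 assume i: "1 \<le> i" and ij: "i < j" and j: "j \<le> length xs"
 \<comment> \<open>Cutting \<open>xs\<close> at both places as \<open>as @ x # bs @ y # cs\<close>
   makes both sides equal to \<open>as @ ys @ bs @ zs @ cs\<close>.\<close>
 define as r where "as = take (i - 1) xs" and "r = drop i xs"
 define bs cs where "bs = take (j - i - 1) r" and "cs = drop (j - i) r"
 have lr: "length r = length xs - i" by (simp add: r_def)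
 have x: "xs = as @ xs ! (i - 1) # r"
  unfolding as_def r_def using id_take_nth_drop[of "i - 1" xs] i ij j by simp
 have r: "r = bs @ r ! (j - i - 1) # cs"
  unfolding bs_def cs_def using id_take_nth_drop[of "j - i - 1" r] lr ij j by (simp add: Suc_diff_Suc)
 have la: "length as = i - 1" and lb: "length bs = j - i - 1"
  using i ij j lr by (auto simp: as_def bs_def)
 obtain x y where xs: "xs = as @ x # bs @ y # cs" using x r by metis
 have app: "ins (Suc (length as)) (as @ x # bs) ys = as @ ys @ bs" for as x bs and ys :: "'a list"
  by (simp add: ins_def)
 have "ins (j + length ys - 1) (ins i xs ys) zs = ins (Suc (length (as @ ys @ bs))) ((as @ ys @ bs) @ y # cs) zs"
 proof -
  have "i = Suc (length as)" "j + length ys - 1 = Suc (length (as @ ys @ bs))" using la lb i ij by auto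
  then show ?thesis using app[of as x "bs @ y # cs" ys] by (simp only: xs append_assoc append_Cons)
 qed
 also have "\<dots> = as @ ys @ bs @ zs @ cs"
  unfolding app by simp
 also have "\<dots> = ins i (ins j xs zs) ys"
 proof -
  have "i = Suc (length as)" "j = Suc (length (as @ x # bs))" using la lb i ij by auto
  then show ?thesis using app[of "as @ x # bs" y cs zs] app[of as x "bs @ zs @ cs" ys] by (simp only: xs append_assoc append_Cons)
 qed
 finally show ?thesis .
qed

lemma ins_update_inner: "1 \<le> i ==> i \<le> length xs ==> j < length ys ==> ins i xs (ys[j := y]) = (ins i xs ys)[i - 1 + j := y]"
 by (cases i) (auto simp: ins_def list_update_append min_def)

lemma ins_update_outer:
 assumes "1 \<le> i" "i \<le> length xs" "j < length xs" "j \<noteq> i - 1"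
 shows "ins i (xs[j := x]) ys = (ins i xs ys)[(if j < i then j else j + length ys - 1) := x]"
proof (cases "j < i")
 case True
 then have "j < i - 1" using assms by auto
 then show ?thesis using assms True by (simp add: ins_def list_update_append take_update_swap)
next
 case False
 then show ?thesis using assms by (auto simp: ins_def list_update_append drop_update_swap take_update_cancel)
qed

lemma lperm_update:
 assumes s: "\<sigma> permutes {1..length xs}" and j: "j < length xs"
 shows "lperm \<sigma> (xs[j := x]) = (lperm \<sigma> xs)[inv \<sigma> (Suc j) - 1 := x]"
proof (rule nth_equalityI)
 fix k assume "k < length (lperm \<sigma> (xs[j := x]))"
 then have k: "k < length xs" by simp
 have b: "1 \<le> \<sigma> (Suc k)" "\<sigma> (Suc k) \<le> length xs" using permutes_bounds[OF s, of "Suc k"] k by auto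
 have c: "1 \<le> inv \<sigma> (Suc j)" "inv \<sigma> (Suc j) \<le> length xs" using permutes_bounds[OF permutes_inv[OF s], of "Suc j"] j by auto
 have "\<sigma> (Suc k) = Suc j \<longleftrightarrow> Suc k = inv \<sigma> (Suc j)"
  using permutes_inverses[OF s] by metis
 then have "\<sigma> (Suc k) - 1 = j \<longleftrightarrow> k = inv \<sigma> (Suc j) - 1" using b c by arith
 moreover have "inv \<sigma> (Suc j) - 1 < length xs" using c by simp
 ultimately show "lperm \<sigma> (xs[j := x]) ! k = (lperm \<sigma> xs)[inv \<sigma> (Suc j) - 1 := x] ! k"
  using k j by (simp add: nth_lperm nth_list_update) metis
qed simp

subsection \<open>Tensor powers\<close>

lemma wordsD: "xs \<in> words V n ==> length xs = n" "xs \<in> words V n ==> x \<in> set xs ==> x \<in> car V"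
 by (auto simp: words_def)

lemma words_nth: "xs \<in> words V n ==> k < n ==> xs ! k \<in> car V"
 by (auto simp: words_def)

lemma words_update: "xs \<in> words V n ==> x \<in> car V ==> xs[i := x] \<in> words V n"
 by (auto simp: words_def dest: set_update_subset_insert[THEN subsetD])

lemma words_ins: "xs \<in> words V m ==> ys \<in> words V n ==> 1 \<le> i ==> i \<le> m ==> ins i xs ys \<in> words V (m + n - 1)"
 using set_ins[of i xs ys] by (auto simp: words_def length_ins)

lemma words_lperm: "xs \<in> words V n ==> \<sigma> permutes {1..n} ==> lperm \<sigma> xs \<in> words V n"
 using set_lperm[of \<sigma> xs] by (auto simp: words_def)

lemma tpow_rel_car: "vspace V ==> tpow_rel V n \<subseteq> car (free (words V n))"
 unfolding tpow_rel_def
 by (auto intro!: car_diff[OF vspace_free] vec_free words_update car_add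
   car_scl[OF vspace_free, simplified] car_scl)

definition mlin :: "('k, 'v::ab_group_add) vs => nat => ('k, 'c::ab_group_add) vs => ('v list => 'c) => bool" where
 "mlin V n C \<phi> \<longleftrightarrow> (\<forall>xs\<in>words V n. \<phi> xs \<in> car C \<and> (\<forall>i<n. (%x. \<phi> (xs[i := x])) \<in> hom V C))"

lemma mlinI:
 "(!!xs. xs \<in> words V n ==> \<phi> xs \<in> car C) ==> (!!xs i. xs \<in> words V n ==> i < n ==> (%x. \<phi> (xs[i := x])) \<in> hom V C) ==> mlin V n C \<phi>"
 by (simp add: mlin_def)

lemma
 assumes "mlin V n C \<phi>" "xs \<in> words V n"
 shows mlin_car: "\<phi> xs \<in> car C" and mlin_hom: "i < n ==> (%x. \<phi> (xs[i := x])) \<in> hom V C"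
 using assms by (auto simp: mlin_def)

lemma scl_tpow [simp]: "scl (tpow V n) = psc"
 by (simp add: tpow_def)

lemma vspace_tpow: "vspace (tpow V n)"
 by (simp add: tpow_def vspace_quot vspace_free)

lemma tword_eq: "xs \<in> words V n ==> tword V xs = qproj (free (words V n)) (tpow_rel V n) (vec xs)"
 by (simp add: tword_def words_def)

lemma tword_mlin: "mlin V n (tpow V n) (tword V)"
proof (rule mlinI)
 let ?q = "qproj (free (words V n)) (tpow_rel V n)"
 fix xs assume xs: "xs \<in> words V n"
 show c: "tword V xs \<in> car (tpow V n)" using xs by (simp add: tword_eq tpow_def qproj_in_quot vec_free)
 fix i assume i: "i < n"
 have z: "?q (r - s - t) = 0 ==> ?q r = ?q s + ?q t" for r s t
  by (simp add: qproj_diff[OF vspace_free] diff_diff_eq qproj_add[OF vspace_free])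
 have y: "?q (r - psc c s) = 0 ==> ?q r = psc c (?q s)" for r s c
  using qproj_scl[OF vspace_free, of "words V n" "tpow_rel V n" c s] by (simp add: qproj_diff vspace_free)
 have rel: "r \<in> tpow_rel V n ==> ?q r = 0" for r by (simp add: qproj_rel vspace_free)
 have t: "tword V (xs[i := x]) = ?q (vec (xs[i := x]))" for x
  using xs by (simp add: tword_def words_def)
 show "(%x. tword V (xs[i := x])) \<in> hom V (tpow V n)"
 proof (rule homI)
  fix x assume x: "x \<in> car V"
  show "tword V (xs[i := x]) \<in> car (tpow V n)"
   unfolding t tpow_def by (rule qproj_in_quot[OF vec_free[OF words_update[OF xs x]]])
  show "tword V (xs[i := scl V c x]) = scl (tpow V n) c (tword V (xs[i := x]))" for c
   unfolding t scl_tpow by (intro y rel) (use xs i x in "auto simp: tpow_rel_def")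
  fix y assume "y \<in> car V"
  then show "tword V (xs[i := x + y]) = tword V (xs[i := x]) + tword V (xs[i := y])"
   unfolding t by (intro z rel) (use xs i x in "auto simp: tpow_rel_def")
 qed
qed

lemmas tword_car = mlin_car[OF tword_mlin]

lemma
 assumes "vspace V" "vspace C" "mlin V n C \<phi>"
 shows tpow_lext: "xs \<in> words V n ==> lext (scl C) \<phi> (tword V xs) = \<phi> xs"
  and tpow_lext_hom: "lext (scl C) \<phi> \<in> hom (tpow V n) C"
proof -
 have vs: "vector_space (scl C)" using assms(2) by (rule vspace_vs)
 have r: "lext (scl C) \<phi> r = 0" if "r \<in> tpow_rel V n" for r
  using that hom_add[OF mlin_hom[OF assms(3)]] hom_scl[OF mlin_hom[OF assms(3)]] unfolding tpow_rel_def
  by (auto simp: lext_diff[OF vs] lext_psc[OF vs] lext_vec[OF vs])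
 show "lext (scl C) \<phi> (tword V xs) = \<phi> xs" if "xs \<in> words V n"
  unfolding tword_eq[OF that] by (rule pres_lext[OF assms(2) mlin_car[OF assms(3)] tpow_rel_car[OF assms(1)] r that])
 show "lext (scl C) \<phi> \<in> hom (tpow V n) C"
  unfolding tpow_def by (rule pres_lext_hom[OF assms(2) mlin_car[OF assms(3)] tpow_rel_car[OF assms(1)]])
qed

lemma tpow_hom_eqI:
 assumes "vspace V" "f \<in> hom (tpow V n) C" "g \<in> hom (tpow V n) C"
  "!!xs. xs \<in> words V n ==> f (tword V xs) = g (tword V xs)" "t \<in> car (tpow V n)"
 shows "f t = g t"
 by (rule pres_hom_eqI[OF assms(2,3)[unfolded tpow_def] tpow_rel_car[OF assms(1)] _ assms(5)[unfolded tpow_def]])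
  (use assms(4) in "auto simp: tword_eq")

lemma tpow_keys: "vspace V ==> t \<in> car (tpow V n) ==> xs \<in> pkeys t ==> xs \<in> words V n"
 using pres_keys[OF tpow_rel_car] by (metis tpow_def)

lemma
 assumes V: "vspace V" and s: "\<sigma> permutes {1..n}"
 shows tperm_tword: "xs \<in> words V n ==> tperm V n \<sigma> (tword V xs) = tword V (lperm \<sigma> xs)"
  and tperm_hom: "tperm V n \<sigma> \<in> hom (tpow V n) (tpow V n)"
proof -
 let ?f = "%xs. tword V (map (%i. xs ! (\<sigma> i - 1)) [1..<Suc n])"
 have f: "?f xs = tword V (lperm \<sigma> xs)" if "xs \<in> words V n" for xs
  using that by (simp add: lperm_def words_def)
 have m: "mlin V n (tpow V n) ?f"
 proof (rule mlinI)
  fix xs assume xs: "xs \<in> words V n"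
  show "?f xs \<in> car (tpow V n)" using f[OF xs] words_lperm[OF xs s] tword_car by metis
  fix i assume i: "i < n"
  have "(%x. tword V ((lperm \<sigma> xs)[inv \<sigma> (Suc i) - 1 := x])) \<in> hom V (tpow V n)"
   using mlin_hom[OF tword_mlin words_lperm[OF xs s], of "inv \<sigma> (Suc i) - 1"]
    permutes_bounds[OF permutes_inv[OF s], of "Suc i"] i by auto
  then show "(%x. ?f (xs[i := x])) \<in> hom V (tpow V n)"
  proof (rule hom_cong[OF _ _ V])
   fix x assume "x \<in> car V"
   then show "tword V ((lperm \<sigma> xs)[inv \<sigma> (Suc i) - 1 := x]) = ?f (xs[i := x])"
    using f[OF words_update[OF xs]] lperm_update[of \<sigma> xs i x] s i wordsD(1)[OF xs] by metis
  qed
 qed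
 show "tperm V n \<sigma> (tword V xs) = tword V (lperm \<sigma> xs)" if "xs \<in> words V n"
  using tpow_lext[OF V vspace_tpow m that] f[OF that] by (simp add: tperm_def)
 show "tperm V n \<sigma> \<in> hom (tpow V n) (tpow V n)"
  using tpow_lext_hom[OF V vspace_tpow m] by (simp add: tperm_def)
qed

text \<open>The inner half of \<open>tins\<close>: for a fixed word it is linear in the tensor
  inserted. This allows the laws of insertion to be reduced to words in two stages, first the
  ambient tensor and then the inserted one.\<close>

definition tinsw :: "('k::field, 'v::ab_group_add) vs => nat => 'v list => ('v list \<Rightarrow>\<^sub>0 'k) => ('v list \<Rightarrow>\<^sub>0 'k)" where
 "tinsw V i xs = lext psc (%ys. tword V (ins i xs ys))"

lemma tins_eq: "tins V i g = lext psc (%xs. tinsw V i xs (g (xs ! (i - 1))))"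
 by (simp add: tins_def tinsw_def ins_def)

lemma
 assumes V: "vspace V" and xs: "xs \<in> words V m" and i: "1 \<le> i" "i \<le> m"
 shows tinsw_tword: "ys \<in> words V n ==> tinsw V i xs (tword V ys) = tword V (ins i xs ys)"
  and tinsw_hom: "tinsw V i xs \<in> hom (tpow V n) (tpow V (m + n - 1))"
proof -
 have m: "mlin V n (tpow V (m + n - 1)) (%ys. tword V (ins i xs ys))"
 proof (rule mlinI)
  fix ys assume ys: "ys \<in> words V n"
  show "tword V (ins i xs ys) \<in> car (tpow V (m + n - 1))" by (rule tword_car[OF words_ins[OF xs ys i]])
  fix j assume j: "j < n"
  have "(%y. tword V ((ins i xs ys)[i - 1 + j := y])) \<in> hom V (tpow V (m + n - 1))"
   by (rule mlin_hom[OF tword_mlin words_ins[OF xs ys i]]) (use i j in auto)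
  then show "(%y. tword V (ins i xs (ys[j := y]))) \<in> hom V (tpow V (m + n - 1))"
   by (rule hom_cong) (use i j V wordsD(1)[OF xs] wordsD(1)[OF ys] in "auto simp: ins_update_inner")
 qed
 show "tinsw V i xs (tword V ys) = tword V (ins i xs ys)" if "ys \<in> words V n"
  using tpow_lext[OF V vspace_tpow m that] by (simp add: tinsw_def)
 show "tinsw V i xs \<in> hom (tpow V n) (tpow V (m + n - 1))"
  using tpow_lext_hom[OF V vspace_tpow m] by (simp add: tinsw_def)
qed

lemma
 assumes V: "vspace V" and g: "g \<in> hom V (tpow V n)" and i: "1 \<le> i" "i \<le> m"
 shows tins_tword: "xs \<in> words V m ==> tins V i g (tword V xs) = tinsw V i xs (g (xs ! (i - 1)))"
  and tins_hom: "tins V i g \<in> hom (tpow V m) (tpow V (m + n - 1))"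
proof -
 let ?f = "%xs. tinsw V i xs (g (xs ! (i - 1)))" and ?C = "tpow V (m + n - 1)"
 have m: "mlin V m ?C ?f"
 proof (rule mlinI)
  fix xs assume xs: "xs \<in> words V m"
  have xi: "xs ! (i - 1) \<in> car V" by (rule words_nth[OF xs]) (use i in auto)
  have gx: "g (xs ! (i - 1)) \<in> car (tpow V n)" by (rule hom_car[OF g xi])
  show "?f xs \<in> car ?C" by (rule hom_car[OF tinsw_hom[OF V xs i] gx])
  fix j assume j: "j < m"
  show "(%x. ?f (xs[j := x])) \<in> hom V ?C"
  proof (cases "j = i - 1")
   case True
   \<comment> \<open>The letter at position \<open>i - 1\<close> is the one that \<open>ins\<close>
     removes, so linearity in it comes from \<open>g\<close> alone.\<close>
   have e: "ins i (xs[i - 1 := x]) ys = ins i xs ys" for x ys using i wordsD(1)[OF xs] by (simp add: ins_def)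
   have "(%x. tinsw V i xs (g x)) \<in> hom V ?C" by (rule hom_comp[OF tinsw_hom[OF V xs i] g])
   then show ?thesis
    by (rule hom_cong) (use V j True wordsD(1)[OF xs] in "auto simp: tinsw_def e[simplified]")
  next
   case False
   have "(%x. lext (scl ?C) (%ys. tword V ((ins i xs ys)[(if j < i then j else j + n - 1) := x])) (g (xs ! (i - 1)))) \<in> hom V ?C"
   proof (rule hom_Lext[OF vspace_tpow])
    fix ys assume "ys \<in> pkeys (g (xs ! (i - 1)))"
    then have ys: "ys \<in> words V n" by (rule tpow_keys[OF V gx])
    show "(%x. tword V ((ins i xs ys)[(if j < i then j else j + n - 1) := x])) \<in> hom V ?C"
     by (rule mlin_hom[OF tword_mlin words_ins[OF xs ys i]]) (use i j False in auto)
   qed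
   then show ?thesis
   proof (rule hom_cong[OF _ _ V])
    fix x
    have "tword V ((ins i xs ys)[(if j < i then j else j + n - 1) := x]) = tword V (ins i (xs[j := x]) ys)"
     if "ys \<in> pkeys (g (xs ! (i - 1)))" for ys
     using ins_update_outer[of i xs j x ys] wordsD(1)[OF tpow_keys[OF V gx that]] i j False wordsD(1)[OF xs] by simp
    then have "lext psc (%ys. tword V ((ins i xs ys)[(if j < i then j else j + n - 1) := x])) (g (xs ! (i - 1))) =
      lext psc (%ys. tword V (ins i (xs[j := x]) ys)) (g (xs ! (i - 1)))"
     by (rule lext_cong)
    then show "lext (scl ?C) (%ys. tword V ((ins i xs ys)[(if j < i then j else j + n - 1) := x])) (g (xs ! (i - 1)))
     = ?f (xs[j := x])"
     using nth_list_update_neq[OF False, of xs x] by (simp only: tinsw_def scl_tpow)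
   qed
  qed
 qed
 show "tins V i g (tword V xs) = tinsw V i xs (g (xs ! (i - 1)))" if "xs \<in> words V m"
  using tpow_lext[OF V vspace_tpow m that] by (simp add: tins_eq)
 show "tins V i g \<in> hom (tpow V m) (tpow V (m + n - 1))"
  using tpow_lext_hom[OF V vspace_tpow m] by (simp add: tins_eq)
qed

section \<open>Associativity and equivariance of insertion into tensors\<close>

lemma tins_seq:
 assumes V: "vspace V" and t: "t \<in> car (tpow V l)" and g: "g \<in> hom V (tpow V m)" and h: "h \<in> hom V (tpow V n)"
  and i: "1 \<le> i" "i \<le> l" and j: "1 \<le> j" "j \<le> m"
 shows "tins V (i - 1 + j) h (tins V i g t) = tins V i (%x. tins V j h (g x)) t"
proof -
 have ar: "l + m - 1 + n - 1 = l + (m + n - 1) - 1" using i j by auto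
 have k: "1 \<le> i - 1 + j" "i - 1 + j \<le> l + m - 1" using i j by auto
 have gh: "(%x. tins V j h (g x)) \<in> hom V (tpow V (m + n - 1))" by (rule hom_comp[OF tins_hom[OF V h j] g])
 show ?thesis
 proof (rule tpow_hom_eqI[OF V _ _ _ t])
  show "(%t. tins V (i - 1 + j) h (tins V i g t)) \<in> hom (tpow V l) (tpow V (l + m - 1 + n - 1))"
   by (rule hom_comp[OF tins_hom[OF V h k] tins_hom[OF V g i]])
  show "tins V i (%x. tins V j h (g x)) \<in> hom (tpow V l) (tpow V (l + m - 1 + n - 1))"
   unfolding ar by (rule tins_hom[OF V gh i])
  fix xs assume xs: "xs \<in> words V l"
  have x: "xs ! (i - 1) \<in> car V" by (rule words_nth[OF xs]) (use i in auto)
  have "tins V (i - 1 + j) h (tinsw V i xs u) = tinsw V i xs (tins V j h u)" if u: "u \<in> car (tpow V m)" for u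
  proof (rule tpow_hom_eqI[OF V _ _ _ u])
   show "(%u. tins V (i - 1 + j) h (tinsw V i xs u)) \<in> hom (tpow V m) (tpow V (l + m - 1 + n - 1))"
    by (rule hom_comp[OF tins_hom[OF V h k] tinsw_hom[OF V xs i]])
   show "(%u. tinsw V i xs (tins V j h u)) \<in> hom (tpow V m) (tpow V (l + m - 1 + n - 1))"
    unfolding ar by (rule hom_comp[OF tinsw_hom[OF V xs i] tins_hom[OF V h j]])
   fix ys assume ys: "ys \<in> words V m"
   have y: "ys ! (j - 1) \<in> car V" by (rule words_nth[OF ys]) (use j in auto)
   have w: "ins i xs ys \<in> words V (l + m - 1)" by (rule words_ins[OF xs ys i])
   have e: "ins i xs ys ! (i - 1 + j - 1) = ys ! (j - 1)"
    using nth_ins[of i xs "i - 1 + j - 1" ys] wordsD(1)[OF xs] wordsD(1)[OF ys] i j by auto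
   have "tinsw V (i - 1 + j) (ins i xs ys) v = tinsw V i xs (tinsw V j ys v)" if v: "v \<in> car (tpow V n)" for v
   proof (rule tpow_hom_eqI[OF V _ _ _ v])
    show "tinsw V (i - 1 + j) (ins i xs ys) \<in> hom (tpow V n) (tpow V (l + m - 1 + n - 1))"
     by (rule tinsw_hom[OF V w k])
    show "(%v. tinsw V i xs (tinsw V j ys v)) \<in> hom (tpow V n) (tpow V (l + m - 1 + n - 1))"
     unfolding ar by (rule hom_comp[OF tinsw_hom[OF V xs i] tinsw_hom[OF V ys j]])
    fix zs assume zs: "zs \<in> words V n"
    show "tinsw V (i - 1 + j) (ins i xs ys) (tword V zs) = tinsw V i xs (tinsw V j ys (tword V zs))"
     unfolding tinsw_tword[OF V w k zs] tinsw_tword[OF V ys j zs] tinsw_tword[OF V xs i words_ins[OF ys zs j]]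
     using ins_ins_seq[of i xs j ys zs] wordsD(1)[OF xs] wordsD(1)[OF ys] i j by simp
   qed
   then show "tins V (i - 1 + j) h (tinsw V i xs (tword V ys)) = tinsw V i xs (tins V j h (tword V ys))"
    unfolding tinsw_tword[OF V xs i ys] tins_tword[OF V h j ys] tins_tword[OF V h k w] e
    using hom_car[OF h y] by blast
  qed
  then show "tins V (i - 1 + j) h (tins V i g (tword V xs)) = tins V i (%x. tins V j h (g x)) (tword V xs)"
   unfolding tins_tword[OF V g i xs] tins_tword[OF V gh i xs] using hom_car[OF g x] by blast
 qed
qed

lemma lext_swap:
 "lext psc (%x. lext psc (\<phi> x) q) p = lext psc (%y. lext psc (%x. \<phi> x y) p) q"
proof -
 interpret vector_space psc by (rule vector_space_psc)
 show ?thesis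
  unfolding lext_def scale_sum_right
  by (subst sum.swap) (simp add: mult.commute)
qed

text \<open>On a word, both orders of insertion are double linear extensions with the same summand
  \<open>ins i (ins j xs zs) ys\<close>; only the order of summation differs.\<close>

lemma tins_par:
 assumes V: "vspace V" and t: "t \<in> car (tpow V l)" and g: "g \<in> hom V (tpow V m)" and h: "h \<in> hom V (tpow V n)"
  and ij: "1 \<le> i" "i < j" "j \<le> l"
 shows "tins V (j + m - 1) h (tins V i g t) = tins V i g (tins V j h t)"
proof -
 have i: "1 \<le> i" "i \<le> l" "1 \<le> j" "j \<le> l" "1 \<le> j + m - 1" "j + m - 1 \<le> l + m - 1" "i \<le> l + n - 1" using ij by auto
 have ar: "l + m - 1 + n - 1 = l + n - 1 + m - 1" using ij by auto
 show ?thesis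
 proof (rule tpow_hom_eqI[OF V _ _ _ t])
  show "(%t. tins V (j + m - 1) h (tins V i g t)) \<in> hom (tpow V l) (tpow V (l + m - 1 + n - 1))"
   by (rule hom_comp[OF tins_hom[OF V h i(5,6)] tins_hom[OF V g i(1,2)]])
  show "(%t. tins V i g (tins V j h t)) \<in> hom (tpow V l) (tpow V (l + m - 1 + n - 1))"
   unfolding ar by (rule hom_comp[OF tins_hom[OF V g i(1,7)] tins_hom[OF V h i(3,4)]])
  fix xs assume xs: "xs \<in> words V l"
  have x: "xs ! (i - 1) \<in> car V" "xs ! (j - 1) \<in> car V" by (rule words_nth[OF xs]; use ij in auto)+
  let ?u = "g (xs ! (i - 1))" and ?v = "h (xs ! (j - 1))"
  have uv: "?u \<in> car (tpow V m)" "?v \<in> car (tpow V n)" using x hom_car[OF g] hom_car[OF h] by auto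
  have L: "tins V (j + m - 1) h (tinsw V i xs ?u) = lext psc (%ys. lext psc (%zs. tword V (ins i (ins j xs zs) ys)) ?v) ?u"
  proof -
   have "tins V (j + m - 1) h (tinsw V i xs ?u) = lext psc (%ys. tins V (j + m - 1) h (tword V (ins i xs ys))) ?u"
    unfolding tinsw_def
    using hom_lext[OF tins_hom[OF V h i(5,6)] vspace_tpow, of ?u "%ys. tword V (ins i xs ys)"] words_ins[OF xs tpow_keys[OF V uv(1)] i(1,2)]
    by (simp add: tword_car)
   also have "\<dots> = lext psc (%ys. lext psc (%zs. tword V (ins i (ins j xs zs) ys)) ?v) ?u"
   proof (rule lext_cong)
    fix ys assume "ys \<in> pkeys ?u"
    then have ys: "ys \<in> words V m" by (rule tpow_keys[OF V uv(1)])
    have e: "ins i xs ys ! (j + m - 1 - 1) = xs ! (j - 1)"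
     using nth_ins[of i xs "j + m - 1 - 1" ys] wordsD(1)[OF xs] wordsD(1)[OF ys] ij by auto
    show "tins V (j + m - 1) h (tword V (ins i xs ys)) = lext psc (%zs. tword V (ins i (ins j xs zs) ys)) ?v"
     unfolding tins_tword[OF V h i(5,6) words_ins[OF xs ys i(1,2)]] e tinsw_def
     using ins_ins_par[of i j xs ys] wordsD(1)[OF xs] wordsD(1)[OF ys] ij by simp
   qed
   finally show ?thesis .
  qed
  have R: "tins V i g (tinsw V j xs ?v) = lext psc (%zs. lext psc (%ys. tword V (ins i (ins j xs zs) ys)) ?u) ?v"
  proof -
   have "tins V i g (tinsw V j xs ?v) = lext psc (%zs. tins V i g (tword V (ins j xs zs))) ?v"
    unfolding tinsw_def
    using hom_lext[OF tins_hom[OF V g i(1,7)] vspace_tpow, of ?v "%zs. tword V (ins j xs zs)"] words_ins[OF xs tpow_keys[OF V uv(2)] i(3,4)]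
    by (simp add: tword_car)
   also have "\<dots> = lext psc (%zs. lext psc (%ys. tword V (ins i (ins j xs zs) ys)) ?u) ?v"
   proof (rule lext_cong)
    fix zs assume "zs \<in> pkeys ?v"
    then have zs: "zs \<in> words V n" by (rule tpow_keys[OF V uv(2)])
    have e: "ins j xs zs ! (i - 1) = xs ! (i - 1)"
     using nth_ins[of j xs "i - 1" zs] wordsD(1)[OF xs] wordsD(1)[OF zs] ij by auto
    show "tins V i g (tword V (ins j xs zs)) = lext psc (%ys. tword V (ins i (ins j xs zs) ys)) ?u"
     unfolding tins_tword[OF V g i(1,7) words_ins[OF xs zs i(3,4)]] e tinsw_def ..
   qed
   finally show ?thesis .
  qed
  show "tins V (j + m - 1) h (tins V i g (tword V xs)) = tins V i g (tins V j h (tword V xs))"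
   unfolding tins_tword[OF V g i(1,2) xs] tins_tword[OF V h i(3,4) xs] L R by (rule lext_swap)
 qed
qed

lemma tins_equiv:
 assumes V: "vspace V" and t: "t \<in> car (tpow V m)" and g: "g \<in> hom V (tpow V n)"
  and i: "1 \<le> i" "i \<le> m" and s: "\<sigma> permutes {1..m}" and r: "\<tau> permutes {1..n}"
 shows "tins V i (%x. tperm V n \<tau> (g x)) (tperm V m \<sigma> t) = tperm V (m + n - 1) (pcomp m n i \<sigma> \<tau>) (tins V (\<sigma> i) g t)"
proof -
 have si: "1 \<le> \<sigma> i" "\<sigma> i \<le> m" using permutes_bounds[OF s i] by auto
 have gt: "(%x. tperm V n \<tau> (g x)) \<in> hom V (tpow V n)" by (rule hom_comp[OF tperm_hom[OF V r] g])
 note p = pcomp_permutes[OF i s r]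
 show ?thesis
 proof (rule tpow_hom_eqI[OF V _ _ _ t])
  show "(%t. tins V i (%x. tperm V n \<tau> (g x)) (tperm V m \<sigma> t)) \<in> hom (tpow V m) (tpow V (m + n - 1))"
   by (rule hom_comp[OF tins_hom[OF V gt i] tperm_hom[OF V s]])
  show "(%t. tperm V (m + n - 1) (pcomp m n i \<sigma> \<tau>) (tins V (\<sigma> i) g t)) \<in> hom (tpow V m) (tpow V (m + n - 1))"
   by (rule hom_comp[OF tperm_hom[OF V p] tins_hom[OF V g si]])
  fix xs assume xs: "xs \<in> words V m"
  note xs' = words_lperm[OF xs s]
  have e: "lperm \<sigma> xs ! (i - 1) = xs ! (\<sigma> i - 1)" using nth_lperm[of "i - 1" xs \<sigma>] wordsD(1)[OF xs] i by simp
  have x: "xs ! (\<sigma> i - 1) \<in> car V" by (rule words_nth[OF xs]) (use si in auto)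
  have "tinsw V i (lperm \<sigma> xs) (tperm V n \<tau> u) = tperm V (m + n - 1) (pcomp m n i \<sigma> \<tau>) (tinsw V (\<sigma> i) xs u)"
   if u: "u \<in> car (tpow V n)" for u
  proof (rule tpow_hom_eqI[OF V _ _ _ u])
   show "(%u. tinsw V i (lperm \<sigma> xs) (tperm V n \<tau> u)) \<in> hom (tpow V n) (tpow V (m + n - 1))"
    by (rule hom_comp[OF tinsw_hom[OF V xs' i] tperm_hom[OF V r]])
   show "(%u. tperm V (m + n - 1) (pcomp m n i \<sigma> \<tau>) (tinsw V (\<sigma> i) xs u)) \<in> hom (tpow V n) (tpow V (m + n - 1))"
    by (rule hom_comp[OF tperm_hom[OF V p] tinsw_hom[OF V xs si]])
   fix ys assume ys: "ys \<in> words V n"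
   show "tinsw V i (lperm \<sigma> xs) (tperm V n \<tau> (tword V ys)) = tperm V (m + n - 1) (pcomp m n i \<sigma> \<tau>) (tinsw V (\<sigma> i) xs (tword V ys))"
    unfolding tperm_tword[OF V r ys] tinsw_tword[OF V xs' i words_lperm[OF ys r]] tinsw_tword[OF V xs si ys]
     tperm_tword[OF V p words_ins[OF xs ys si]]
    using lperm_ins[of i xs \<sigma> \<tau> ys] wordsD(1)[OF xs] wordsD(1)[OF ys] i s r by simp
  qed
  then show "tins V i (%x. tperm V n \<tau> (g x)) (tperm V m \<sigma> (tword V xs)) =
   tperm V (m + n - 1) (pcomp m n i \<sigma> \<tau>) (tins V (\<sigma> i) g (tword V xs))"
   unfolding tperm_tword[OF V s xs] tins_tword[OF V gt i xs'] tins_tword[OF V g si xs] e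
   using hom_car[OF g x] by blast
 qed
qed

lemma tperm_id: "vspace V ==> t \<in> car (tpow V n) ==> tperm V n id t = t"
 by (rule tpow_hom_eqI[OF _ tperm_hom[OF _ permutes_id] hom_id]) (simp_all add: tperm_tword[OF _ permutes_id])

subsection \<open>The operad of maps to tensor powers\<close>

lemma coendo_simps:
 "ocomp (coendo V) = (%m n i f g x. tins V i g (f x))"
 "oact (coendo V) = (%n \<sigma> f x. tperm V n \<sigma> (f x))"
 "scl (ocar (coendo V) n) = (%c f x. psc c (f x))"
 by (simp_all add: coendo_def)

lemma psc_0 [simp]: "psc c 0 = 0"
 by (rule poly_mapping_eqI) (simp add: lookup_psc)

lemma coendo_hom: "f \<in> car (ocar (coendo V) n) ==> f \<in> hom V (tpow V n)"
 by (cases "n = 0") (auto simp: coendo_def zero_fun_def intro: hom_zero[OF vspace_tpow])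

lemma coendo_out: "f \<in> car (ocar (coendo V) n) ==> x \<notin> car V ==> f x = 0"
 by (cases "n = 0") (auto simp: coendo_def)

lemma coendo_0: "f \<in> car (ocar (coendo V) 0) ==> f = 0"
 by (simp add: coendo_def)

lemma coendoI:
 "f \<in> hom V (tpow V n) ==> (!!x. x \<notin> car V ==> f x = 0) ==> (n = 0 ==> f = 0) ==> f \<in> car (ocar (coendo V) n)"
 by (simp add: coendo_def)

lemma vspace_coendo: "vspace (ocar (coendo V) n)"
proof (rule vspaceI)
 interpret vector_space "psc :: 'a => ('b list \<Rightarrow>\<^sub>0 'a) => _" by (rule vector_space_psc)
 show "vector_space (scl (ocar (coendo V) n))"
  unfolding coendo_simps
  by unfold_locales (auto simp: fun_eq_iff scale_right_distrib scale_left_distrib)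
 show "0 \<in> car (ocar (coendo V) n)"
  by (rule coendoI) (simp_all add: zero_fun_def hom_zero[OF vspace_tpow])
next
 fix f g assume fg: "f \<in> car (ocar (coendo V) n)" "g \<in> car (ocar (coendo V) n)"
 have "(%x. f x + g x) \<in> hom V (tpow V n)"
  by (rule hom_plus[OF vspace_tpow coendo_hom[OF fg(1)] coendo_hom[OF fg(2)]])
 then show "f + g \<in> car (ocar (coendo V) n)"
  using fg coendo_out[OF fg(1)] coendo_out[OF fg(2)] coendo_0[of f V] coendo_0[of g V]
  by (intro coendoI) (auto simp: plus_fun_def)
next
 fix c f assume f: "f \<in> car (ocar (coendo V) n)"
 have "(%x. psc c (f x)) \<in> hom V (tpow V n)"
  using hom_scale[OF vspace_tpow coendo_hom[OF f]] by simp
 then show "scl (ocar (coendo V) n) c f \<in> car (ocar (coendo V) n)"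
  using f coendo_out[OF f] coendo_0[of f V] by (intro coendoI) (auto simp: coendo_simps zero_fun_def)
qed

lemma tinsw_zero [simp]: "tinsw V i xs 0 = 0"
 by (simp add: tinsw_def lext_def)

lemma tins_zero_fun: "tins V i (%x. 0) t = 0" "tins V i 0 t = 0"
 by (simp_all add: tins_eq lext_zero_fun[OF vector_space_psc])

lemma tins_zero [simp]: "tins V i g 0 = 0"
 by (simp add: tins_eq lext_def)

lemma tperm_zero [simp]: "tperm V n \<sigma> 0 = 0"
 by (simp add: tperm_def lext_def)

lemma tins_bihom:
 assumes V: "vspace V" and i: "1 \<le> i" "i \<le> m"
 shows "(%t g. tins V i g t) \<in> bihom (tpow V m) (ocar (coendo V) n) (tpow V (m + n - 1))"
proof (rule bihomI)
 show "(%t. tins V i g t) \<in> hom (tpow V m) (tpow V (m + n - 1))" if "g \<in> car (ocar (coendo V) n)" for g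
  by (rule tins_hom[OF V coendo_hom[OF that] i])
 show "(%g. tins V i g t) \<in> hom (ocar (coendo V) n) (tpow V (m + n - 1))" if t: "t \<in> car (tpow V m)" for t
 proof (rule homI)
  fix g assume "g \<in> car (ocar (coendo V) n)"
  then show "tins V i g t \<in> car (tpow V (m + n - 1))" by (rule hom_car[OF tins_hom[OF V coendo_hom i] t])
 qed (simp_all add: tins_eq tinsw_def coendo_simps lext_add[OF vector_space_psc] lext_psc[OF vector_space_psc]
   lext_add_fun[OF vector_space_psc] lext_scl_fun[OF vector_space_psc])
qed

lemma coendo_comp:
 assumes V: "vspace V" and i: "1 \<le> i" "i \<le> m"
  and f: "f \<in> car (ocar (coendo V) m)" and g: "g \<in> car (ocar (coendo V) n)"
 shows "(%x. tins V i g (f x)) \<in> car (ocar (coendo V) (m + n - 1))"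
proof (rule coendoI)
 show "(%x. tins V i g (f x)) \<in> hom V (tpow V (m + n - 1))"
  by (rule hom_comp[OF tins_hom[OF V coendo_hom[OF g] i] coendo_hom[OF f]])
 show "tins V i g (f x) = 0" if "x \<notin> car V" for x
  using coendo_out[OF f that] by simp
 \<comment> \<open>As \<open>m\<close> is positive, the composite has arity 0 only for
   \<open>n = 0\<close>, and there \<open>coendo\<close> contains only the zero map.\<close>
 assume "m + n - 1 = 0"
 then have "n = 0 \<or> (m = 1 \<and> n = 0)" using i by auto
 then have "g = 0" using coendo_0[of g V] g by auto
 then show "(%x. tins V i g (f x)) = 0" by (simp add: tins_zero_fun zero_fun_def)
qed

lemma coendo_act:
 assumes V: "vspace V" and s: "\<sigma> permutes {1..n}" and f: "f \<in> car (ocar (coendo V) n)"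
 shows "(%x. tperm V n \<sigma> (f x)) \<in> car (ocar (coendo V) n)"
 using coendo_out[OF f] coendo_0[of f V] f
 by (intro coendoI hom_comp[OF tperm_hom[OF V s] coendo_hom[OF f]]) (auto simp: zero_fun_def)

lemma coendo_bihom:
 assumes V: "vspace V" and i: "1 \<le> i" "i \<le> m"
 shows "ocomp (coendo V) m n i \<in> bihom (ocar (coendo V) m) (ocar (coendo V) n) (ocar (coendo V) (m + n - 1))"
proof -
 note tb = tins_bihom[OF V i, of n]
 \<comment> \<open>Equality in \<open>coendo\<close> is equality of functions on the whole type, so
   values at arguments outside the carrier, which are 0, must also lie in the tensor power.\<close>
 have out: "f x \<in> car (tpow V m)" if "f \<in> car (ocar (coendo V) m)" for f x
  using coendo_out[OF that, of x] hom_car[OF coendo_hom[OF that], of x] car_0[OF vspace_tpow] by (cases "x \<in> car V") auto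
 show ?thesis
 proof (rule bihomI; rule homI)
  fix f g assume "f \<in> car (ocar (coendo V) m)" "g \<in> car (ocar (coendo V) n)"
  then show "ocomp (coendo V) m n i f g \<in> car (ocar (coendo V) (m + n - 1))"
   "ocomp (coendo V) m n i f g \<in> car (ocar (coendo V) (m + n - 1))"
   using coendo_comp[OF V i] by (simp_all add: coendo_simps)
 next
  fix f g g' assume "f \<in> car (ocar (coendo V) m)" "g \<in> car (ocar (coendo V) n)" "g' \<in> car (ocar (coendo V) n)"
  then show "ocomp (coendo V) m n i f (g + g') = ocomp (coendo V) m n i f g + ocomp (coendo V) m n i f g'"
   using hom_add[OF bihom_right[OF tb out]] by (auto simp: coendo_simps fun_eq_iff)
 next
  fix f g c assume "f \<in> car (ocar (coendo V) m)" "g \<in> car (ocar (coendo V) n)"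
  then show "ocomp (coendo V) m n i f (scl (ocar (coendo V) n) c g) = scl (ocar (coendo V) (m + n - 1)) c (ocomp (coendo V) m n i f g)"
   "ocomp (coendo V) m n i (scl (ocar (coendo V) m) c f) g = scl (ocar (coendo V) (m + n - 1)) c (ocomp (coendo V) m n i f g)"
   using hom_scl[OF bihom_right[OF tb out], of f g] hom_scl[OF bihom_left[OF tb] out, of g f]
   by (auto simp: coendo_simps fun_eq_iff)
 next
  fix f f' g assume "g \<in> car (ocar (coendo V) n)" "f \<in> car (ocar (coendo V) m)" "f' \<in> car (ocar (coendo V) m)"
  then show "ocomp (coendo V) m n i (f + f') g = ocomp (coendo V) m n i f g + ocomp (coendo V) m n i f' g"
   using hom_add[OF bihom_left[OF tb] out out] by (auto simp: coendo_simps fun_eq_iff)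
 qed
qed

lemma coendo_oact_hom:
 assumes V: "vspace V" and s: "\<sigma> permutes {1..n}"
 shows "oact (coendo V) n \<sigma> \<in> hom (ocar (coendo V) n) (ocar (coendo V) n)"
 by (rule homI) (use coendo_act[OF V s] in "auto simp: coendo_simps tperm_def fun_eq_iff lext_add[OF vector_space_psc] lext_psc[OF vector_space_psc]")

lemma coendo_oact_id:
 assumes V: "vspace V" and f: "f \<in> car (ocar (coendo V) n)"
 shows "oact (coendo V) n id f = f"
proof
 fix x
 show "oact (coendo V) n id f x = f x"
  using coendo_out[OF f, of x] hom_car[OF coendo_hom[OF f], of x] tperm_id[OF V] by (cases "x \<in> car V") (auto simp: coendo_simps)
qed

lemma tpow_right_module:
 assumes V: "vspace V"
 shows "right_module (tpow V) (%m n i t g. tins V i g t) (tperm V) (coendo V)"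
proof -
 have s: "tins V (i - 1 + j) r (tins V i q x) = tins V i (ocomp (coendo V) m n j q r) x"
  if "x \<in> car (tpow V l)" "q \<in> car (ocar (coendo V) m)" "r \<in> car (ocar (coendo V) n)" "1 \<le> i" "i \<le> l" "1 \<le> j" "j \<le> m"
  for l m n i j x q r
  unfolding coendo_simps by (rule tins_seq[OF V that(1) coendo_hom[OF that(2)] coendo_hom[OF that(3)] that(4-)])
 have e: "tins V i (oact (coendo V) n \<tau> q) (tperm V m \<sigma> x) = tperm V (m + n - 1) (pcomp m n i \<sigma> \<tau>) (tins V (\<sigma> i) q x)"
  if "x \<in> car (tpow V m)" "q \<in> car (ocar (coendo V) n)" "1 \<le> i" "i \<le> m" "\<sigma> permutes {1..m}" "\<tau> permutes {1..n}"
  for m n i \<sigma> \<tau> x q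
  unfolding coendo_simps by (rule tins_equiv[OF V that(1) coendo_hom[OF that(2)] that(3-)])
 show ?thesis
 proof (rule right_module.intro)
  show "(%t g. tins V i g t) \<in> bihom (tpow V m) (ocar (coendo V) n) (tpow V (m + n - 1))"
   if "1 \<le> i" "i \<le> m" for m n i by (rule tins_bihom[OF V that])
  show "ocomp (coendo V) m n i \<in> bihom (ocar (coendo V) m) (ocar (coendo V) n) (ocar (coendo V) (m + n - 1))"
   if "1 \<le> i" "i \<le> m" for m n i by (rule coendo_bihom[OF V that])
  show "tins V (j + m - 1) r (tins V i q x) = tins V i q (tins V j r x)"
   if "x \<in> car (tpow V l)" "q \<in> car (ocar (coendo V) m)" "r \<in> car (ocar (coendo V) n)" "1 \<le> i" "i < j" "j \<le> l"
   for l m n i j x q r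
   by (rule tins_par[OF V that(1) coendo_hom[OF that(2)] coendo_hom[OF that(3)] that(4-)])
 qed (fact vspace_tpow vspace_coendo tperm_hom[OF V] coendo_oact_hom[OF V] tperm_id[OF V] coendo_oact_id[OF V] s e)+
qed

text \<open>Partial composition inserts into the value \<open>f x\<close> and permutations act on
  it, so each law holds pointwise by the corresponding law for tensor powers.\<close>

lemma coendo_right_module:
 assumes V: "vspace V"
 shows "right_module (ocar (coendo V)) (ocomp (coendo V)) (oact (coendo V)) (coendo V)"
proof -
 have out: "f x \<in> car (tpow V m)" if "f \<in> car (ocar (coendo V) m)" for f x m
  using coendo_out[OF that, of x] hom_car[OF coendo_hom[OF that], of x] car_0[OF vspace_tpow] by (cases "x \<in> car V") auto
 interpret T: right_module "tpow V" "%m n i t g. tins V i g t" "tperm V" "coendo V"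
  by (rule tpow_right_module[OF V])
 have s: "ocomp (coendo V) (l + m - 1) n (i - 1 + j) (ocomp (coendo V) l m i x q) r = ocomp (coendo V) l (m + n - 1) i x (ocomp (coendo V) m n j q r)"
  if "x \<in> car (ocar (coendo V) l)" "q \<in> car (ocar (coendo V) m)" "r \<in> car (ocar (coendo V) n)" "1 \<le> i" "i \<le> l" "1 \<le> j" "j \<le> m"
  for l m n i j x q r
  using T.seq[OF out[OF that(1)] that(2-)] by (simp add: coendo_simps)
 have p: "ocomp (coendo V) (l + m - 1) n (j + m - 1) (ocomp (coendo V) l m i x q) r = ocomp (coendo V) (l + n - 1) m i (ocomp (coendo V) l n j x r) q"
  if "x \<in> car (ocar (coendo V) l)" "q \<in> car (ocar (coendo V) m)" "r \<in> car (ocar (coendo V) n)" "1 \<le> i" "i < j" "j \<le> l"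
  for l m n i j x q r
  using T.par[OF out[OF that(1)] that(2-)] by (simp add: coendo_simps)
 have e: "ocomp (coendo V) m n i (oact (coendo V) m \<sigma> x) (oact (coendo V) n \<tau> q) =
   oact (coendo V) (m + n - 1) (pcomp m n i \<sigma> \<tau>) (ocomp (coendo V) m n (\<sigma> i) x q)"
  if "x \<in> car (ocar (coendo V) m)" "q \<in> car (ocar (coendo V) n)" "1 \<le> i" "i \<le> m" "\<sigma> permutes {1..m}" "\<tau> permutes {1..n}"
  for m n i \<sigma> \<tau> x q
  using T.equiv[OF out[OF that(1)] that(2-)] by (simp add: coendo_simps)
 show ?thesis
 proof (rule right_module.intro)
  show "ocomp (coendo V) m n i \<in> bihom (ocar (coendo V) m) (ocar (coendo V) n) (ocar (coendo V) (m + n - 1))"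
   "ocomp (coendo V) m n i \<in> bihom (ocar (coendo V) m) (ocar (coendo V) n) (ocar (coendo V) (m + n - 1))"
   if "1 \<le> i" "i \<le> m" for m n i using coendo_bihom[OF V that] by auto
 qed (fact vspace_coendo coendo_oact_hom[OF V] coendo_oact_id[OF V] s p e)+
qed

subsection \<open>The free algebra as a space of coinvariants\<close>

text \<open>\<open>fact\<close> agrees with the abstract action \<open>FM.bm\<close> on carriers,
  which is enough to transport the module structure.\<close>

lemma prelie_module_cong:
 assumes "prelie_module W X b bm" and eq: "!!m w. m \<in> car X ==> w \<in> car W ==> bm m w = bm' m w"
 shows "prelie_module W X b bm'"
proof -
 interpret prelie_module W X b bm by fact
 show ?thesis
 proof
  show "bm' \<in> bihom X W X"
  proof (rule bihomI)
   show "bm' m \<in> hom W X" if "m \<in> car X" for m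
    by (rule hom_cong[OF bm_right[OF that] eq[OF that] vW])
   show "(%m. bm' m w) \<in> hom X X" if "w \<in> car W" for w
    by (rule hom_cong[OF bm_left[OF that] eq[OF _ that] vX])
  qed
  show "bm' (bm' m y) z + bm' m (b z y) = bm' (bm' m z) y + bm' m (b y z)"
   if "m \<in> car X" "y \<in> car W" "z \<in> car W" for m y z
   using module[OF that] that by (simp add: bm_car b_car flip: eq)
 qed (use vW vX b_bihom prelie in auto)
qed

locale op_alg =
 fixes P :: "('k::field, 'p::ab_group_add) operad" and V :: "('k, 'v::ab_group_add) vs"
 assumes op: "is_operad P" and vV: "vspace V"
begin

lemma vP: "vspace (ocar P n)"
 and P_comp: "1 \<le> i ==> i \<le> m ==> ocomp P m n i \<in> bihom (ocar P m) (ocar P n) (ocar P (m + n - 1))"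
 and P_act: "\<sigma> permutes {1..n} ==> oact P n \<sigma> \<in> hom (ocar P n) (ocar P n)"
 and P_unit: "ounit P \<in> car (ocar P 1)"
 and P_unit_right: "p \<in> car (ocar P n) ==> 1 \<le> i ==> i \<le> n ==> ocomp P n 1 i p (ounit P) = p"
 and P_unit_left: "p \<in> car (ocar P n) ==> ocomp P 1 n 1 (ounit P) p = p"
 and P_id: "p \<in> car (ocar P n) ==> oact P n id p = p"
 using op by (simp_all add: is_operad_def)

lemma P_seq: "p \<in> car (ocar P l) ==> q \<in> car (ocar P m) ==> r \<in> car (ocar P n) ==>
  1 \<le> i ==> i \<le> l ==> 1 \<le> j ==> j \<le> m ==>
  ocomp P (l + m - 1) n (i - 1 + j) (ocomp P l m i p q) r = ocomp P l (m + n - 1) i p (ocomp P m n j q r)"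
 using op by (simp only: is_operad_def)

lemma P_par: "p \<in> car (ocar P l) ==> q \<in> car (ocar P m) ==> r \<in> car (ocar P n) ==>
  1 \<le> i ==> i < j ==> j \<le> l ==>
  ocomp P (l + m - 1) n (j + m - 1) (ocomp P l m i p q) r = ocomp P (l + n - 1) m i (ocomp P l n j p r) q"
 using op by (simp only: is_operad_def)

lemma P_equiv: "p \<in> car (ocar P m) ==> q \<in> car (ocar P n) ==> 1 \<le> i ==> i \<le> m ==>
  \<sigma> permutes {1..m} ==> \<tau> permutes {1..n} ==>
  ocomp P m n i (oact P m \<sigma> p) (oact P n \<tau> q) = oact P (m + n - 1) (pcomp m n i \<sigma> \<tau>) (ocomp P m n (\<sigma> i) p q)"
 using op by (simp only: is_operad_def)

lemmas P_comp_car = bihom_car[OF P_comp] and P_act_car = hom_car[OF P_act]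

lemma P_module: "right_module (ocar P) (ocomp P) (oact P) P"
proof (rule right_module.intro)
 show "ocomp P m n i \<in> bihom (ocar P m) (ocar P n) (ocar P (m + n - 1))"
  "ocomp P m n i \<in> bihom (ocar P m) (ocar P n) (ocar P (m + n - 1))"
  if "1 \<le> i" "i \<le> m" for m n i using P_comp[OF that] by auto
qed (fact vP P_act P_id P_seq P_par P_equiv)+

abbreviation "Q \<equiv> operad_tens P (coendo V)"
abbreviation "MT n \<equiv> tens (ocar P n) (tpow V n)"
abbreviation "pu n \<equiv> pure (ocar P n) (tpow V n)"
definition "mT m n i = tmap2 (ocar P (m + n - 1)) (tpow V (m + n - 1)) (ocomp P m n i) (%t g. tins V i g t)"
definition "aT n \<sigma> = tmap (ocar P n) (tpow V n) (oact P n \<sigma>) (tperm V n \<sigma>)"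

sublocale FM: right_module MT mT aT Q
 using tens_right_module[OF P_module tpow_right_module[OF vV]] by (simp add: mT_def[abs_def] aT_def[abs_def])

lemma Q_module: "right_module (ocar Q) (ocomp Q) (oact Q) Q"
 using tens_right_module[OF P_module coendo_right_module[OF vV]] by (simp add: operad_tens_simps)

abbreviation "F \<equiv> free_alg P V"
abbreviation "fc \<equiv> fcls P V"
abbreviation "W \<equiv> coinv Q"

lemmas pu_bihom = pure_bihom[OF vP vspace_tpow]
lemmas pu_car = bihom_car[OF pu_bihom]

lemma aT_pu: "\<sigma> permutes {1..n} ==> p \<in> car (ocar P n) ==> t \<in> car (tpow V n) ==>
  aT n \<sigma> (pu n p t) = pu n (oact P n \<sigma> p) (tperm V n \<sigma> t)"
 unfolding aT_def by (rule tmap_pure[OF vP vspace_tpow vP vspace_tpow P_act tperm_hom[OF vV]])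

lemma mT_pu: "1 \<le> i ==> i \<le> m ==> p \<in> car (ocar P m) ==> t \<in> car (tpow V m) ==>
  q \<in> car (ocar P n) ==> f \<in> car (ocar (coendo V) n) ==>
  mT m n i (pu m p t) (pure (ocar P n) (ocar (coendo V) n) q f) = pu (m + n - 1) (ocomp P m n i p q) (tins V i f t)"
 unfolding mT_def
 by (rule tmap2_pure[OF vP vspace_tpow vP vspace_coendo vP vspace_tpow P_comp tins_bihom[OF vV]])

lemma tperm_inv: "\<sigma> permutes {1..n} ==> t \<in> car (tpow V n) ==> tperm V n \<sigma> (tperm V n (inv \<sigma>) t) = t"
 by (rule tpow_hom_eqI[OF vV hom_comp[OF tperm_hom[OF vV] tperm_hom[OF vV]] hom_id])
  (auto simp: tperm_tword[OF vV] permutes_inv words_lperm wordsD(1) lperm_inv)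

lemma tperm_inv': "\<sigma> permutes {1..n} ==> t \<in> car (tpow V n) ==> tperm V n (inv \<sigma>) (tperm V n \<sigma> t) = t"
 by (rule tpow_hom_eqI[OF vV hom_comp[OF tperm_hom[OF vV] tperm_hom[OF vV]] hom_id])
  (auto simp: tperm_tword[OF vV] permutes_inv words_lperm wordsD(1) lperm_inv')

text \<open>The relations of the free algebra are those of coinvariants for the diagonal action,
  stated on words and with the permutation moved to the tensor factor. Equality of spans makes the
  two quotients equal.\<close>

lemma fr_rel_span: "module.span psc (fr_rel P V n) = module.span psc (crel MT aT n)"
proof -
 interpret module "psc :: 'k => (('p \<times> ('v list \<Rightarrow>\<^sub>0 'k)) \<Rightarrow>\<^sub>0 'k) => _"
  using vspace_module[OF vspace_tens] by (metis scl_tens)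
 have 1: "fr_rel P V n \<subseteq> crel MT aT n"
 proof
  fix r assume "r \<in> fr_rel P V n"
  then obtain p \<sigma> xs where r: "r = pu n (oact P n \<sigma> p) (tword V xs) - pu n p (tperm V n (inv \<sigma>) (tword V xs))"
   "p \<in> car (ocar P n)" "\<sigma> permutes {1..n}" "xs \<in> words V n" by (auto simp: fr_rel_def)
  let ?t = "tperm V n (inv \<sigma>) (tword V xs)"
  have t: "?t \<in> car (tpow V n)" by (rule hom_car[OF tperm_hom[OF vV permutes_inv[OF r(3)]] tword_car[OF r(4)]])
  have "r = aT n \<sigma> (pu n p ?t) - pu n p ?t"
   using r aT_pu[OF r(3,2) t] tperm_inv[OF r(3) tword_car[OF r(4)]] by simp
  then show "r \<in> crel MT aT n" using pu_car[OF r(2) t] r(3) by (auto simp: crel_def)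
 qed
 have fr_car: "fr_rel P V n \<subseteq> car (MT n)" using 1 FM.R_car by blast
 have 2: "crel MT aT n \<subseteq> span (fr_rel P V n)"
 proof
  fix r assume "r \<in> crel MT aT n"
  then obtain y \<sigma> where r: "r = aT n \<sigma> y - y" "y \<in> car (MT n)" "\<sigma> permutes {1..n}" by (auto simp: crel_def)
  let ?q = "qproj (MT n) (fr_rel P V n)"
  note qh = qproj_hom[OF vspace_tens, of "ocar P n" "tpow V n" "fr_rel P V n"]
  note h = hom_comp[OF qh FM.ma_hom[OF r(3)]]
  have "?q (aT n \<sigma> y) = ?q y"
  proof (rule tens_hom_eqI[OF vP vspace_tpow h qh _ r(2)])
   fix p t assume p: "p \<in> car (ocar P n)" and t: "t \<in> car (tpow V n)"
   show "?q (aT n \<sigma> (pu n p t)) = ?q (pu n p t)"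
   proof (rule tpow_hom_eqI[OF vV hom_comp[OF h bihom_right[OF pu_bihom p]] hom_comp[OF qh bihom_right[OF pu_bihom p]] _ t])
    fix xs assume xs: "xs \<in> words V n"
    \<comment> \<open>The defining relation to use is the one for the word
      \<open>lperm \<sigma> xs\<close>, which the inverse permutation takes back to
      \<open>xs\<close>.\<close>
    have i: "tperm V n (inv \<sigma>) (tword V (lperm \<sigma> xs)) = tword V xs"
     using tperm_inv'[OF r(3) tword_car[OF xs]] tperm_tword[OF vV r(3) xs] by simp
    have e: "aT n \<sigma> (pu n p (tword V xs)) = pu n (oact P n \<sigma> p) (tword V (lperm \<sigma> xs))"
     using aT_pu[OF r(3) p tword_car[OF xs]] tperm_tword[OF vV r(3) xs] by simp
    have "aT n \<sigma> (pu n p (tword V xs)) - pu n p (tword V xs) \<in> fr_rel P V n"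
     unfolding fr_rel_def e using p r(3) words_lperm[OF xs r(3)]
     by (auto intro!: exI[of _ p] exI[of _ \<sigma>] exI[of _ "lperm \<sigma> xs"] simp: i)
    then show "?q (aT n \<sigma> (pu n p (tword V xs))) = ?q (pu n p (tword V xs))"
     by (intro qproj_eqI[OF vspace_tens]) (simp add: span_base)
   qed
  qed
  then have "?q r = 0" unfolding r(1) by (simp add: qproj_diff vspace_tens)
  then show "r \<in> span (fr_rel P V n)" using qproj_eq_0_iff[OF vspace_vs[OF vspace_tens]] by (metis scl_tens)
 qed
 show ?thesis
  using 1 2 by (intro equalityI span_minimal subspace_span) (auto intro: span_base)
qed

lemma free_alg_eq: "F = cinv MT aT"
 unfolding free_alg_def cinv_def
 by (intro arg_cong[where f = dsum] ext quot_span_cong) (simp add: fr_rel_span)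

lemma fc_eq: "fc n p t = ccl MT aT n (pu n p t)"
 unfolding fcls_def ccl_def using qproj_span_cong[of "MT n" "fr_rel P V n" "crel MT aT n"] fr_rel_span by simp

lemma vF: "vspace F"
 unfolding free_alg_eq by (rule FM.vX)

lemma fc_bihom: "fc n \<in> bihom (ocar P n) (tpow V n) F"
 unfolding fc_eq[abs_def] free_alg_eq
 by (intro bihomI hom_comp[OF FM.cl_hom] bihom_left[OF pu_bihom] bihom_right[OF pu_bihom])

lemmas fc_car = bihom_car[OF fc_bihom]

lemma fc_act:
 assumes "p \<in> car (ocar P n)" "t \<in> car (tpow V n)" "\<sigma> permutes {1..n}"
 shows "fc n (oact P n \<sigma> p) (tperm V n \<sigma> t) = fc n p t"
 unfolding fc_eq ccl_def aT_pu[OF assms(3,1,2), symmetric] FM.pr_ma[OF pu_car[OF assms(1,2)] assms(3)] ..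

lemma F_eqI:
 assumes f: "f \<in> hom F C" and g: "g \<in> hom F C"
  and e: "!!n p xs. p \<in> car (ocar P n) ==> xs \<in> words V n ==> f (fc n p (tword V xs)) = g (fc n p (tword V xs))"
  and a: "a \<in> car F"
 shows "f a = g a"
proof (rule FM.X_eqI[OF f[unfolded free_alg_eq] g[unfolded free_alg_eq] _ a[unfolded free_alg_eq]])
 note fh = hom_comp[OF f[unfolded free_alg_eq] FM.cl_hom] and gh = hom_comp[OF g[unfolded free_alg_eq] FM.cl_hom]
 fix n x assume x: "x \<in> car (MT n)"
 show "f (FM.cl n x) = g (FM.cl n x)"
 proof (rule tens_hom_eqI[OF vP vspace_tpow fh gh _ x])
  fix p t assume p: "p \<in> car (ocar P n)" and t: "t \<in> car (tpow V n)"
  show "f (FM.cl n (pu n p t)) = g (FM.cl n (pu n p t))"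
   by (rule tpow_hom_eqI[OF vV hom_comp[OF fh bihom_right[OF pu_bihom p]] hom_comp[OF gh bihom_right[OF pu_bihom p]] _ t])
    (use e[OF p] in "simp add: fc_eq")
 qed
qed

lemma W_eqI:
 assumes f: "f \<in> hom W C" and g: "g \<in> hom W C"
  and e: "!!n q h. q \<in> car (ocar P n) ==> h \<in> car (ocar (coendo V) n) ==>
   f (FM.clQ n (pure (ocar P n) (ocar (coendo V) n) q h)) = g (FM.clQ n (pure (ocar P n) (ocar (coendo V) n) q h))"
  and w: "w \<in> car W"
 shows "f w = g w"
proof (rule FM.W_eqI[OF f g _ w])
 fix n x assume x: "x \<in> car (ocar Q n)"
 show "f (FM.clQ n x) = g (FM.clQ n x)"
 proof (rule tens_hom_eqI[OF vP vspace_coendo])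
  show "(%x. f (FM.clQ n x)) \<in> hom (tens (ocar P n) (ocar (coendo V) n)) C"
   "(%x. g (FM.clQ n x)) \<in> hom (tens (ocar P n) (ocar (coendo V) n)) C"
   using hom_comp[OF f FM.clQ_hom[of n]] hom_comp[OF g FM.clQ_hom[of n]] by (simp_all only: operad_tens_simps)
 qed (use e x in "simp_all add: operad_tens_simps")
qed

lemma fact_gen:
 assumes p: "p \<in> car (ocar P m)" and t: "t \<in> car (tpow V m)"
  and q: "q \<in> car (ocar P n)" and h: "h \<in> car (ocar (coendo V) n)"
 shows "FM.cl (m + n - 1) (FM.SM m n (pu m p t) (pure (ocar P n) (ocar (coendo V) n) q h)) =
  (\<Sum>i=1..m. fc (m + n - 1) (ocomp P m n i p q) (tins V i h t))"
proof -
 have "FM.SM m n (pu m p t) (pure (ocar P n) (ocar (coendo V) n) q h) =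
  (\<Sum>i=1..m. pu (m + n - 1) (ocomp P m n i p q) (tins V i h t))"
  unfolding FM.SM_def by (rule sum.cong[OF refl]) (use mT_pu[OF _ _ p t q h] in simp)
 moreover have "FM.cl (m + n - 1) (\<Sum>i=1..m. pu (m + n - 1) (ocomp P m n i p q) (tins V i h t)) =
  (\<Sum>i=1..m. FM.cl (m + n - 1) (pu (m + n - 1) (ocomp P m n i p q) (tins V i h t)))"
 proof (rule hom_sum[OF FM.cl_hom vspace_tens])
  fix i assume "i \<in> {1..m}"
  then have "1 \<le> i" "i \<le> m" by auto
  then show "pu (m + n - 1) (ocomp P m n i p q) (tins V i h t) \<in> car (MT (m + n - 1))"
   by (intro pu_car P_comp_car p q bihom_car[OF tins_bihom[OF vV] t h])
 qed
 ultimately show ?thesis by (simp add: fc_eq)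
qed

text \<open>\<open>fact\<close> is a formula in the coefficients of the chosen representatives,
  \<open>FM.bm\<close> an operation on classes. They meet because a representative is the
  combination of pure tensors given by its own coefficients (\<open>tens_eq\<close>).\<close>

lemma fact_eq:
 assumes a: "a \<in> car F" and w: "w \<in> car W"
 shows "FM.bm a w = fact P V a w"
proof -
 have a': "a \<in> car FM.X" using a by (simp add: free_alg_eq)
 let ?s = "scl F"
 have "FM.bm a w = (\<Sum>m\<in>pkeys a. \<Sum>n\<in>pkeys w.
   FM.cl (m + n - 1) (FM.SM m n (plookup a m) (plookup w n)))"
  by (rule FM.bm_superset[OF a' w]) simp_all
 also have "\<dots> = fact P V a w"
  unfolding fact_def Let_def
 proof (intro sum.cong refl)
  fix k n
  let ?x = "plookup a k" and ?y = "plookup w n"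
  have x: "?x \<in> car (MT k)" by (rule FM.X_lookup[OF a'])
  have y: "?y \<in> car (tens (ocar P n) (ocar (coendo V) n))" using FM.W_lookup[OF w, of n] by (simp add: operad_tens_simps)
  have y': "?y \<in> car (ocar Q n)" by (rule FM.W_lookup[OF w])
  note Sb = FM.SM_bihom[of k n]
  note h1 = hom_comp[OF FM.cl_hom bihom_left[OF Sb y'], folded free_alg_eq]
  have "FM.cl (k + n - 1) (FM.SM k n ?x ?y) =
    FM.cl (k + n - 1) (FM.SM k n (lext (scl (MT k)) (%(p, t). pu k p t) ?x) ?y)"
   using tens_eq[OF x] by simp
  also have "\<dots> = lext ?s (%z. FM.cl (k + n - 1) (FM.SM k n ((%(p, t). pu k p t) z) ?y)) ?x"
   by (rule hom_lext[OF h1 vspace_tens]) (use tens_keys[OF vP vspace_tpow x] in "auto intro!: pu_car")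
  also have "\<dots> = lext ?s (%(p, t). lext ?s (%(q, f). \<Sum>i=1..k. fc (k + n - 1) (ocomp P k n i p q) (tins V i f t)) ?y) ?x"
  proof (rule lext_cong)
   fix z assume "z \<in> pkeys ?x"
   then obtain p t where z: "z = (p, t)" "p \<in> car (ocar P k)" "t \<in> car (tpow V k)"
    using tens_keys[OF vP vspace_tpow x] by blast
   note h2 = hom_comp[OF FM.cl_hom bihom_right[OF Sb pu_car[OF z(2,3)]], folded free_alg_eq, unfolded operad_tens_simps]
   let ?pq = "pure (ocar P n) (ocar (coendo V) n)"
   have "FM.cl (k + n - 1) (FM.SM k n (pu k p t) ?y) =
    FM.cl (k + n - 1) (FM.SM k n (pu k p t) (lext (scl (tens (ocar P n) (ocar (coendo V) n))) (%(q, f). ?pq q f) ?y))"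
    using tens_eq[OF y] by simp
   also have "\<dots> = lext ?s (%z. FM.cl (k + n - 1) (FM.SM k n (pu k p t) ((%(q, f). ?pq q f) z))) ?y"
    by (rule hom_lext[OF h2 vspace_tens]) (use tens_keys[OF vP vspace_coendo y] in "auto intro!: pure_car[OF vP vspace_coendo]")
   also have "\<dots> = lext ?s (%(q, f). \<Sum>i=1..k. fc (k + n - 1) (ocomp P k n i p q) (tins V i f t)) ?y"
   proof (rule lext_cong)
    fix z' assume "z' \<in> pkeys ?y"
    then obtain q f where z': "z' = (q, f)" "q \<in> car (ocar P n)" "f \<in> car (ocar (coendo V) n)"
     using tens_keys[OF vP vspace_coendo y] by blast
    show "FM.cl (k + n - 1) (FM.SM k n (pu k p t) ((%(q, f). ?pq q f) z')) =
     (case z' of (q, f) => \<Sum>i=1..k. fc (k + n - 1) (ocomp P k n i p q) (tins V i f t))"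
     unfolding z'(1) prod.case by (rule fact_gen[OF z(2,3) z'(2,3)])
   qed
   finally show "FM.cl (k + n - 1) (FM.SM k n ((%(p, t). pu k p t) z) ?y) =
    (case z of (p, t) => lext ?s (%(q, f). \<Sum>i=1..k. fc (k + n - 1) (ocomp P k n i p q) (tins V i f t)) ?y)"
    unfolding z(1) prod.case .
  qed
  finally show "FM.cl (k + n - 1) (FM.SM k n ?x ?y) =
   lext ?s (%(p, t). lext ?s (%(q, f). \<Sum>i=1..k. fc (k + n - 1) (ocomp P k n i p q) (tins V i f t)) ?y) ?x" .
 qed
 finally show ?thesis .
qed

lemma fact_module: "prelie_module W F (coinv_prod Q) (fact P V)"
 using prelie_module_cong[OF FM.cinv_prelie_module[OF Q_module, folded free_alg_eq] fact_eq] .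

lemma fact_bihom: "fact P V \<in> bihom F W F"
 by (rule prelie_module.bm_bihom[OF fact_module])

lemma fact_fc:
 assumes "p \<in> car (ocar P m)" "t \<in> car (tpow V m)" "q \<in> car (ocar P n)" "h \<in> car (ocar (coendo V) n)"
 shows "fact P V (fc m p t) (FM.clQ n (pure (ocar P n) (ocar (coendo V) n) q h)) =
  (\<Sum>i=1..m. fc (m + n - 1) (ocomp P m n i p q) (tins V i h t))"
proof -
 have c: "pure (ocar P n) (ocar (coendo V) n) q h \<in> car (ocar Q n)"
  using pure_car[OF vP vspace_coendo assms(3,4)] by (simp add: operad_tens_simps)
 show ?thesis
  using fact_eq[OF fc_car[OF assms(1,2)] hom_car[OF FM.clQ_hom c]] FM.bm_cl[OF pu_car[OF assms(1,2)] c]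
   fact_gen[OF assms] by (simp add: fc_eq)
qed

subsection \<open>Iterated partial compositions\<close>

text \<open>The parameter \<open>d\<close> counts the inputs to the right of those still to be
  filled. It grows by the arity of each grafted operation, so the arity of \<open>p\<close> is
  always \<open>length rs + d\<close>.\<close>

definition "RC d p rs = rcompose P (length rs + d) p rs"
definition "rvalid rs \<longleftrightarrow> (\<forall>(m, q)\<in>set rs. q \<in> car (ocar P m))"
abbreviation "msum rs \<equiv> sum_list (map fst rs)"

lemma RC_simps [simp]:
 "RC d p [] = p"
 "RC d p ((m, q) # rs) = RC (d + m) (ocomp P (Suc (length rs + d)) m (Suc (length rs)) p q) rs"
 by (simp_all add: RC_def add.assoc)

lemma rvalid_simps [simp]:
 "rvalid []" "rvalid ((m, q) # rs) \<longleftrightarrow> q \<in> car (ocar P m) \<and> rvalid rs"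
 "rvalid (rs @ ss) \<longleftrightarrow> rvalid rs \<and> rvalid ss" "rvalid (rev rs) \<longleftrightarrow> rvalid rs"
 by (auto simp: rvalid_def)

lemma P_comp_car': "p \<in> car (ocar P l) ==> q \<in> car (ocar P m) ==> 1 \<le> i ==> i \<le> l ==> N = l + m - 1 ==>
  ocomp P l m i p q \<in> car (ocar P N)"
 using P_comp_car by simp

lemma RC_car: "rvalid rs ==> p \<in> car (ocar P (length rs + d)) ==> RC d p rs \<in> car (ocar P (msum rs + d))"
proof (induction rs arbitrary: d p)
 case (Cons r rs)
 obtain m q where r: "r = (m, q)" by (cases r)
 have "RC (d + m) (ocomp P (Suc (length rs + d)) m (Suc (length rs)) p q) rs \<in> car (ocar P (msum rs + (d + m)))"
  by (rule Cons.IH) (use Cons.prems r in "auto intro!: P_comp_car'")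
 then show ?case by (simp add: r ac_simps)
qed simp

lemma RC_hom: "rvalid rs ==> (%p. RC d p rs) \<in> hom (ocar P (length rs + d)) (ocar P (msum rs + d))"
proof (induction rs arbitrary: d)
 case (Cons r rs)
 obtain m q where r: "r = (m, q)" by (cases r)
 have q: "q \<in> car (ocar P m)" "rvalid rs" using Cons.prems r by auto
 have "(%p. ocomp P (Suc (length rs + d)) m (Suc (length rs)) p q) \<in> hom (ocar P (Suc (length rs + d))) (ocar P (length rs + (d + m)))"
  using bihom_left[OF P_comp[of "Suc (length rs)" "Suc (length rs + d)" m] q(1)] by (simp add: add.assoc)
 from hom_comp[OF Cons.IH[OF q(2)] this] show ?case by (simp add: r ac_simps)
qed (simp add: hom_id)

text \<open>\<open>r\<close> sits to the right of all inputs filled from \<open>B\<close>, so the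
  parallel axiom moves it past each grafting; its place \<open>length B + j\<close> becomes
  \<open>msum B + j\<close> once they are filled.\<close>

lemma RC_comp:
 "rvalid B ==> p \<in> car (ocar P (length B + d)) ==> r \<in> car (ocar P n) ==> 1 \<le> j ==> j \<le> d ==>
  ocomp P (msum B + d) n (msum B + j) (RC d p B) r = RC (d + n - 1) (ocomp P (length B + d) n (length B + j) p r) B"
proof (induction B arbitrary: d p j)
 case (Cons b B)
 obtain m q where b: "b = (m, q)" by (cases b)
 have q: "q \<in> car (ocar P m)" "rvalid B" using Cons.prems b by auto
 let ?l = "Suc (length B + d)"
 have p: "p \<in> car (ocar P ?l)" using Cons.prems by simp
 have pq: "ocomp P ?l m (Suc (length B)) p q \<in> car (ocar P (length B + (d + m)))"
  by (rule P_comp_car'[OF p q(1)]) auto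
 have "ocomp P (msum B + (d + m)) n (msum B + (m + j)) (RC (d + m) (ocomp P ?l m (Suc (length B)) p q) B) r =
  RC (d + m + n - 1) (ocomp P (length B + (d + m)) n (length B + (m + j)) (ocomp P ?l m (Suc (length B)) p q) r) B"
  by (rule Cons.IH[OF q(2) pq]) (use Cons.prems in auto)
 also have "ocomp P (length B + (d + m)) n (length B + (m + j)) (ocomp P ?l m (Suc (length B)) p q) r =
  ocomp P (Suc (length B + (d + n - 1))) m (Suc (length B)) (ocomp P ?l n (Suc (length B + j)) p r) q"
 proof -
  have e: "?l + m - 1 = length B + (d + m)" "Suc (length B + j) + m - 1 = length B + (m + j)"
   "?l + n - 1 = Suc (length B + (d + n - 1))" using Cons.prems(4,5) by auto
  show ?thesis
   using P_par[OF p q(1) Cons.prems(3), of "Suc (length B)" "Suc (length B + j)"] Cons.prems(4,5)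
   unfolding e by auto
 qed
 also have "d + m + n - 1 = d + n - 1 + m" using Cons.prems(4,5) by auto
 finally show ?case by (simp add: b ac_simps)
qed simp

text \<open>Filling a slot with the unit keeps it open. The composite is thus a fixed operation with
  \<open>q\<close> grafted at one place, which shows linearity and equivariance in \<open>q\<close>.
  Lists being reversed, \<open>B\<close> holds the inputs before the slot.\<close>

lemma RC_slot:
 assumes "rvalid A" "rvalid B" "q \<in> car (ocar P m)" "p \<in> car (ocar P (Suc (length A + length B + d)))"
 shows "RC d p (A @ (m, q) # B) =
  ocomp P (Suc (msum A + msum B + d)) m (Suc (msum B)) (RC d p (A @ (1, ounit P) # B)) q"
 using assms
proof (induction A arbitrary: d p)
 case Nil
 then have p: "p \<in> car (ocar P (length B + Suc d))" by simp
 have "ocomp P (msum B + Suc d) m (msum B + 1) (RC (Suc d) p B) q =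
  RC (Suc d + m - 1) (ocomp P (length B + Suc d) m (length B + 1) p q) B"
  by (rule RC_comp) (use Nil p in auto)
 moreover have "ocomp P (Suc (length B + d)) (Suc 0) (Suc (length B)) p (ounit P) = p"
  using P_unit_right[of p "Suc (length B + d)" "Suc (length B)"] p by simp
 ultimately show ?case by simp
next
 case (Cons a A)
 obtain k r where a: "a = (k, r)" by (cases a)
 let ?p = "ocomp P (Suc (length A + Suc (length B) + d)) k (Suc (length A + Suc (length B))) p r"
 have "?p \<in> car (ocar P (Suc (length A + length B + (d + k))))"
  by (rule P_comp_car') (use Cons.prems a in auto)
 then have "RC (d + k) ?p (A @ (m, q) # B) =
  ocomp P (Suc (msum A + msum B + (d + k))) m (Suc (msum B)) (RC (d + k) ?p (A @ (1, ounit P) # B)) q"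
  using Cons.prems a by (intro Cons.IH) auto
 then show ?case by (simp add: a ac_simps)
qed

lemma RC_unit_car:
 assumes "rvalid A" "rvalid B" "p \<in> car (ocar P (Suc (length A + length B + d)))"
 shows "RC d p (A @ (1, ounit P) # B) \<in> car (ocar P (Suc (msum A + msum B + d)))"
 using RC_car[of "A @ (1, ounit P) # B" p d] assms P_unit by simp

lemma RC_graft_first:
 "rvalid Y ==> rvalid B ==> q \<in> car (ocar P (length Y + e)) ==> p \<in> car (ocar P (Suc (length B + d))) ==>
  RC (e + d) (ocomp P (Suc (length B + d)) (length Y + e) (Suc (length B)) p q) (Y @ B) =
  RC (msum Y + e + d) (ocomp P (Suc (length B + d)) (msum Y + e) (Suc (length B)) p (RC e q Y)) B"
proof (induction Y arbitrary: q e)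
 case (Cons y Y)
 obtain m r where y: "y = (m, r)" by (cases y)
 have r: "r \<in> car (ocar P m)" "rvalid Y" using Cons.prems y by auto
 let ?q = "ocomp P (Suc (length Y + e)) m (Suc (length Y)) q r"
 have q: "q \<in> car (ocar P (Suc (length Y + e)))" using Cons.prems by simp
 have qr: "?q \<in> car (ocar P (length Y + (e + m)))" by (rule P_comp_car'[OF q r(1)]) auto
 have e: "Suc (length B + d) + Suc (length Y + e) - 1 = Suc (length Y + length B + (e + d))"
  "Suc (length B) - 1 + Suc (length Y) = Suc (length Y + length B)"
  "Suc (length Y + e) + m - 1 = length Y + (e + m)" by auto
 have "ocomp P (Suc (length Y + length B + (e + d))) m (Suc (length Y + length B))
   (ocomp P (Suc (length B + d)) (Suc (length Y + e)) (Suc (length B)) p q) r =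
  ocomp P (Suc (length B + d)) (length Y + (e + m)) (Suc (length B)) p ?q"
  using P_seq[OF Cons.prems(4) q r(1), of "Suc (length B)" "Suc (length Y)"] unfolding e by auto
 then show ?case
  using Cons.IH[OF r(2) Cons.prems(2) qr Cons.prems(4)] by (simp add: y ac_simps)
qed simp

text \<open>Associativity of full composition in one slot: the sequential axiom lets
  \<open>q\<close> absorb the operations \<open>Y\<close>, and the parallel axiom moves
  \<open>q\<close> past the later inputs \<open>A\<close>.\<close>

lemma RC_graft:
 assumes "rvalid A" "rvalid Y" "rvalid B" "q \<in> car (ocar P (length Y))" "p \<in> car (ocar P (Suc (length A + length B + d)))"
 shows "RC d (ocomp P (Suc (length A + length B + d)) (length Y) (Suc (length B)) p q) (A @ Y @ B) =
  RC d p (A @ (msum Y, RC 0 q Y) # B)"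
 using assms
proof (induction A arbitrary: d p)
 case Nil
 then show ?case using RC_graft_first[of Y B q 0 p d] by (simp add: add.commute)
next
 case (Cons a A)
 obtain k r where a: "a = (k, r)" by (cases a)
 have r: "r \<in> car (ocar P k)" "rvalid A" using Cons.prems a by auto
 let ?l = "Suc (Suc (length A + length B + d))"
 have p: "p \<in> car (ocar P ?l)" using Cons.prems by simp
 let ?p = "ocomp P ?l k (Suc (Suc (length A + length B))) p r"
 have pr: "?p \<in> car (ocar P (Suc (length A + length B + (d + k))))"
  by (rule P_comp_car'[OF p r(1)]) auto
 have e: "?l + length Y - 1 = Suc (length A + (length Y + length B) + d)"
  "Suc (Suc (length A + length B)) + length Y - 1 = Suc (length A + (length Y + length B))"
  "?l + k - 1 = Suc (length A + length B + (d + k))" by auto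
 have "ocomp P (Suc (length A + (length Y + length B) + d)) k (Suc (length A + (length Y + length B)))
   (ocomp P ?l (length Y) (Suc (length B)) p q) r =
  ocomp P (Suc (length A + length B + (d + k))) (length Y) (Suc (length B)) ?p q"
  using P_par[OF p Cons.prems(4) r(1), of "Suc (length B)" "Suc (Suc (length A + length B))"] unfolding e by auto
 then show ?case
  using Cons.IH[OF r(2) Cons.prems(2-4) pr] by (simp add: a ac_simps)
qed

lemma RC_units: "p \<in> car (ocar P (n + d)) ==> RC d p (replicate n (1, ounit P)) = p"
proof (induction n arbitrary: d)
 case (Suc n)
 have "ocomp P (Suc (n + d)) (Suc 0) (Suc n) p (ounit P) = p"
  using P_unit_right[of p "Suc (n + d)" "Suc n"] Suc.prems by simp
 then show ?case using Suc.IH[of "Suc d"] Suc.prems by simp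
qed simp

end

subsection \<open>Concatenation of tensors\<close>

abbreviation tcat2 :: "('k::field, 'v::ab_group_add) vs => ('v list \<Rightarrow>\<^sub>0 'k) => ('v list \<Rightarrow>\<^sub>0 'k) => ('v list \<Rightarrow>\<^sub>0 'k)" where
 "tcat2 V t u \<equiv> lext psc (%xs. lext psc (%ys. tword V (xs @ ys)) u) t"

lemma words_append: "xs \<in> words V m ==> ys \<in> words V n ==> xs @ ys \<in> words V (m + n)"
 by (auto simp: words_def)

lemma
 assumes V: "vspace V"
 shows tcat2_tword: "xs \<in> words V m ==> ys \<in> words V n ==> tcat2 V (tword V xs) (tword V ys) = tword V (xs @ ys)"
  and tcat2_bihom: "tcat2 V \<in> bihom (tpow V m) (tpow V n) (tpow V (m + n))"
proof -
 let ?C = "tpow V (m + n)" and ?I = "%xs u. lext psc (%ys. tword V (xs @ ys)) u"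
 have m1: "mlin V n ?C (%ys. tword V (xs @ ys))" if xs: "xs \<in> words V m" for xs
 proof (rule mlinI)
  fix ys i assume ys: "ys \<in> words V n" and i: "i < n"
  show "(%x. tword V (xs @ ys[i := x])) \<in> hom V ?C"
   using mlin_hom[OF tword_mlin words_append[OF xs ys], of "m + i"] i wordsD(1)[OF xs]
   by (simp add: list_update_append)
 qed (use tword_car[OF words_append[OF xs]] in auto)
 note I = tpow_lext[OF V vspace_tpow m1, simplified] tpow_lext_hom[OF V vspace_tpow m1, simplified]
 have m2: "mlin V m ?C (%xs. ?I xs u)" if u: "u \<in> car (tpow V n)" for u
 proof (rule mlinI)
  fix xs i assume xs: "xs \<in> words V m" and i: "i < m"
  have "(%x. lext (scl ?C) (%ys. tword V ((xs @ ys)[i := x])) u) \<in> hom V ?C"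
   by (rule hom_Lext[OF vspace_tpow], rule mlin_hom[OF tword_mlin words_append[OF xs tpow_keys[OF V u]]]) (use i in auto)
  then show "(%x. ?I (xs[i := x]) u) \<in> hom V ?C"
   using i wordsD(1)[OF xs] by (simp add: list_update_append)
 qed (rule hom_car[OF I(2) u])
 show "tcat2 V (tword V xs) (tword V ys) = tword V (xs @ ys)" if "xs \<in> words V m" "ys \<in> words V n"
  using tpow_lext[OF V vspace_tpow m2[OF tword_car[OF that(2)]] that(1)] I(1)[OF that] by simp
 show "tcat2 V \<in> bihom (tpow V m) (tpow V n) ?C"
 proof (rule bihomI)
  show "tcat2 V t \<in> hom (tpow V n) ?C" if t: "t \<in> car (tpow V m)" for t
   using hom_Lext[OF vspace_tpow I(2)[OF tpow_keys[OF V t]], of t "%x. x"] by simp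
 qed (use tpow_lext_hom[OF V vspace_tpow m2] in simp)
qed

lemma tcat2_car: "vspace V ==> t \<in> car (tpow V m) ==> u \<in> car (tpow V n) ==> tcat2 V t u \<in> car (tpow V (m + n))"
 by (rule bihom_car[OF tcat2_bihom])

lemma tcat2_assoc:
 assumes V: "vspace V" and t: "t \<in> car (tpow V l)" and u: "u \<in> car (tpow V m)" and v: "v \<in> car (tpow V n)"
 shows "tcat2 V (tcat2 V t u) v = tcat2 V t (tcat2 V u v)"
proof -
 let ?C = "tpow V (l + (m + n))"
 note lm = tcat2_bihom[OF V, of l m] and mn = tcat2_bihom[OF V, of m n]
  and lm_n = tcat2_bihom[OF V, of "l + m" n] and l_mn = tcat2_bihom[OF V, of l "m + n"]
 note L = hom_comp[OF bihom_left[OF lm_n] bihom_left[OF lm]] hom_comp[OF bihom_left[OF lm_n] bihom_right[OF lm]] bihom_right[OF lm_n]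
 note R = bihom_left[OF l_mn] hom_comp[OF bihom_right[OF l_mn] bihom_left[OF mn]] hom_comp[OF bihom_right[OF l_mn] bihom_right[OF mn]]
 note w = tword_car and c = tcat2_car[OF V]
 show ?thesis
 proof (rule tpow_hom_eqI[OF V _ _ _ t, where C = ?C and f = "%t. tcat2 V (tcat2 V t u) v"])
  fix xs assume xs: "xs \<in> words V l"
  show "tcat2 V (tcat2 V (tword V xs) u) v = tcat2 V (tword V xs) (tcat2 V u v)"
  proof (rule tpow_hom_eqI[OF V _ _ _ u, where C = ?C and f = "%u. tcat2 V (tcat2 V (tword V xs) u) v"])
   fix ys assume ys: "ys \<in> words V m"
   show "tcat2 V (tcat2 V (tword V xs) (tword V ys)) v = tcat2 V (tword V xs) (tcat2 V (tword V ys) v)"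
    by (rule tpow_hom_eqI[OF V _ _ _ v, where C = ?C and f = "%v. tcat2 V (tcat2 V (tword V xs) (tword V ys)) v"])
     (use L(3)[OF w[OF words_append[OF xs ys]]] R(3)[OF w[OF xs] w[OF ys]] tcat2_tword[OF V words_append[OF xs ys]]
      tcat2_tword[OF V xs words_append[OF ys]] in "simp_all add: tcat2_tword[OF V xs ys] tcat2_tword[OF V ys] add.assoc")
  qed (use L(2)[OF v w[OF xs]] R(2)[OF w[OF xs] v] in "simp_all add: add.assoc")
 qed (use L(1) R(1) u v c in "auto simp: add.assoc")
qed

text \<open>Permuting the middle factor permutes the whole word by the same \<open>pcomp\<close>
  that \<open>P_equiv\<close> yields when the operation grafted at that place is permuted. This
  agreement makes \<open>fop\<close> well defined.\<close>

lemma tcat2_tperm: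
 assumes V: "vspace V" and a: "a \<in> car (tpow V k)" and t: "t \<in> car (tpow V m)" and b: "b \<in> car (tpow V l)"
  and s: "\<sigma> permutes {1..m}"
 shows "tcat2 V a (tcat2 V (tperm V m \<sigma> t) b) =
  tperm V (k + (m + l)) (pcomp (Suc (k + l)) m (Suc k) id \<sigma>) (tcat2 V a (tcat2 V t b))"
proof -
 let ?C = "tpow V (k + (m + l))" and ?r = "pcomp (Suc (k + l)) m (Suc k) id \<sigma>"
 note ml = tcat2_bihom[OF V, of m l] and k_ml = tcat2_bihom[OF V, of k "m + l"] and p = tperm_hom[OF V s]
 have r: "?r permutes {1..k + (m + l)}"
  using pcomp_permutes[OF _ _ permutes_id s, of "Suc k" "Suc (k + l)"] by (simp add: ac_simps)
 note pr = tperm_hom[OF V r] and w = tword_car and c = tcat2_car[OF V]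
 note L = bihom_left[OF k_ml] hom_comp[OF bihom_right[OF k_ml] hom_comp[OF bihom_left[OF ml] p]]
  hom_comp[OF bihom_right[OF k_ml] bihom_right[OF ml]]
 note L' = L(1) hom_comp[OF bihom_right[OF k_ml] bihom_left[OF ml]] L(3)
 \<comment> \<open>Concatenation is viewed as inserting \<open>ys\<close> into a word with a
   placeholder, here \<open>undefined\<close>, at place \<open>k + 1\<close>.\<close>
 have e: "xs @ lperm \<sigma> ys @ zs = lperm ?r (xs @ ys @ zs)" if "length xs = k" "length ys = m" "length zs = l" for xs ys zs :: "'b list"
  using lperm_ins[of "Suc k" "xs @ undefined # zs" id \<sigma> ys] that s by (simp add: ins_def permutes_id)
 show ?thesis
 proof (rule tpow_hom_eqI[OF V _ _ _ a, where C = ?C and f = "%a. tcat2 V a (tcat2 V (tperm V m \<sigma> t) b)"])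
  fix xs assume xs: "xs \<in> words V k"
  show "tcat2 V (tword V xs) (tcat2 V (tperm V m \<sigma> t) b) = tperm V (k + (m + l)) ?r (tcat2 V (tword V xs) (tcat2 V t b))"
  proof (rule tpow_hom_eqI[OF V _ _ _ t, where C = ?C and f = "%t. tcat2 V (tword V xs) (tcat2 V (tperm V m \<sigma> t) b)"])
   fix ys assume ys: "ys \<in> words V m"
   note ys' = words_lperm[OF ys s]
   show "tcat2 V (tword V xs) (tcat2 V (tperm V m \<sigma> (tword V ys)) b) =
    tperm V (k + (m + l)) ?r (tcat2 V (tword V xs) (tcat2 V (tword V ys) b))"
    unfolding tperm_tword[OF V s ys]
   proof (rule tpow_hom_eqI[OF V _ _ _ b, where C = ?C and f = "%b. tcat2 V (tword V xs) (tcat2 V (tword V (lperm \<sigma> ys)) b)"])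
    fix zs assume zs: "zs \<in> words V l"
    note ws = words_append[OF xs words_append[OF ys zs]]
    show "tcat2 V (tword V xs) (tcat2 V (tword V (lperm \<sigma> ys)) (tword V zs)) =
     tperm V (k + (m + l)) ?r (tcat2 V (tword V xs) (tcat2 V (tword V ys) (tword V zs)))"
     unfolding tcat2_tword[OF V ys zs] tcat2_tword[OF V ys' zs] tcat2_tword[OF V xs words_append[OF ys zs]]
      tcat2_tword[OF V xs words_append[OF ys' zs]] tperm_tword[OF V r ws] e[OF xs[THEN wordsD(1)] ys[THEN wordsD(1)] zs[THEN wordsD(1)]] ..
   qed (rule L(3)[OF w[OF xs] w[OF ys']] hom_comp[OF pr L'(3)[OF w[OF xs] w[OF ys]]])+
  qed (rule L(2)[OF w[OF xs] b] hom_comp[OF pr L'(2)[OF w[OF xs] b]])+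
 qed (rule L(1)[OF c[OF hom_car[OF p t] b]] hom_comp[OF pr L'(1)[OF c[OF t b]]])+
qed

lemma tcat2_unit: "vspace V ==> t \<in> car (tpow V n) ==> tcat2 V (tword V []) t = t"
 by (rule tpow_hom_eqI[OF _ _ hom_id, where f = "%t. tcat2 V (tword V []) t"])
  (use bihom_right[OF tcat2_bihom[of V], of "tword V []" 0 n] tword_car[of "[]" V 0] tcat2_tword[of V "[]" 0] in "auto simp: words_def")

lemma tcat_append:
 assumes V: "vspace V"
 shows "list_all2 (%t m. t \<in> car (tpow V m)) ts ms ==> u \<in> car (tpow V n) ==>
  tcat V ts \<in> car (tpow V (sum_list ms)) \<and> foldr (tcat2 V) ts u = tcat2 V (tcat V ts) u"
proof (induction ts ms rule: list_all2_induct)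
 case Nil
 then show ?case using tcat2_unit[OF V] tword_car[of "[]" V 0] by (auto simp: words_def)
next
 case (Cons t ts m ms)
 then show ?case using tcat2_assoc[OF V Cons(1) conjunct1[OF Cons(3)] Cons(4)] tcat2_car[OF V Cons(1)] by simp
qed

lemma tcat_foldr: "tcat V (ts @ us) = foldr (tcat2 V) ts (tcat V us)"
 by (induction ts) simp_all

lemma tcat_tword:
 assumes V: "vspace V"
 shows "\<forall>xs\<in>set xss. set xs \<subseteq> car V ==> tcat V (map (tword V) xss) = tword V (concat xss)"
proof (induction xss)
 case (Cons xs xss)
 then show ?case
  using tcat2_tword[OF V, of xs "length xs" "concat xss" "length (concat xss)"] by (auto simp: words_def)
qed simp

subsection \<open>The operations of the free algebra\<close>

lemma dsum_lift:
 assumes v: "!!n. vspace (A n)" and vC: "vspace C" and h: "!!n. h n \<in> hom (A n) C"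
 shows "(%w. \<Sum>n\<in>pkeys w. h n (plookup w n)) \<in> hom (dsum A) C"
proof -
 let ?h = "%w. \<Sum>n\<in>pkeys w. h n (plookup w n)"
 have e: "?h w = (\<Sum>n\<in>B. h n (plookup w n))" if "finite B" "pkeys w \<subseteq> B" for w B
  by (rule sum.mono_neutral_left) (use that hom_0[OF h v] in "auto simp: in_keys_iff")
 have l: "w \<in> car (dsum A) ==> plookup w n \<in> car (A n)" for w n by (simp add: dsum_def)
 show ?thesis
 proof (rule homI)
  show "?h w \<in> car C" if "w \<in> car (dsum A)" for w using that l hom_car[OF h] by (intro car_sum vC) auto
 next
  fix w w' assume w: "w \<in> car (dsum A)" "w' \<in> car (dsum A)"
  let ?B = "pkeys w \<union> pkeys w'"
  show "?h (w + w') = ?h w + ?h w'"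
   using e[of ?B w] e[of ?B w'] e[of ?B "w + w'"] keys_add[of w w'] hom_add[OF h l[OF w(1)] l[OF w(2)]]
   by (simp add: lookup_add sum.distrib)
 next
  fix c w assume w: "w \<in> car (dsum A)"
  have k: "pkeys (scl (dsum A) c w) \<subseteq> pkeys w"
   using scl_0[OF v] by (auto simp: in_keys_iff lookup_scl_dsum[OF v])
  have "scl C c (\<Sum>n\<in>pkeys w. h n (plookup w n)) =
    (\<Sum>n\<in>pkeys w. scl C c (h n (plookup w n)))"
   using module.scale_sum_right[OF vspace_module[OF vC]] by blast
  then show "?h (scl (dsum A) c w) = scl C c (?h w)"
   using e[OF _ k] hom_scl[OF h l[OF w]] by (simp add: lookup_scl_dsum[OF v])
 qed
qed

context op_alg
begin

text \<open>The conditions under which a map on representatives \<open>(p, t)\<close> descends to the free algebra in one argument.\<close>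

definition "slot C \<psi> \<longleftrightarrow> (\<forall>m. (%p t. \<psi> m (p, t)) \<in> bihom (ocar P m) (tpow V m) C \<and>
 (\<forall>p\<in>car (ocar P m). \<forall>t\<in>car (tpow V m). \<forall>\<sigma>. \<sigma> permutes {1..m} \<longrightarrow>
   \<psi> m (oact P m \<sigma> p, tperm V m \<sigma> t) = \<psi> m (p, t)))"

text \<open>The two conditions in \<open>slot\<close> match the two quotients: bilinearity handles
  the tensor product, invariance under the diagonal action the coinvariants.\<close>

lemma
 assumes vC: "vspace C" and s: "slot C \<psi>"
 shows slot_lift_hom: "(%a. \<Sum>m\<in>pkeys a. lext (scl C) (\<psi> m) (plookup a m)) \<in> hom F C"
  and slot_lift_fc: "p \<in> car (ocar P n) ==> t \<in> car (tpow V n) ==>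
   (\<Sum>m\<in>pkeys (fc n p t). lext (scl C) (\<psi> m) (plookup (fc n p t) m)) = \<psi> n (p, t)"
proof -
 have b: "(%p t. \<psi> m (p, t)) \<in> bihom (ocar P m) (tpow V m) C" for m using s by (simp add: slot_def)
 note h = lext_tens_hom[OF vP vspace_tpow vC b, simplified] and hp = lext_pure[OF vP vspace_tpow vC b, simplified]
 have r: "lext (scl C) (\<psi> m) r = 0" if rr: "r \<in> FM.R m" for r m
 proof -
  obtain \<sigma> y where r: "r = aT m \<sigma> y - y" and y: "y \<in> car (MT m)" and p: "\<sigma> permutes {1..m}"
   using rr by (auto simp: crel_def)
  have "lext (scl C) (\<psi> m) (aT m \<sigma> y) = lext (scl C) (\<psi> m) y"
  proof (rule tens_hom_eqI[OF vP vspace_tpow hom_comp[OF h FM.ma_hom[OF p]] h _ y])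
   fix q t assume "q \<in> car (ocar P m)" "t \<in> car (tpow V m)"
   then show "lext (scl C) (\<psi> m) (aT m \<sigma> (pu m q t)) = lext (scl C) (\<psi> m) (pu m q t)"
    using s p by (simp add: aT_pu hp P_act_car hom_car[OF tperm_hom[OF vV p]] slot_def)
  qed
  then show ?thesis unfolding r using hom_diff[OF h vspace_tens hom_car[OF FM.ma_hom[OF p] y] y] by simp
 qed
 show "(%a. \<Sum>m\<in>pkeys a. lext (scl C) (\<psi> m) (plookup a m)) \<in> hom F C"
  unfolding free_alg_eq cinv_def
  by (rule dsum_lift[OF vspace_quot[OF vspace_tens] vC]) (rule quot_hom[OF vspace_tens FM.R_car h])
 assume p: "p \<in> car (ocar P n)" and t: "t \<in> car (tpow V n)"
 have "lext (scl C) (\<psi> n) (FM.pr n (pu n p t)) = \<psi> n (p, t)"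
  using quot_lift[OF h vspace_tens vC FM.R_car r pu_car[OF p t]] hp[OF p t] by simp
 \<comment> \<open>A zero class has no keys and gives an empty sum, hence the case
   distinction.\<close>
 then show "(\<Sum>m\<in>pkeys (fc n p t). lext (scl C) (\<psi> m) (plookup (fc n p t) m)) = \<psi> n (p, t)"
  by (cases "FM.pr n (pu n p t) = 0") (simp_all add: fc_eq ccl_def lext_def)
qed

definition "gvalid zs \<longleftrightarrow> (\<forall>(m, p, t)\<in>set zs. p \<in> car (ocar P m) \<and> t \<in> car (tpow V m))"

lemma gvalid_simps [simp]:
 "gvalid []" "gvalid ((m, p, t) # zs) \<longleftrightarrow> p \<in> car (ocar P m) \<and> t \<in> car (tpow V m) \<and> gvalid zs"
 "gvalid (zs @ zs') \<longleftrightarrow> gvalid zs \<and> gvalid zs'"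
 by (simp_all add: gvalid_def ball_Un)

lemma F_keys: "a \<in> car F ==> x \<in> pkeys (plookup a m) ==> gvalid [(m, x)]"
 using tens_keys[OF vP vspace_tpow FM.X_lookup[of a m, folded free_alg_eq]] by (auto simp: gvalid_def)

lemma gvalid_ConsI: "gvalid [z] ==> gvalid zs ==> gvalid (z # zs)"
 by (simp add: gvalid_def)

lemma mlext_cong:
 "set as \<subseteq> car F ==> (!!zs. gvalid zs ==> length zs = length as ==> \<phi> zs = \<phi>' zs) ==> mlext s \<phi> as = mlext s \<phi>' as"
proof (induction as arbitrary: \<phi> \<phi>')
 case (Cons a as)
 have "mlext s (%zs. \<phi> ((m, x) # zs)) as = mlext s (%zs. \<phi>' ((m, x) # zs)) as"
  if "x \<in> pkeys (plookup a m)" for m x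
  by (rule Cons.IH) (use Cons.prems gvalid_ConsI[OF F_keys[OF _ that]] in auto)
 then show ?case by (auto intro!: sum.cong lext_cong)
qed simp

lemma mlext_hom:
 "vspace C ==> set as \<subseteq> car F ==> (!!zs. gvalid zs ==> length zs = length as ==> (%y. \<phi> y zs) \<in> hom D C) ==>
  (%y. mlext (scl C) (\<phi> y) as) \<in> hom D C"
proof (induction as arbitrary: \<phi>)
 case (Cons a as)
 have "(%y. mlext (scl C) (%zs. \<phi> y ((m, x) # zs)) as) \<in> hom D C"
  if "x \<in> pkeys (plookup a m)" for m x
  by (rule Cons.IH) (use Cons.prems gvalid_ConsI[OF F_keys[OF _ that]] in auto)
 then show ?case using Cons.prems(1) by (auto intro!: hom_Sum hom_Lext)
qed simp

text \<open>The functions on lists of representatives that descend to the free algebra in every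
  argument. For these \<open>mlext\<close> is multilinear (\<open>mlext_mlin\<close>) and has the
  expected values on generators (\<open>mlext_gen\<close>).\<close>

definition "good n \<phi> \<longleftrightarrow> (\<forall>zs. gvalid zs \<and> length zs = n \<longrightarrow> \<phi> zs \<in> car F) \<and>
 (\<forall>zs zs'. gvalid zs \<and> gvalid zs' \<and> Suc (length zs + length zs') = n \<longrightarrow> slot F (%m x. \<phi> (zs @ (m, x) # zs')))"

lemma goodD:
 "good n \<phi> ==> gvalid zs ==> length zs = n ==> \<phi> zs \<in> car F"
 "good n \<phi> ==> gvalid zs ==> gvalid zs' ==> Suc (length zs + length zs') = n ==> slot F (%m x. \<phi> (zs @ (m, x) # zs'))"
 by (simp_all add: good_def)

lemma good_Cons:
 assumes "good (Suc n) \<phi>" "gvalid [z]"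
 shows "good n (%zs. \<phi> (z # zs))"
 unfolding good_def
proof (intro conjI allI impI)
 show "\<phi> (z # zs) \<in> car F" if "gvalid zs \<and> length zs = n" for zs
  using goodD(1)[OF assms(1) gvalid_ConsI[OF assms(2)], of zs] that by simp
 show "slot F (%m x. \<phi> (z # zs @ (m, x) # zs'))" if "gvalid zs \<and> gvalid zs' \<and> Suc (length zs + length zs') = n" for zs zs'
  using goodD(2)[OF assms(1) gvalid_ConsI[OF assms(2)], of zs zs'] that by simp
qed

lemma good_slot:
 assumes g: "good (Suc n) \<phi>" and as: "as \<in> words F n"
 shows "slot F (%m x. mlext (scl F) (%zs. \<phi> ((m, x) # zs)) as)"
proof -
 have as': "set as \<subseteq> car F" "length as = n" using as by (auto simp: words_def)
 have s: "slot F (%m x. \<phi> ((m, x) # zs))" if "gvalid zs" "length zs = length as" for zs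
  using goodD(2)[OF g gvalid_simps(1) that(1)] that as' by simp
 show ?thesis
  unfolding slot_def
 proof (intro conjI allI ballI impI bihomI)
  show "(%t. mlext (scl F) (%zs. \<phi> ((m, p, t) # zs)) as) \<in> hom (tpow V m) F" if "p \<in> car (ocar P m)" for m p
   by (rule mlext_hom[OF vF as'(1)], rule bihom_right[where f = "%p t. \<phi> ((m, p, t) # _)"]) (use s that in "auto simp: slot_def")
  show "(%p. mlext (scl F) (%zs. \<phi> ((m, p, t) # zs)) as) \<in> hom (ocar P m) F" if "t \<in> car (tpow V m)" for m t
   by (rule mlext_hom[OF vF as'(1)], rule bihom_left[where f = "%p t. \<phi> ((m, p, t) # _)"]) (use s that in "auto simp: slot_def")
  show "mlext (scl F) (%zs. \<phi> ((m, oact P m \<sigma> p, tperm V m \<sigma> t) # zs)) as = mlext (scl F) (%zs. \<phi> ((m, p, t) # zs)) as"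
   if "p \<in> car (ocar P m)" "t \<in> car (tpow V m)" "\<sigma> permutes {1..m}" for m p t \<sigma>
   by (rule mlext_cong[OF as'(1)]) (use s that in "auto simp: slot_def")
 qed
qed

lemma mlext_mlin: "good n \<phi> ==> mlin F n F (mlext (scl F) \<phi>)"
proof (induction n arbitrary: \<phi>)
 case 0
 then show ?case by (auto simp: mlin_def words_def good_def)
next
 case (Suc n)
 show ?case
 proof (rule mlinI)
  fix bs assume "bs \<in> words F (Suc n)"
  then obtain a as where bs: "bs = a # as" and a: "a \<in> car F" and as: "as \<in> words F n"
   by (cases bs) (auto simp: words_def)
  note h = slot_lift_hom[OF vF good_slot[OF Suc.prems as]]
  show "mlext (scl F) \<phi> bs \<in> car F" using hom_car[OF h a] by (simp add: bs)
  fix i assume i: "i < Suc n"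
  show "(%x. mlext (scl F) \<phi> (bs[i := x])) \<in> hom F F"
  proof (cases i)
   case 0
   then show ?thesis using h by (simp add: bs)
  next
   case (Suc j)
   then show ?thesis using i unfolding bs
    by (auto intro!: hom_Sum hom_Lext vF mlin_hom[OF Suc.IH[OF good_Cons[OF Suc.prems F_keys[OF a]]] as])
  qed
 qed
qed

lemma mlext_gen: "good (length zs) \<phi> ==> gvalid zs ==> mlext (scl F) \<phi> (map (%(m, p, t). fc m p t) zs) = \<phi> zs"
proof (induction zs arbitrary: \<phi>)
 case (Cons z zs)
 obtain m p t where z: "z = (m, p, t)" by (cases z)
 have c: "map (%(m, p, t). fc m p t) zs \<in> words F (length zs)"
  using Cons.prems(2) by (auto simp: words_def gvalid_def intro: fc_car)
 have g: "good (Suc (length zs)) \<phi>" using Cons.prems(1) by simp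
 have v: "p \<in> car (ocar P m)" "t \<in> car (tpow V m)" "gvalid zs" using Cons.prems(2) z by auto
 show ?case
  using slot_lift_fc[OF vF good_slot[OF g c] v(1,2)] Cons.IH[OF good_Cons[OF g] v(3), of z] v by (simp add: z)
qed simp

end

lemma lperm_map:
 assumes "\<sigma> permutes {1..length xs}"
 shows "lperm \<sigma> (map f xs) = map f (lperm \<sigma> xs)"
proof (rule nth_equalityI)
 fix k assume "k < length (lperm \<sigma> (map f xs))"
 then have k: "k < length xs" by simp
 then have "\<sigma> (Suc k) - 1 < length xs" using permutes_bounds[OF assms, of "Suc k"] by auto
 then show "lperm \<sigma> (map f xs) ! k = map f (lperm \<sigma> xs) ! k" using k by (simp add: nth_lperm)
qed simp

lemma mlin_app:
 assumes V: "vspace V" and m: "mlin V n C \<Phi>" and "set pre \<subseteq> car V" "set post \<subseteq> car V" "n = Suc (length pre + length post)"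
 shows "(%a. \<Phi> (pre @ a # post)) \<in> hom V C"
proof -
 have "pre @ 0 # post \<in> words V n" using assms car_0[OF V] by (auto simp: words_def)
 from mlin_hom[OF m this, of "length pre"] show ?thesis using assms(5) by simp
qed

lemma mlinI_app:
 assumes "!!as. as \<in> words V n ==> \<Phi> as \<in> car C"
  and "!!pre post. set pre \<subseteq> car V ==> set post \<subseteq> car V ==> n = Suc (length pre + length post) ==> (%a. \<Phi> (pre @ a # post)) \<in> hom V C"
 shows "mlin V n C \<Phi>"
proof (rule mlinI[OF assms(1)])
 fix as i assume as: "as \<in> words V n" and i: "i < n"
 have "set (take i as) \<subseteq> car V" "set (drop (Suc i) as) \<subseteq> car V"
  using as set_take_subset[of i as] set_drop_subset[of "Suc i" as] by (simp_all add: words_def subset_trans)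
 from assms(2)[OF this] show "(%a. \<Phi> (as[i := a])) \<in> hom V C"
  using i wordsD(1)[OF as] by (simp add: upd_conv_take_nth_drop)
qed

lemma mlin_section:
 assumes "vspace V" "mlin V N C \<Phi>" "set pre \<subseteq> car V" "set post \<subseteq> car V" "N = length pre + n + length post"
 shows "mlin V n C (%as. \<Phi> (pre @ as @ post))"
proof (rule mlinI_app)
 show "\<Phi> (pre @ as @ post) \<in> car C" if "as \<in> words V n" for as
  by (rule mlin_car[OF assms(2)]) (use assms that in "auto simp: words_def")
 show "(%a. \<Phi> (pre @ (pre' @ a # post') @ post)) \<in> hom V C"
  if "set pre' \<subseteq> car V" "set post' \<subseteq> car V" "n = Suc (length pre' + length post')" for pre' post'
  using mlin_app[OF assms(1,2), of "pre @ pre'" "post' @ post"] that assms(3-) by simp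
qed

lemma mlin_hom_comp: "mlin V n B \<Phi> ==> h \<in> hom B C ==> mlin V n C (%as. h (\<Phi> as))"
 unfolding mlin_def using hom_comp[of h B C] by (auto simp: hom_car)

section \<open>The operations of the free algebra and their composition\<close>

context op_alg
begin

abbreviation "mq \<equiv> map (%(m, q, t). (m, q))"
abbreviation "tt \<equiv> map (%(m, q, t). t)"
abbreviation "gs \<equiv> map (%(m, q, t). fc m q t)"

lemma gvalid_mq: "gvalid zs ==> rvalid (mq zs)"
 by (induction zs) (auto simp: gvalid_def rvalid_def)

lemma fst_mq [simp]: "fst \<circ> (%(m, q, t). (m, q)) = fst"
 by auto

lemma msum_mq: "msum (rev (mq zs)) = (msum zs :: nat)"
 by (induction zs) auto

lemma gvalid_tt: "gvalid zs ==> list_all2 (%t m. t \<in> car (tpow V m)) (tt zs) (map fst zs)"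
 by (induction zs) (auto simp: gvalid_def)

lemma tcat_tt:
 assumes "gvalid zs"
 shows "tcat V (tt zs) \<in> car (tpow V (msum zs))"
  and "gvalid zs' ==> tcat V (tt zs @ tt zs') = tcat2 V (tcat V (tt zs)) (tcat V (tt zs'))"
  and "gvalid zs' ==> t \<in> car (tpow V m) ==> tcat V (tt zs @ t # tt zs') = tcat2 V (tcat V (tt zs)) (tcat2 V t (tcat V (tt zs')))"
proof -
 note a = tcat_append[OF vV gvalid_tt]
 have c: "tcat V (tt zs) \<in> car (tpow V (msum zs))" if "gvalid zs" for zs
  using a[OF that tword_car[of "[]" V 0]] by (simp add: words_def)
 show "tcat V (tt zs) \<in> car (tpow V (msum zs))" by (rule c[OF assms])
 show "tcat V (tt zs @ tt zs') = tcat2 V (tcat V (tt zs)) (tcat V (tt zs'))" if "gvalid zs'"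
  unfolding tcat_foldr using a[OF assms c[OF that]] by blast
 show "tcat V (tt zs @ t # tt zs') = tcat2 V (tcat V (tt zs)) (tcat2 V t (tcat V (tt zs')))"
  if "gvalid zs'" "t \<in> car (tpow V m)"
  unfolding tcat_foldr using a[OF assms tcat2_car[OF vV that(2) c[OF that(1)]]] by simp
qed

definition "fopg p n zs = fc (msum zs) (rcompose P n p (rev (mq zs))) (tcat V (tt zs))"

lemma fopg_RC: "length zs = n ==> fopg p n zs = fc (msum zs) (RC 0 p (rev (mq zs))) (tcat V (tt zs))"
 by (simp add: fopg_def RC_def)

lemma RC_mq_car: "gvalid zs ==> p \<in> car (ocar P (length zs)) ==> RC 0 p (rev (mq zs)) \<in> car (ocar P (msum zs))"
 using RC_car[of "rev (mq zs)" p 0] gvalid_mq by (simp add: msum_mq del: sum_list_rev)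

text \<open>\<open>RC_slot\<close> and associativity of concatenation isolate one argument as a
  grafting at a fixed place and an insertion into a fixed word. A permutation of that argument acts
  on both through the same \<open>pcomp\<close>, which the coinvariants identify.\<close>

lemma fopg_good:
 assumes p: "p \<in> car (ocar P n)"
 shows "good n (fopg p n)"
 unfolding good_def
proof (intro conjI allI impI)
 show "fopg p n zs \<in> car F" if "gvalid zs \<and> length zs = n" for zs
  using that p by (auto simp: fopg_RC intro!: fc_car RC_mq_car tcat_tt)
 fix zs zs' assume z: "gvalid zs \<and> gvalid zs' \<and> Suc (length zs + length zs') = n"
 let ?A = "rev (mq zs')" and ?B = "rev (mq zs)" and ?k = "msum zs" and ?l = "msum zs'"
 let ?Y = "RC 0 p (?A @ (1, ounit P) # ?B)" and ?N = "Suc (msum zs + msum zs')"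
 let ?a = "tcat V (tt zs)" and ?b = "tcat V (tt zs')"
 have v: "rvalid ?A" "rvalid ?B" using z gvalid_mq by auto
 have ms: "msum ?A = ?l" "msum ?B = ?k" by (rule msum_mq)+
 have pn: "p \<in> car (ocar P (Suc (length ?A + length ?B + 0)))" using p z by (simp add: add.commute)
 have Y: "?Y \<in> car (ocar P ?N)" using RC_unit_car[OF v pn] by (simp add: ms add.commute)
 have a: "?a \<in> car (tpow V ?k)" and b: "?b \<in> car (tpow V ?l)" using z tcat_tt(1) by auto
 have e: "fopg p n (zs @ (m, q, t) # zs') = fc (?k + (m + ?l)) (ocomp P ?N m (Suc ?k) ?Y q) (tcat2 V ?a (tcat2 V t ?b))"
  if "q \<in> car (ocar P m)" "t \<in> car (tpow V m)" for m q t
  using RC_slot[OF v that(1) pn] z tcat_tt(3)[OF _ _ that(2), of zs zs'] by (simp add: fopg_RC ms add.commute)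
 have N: "?N + m - 1 = ?k + (m + ?l)" for m by simp
 have cb: "ocomp P ?N m (Suc ?k) \<in> bihom (ocar P ?N) (ocar P m) (ocar P (?k + (m + ?l)))" for m
  using P_comp[of "Suc ?k" ?N m] by (simp add: ac_simps)
 note c = bihom_right[OF cb Y]
 have th: "(%t. tcat2 V ?a (tcat2 V t ?b)) \<in> hom (tpow V m) (tpow V (?k + (m + ?l)))" for m
  by (rule hom_comp[OF bihom_right[OF tcat2_bihom[OF vV] a] bihom_left[OF tcat2_bihom[OF vV] b]])
 show "slot F (%m x. fopg p n (zs @ (m, x) # zs'))"
  unfolding slot_def
 proof (intro conjI allI ballI impI bihomI)
  fix m
  show "(%t. fopg p n (zs @ (m, q, t) # zs')) \<in> hom (tpow V m) F" if q: "q \<in> car (ocar P m)" for q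
   by (rule hom_cong[OF hom_comp[OF bihom_right[OF fc_bihom hom_car[OF c q]] th] e[OF q, symmetric] vspace_tpow])
  show "(%q. fopg p n (zs @ (m, q, t) # zs')) \<in> hom (ocar P m) F" if t: "t \<in> car (tpow V m)" for t
   by (rule hom_cong[OF hom_comp[OF bihom_left[OF fc_bihom hom_car[OF th t]] c] e[OF _ t, symmetric] vP])
  fix q t \<sigma> assume q: "q \<in> car (ocar P m)" and t: "t \<in> car (tpow V m)" and s: "\<sigma> permutes {1..m}"
  let ?r = "pcomp ?N m (Suc ?k) id \<sigma>"
  have r: "?r permutes {1..?k + (m + ?l)}"
   using pcomp_permutes[OF _ _ permutes_id s, of "Suc ?k" ?N] by (simp add: ac_simps)
  have "ocomp P ?N m (Suc ?k) ?Y (oact P m \<sigma> q) = oact P (?k + (m + ?l)) ?r (ocomp P ?N m (Suc ?k) ?Y q)"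
   using P_equiv[OF Y q _ _ permutes_id s, of "Suc ?k", unfolded N P_id[OF Y]] by simp
  then show "fopg p n (zs @ (m, oact P m \<sigma> q, tperm V m \<sigma> t) # zs') = fopg p n (zs @ (m, q, t) # zs')"
   unfolding e[OF q t] e[OF P_act_car[OF s q] hom_car[OF tperm_hom[OF vV s] t]] tcat2_tperm[OF vV a t b s]
   using fc_act[OF hom_car[OF c q] hom_car[OF th t] r] by simp
 qed
qed

lemma fop_mlext: "length as = n ==> fop P V p as = mlext (scl F) (fopg p n) as"
 by (auto simp: fop_def fopg_def[abs_def])

lemma fop_gen:
 "gvalid zs ==> p \<in> car (ocar P (length zs)) ==> fop P V p (gs zs) = fc (msum zs) (RC 0 p (rev (mq zs))) (tcat V (tt zs))"
 using fop_mlext[of "gs zs" "length zs" p] mlext_gen[OF fopg_good] by (simp add: fopg_RC)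

lemma fop_mlin: "p \<in> car (ocar P n) ==> mlin F n F (fop P V p)"
 using mlext_mlin[OF fopg_good] unfolding mlin_def by (auto simp: words_def fop_mlext)

lemmas fop_car = mlin_car[OF fop_mlin]

lemma fop_hom:
 assumes "as \<in> words F n"
 shows "(%p. fop P V p as) \<in> hom (ocar P n) F"
proof -
 have as: "set as \<subseteq> car F" "length as = n" using assms by (auto simp: words_def)
 have "(%p. fopg p n zs) \<in> hom (ocar P n) F" if z: "gvalid zs" "length zs = length as" for zs
 proof -
  have "(%p. RC 0 p (rev (mq zs))) \<in> hom (ocar P n) (ocar P (msum zs))"
   using RC_hom[of "rev (mq zs)" 0] gvalid_mq[OF z(1)] z(2) as(2) unfolding msum_mq by simp
  from hom_comp[OF bihom_left[OF fc_bihom tcat_tt(1)[OF z(1)]] this] show ?thesis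
   using z(2) as(2) by (simp add: fopg_RC)
 qed
 from mlext_hom[OF vF as(1) this] show ?thesis by (simp add: fop_mlext[OF as(2)])
qed

lemma fop_comp_gen:
 assumes xs: "gvalid xs" and ys: "gvalid ys" and zs: "gvalid zs"
  and p: "p \<in> car (ocar P (Suc (length xs + length zs)))" and q: "q \<in> car (ocar P (length ys))"
 shows "fop P V (ocomp P (Suc (length xs + length zs)) (length ys) (Suc (length xs)) p q) (gs xs @ gs ys @ gs zs) =
  fop P V p (gs xs @ fop P V q (gs ys) # gs zs)"
proof -
 let ?R = "RC 0 q (rev (mq ys))" and ?T = "tcat V (tt ys)"
 let ?pq = "ocomp P (Suc (length xs + length zs)) (length ys) (Suc (length xs)) p q"
 have R: "?R \<in> car (ocar P (msum ys))" and T: "?T \<in> car (tpow V (msum ys))"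
  using RC_mq_car[OF ys q] tcat_tt(1)[OF ys] by auto
 have pq: "?pq \<in> car (ocar P (length (xs @ ys @ zs)))" by (rule P_comp_car'[OF p q]) auto
 have "fop P V p (gs xs @ fop P V q (gs ys) # gs zs) = fop P V p (gs (xs @ (msum ys, ?R, ?T) # zs))"
  by (simp add: fop_gen[OF ys q])
 also have "\<dots> = fc (msum xs + (msum ys + msum zs)) (RC 0 p (rev (mq zs) @ (msum ys, ?R) # rev (mq xs))) (tcat V (tt xs @ ?T # tt zs))"
  using fop_gen[of "xs @ (msum ys, ?R, ?T) # zs" p] xs zs R T p by simp
 also have "RC 0 p (rev (mq zs) @ (msum ys, ?R) # rev (mq xs)) = RC 0 ?pq (rev (mq zs) @ rev (mq ys) @ rev (mq xs))"
  using RC_graft[of "rev (mq zs)" "rev (mq ys)" "rev (mq xs)" q p 0] xs ys zs gvalid_mq p q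
  unfolding msum_mq by (simp add: add.commute)
 also have "tcat V (tt xs @ ?T # tt zs) = tcat V (tt xs @ tt ys @ tt zs)"
  using tcat_tt(3)[OF xs zs T] tcat_tt(2)[OF xs, of "ys @ zs"] tcat_tt(2)[OF ys zs] ys zs by simp
 also have "fc (msum xs + (msum ys + msum zs)) (RC 0 ?pq (rev (mq zs) @ rev (mq ys) @ rev (mq xs))) (tcat V (tt xs @ tt ys @ tt zs)) =
   fop P V ?pq (gs (xs @ ys @ zs))"
  using fop_gen[of "xs @ ys @ zs" ?pq] xs ys zs pq by simp
 finally show ?thesis by simp
qed

section \<open>Reduction of identities in the free algebra to generators and to letters\<close>

definition "gens = {fc m q (tword V xs) | m q xs. q \<in> car (ocar P m) \<and> xs \<in> words V m}"

lemma gens_car: "gens \<subseteq> car F"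
 by (auto simp: gens_def intro!: fc_car tword_car)

lemma gens_gs: "set as \<subseteq> gens ==> \<exists>zs. gvalid zs \<and> as = gs zs"
proof (induction as)
 case (Cons a as)
 then obtain zs m q xs where "gvalid zs" "as = gs zs" "a = fc m q (tword V xs)" "q \<in> car (ocar P m)" "xs \<in> words V m"
  by (auto simp: gens_def)
 then show ?case by (intro exI[of _ "(m, q, tword V xs) # zs"]) (simp add: tword_car)
qed (auto intro: exI[of _ "[]"])

text \<open>Arguments are reduced one at a time: \<open>bs\<close> collects those already replaced
  by generators, \<open>cs\<close> those still arbitrary.\<close>

lemma F_mlin_eqI:
 assumes f: "mlin F n C \<Phi>" and g: "mlin F n C \<Psi>"
  and e: "!!as. set as \<subseteq> gens ==> length as = n ==> \<Phi> as = \<Psi> as" and as: "as \<in> words F n"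
 shows "\<Phi> as = \<Psi> as"
proof -
 have "\<Phi> (bs @ cs) = \<Psi> (bs @ cs)" if "set bs \<subseteq> gens" "set cs \<subseteq> car F" "length bs + length cs = n" for bs cs
  using that
 proof (induction cs arbitrary: bs)
  case Nil
  then show ?case using e by simp
 next
  case (Cons c cs)
  have b: "set bs \<subseteq> car F" using Cons.prems(1) gens_car by (rule subset_trans)
  show ?case
  proof (rule F_eqI[where f = "%a. \<Phi> (bs @ a # cs)" and C = C])
   fix n p xs assume "p \<in> car (ocar P n)" "xs \<in> words V n"
   then have "fc n p (tword V xs) \<in> gens" by (auto simp: gens_def)
   then show "\<Phi> (bs @ fc n p (tword V xs) # cs) = \<Psi> (bs @ fc n p (tword V xs) # cs)"
    using Cons.IH[of "bs @ [fc n p (tword V xs)]"] Cons.prems by simp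
  qed (use mlin_app[OF vF f b] mlin_app[OF vF g b] Cons.prems in auto)
 qed
 from this[of "[]" as] show ?thesis using as by (simp add: words_def)
qed

text \<open>On generators this is associativity of composition in the operad and of concatenation
  (\<open>fop_comp_gen\<close>). Multilinearity then frees the arguments after the slot, those
  inside it, and finally those before it.\<close>

lemma fop_comp:
 assumes p: "p \<in> car (ocar P l)" and q: "q \<in> car (ocar P m)"
  and as: "set as \<subseteq> car F" and bs: "bs \<in> words F m" and cs: "set cs \<subseteq> car F" and l: "l = Suc (length as + length cs)"
 shows "fop P V (ocomp P l m (Suc (length as)) p q) (as @ bs @ cs) = fop P V p (as @ fop P V q bs # cs)"
proof -
 note g = gens_car[THEN subset_trans[rotated]]
 let ?pq = "%i. ocomp P l m (Suc i) p q"
 have pq: "mlin F (l + m - 1) F (fop P V (?pq i))" if "i < l" for i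
  by (rule fop_mlin[OF P_comp_car[OF _ _ p q]]) (use that in auto)
 have w: "fop P V q bs \<in> car F" if "bs \<in> words F m" for bs by (rule fop_car[OF q that])
 have 1: "fop P V (?pq (length as)) (as @ bs @ cs) = fop P V p (as @ fop P V q bs # cs)"
  if a: "set as \<subseteq> gens" and b: "set bs \<subseteq> gens" "length bs = m" and c: "set cs \<subseteq> car F" "l = Suc (length as + length cs)" for as bs cs
 proof (rule F_mlin_eqI[where C = F and n = "length cs" and \<Phi> = "%cs. fop P V (?pq (length as)) (as @ bs @ cs)"])
  show "mlin F (length cs) F (%cs. fop P V (?pq (length as)) (as @ bs @ cs))"
   using mlin_section[OF vF pq[of "length as"], of "as @ bs" "[]" "length cs"] g[OF a] g[OF b(1)] b c by simp
  have "fop P V q bs \<in> car F" using g[OF b(1)] b(2) by (intro w) (simp add: words_def)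
  then show "mlin F (length cs) F (%cs. fop P V p (as @ fop P V q bs # cs))"
   using mlin_section[OF vF fop_mlin[OF p], of "as @ [fop P V q bs]" "[]" "length cs"] g[OF a] c by simp
  show "fop P V (?pq (length as)) (as @ bs @ cs') = fop P V p (as @ fop P V q bs # cs')"
   if "set cs' \<subseteq> gens" "length cs' = length cs" for cs'
   using gens_gs[OF a] gens_gs[OF b(1)] gens_gs[OF that(1)] fop_comp_gen[of _ _ _ p q] b(2) c(2) p q that(2) by fastforce
 qed (use c in "simp add: words_def")
 have 2: "fop P V (?pq (length as)) (as @ bs @ cs) = fop P V p (as @ fop P V q bs # cs)"
  if a: "set as \<subseteq> gens" and b: "bs \<in> words F m" and c: "set cs \<subseteq> car F" "l = Suc (length as + length cs)" for as bs cs
 proof (rule F_mlin_eqI[where C = F and n = m and \<Phi> = "%bs. fop P V (?pq (length as)) (as @ bs @ cs)"])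
  show "mlin F m F (%bs. fop P V (?pq (length as)) (as @ bs @ cs))"
   by (rule mlin_section[OF vF pq[of "length as"]]) (use g[OF a] c in auto)
  show "mlin F m F (%bs. fop P V p (as @ fop P V q bs # cs))"
   by (rule mlin_hom_comp[OF fop_mlin[OF q] mlin_app[OF vF fop_mlin[OF p] g[OF a] c]])
 qed (use 1[OF a _ _ c] b in auto)
 have "fop P V (ocomp P (Suc (length as + length cs)) m (Suc (length as)) p q) (as @ bs @ cs) = fop P V p (as @ fop P V q bs # cs)"
 proof (rule F_mlin_eqI[where C = F and n = "length as" and \<Psi> = "%as. fop P V p (as @ fop P V q bs # cs)" and \<Phi> = "%as. fop P V (ocomp P (Suc (length as + length cs)) m (Suc (length as)) p q) (as @ bs @ cs)"])
  show "mlin F (length as) F (%as. fop P V (ocomp P (Suc (length as + length cs)) m (Suc (length as)) p q) (as @ bs @ cs))"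
   using mlin_section[OF vF pq[of "length as"], of "[]" "bs @ cs" "length as"] bs cs l unfolding mlin_def by (auto simp: words_def)
  show "mlin F (length as) F (%as. fop P V p (as @ fop P V q bs # cs))"
   using mlin_section[OF vF fop_mlin[OF p], of "[]" "fop P V q bs # cs" "length as"] w[OF bs] cs l by simp
  show "fop P V (ocomp P (Suc (length as' + length cs)) m (Suc (length as')) p q) (as' @ bs @ cs) = fop P V p (as' @ fop P V q bs # cs)"
   if "set as' \<subseteq> gens" "length as' = length as" for as'
   using 2[OF that(1) bs cs] l that(2) by simp
 qed (use as in "simp add: words_def")
 then show ?thesis by (simp only: l)
qed

definition "\<iota> v = fc 1 (ounit P) (tword V [v])"

lemma \<iota>_car: "v \<in> car V ==> \<iota> v \<in> car F"
 unfolding \<iota>_def by (intro fc_car P_unit tword_car) (simp add: words_def)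

lemma map_\<iota>_words: "xs \<in> words V n ==> map \<iota> xs \<in> words F n"
 using \<iota>_car by (auto simp: words_def)

text \<open>The unit operations carried by the letters disappear in the composition, so a generator
  is its operation applied to letters.\<close>

lemma fop_letters:
 assumes p: "p \<in> car (ocar P n)" and xs: "xs \<in> words V n"
 shows "fop P V p (map \<iota> xs) = fc n p (tword V xs)"
proof -
 let ?zs = "map (%v. (1, ounit P, tword V [v])) xs"
 have v: "gvalid ?zs" using xs P_unit tword_car[of "[_]" V 1] by (auto simp: gvalid_def words_def)
 have q: "mq ?zs = replicate n (1, ounit P)" "tt ?zs = map (tword V) (map (%v. [v]) xs)" "gs ?zs = map \<iota> xs"
  using xs by (simp_all add: words_def \<iota>_def[abs_def] map_replicate_const comp_def)
 have T: "tcat V (tt ?zs) = tword V xs"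
  unfolding q(2) by (subst tcat_tword[OF vV]) (use xs in "auto simp: words_def")
 have "msum ?zs = n" using xs by (simp add: words_def comp_def sum_list_triv)
 then show ?thesis
  using fop_gen[OF v, of p] RC_units[of p n 0] p xs T unfolding q by (simp add: words_def)
qed

text \<open>Each step trades the argument \<open>q.(x\<^sub>1 \<dots> x\<^sub>m)\<close> of \<open>p\<close> for the letters \<open>x\<^sub>i\<close> and \<open>p\<close> for a partial composition with \<open>q\<close>.\<close>

lemma letter_induct [consumes 2, case_names base step]:
 assumes "set as \<subseteq> gens" "p \<in> car (ocar P (length as))"
  and base: "!!n p xs. p \<in> car (ocar P n) ==> xs \<in> words V n ==> Pr p (map \<iota> xs)"
  and step: "!!m p q pre ys post. p \<in> car (ocar P (Suc (length pre + length post))) ==> q \<in> car (ocar P m) ==> ys \<in> words V m ==>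
   set pre \<subseteq> car F ==> set post \<subseteq> car F ==>
   Pr (ocomp P (Suc (length pre + length post)) m (Suc (length pre)) p q) (pre @ map \<iota> ys @ post) ==>
   Pr p (pre @ fop P V q (map \<iota> ys) # post)"
 shows "Pr p as"
 using assms(1,2)
\<comment> \<open>The measure is the number of arguments that are not letters; the letters
  introduced by a step do not count.\<close>
proof (induction "length (filter (%a. a \<notin> \<iota> ` car V) as)" arbitrary: p as rule: less_induct)
 case less
 show ?case
 proof (cases "set as \<subseteq> \<iota> ` car V")
  case True
  then have "as \<in> map \<iota> ` lists (car V)" unfolding lists_image[symmetric] by (auto simp: in_lists_conv_set)
  then obtain xs where "as = map \<iota> xs" "set xs \<subseteq> car V" by auto
  then show ?thesis using base[of p "length as" xs] less.prems by (simp add: words_def)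
 next
  case False
  then obtain a where a: "a \<in> set as" "a \<notin> \<iota> ` car V" by auto
  then obtain pre post where as: "as = pre @ a # post" by (meson split_list)
  obtain m q ys where q: "a = fc m q (tword V ys)" "q \<in> car (ocar P m)" "ys \<in> words V m"
   using less.prems(1) a by (auto simp: gens_def)
  have i: "set (map \<iota> ys) \<subseteq> \<iota> ` car V" using q(3) by (auto simp: words_def)
  have g: "\<iota> v \<in> gens" if "v \<in> car V" for v
   unfolding gens_def \<iota>_def using P_unit that by (intro CollectI exI[of _ 1] exI[of _ "ounit P"] exI[of _ "[v]"]) (auto simp: words_def)
  have z: "filter (%a. a \<notin> \<iota> ` car V) (map \<iota> ys) = []" using i by (auto simp: filter_empty_conv)
  have p: "p \<in> car (ocar P (Suc (length pre + length post)))" using less.prems(2) as by simp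
  have "Pr (ocomp P (Suc (length pre + length post)) m (Suc (length pre)) p q) (pre @ map \<iota> ys @ post)"
  proof (rule less.hyps)
   show "length (filter (%a. a \<notin> \<iota> ` car V) (pre @ map \<iota> ys @ post)) < length (filter (%a. a \<notin> \<iota> ` car V) as)"
    using a(2) z unfolding as by simp
   show "set (pre @ map \<iota> ys @ post) \<subseteq> gens" using less.prems(1) as g q(3) by (auto simp: words_def)
   show "ocomp P (Suc (length pre + length post)) m (Suc (length pre)) p q \<in> car (ocar P (length (pre @ map \<iota> ys @ post)))"
    by (rule P_comp_car'[OF p q(2)]) (use q(3) in "auto simp: words_def")
  qed
  moreover have "set pre \<subseteq> car F" "set post \<subseteq> car F"
   using subset_trans[OF less.prems(1) gens_car] unfolding as by simp_all
  ultimately show ?thesis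
   unfolding as q(1) fop_letters[OF q(2,3), symmetric] by (intro step[OF p q(2,3)])
 qed
qed

text \<open>On letters this is the defining relation of the coinvariants. In the step, grafting
  \<open>q\<close> turns a permutation of the arguments into a block permutation, to which the
  induction hypothesis applies.\<close>

lemma fop_act:
 assumes p: "p \<in> car (ocar P n)" and s: "\<sigma> permutes {1..n}" and as: "as \<in> words F n"
 shows "fop P V (oact P n \<sigma> p) (lperm \<sigma> as) = fop P V p as"
proof (rule F_mlin_eqI[OF _ fop_mlin[OF p] _ as, where \<Phi> = "%as. fop P V (oact P n \<sigma> p) (lperm \<sigma> as)"])
 show "mlin F n F (%as. fop P V (oact P n \<sigma> p) (lperm \<sigma> as))"
 proof (rule mlinI)
  fix as assume a: "as \<in> words F n"
  note m = fop_mlin[OF P_act_car[OF s p]] and a' = words_lperm[OF a s]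
  show "fop P V (oact P n \<sigma> p) (lperm \<sigma> as) \<in> car F" by (rule mlin_car[OF m a'])
  fix i assume i: "i < n"
  have "inv \<sigma> (Suc i) - 1 < n" using permutes_bounds[OF permutes_inv[OF s], of "Suc i"] i by auto
  from mlin_hom[OF m a' this] show "(%x. fop P V (oact P n \<sigma> p) (lperm \<sigma> (as[i := x]))) \<in> hom F F"
   using lperm_update[of \<sigma> as i] s i wordsD(1)[OF a] by simp
 qed
 fix as assume as: "set as \<subseteq> gens" "length as = n"
 then have "p \<in> car (ocar P (length as))" using p by simp
 \<comment> \<open>The permutation is quantified inside the induction because the step passes from
   \<open>\<sigma>\<close> to a block permutation of more inputs.\<close>
 with as(1) have "\<forall>\<sigma>. \<sigma> permutes {1..length as} \<longrightarrow> fop P V (oact P (length as) \<sigma> p) (lperm \<sigma> as) = fop P V p as"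
 proof (induction p as rule: letter_induct)
  case (base n p xs)
  have "fop P V (oact P n \<sigma> p) (lperm \<sigma> (map \<iota> xs)) = fop P V p (map \<iota> xs)" if s: "\<sigma> permutes {1..n}" for \<sigma>
  proof -
   have "lperm \<sigma> (map \<iota> xs) = map \<iota> (lperm \<sigma> xs)"
    using lperm_map[of \<sigma> xs] s wordsD(1)[OF base(2)] by simp
   then show ?thesis
    using fop_letters[OF P_act_car[OF s base(1)] words_lperm[OF base(2) s]] fop_letters[OF base]
     fc_act[OF base(1) tword_car[OF base(2)] s] tperm_tword[OF vV s base(2)] by simp
  qed
  then show ?case using wordsD(1)[OF base(2)] by simp
 next
  case (step m p q pre ys post)
  let ?l = "Suc (length pre + length post)" and ?bs = "map \<iota> ys" and ?a = "fop P V q (map \<iota> ys)"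
  let ?as = "pre @ ?a # post" and ?c = "Suc (length pre)"
  have bs: "?bs \<in> words F m" by (rule map_\<iota>_words[OF step(3)])
  have a: "?a \<in> car F" by (rule fop_car[OF step(2) bs])
  have "fop P V (oact P ?l \<sigma> p) (lperm \<sigma> ?as) = fop P V p ?as" if s: "\<sigma> permutes {1..?l}" for \<sigma>
  proof -
   \<comment> \<open>The place to which \<open>lperm \<sigma>\<close> brings the argument
     \<open>?a\<close>, so that \<open>\<sigma> i = ?c\<close>.\<close>
   define i where "i = inv \<sigma> ?c"
   have i: "1 \<le> i" "i \<le> ?l" "\<sigma> i = ?c"
    using permutes_bounds[OF permutes_inv[OF s], of ?c] permutes_inverses(1)[OF s] by (auto simp: i_def)
   let ?r = "pcomp ?l m i \<sigma> id" and ?L = "lperm \<sigma> ?as"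
   have L: "?L = take (i - 1) ?L @ ?a # drop i ?L"
    using id_take_nth_drop[of "i - 1" ?L] i nth_lperm[of "i - 1" ?as \<sigma>] by simp
   have cL: "set ?L \<subseteq> car F" using set_lperm[of \<sigma> ?as] s step(4,5) a by auto
   have ins: "ins ?c ?as ?bs = pre @ ?bs @ post" by (simp add: ins_def)
   have l: "length (pre @ ?bs @ post) = ?l + m - 1" using wordsD(1)[OF step(3)] by simp
   have "fop P V p ?as = fop P V (ocomp P ?l m ?c p q) (pre @ ?bs @ post)"
    using fop_comp[OF step(1,2,4) bs step(5)] by simp
   also have "\<dots> = fop P V (oact P (?l + m - 1) ?r (ocomp P ?l m ?c p q)) (lperm ?r (pre @ ?bs @ post))"
    using step(6) pcomp_permutes[OF i(1,2) s permutes_id, of m] unfolding l by simp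
   also have "oact P (?l + m - 1) ?r (ocomp P ?l m ?c p q) = ocomp P ?l m i (oact P ?l \<sigma> p) q"
    using P_equiv[OF step(1,2) i(1,2) s permutes_id] P_id[OF step(2)] i(3) by simp
   also have "lperm ?r (pre @ ?bs @ post) = take (i - 1) ?L @ ?bs @ drop i ?L"
    using lperm_ins[of i ?as \<sigma> id ?bs] i s wordsD(1)[OF step(3)] ins by (simp add: ins_def permutes_id)
   also have "fop P V (ocomp P ?l m i (oact P ?l \<sigma> p) q) (take (i - 1) ?L @ ?bs @ drop i ?L) = fop P V (oact P ?l \<sigma> p) (take (i - 1) ?L @ ?a # drop i ?L)"
   proof -
    have e: "Suc (length (take (i - 1) ?L)) = i" "?l = Suc (length (take (i - 1) ?L) + length (drop i ?L))" using i by auto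
    have c: "set (take (i - 1) ?L) \<subseteq> car F" "set (drop i ?L) \<subseteq> car F"
     by (rule subset_trans[OF set_take_subset cL], rule subset_trans[OF set_drop_subset cL])
    show ?thesis by (rule fop_comp[OF P_act_car[OF s step(1)] step(2) c(1) bs c(2) e(2), unfolded e(1)])
   qed
   finally show ?thesis using L by simp
  qed
  then show ?case by simp
 qed
 then show "fop P V (oact P n \<sigma> p) (lperm \<sigma> as) = fop P V p as" using s as(2) by auto
qed

end

section \<open>Derivations of the operations of the free algebra\<close>

definition dsl :: "('a => 'a) => ('a list => 'b::comm_monoid_add) => 'a list => 'b" where
 "dsl D \<Phi> as = (\<Sum>i<length as. \<Phi> (as[i := D (as ! i)]))"

lemma sum_lessThan_add: "(\<Sum>i<m + n. f i) = (\<Sum>i<m. f i) + (\<Sum>i<n. f (m + i))" for m n :: nat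
 by (induction n) (simp_all add: add.assoc)

lemma dsl_append: "dsl D \<Phi> (xs @ ys) = dsl D (%xs. \<Phi> (xs @ ys)) xs + dsl D (%ys. \<Phi> (xs @ ys)) ys"
 by (simp add: dsl_def sum_lessThan_add list_update_append nth_append)

lemma dsl_Cons: "dsl D \<Phi> (a # as) = \<Phi> (D a # as) + dsl D (%as. \<Phi> (a # as)) as"
 unfolding dsl_def by (simp only: list.size sum.lessThan_Suc_shift add_0_right add_Suc_right) simp

lemma dsl_words_cong:
 assumes D: "D \<in> hom F F" and as: "set as \<subseteq> car F" and e: "!!bs. bs \<in> words F (length as) ==> \<Phi> bs = \<Psi> bs"
 shows "dsl D \<Phi> as = dsl D \<Psi> as"
 unfolding dsl_def
 by (intro sum.cong refl e words_update hom_car[OF D]) (use as in "auto simp: words_def")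

context op_alg
begin

text \<open>An element q \<otimes> h sends the letter v to q.h(v). Its action on a generator grafts
  \<open>q\<close> and inserts \<open>h\<close> at each place in turn, which is the operation with
  one letter replaced in this way.\<close>

lemma fact_letters:
 assumes p: "p \<in> car (ocar P k)" and xs: "xs \<in> words V k" and w: "w \<in> car W"
 shows "fact P V (fop P V p (map \<iota> xs)) w = dsl (%a. fact P V a w) (fop P V p) (map \<iota> xs)"
proof -
 let ?g = "%w. dsl (%a. fact P V a w) (fop P V p) (map \<iota> xs)"
 note xw = map_\<iota>_words[OF xs]
 have lx: "length xs = k" using xs by (simp add: words_def)
 have iF: "\<iota> (xs ! i) \<in> car F" if "i < k" for i by (rule \<iota>_car[OF words_nth[OF xs that]])
 have g: "?g \<in> hom W F"
  unfolding dsl_def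
 proof (rule hom_Sum[OF vF])
  fix i assume "i \<in> {..<length (map \<iota> xs)}"
  then have i: "i < k" by (simp add: lx)
  then show "(%w. fop P V p ((map \<iota> xs)[i := fact P V (map \<iota> xs ! i) w])) \<in> hom W F"
   using hom_comp[OF mlin_hom[OF fop_mlin[OF p] xw i] bihom_right[OF fact_bihom iF[OF i]]] by (simp add: lx)
 qed
 show ?thesis
 proof (rule W_eqI[OF bihom_right[OF fact_bihom fop_car[OF p xw]] g _ w])
  fix n q h assume q: "q \<in> car (ocar P n)" and h: "h \<in> car (ocar (coendo V) n)"
  let ?w = "FM.clQ n (pure (ocar P n) (ocar (coendo V) n) q h)"
  note hh = coendo_hom[OF h]
  have l: "fact P V (\<iota> v) ?w = fc n q (h v)" if v: "v \<in> car V" for v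
  proof -
   have vw: "[v] \<in> words V 1" using v by (simp add: words_def)
   have "tinsw V 1 [v] (h v) = h v"
    by (rule tpow_hom_eqI[OF vV _ hom_id _ hom_car[OF hh v], where f = "tinsw V 1 [v]"])
     (use tinsw_hom[OF vV vw, of 1 n] tinsw_tword[OF vV vw, of 1] in "simp_all add: ins_def")
   then have "tins V 1 h (tword V [v]) = h v" using tins_tword[OF vV hh _ _ vw, of 1] by simp
   then show ?thesis
    unfolding \<iota>_def using fact_fc[OF P_unit tword_car[OF vw] q h] P_unit_left[OF q] by simp
  qed
  \<comment> \<open>The value of \<open>h\<close> at a letter need not be decomposable. The claim is
    therefore made for every tensor \<open>u\<close> and reduced to words, where
    \<open>fop_comp\<close> on letters applies.\<close>
  have key: "fc (k + n - 1) (ocomp P k n (Suc i) p q) (tinsw V (Suc i) xs u) = fop P V p ((map \<iota> xs)[i := fc n q u])"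
   if i: "i < k" and u: "u \<in> car (tpow V n)" for i u
  proof (rule tpow_hom_eqI[OF vV _ _ _ u, where C = F and f = "%u. fc (k + n - 1) (ocomp P k n (Suc i) p q) (tinsw V (Suc i) xs u)"])
   have i': "1 \<le> Suc i" "Suc i \<le> k" using i by auto
   note pq = P_comp_car[OF i' p q]
   show "(%u. fc (k + n - 1) (ocomp P k n (Suc i) p q) (tinsw V (Suc i) xs u)) \<in> hom (tpow V n) F"
    by (rule hom_comp[OF bihom_right[OF fc_bihom pq] tinsw_hom[OF vV xs i']])
   show "(%u. fop P V p ((map \<iota> xs)[i := fc n q u])) \<in> hom (tpow V n) F"
    by (rule hom_comp[OF mlin_hom[OF fop_mlin[OF p] xw i] bihom_right[OF fc_bihom q]])
   fix ys assume ys: "ys \<in> words V n"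
   have xF: "set (map \<iota> xs) \<subseteq> car F" using xw unfolding words_def by blast
   have c: "set (take i (map \<iota> xs)) \<subseteq> car F" "set (drop (Suc i) (map \<iota> xs)) \<subseteq> car F"
    by (rule subset_trans[OF set_take_subset xF], rule subset_trans[OF set_drop_subset xF])
   have "fc (k + n - 1) (ocomp P k n (Suc i) p q) (tword V (ins (Suc i) xs ys)) =
     fop P V (ocomp P k n (Suc i) p q) (map \<iota> (ins (Suc i) xs ys))"
    by (rule fop_letters[OF pq words_ins[OF xs ys i'], symmetric])
   also have "map \<iota> (ins (Suc i) xs ys) = take i (map \<iota> xs) @ map \<iota> ys @ drop (Suc i) (map \<iota> xs)"
    by (simp add: ins_def take_map drop_map)
   also have "fop P V (ocomp P k n (Suc i) p q) \<dots> = fop P V p (take i (map \<iota> xs) @ fc n q (tword V ys) # drop (Suc i) (map \<iota> xs))"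
    using fop_comp[OF p q c(1) map_\<iota>_words[OF ys] c(2)] i lx fop_letters[OF q ys] by simp
   finally show "fc (k + n - 1) (ocomp P k n (Suc i) p q) (tinsw V (Suc i) xs (tword V ys)) = fop P V p ((map \<iota> xs)[i := fc n q (tword V ys)])"
    using i lx tinsw_tword[OF vV xs i' ys] by (simp add: upd_conv_take_nth_drop)
  qed
  have "fact P V (fop P V p (map \<iota> xs)) ?w = (\<Sum>i<k. fc (k + n - 1) (ocomp P k n (Suc i) p q) (tins V (Suc i) h (tword V xs)))"
   using fact_fc[OF p tword_car[OF xs] q h] by (simp add: fop_letters[OF p xs] sum.atLeast1_atMost_eq)
  also have "\<dots> = ?g ?w"
   unfolding dsl_def length_map lx
  proof (rule sum.cong[OF refl])
   fix i assume "i \<in> {..<k}"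
   then have i: "i < k" by simp
   have v: "xs ! i \<in> car V" by (rule words_nth[OF xs i])
   show "fc (k + n - 1) (ocomp P k n (Suc i) p q) (tins V (Suc i) h (tword V xs)) = fop P V p ((map \<iota> xs)[i := fact P V (map \<iota> xs ! i) ?w])"
    using key[OF i hom_car[OF hh v]] tins_tword[OF vV hh _ _ xs, of "Suc i"] l[OF v] i lx by simp
  qed
  finally show "fact P V (fop P V p (map \<iota> xs)) ?w = ?g ?w" .
 qed
qed

text \<open>In the induction, the Leibniz sum for the composite runs over the arguments before,
  inside and after the slot. By \<open>fact_letters\<close> the inner part adds up to the action on
  the argument that fills the slot.\<close>

lemma fact_fop:
 assumes p: "p \<in> car (ocar P n)" and as: "as \<in> words F n" and w: "w \<in> car W"
 shows "fact P V (fop P V p as) w = dsl (%a. fact P V a w) (fop P V p) as"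
proof -
 let ?D = "%a. fact P V a w"
 note D = bihom_left[OF fact_bihom w]
 have d: "dsl ?D (fop P V p) as \<in> car F" if p: "p \<in> car (ocar P n)" and as: "as \<in> words F n" for p n as
  unfolding dsl_def
  by (intro car_sum[OF vF] fop_car[OF p] words_update[OF as] hom_car[OF D]) (use as in "auto simp: words_def")
 show ?thesis
 proof (rule F_mlin_eqI[OF mlin_hom_comp[OF fop_mlin[OF p] D] _ _ as])
  show "mlin F n F (dsl ?D (fop P V p))"
  proof (rule mlinI_app[OF d[OF p]])
   fix pre post assume pre: "set pre \<subseteq> car F" and post: "set post \<subseteq> car F" and n: "n = Suc (length pre + length post)"
   note m = mlin_app[OF vF fop_mlin[OF p]]
   have D': "set (bs[i := ?D (bs ! i)]) \<subseteq> car F" if "set bs \<subseteq> car F" "i < length bs" for bs i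
    using words_update[of bs F "length bs" "?D (bs ! i)" i] hom_car[OF D, of "bs ! i"] that nth_mem[of i bs] by (auto simp: words_def simp del: nth_mem)
   have "(%a. \<Sum>i<length pre. fop P V p (pre[i := ?D (pre ! i)] @ a # post)) \<in> hom F F"
    by (rule hom_Sum[OF vF], rule m[OF D'[OF pre] post]) (use n in auto)
   moreover have "(%a. fop P V p (pre @ ?D a # post)) \<in> hom F F" by (rule hom_comp[OF m[OF pre post n] D])
   moreover have "(%a. \<Sum>i<length post. fop P V p (pre @ a # post[i := ?D (post ! i)])) \<in> hom F F"
    by (rule hom_Sum[OF vF], rule m[OF pre D'[OF post]]) (use n in auto)
   ultimately show "(%a. dsl ?D (fop P V p) (pre @ a # post)) \<in> hom F F"
    unfolding dsl_append dsl_Cons unfolding dsl_def by (intro hom_plus[OF vF])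
  qed
  fix as assume as: "set as \<subseteq> gens" "length as = n"
  then have "p \<in> car (ocar P (length as))" using p by simp
  with as(1) show "?D (fop P V p as) = dsl ?D (fop P V p) as"
  proof (induction p as rule: letter_induct)
   case (base n p xs)
   then show ?case by (rule fact_letters[OF _ _ w])
  next
   case (step m p q pre ys post)
   let ?l = "Suc (length pre + length post)" and ?bs = "map \<iota> ys" and ?a = "fop P V q (map \<iota> ys)"
   let ?pq = "ocomp P ?l m (Suc (length pre)) p q"
   have bs: "?bs \<in> words F m" by (rule map_\<iota>_words[OF step(3)])
   have bs': "set ?bs \<subseteq> car F" "length ?bs = m" using bs by (simp_all add: words_def)
   note c = fop_comp[OF step(1,2)]
   have "?D (fop P V p (pre @ ?a # post)) = dsl ?D (fop P V ?pq) (pre @ ?bs @ post)"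
    using c[OF step(4) bs step(5)] step(6) by simp
   also have "\<dots> = dsl ?D (%xs. fop P V ?pq (xs @ ?bs @ post)) pre +
     (dsl ?D (%xs. fop P V ?pq (pre @ xs @ post)) ?bs + dsl ?D (%xs. fop P V ?pq (pre @ ?bs @ xs)) post)"
    by (simp only: dsl_append)
   also have "dsl ?D (%xs. fop P V ?pq (xs @ ?bs @ post)) pre = dsl ?D (%xs. fop P V p (xs @ ?a # post)) pre"
   proof (rule dsl_words_cong[OF D step(4)])
    fix xs assume "xs \<in> words F (length pre)"
    then show "fop P V ?pq (xs @ ?bs @ post) = fop P V p (xs @ ?a # post)"
     using c[OF _ bs step(5), of xs] by (simp add: words_def)
   qed
   also have "dsl ?D (%xs. fop P V ?pq (pre @ ?bs @ xs)) post = dsl ?D (%xs. fop P V p (pre @ ?a # xs)) post"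
   proof (rule dsl_words_cong[OF D step(5)])
    fix xs assume "xs \<in> words F (length post)"
    then show "fop P V ?pq (pre @ ?bs @ xs) = fop P V p (pre @ ?a # xs)"
     using c[OF step(4) bs, of xs] by (simp add: words_def)
   qed
   also have "dsl ?D (%xs. fop P V ?pq (pre @ xs @ post)) ?bs = dsl ?D (%xs. fop P V p (pre @ fop P V q xs # post)) ?bs"
    by (rule dsl_words_cong[OF D bs'(1)]) (use c[OF step(4) _ step(5)] bs'(2) in simp)
   also have "\<dots> = fop P V p (pre @ dsl ?D (fop P V q) ?bs # post)"
    unfolding dsl_def
   proof (rule hom_sum[OF mlin_app[OF vF fop_mlin[OF step(1)] step(4,5) refl] vF, symmetric])
    fix i assume "i \<in> {..<length ?bs}"
    then have "?bs ! i \<in> car F" by (intro words_nth[OF bs]) (use wordsD(1)[OF step(3)] in simp)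
    then show "fop P V q (?bs[i := ?D (?bs ! i)]) \<in> car F"
     by (intro fop_car[OF step(2)] words_update[OF bs] hom_car[OF D])
   qed
   also have "dsl ?D (fop P V q) ?bs = ?D ?a" by (rule fact_letters[OF step(2,3) w, symmetric])
   finally show ?case by (simp add: dsl_append dsl_Cons)
  qed
 qed
qed

lemma fop_unit: "a \<in> car F ==> fop P V (ounit P) [a] = a"
proof (rule F_eqI[where f = "%a. fop P V (ounit P) [a]" and g = "%a. a" and C = F])
 show "(%a. fop P V (ounit P) [a]) \<in> hom F F" using mlin_app[OF vF fop_mlin[OF P_unit], of "[]" "[]"] by simp
 fix n p xs assume p: "p \<in> car (ocar P n)" "xs \<in> words V n"
 have "fop P V (ounit P) [fop P V p (map \<iota> xs)] = fop P V (ocomp P 1 n 1 (ounit P) p) (map \<iota> xs)"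
  using fop_comp[OF P_unit p(1), of "[]" "map \<iota> xs" "[]"] map_\<iota>_words[OF p(2)] by simp
 then show "fop P V (ounit P) [fc n p (tword V xs)] = fc n p (tword V xs)"
  using fop_letters[OF p] P_unit_left[OF p(1)] by simp
qed (rule hom_id)

end

subsection \<open>Two-level bracket trees\<close>

lemma leaves_subst: "leaves (subst f t) = concat (map (%a. leaves (f a)) (leaves t))"
proof (induction t)
 case (Br us vs)
 have "concat (map leaves (map (subst f) ts)) = concat (map (%a. leaves (f a)) (concat (map leaves ts)))"
  if "!!t. t \<in> set ts ==> leaves (subst f t) = concat (map (%a. leaves (f a)) (leaves t))" for ts
  using that by (induction ts) simp_all
 then show ?case using Br by simp
qed simp

lemma subst_subst: "subst f (subst g t) = subst (%a. subst f (g a)) t"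
 by (induction t) auto

lemma subst_cong: "(!!a. a \<in> set (leaves t) ==> f a = g a) ==> subst f t = subst g t"
proof (induction t)
 case (Br us vs)
 have "map (subst f) us = map (subst g) us" by (rule map_cong[OF refl], rule Br.IH(1), assumption, rule Br.prems, auto)
 moreover have "map (subst f) vs = map (subst g) vs" by (rule map_cong[OF refl], rule Br.IH(2), assumption, rule Br.prems, auto)
 ultimately show ?case by simp
qed simp

lemma map_shift: "map (%a. a + d) [i..<j] = [i + d..<j + d]"
 by (rule nth_equalityI) auto

definition "Tr n = {t. mset (leaves t) = mset [1..<Suc n]}"

lemma TrD: "t \<in> Tr n ==> mset (leaves t) = mset [1..<Suc n]"
 by (simp add: Tr_def)

lemma Tr_length: "t \<in> Tr n ==> length (leaves t) = n"
 using TrD by (metis diff_Suc_1 length_upt size_mset)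

lemma Tr_ge: "t \<in> Tr n ==> a \<in> set (leaves t) ==> 1 \<le> a \<and> a \<le> n"
 using mset_eq_setD[OF TrD, of t n] by auto

lemma mset_concat_cong: "mset xs = mset ys ==> mset (concat (map f xs)) = mset (concat (map f ys))"
proof -
 have "mset (concat (map f xs)) = (\<Sum>x\<in>#mset xs. mset (f x))" for xs by (induction xs) auto
 then show "mset xs = mset ys ==> ?thesis" by simp
qed

lemma graft_Tr:
 assumes t: "t \<in> Tr m" and s: "s \<in> Tr n" and i: "1 \<le> i" "i \<le> m"
 shows "graft n i t s \<in> Tr (m + n - 1)"
proof -
 let ?f = "%j. if j < i then Leaf j else if j = i then subst (%a. Leaf (a + i - 1)) s else Leaf (j + n - 1)"
 let ?g = "%a. leaves (?f a)"
 have sp: "[1..<Suc m] = [1..<i] @ [i] @ [Suc i..<Suc m]"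
  using i by (metis append_Cons append_Nil le_SucI not_less_eq_eq upt_add_eq_append upt_conv_Cons le_add_diff_inverse Suc_le_mono le_imp_less_Suc)
 have 1: "concat (map ?g [1..<i]) = [1..<i]" by (rule trans[OF arg_cong[of _ "map (%a. [a]) [1..<i]"]]) auto
 have 2: "mset (?g i) = mset [i..<i + n]"
 proof -
  have "mset (?g i) = image_mset (%a. a + i - 1) (mset [1..<Suc n])"
   using TrD[OF s] by (simp add: leaves_subst del: upt_Suc)
  also have "\<dots> = mset (map (%a. a + (i - 1)) [1..<Suc n])" using i by (simp del: upt_Suc)
  also have "map (%a. a + (i - 1)) [1..<Suc n] = [i..<i + n]" unfolding map_shift
   using i by (simp add: add.commute)
  finally show ?thesis .
 qed
 have 3: "concat (map ?g [Suc i..<Suc m]) = [i + n..<m + n]"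
 proof -
  have "concat (map ?g [Suc i..<Suc m]) = concat (map (%a. [a + n - 1]) [Suc i..<Suc m])"
   by (rule arg_cong[of _ _ concat]) auto
  also have "\<dots> = map (%a. a + n - 1) [Suc i..<Suc m]" by simp
  also have "\<dots> = [i + n..<m + n]" by (rule nth_equalityI) (auto simp del: upt_Suc)
  finally show ?thesis .
 qed
 have "mset (leaves (graft n i t s)) = mset (concat (map ?g [1..<Suc m]))"
  unfolding graft_def leaves_subst by (rule mset_concat_cong[OF TrD[OF t]])
 also have "\<dots> = mset [1..<i] + mset [i..<i + n] + mset [i + n..<m + n]"
  unfolding sp map_append concat_append mset_append 1 3 using 2 by simp
 also have "\<dots> = mset ([1..<i] @ [i..<i + n] @ [i + n..<m + n])" by simp
 also have "[1..<i] @ [i..<i + n] @ [i + n..<m + n] = [1..<Suc (m + n - 1)]"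
  using i upt_add_eq_append[of 1 i n] upt_add_eq_append[of 1 "i + n" "m - i"] by (simp add: add.commute del: upt_Suc)
 finally show ?thesis by (simp add: Tr_def)
qed

lemma perm_Tr:
 assumes t: "t \<in> Tr n" and s: "\<sigma> permutes {1..n}"
 shows "subst (%j. Leaf (\<sigma> j)) t \<in> Tr n"
proof -
 have "mset [1..<Suc n] = mset_set {1..n}" by (metis atLeastLessThanSuc_atLeastAtMost mset_upt)
 then show ?thesis using TrD[OF t] permutes_image[OF s] image_mset_mset_set[OF permutes_inj_on[OF s]]
  by (simp add: leaves_subst Tr_def del: upt_Suc mset_upt)
qed

text \<open>The children are relabelled so that the inputs are numbered from left to right.\<close>

fun lay :: "nat => bterm list => bterm list" where
 "lay d [] = []"
| "lay d (s # cs) = subst (%a. Leaf (a + d)) s # lay (d + length (leaves s)) cs"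

abbreviation "planar s \<equiv> leaves s = [1..<Suc (length (leaves s))]"

text \<open>The planar tree with root bracket and children \<open>cs\<close>, of which the first
  \<open>k\<close> form the left group of arguments.\<close>

definition "TT k cs = Br (take k (lay 0 cs)) (drop k (lay 0 cs))"

lemma length_lay [simp]: "length (lay d cs) = length cs"
 by (induction cs arbitrary: d) auto

lemma lay_leaves: "\<forall>s\<in>set cs. planar s ==>
  concat (map leaves (lay d cs)) = [Suc d..<Suc (d + length (concat (map leaves cs)))]"
proof (induction cs arbitrary: d)
 case (Cons s cs)
 have "leaves (subst (%a. Leaf (a + d)) s) = map (%a. a + d) (leaves s)" by (simp add: leaves_subst)
 also have "\<dots> = map (%a. a + d) [1..<Suc (length (leaves s))]" using Cons.prems by (metis list.set_intros(1))
 also have "\<dots> = [Suc d..<Suc (d + length (leaves s))]" unfolding map_shift by (simp add: add.commute)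
 finally show ?case
  using Cons upt_add_eq_append[of "Suc d" "Suc (d + length (leaves s))" "length (concat (map leaves cs))"]
  by (simp add: add.assoc del: upt_Suc)
qed simp

lemma TT_leaves: "\<forall>s\<in>set cs. planar s ==> leaves (TT k cs) = [1..<Suc (length (concat (map leaves cs)))]"
 unfolding TT_def using lay_leaves[of cs 0] by (simp flip: concat_append map_append del: upt_Suc)

lemma lay_Leaf: "lay d (replicate j (Leaf 1) @ cs) = map Leaf [Suc d..<Suc (d + j)] @ lay (d + j) cs"
proof (induction j arbitrary: d)
 case (Suc j)
 have "[Suc d..<Suc (d + Suc j)] = Suc d # [Suc (Suc d)..<Suc (Suc d + j)]" by (simp add: upt_conv_Cons del: upt_Suc)
 then show ?case using Suc[of "Suc d"] by (simp del: upt_Suc)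
qed simp

text \<open>\<open>Leaf 1\<close> stands for a child not yet grafted and occupies one input.
  Grafting \<open>s\<close> onto the last placeholder moves the inputs of the children to its right
  by \<open>n - 1\<close>, so the whole tree is obtained from a corolla by graftings.\<close>

lemma TT_graft:
 assumes s: "planar s" "length (leaves s) = n" and cs: "\<forall>s\<in>set cs. planar s"
 shows "TT k (replicate j (Leaf 1) @ s # cs) = graft n (Suc j) (TT k (replicate (Suc j) (Leaf 1) @ cs)) s"
proof -
 let ?f = "%a. if a < Suc j then Leaf a else if a = Suc j then subst (%a. Leaf (a + Suc j - 1)) s else Leaf (a + n - 1)"
 have l: "map (subst ?f) (lay d cs) = lay (d + n - 1) cs" if "Suc j \<le> d" "\<forall>s\<in>set cs. planar s" for d cs
  using that
 proof (induction cs arbitrary: d)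
  case (Cons u cs)
  have "subst ?f (subst (%a. Leaf (a + d)) u) = subst (%a. Leaf (a + (d + n - 1))) u"
   unfolding subst_subst
  proof (rule subst_cong)
   fix a assume "a \<in> set (leaves u)"
   then have "a \<in> set [1..<Suc (length (leaves u))]" using Cons.prems(2) by (metis list.set_intros(1))
   then show "subst ?f (Leaf (a + d)) = Leaf (a + (d + n - 1))" using Cons.prems(1) by auto
  qed
  moreover have "d + length (leaves u) + n - 1 = d + n - 1 + length (leaves u)" using Cons.prems(1) by simp
  moreover have "map (subst ?f) (lay (d + length (leaves u)) cs) = lay (d + length (leaves u) + n - 1) cs"
   using Cons by simp
  ultimately show ?case by (simp only: lay.simps list.map)
 qed simp
 have f: "map (subst ?f) (map Leaf [1..<Suc j]) = map Leaf [1..<Suc j]" by simp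
 have "lay 0 (replicate j (Leaf 1) @ s # cs) = map Leaf [1..<Suc j] @ subst (%a. Leaf (a + j)) s # lay (j + n) cs"
  using lay_Leaf[of 0 j "s # cs"] s by simp
 also have "\<dots> = map (subst ?f) (map Leaf [1..<Suc j] @ Leaf (Suc j) # lay (Suc j) cs)"
  unfolding map_append f using l[of "Suc j" cs] cs by simp
 also have "map Leaf [1..<Suc j] @ Leaf (Suc j) # lay (Suc j) cs = lay 0 (replicate (Suc j) (Leaf 1) @ cs)"
  using lay_Leaf[of 0 "Suc j" cs] by simp
 finally show ?thesis by (simp only: TT_def graft_def subst.simps take_map drop_map)
qed

text \<open>The shape of a term without nested brackets, its inputs renumbered from left to right;
  \<open>flat_std\<close> recovers the term by relabelling.\<close>

primrec std :: "bterm => bterm" where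
 "std (Leaf i) = Leaf 1"
| "std (Br us vs) = corolla (length us) (length vs)"

definition "flat u \<longleftrightarrow> (\<exists>i. u = Leaf i) \<or> (\<exists>is js. u = Br (map Leaf is) (map Leaf js))"

lemma concat_leaves_Leaf [simp]: "concat (map leaves (map Leaf xs)) = xs"
 by (induction xs) auto

lemma corolla_leaves: "leaves (corolla k l) = [1..<Suc (k + l)]"
 using upt_add_eq_append[of 1 "Suc k" l] unfolding corolla_def leaves.simps concat_leaves_Leaf by simp

lemma flat_std:
 assumes "flat u"
 shows "planar (std u)" "length (leaves (std u)) = length (leaves u)" "subst (%a. Leaf (leaves u ! (a - 1))) (std u) = u"
proof -
 have m: "map (%a. Leaf (xs ! (a - 1))) [Suc d..<Suc (d + n)] = map Leaf (take n (drop d xs))" if "d + n \<le> length xs" for d n xs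
  by (rule nth_equalityI) (use that in "auto simp del: upt_Suc")
 have "planar (std u) \<and> length (leaves (std u)) = length (leaves u) \<and> subst (%a. Leaf (leaves u ! (a - 1))) (std u) = u"
  using assms unfolding flat_def
 proof (elim disjE exE)
  fix "is" js assume u: "u = Br (map Leaf is) (map Leaf js)"
  then have l: "leaves u = is @ js" by (simp only: leaves.simps concat_leaves_Leaf)
  have "subst (%a. Leaf ((is @ js) ! (a - 1))) (corolla (length is) (length js)) = u"
   using m[of 0 "length is" "is @ js"] m[of "length is" "length js" "is @ js"]
   by (simp add: u corolla_def comp_def del: upt_Suc)
  then show ?thesis unfolding l by (simp add: u corolla_leaves del: upt_Suc)
 qed auto
 then show "planar (std u)" "length (leaves (std u)) = length (leaves u)" "subst (%a. Leaf (leaves u ! (a - 1))) (std u) = u" by auto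
qed

text \<open>The lists \<open>pre\<close> and \<open>post\<close> of labels belonging to the
  neighbouring children make the induction along \<open>us\<close> possible.\<close>

lemma lay_relabel:
 assumes "\<forall>u\<in>set us. flat u"
 shows "map (subst (%j. Leaf ((pre @ concat (map leaves us) @ post) ! (j - 1)))) (lay (length pre) (map std us)) = us"
 using assms
proof (induction us arbitrary: pre)
 case (Cons u us)
 note fs = flat_std[of u]
 have u: "flat u" using Cons.prems by simp
 have "subst (%j. Leaf ((pre @ concat (map leaves (u # us)) @ post) ! (j - 1))) (subst (%a. Leaf (a + length pre)) (std u)) =
   subst (%a. Leaf (leaves u ! (a - 1))) (std u)"
  unfolding subst_subst
 proof (rule subst_cong)
  fix a assume "a \<in> set (leaves (std u))"
  then have "a \<in> set [1..<Suc (length (leaves u))]" using fs[OF u] by metis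
  then have a: "1 \<le> a" "a \<le> length (leaves u)" by auto
  then have "a + length pre - 1 = length pre + (a - 1)" "a - 1 < length (leaves u)" by auto
  then show "subst (%j. Leaf ((pre @ concat (map leaves (u # us)) @ post) ! (j - 1))) (Leaf (a + length pre)) = Leaf (leaves u ! (a - 1))"
   by (simp add: nth_append)
 qed
 then show ?case using Cons.IH[of "pre @ leaves u"] Cons.prems fs[OF u] by simp
qed simp

lemma partition_mset_set:
 assumes "partition_on A \<pi>" "finite A"
 shows "(\<Sum>I\<in>\<pi>. mset_set I) = mset_set A"
proof -
 have "(\<Sum>x\<in>\<Union>\<pi>. {#x#}) = (\<Sum>I\<in>\<pi>. \<Sum>x\<in>I. {#x#})"
  using sum.Union_disjoint[of \<pi> "%x. {#x#}"] assms partition_onD1[OF assms(1)] partition_onD2[OF assms(1)]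
  by (auto simp: disjoint_def dest: finite_subset[rotated])
 then show ?thesis using partition_onD1[OF assms(1)] by (simp add: sum_multiset_singleton)
qed

lemma block_leaves: "finite I ==> mset (leaves (block h I)) = mset_set I"
proof -
 assume I: "finite I"
 have "mset (leaves (block h I)) = mset_set {i \<in> I. i \<le> h} + mset_set {i \<in> I. h < i}"
  unfolding block_def leaves.simps concat_leaves_Leaf by (simp flip: sorted_list_of_mset_set)
 also have "\<dots> = mset_set ({i \<in> I. i \<le> h} \<union> {i \<in> I. h < i})"
  by (rule mset_set_Union[symmetric]) (use I in auto)
 also have "{i \<in> I. i \<le> h} \<union> {i \<in> I. h < i} = I" by auto
 finally show ?thesis .
qed

lemma blocks_leaves:
 assumes "partition_on A \<pi>" "finite A"
 shows "mset (concat (map leaves (map (block h) (list_of (mset_set \<pi>))))) = mset_set A"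
proof -
 have f: "finite I" if "I \<in> \<pi>" for I using assms that partition_onD1 finite_subset[of I A] by blast
 have fp: "finite \<pi>" by (rule finite_elements[OF assms(2,1)])
 have "mset (concat (map leaves (map (block h) Is))) = (\<Sum>I\<in>#mset Is. mset (leaves (block h I)))" for Is
  by (induction Is) auto
 then have "mset (concat (map leaves (map (block h) (list_of (mset_set \<pi>))))) = (\<Sum>I\<in>\<pi>. mset (leaves (block h I)))"
  by (simp add: sum_unfold_sum_mset)
 also have "\<dots> = (\<Sum>I\<in>\<pi>. mset_set I)" by (rule sum.cong[OF refl]) (simp add: f block_leaves)
 finally show ?thesis using partition_mset_set[OF assms] by simp
qed

subsection \<open>The operad of brackets\<close>

type_synonym 'k bvs = "('k, bterm \<Rightarrow>\<^sub>0 'k) vs"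
abbreviation "FB \<equiv> free_bracket_operad"
abbreviation "IB n \<equiv> {r :: bterm \<Rightarrow>\<^sub>0 'k::field. opideal FB binf_rel n r}"
abbreviation "bcls n \<equiv> qproj (free (Tr n)) (IB n)"

lemma FB_simps:
 "ocar FB n = free (Tr n)"
 "ocomp FB m n i a b = lext psc (%t. lext psc (%s. vec (graft n i t s)) b) a"
 "oact FB n \<sigma> = lext psc (%t. vec (subst (%j. Leaf (inv \<sigma> j)) t))"
 "ounit FB = vec (Leaf 1)"
 by (simp_all add: free_bracket_operad_def Tr_def del: upt_Suc)

lemma FB_comp:
 assumes "1 \<le> i" "i \<le> m"
 shows "ocomp FB m n i \<in> bihom (free (Tr m)) (free (Tr n)) (free (Tr (m + n - 1)) :: 'k::field bvs)"
proof -
 have s: "scl (free X) = psc" for X :: "bterm set" by (simp add: free_def)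
 have v: "(vec (graft n i t s) :: bterm \<Rightarrow>\<^sub>0 'k) \<in> car (free (Tr (m + n - 1)))" if "t \<in> Tr m" "s \<in> Tr n" for t s
  by (rule vec_free[OF graft_Tr[OF that assms]])
 have h: "lext psc (%s. vec (graft n i t s)) \<in> hom (free (Tr n)) (free (Tr (m + n - 1)) :: 'k bvs)" if "t \<in> Tr m" for t
  using lext_hom_free[OF vspace_free v[OF that]] by (simp only: s)
 have c: "lext psc (%s. vec (graft n i t s)) b \<in> car (free (Tr (m + n - 1)) :: 'k bvs)"
  if "t \<in> Tr m" "b \<in> car (free (Tr n))" for t b by (rule hom_car[OF h[OF that(1)] that(2)])
 show ?thesis
  unfolding FB_simps[abs_def]
 proof (rule bihomI)
  fix a :: "bterm \<Rightarrow>\<^sub>0 'k" assume "a \<in> car (free (Tr m))"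
  then have "t \<in> pkeys a ==> t \<in> Tr m" for t by (auto simp: free_def)
  from hom_Lext[OF vspace_free h[OF this], of a "%x. x"] show "(%b. lext psc (%t. lext psc (%s. vec (graft n i t s)) b) a)
    \<in> hom (free (Tr n)) (free (Tr (m + n - 1)) :: 'k bvs)" by (simp only: s)
 next
  fix b :: "bterm \<Rightarrow>\<^sub>0 'k" assume "b \<in> car (free (Tr n))"
  from lext_hom_free[OF vspace_free c[OF _ this]] show "(%a. lext psc (%t. lext psc (%s. vec (graft n i t s)) b) a)
    \<in> hom (free (Tr m)) (free (Tr (m + n - 1)) :: 'k bvs)" by (simp only: s)
 qed
qed

lemma FB_act:
 assumes "\<sigma> permutes {1..n}"
 shows "oact FB n \<sigma> \<in> hom (free (Tr n)) (free (Tr n) :: 'k::field bvs)"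
proof -
 have s: "scl (free (Tr n)) = psc" by (simp add: free_def)
 show ?thesis
  unfolding FB_simps using lext_hom_free[OF vspace_free vec_free[OF perm_Tr[OF _ permutes_inv[OF assms]]]] by (simp only: s)
qed

lemma mset_upt_Suc: "mset [1..<Suc n] = mset_set {1..n}"
 by (metis atLeastLessThanSuc_atLeastAtMost mset_upt)

lemma assoc_trees_Tr:
 assumes "n = k + l + m"
 shows "partition_on {1..k + l} \<pi> ==>
   Br (map (block k) (list_of (mset_set \<pi>))) (map Leaf [Suc (k + l)..<Suc (k + l + m)]) \<in> Tr n"
  and "partition_on {Suc k..k + l + m} \<pi> ==>
   Br (map Leaf [1..<Suc k]) (map (block (k + l)) (list_of (mset_set \<pi>))) \<in> Tr n"
proof -
 have 1: "mset_set {1..k + l} + mset [Suc (k + l)..<Suc n] = mset [1..<Suc n]"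
 proof -
  have "[1..<Suc n] = [1..<Suc (k + l)] @ [Suc (k + l)..<Suc n]" using upt_add_eq_append[of 1 "Suc (k + l)" m] assms by (simp del: upt_Suc)
  then show ?thesis by (simp only: mset_append mset_upt_Suc[symmetric])
 qed
 have 2: "mset [1..<Suc k] + mset_set {Suc k..k + l + m} = mset [1..<Suc n]"
 proof -
  have "mset_set {Suc k..k + l + m} = mset [Suc k..<Suc n]" using assms by (metis atLeastLessThanSuc_atLeastAtMost mset_upt)
  moreover have "[1..<Suc n] = [1..<Suc k] @ [Suc k..<Suc n]" using upt_add_eq_append[of 1 "Suc k" "l + m"] assms by (simp add: add.assoc del: upt_Suc)
  ultimately show ?thesis by (simp only: mset_append)
 qed
 show "Br (map (block k) (list_of (mset_set \<pi>))) (map Leaf [Suc (k + l)..<Suc (k + l + m)]) \<in> Tr n" if "partition_on {1..k + l} \<pi>"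
  unfolding Tr_def mem_Collect_eq leaves.simps concat_leaves_Leaf mset_append blocks_leaves[OF that finite_atLeastAtMost]
  using 1 assms by (simp only:)
 show "Br (map Leaf [1..<Suc k]) (map (block (k + l)) (list_of (mset_set \<pi>))) \<in> Tr n" if "partition_on {Suc k..k + l + m} \<pi>"
  unfolding Tr_def mem_Collect_eq leaves.simps concat_leaves_Leaf mset_append blocks_leaves[OF that finite_atLeastAtMost]
  using 2 by (simp only:)
qed

lemma corolla_Tr: "corolla k l \<in> Tr (k + l)"
 by (simp only: Tr_def mem_Collect_eq corolla_leaves)

lemma Leaf_Tr: "Leaf 1 \<in> Tr 1"
 by (simp add: Tr_def)

lemma binf_rel_car: "binf_rel n \<subseteq> car (free (Tr n) :: 'k::field bvs)"
proof -
 note d = car_diff[OF vspace_free] and v = vec_free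
 have 1: "vec (subst (%j. Leaf (inv \<sigma> j)) (corolla k l)) - vec (corolla k l) \<in> car (free (Tr (k + l)) :: 'k bvs)"
  if "\<sigma> permutes {1..k + l}" for \<sigma> k l
  by (intro d v perm_Tr[OF corolla_Tr permutes_inv[OF that]] corolla_Tr)
 have 2: "vec (corolla 0 n) \<in> car (free (Tr n) :: 'k bvs)" "vec (corolla n 0) \<in> car (free (Tr n) :: 'k bvs)" for n
  using corolla_Tr[of 0 n] corolla_Tr[of n 0] by (auto intro!: v)
 have 3: "vec (Leaf 1) \<in> car (free (Tr 1) :: 'k bvs)" by (rule v[OF Leaf_Tr])
 have 4: "(\<Sum>\<pi> | partition_on {1..k + l} \<pi>. vec (Br (map (block k) (list_of (mset_set \<pi>))) (map Leaf [Suc (k + l)..<Suc (k + l + m)])))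
   - (\<Sum>\<pi> | partition_on {Suc k..k + l + m} \<pi>. vec (Br (map Leaf [1..<Suc k]) (map (block (k + l)) (list_of (mset_set \<pi>)))))
   \<in> car (free (Tr (k + l + m)) :: 'k bvs)" for k l m
  by (intro d car_sum[OF vspace_free] v; (elim CollectE)?; (rule assoc_trees_Tr[OF refl])?; assumption?)
 show ?thesis
  unfolding binf_rel_def
 proof (intro Un_least)
  show "(if n = 1 then {vec (corolla 0 1) - vec (Leaf 1), vec (corolla 1 0) - vec (Leaf 1)} else {vec (corolla 0 n), vec (corolla n 0)})
    \<subseteq> car (free (Tr n) :: 'k bvs)"
   using 2[of n] d[OF 2(1)[of 1] 3] d[OF 2(2)[of 1] 3] by (cases "n = 1") simp_all
 qed (use 1 in blast, use 4 in blast)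
qed

lemma IB_car: "opideal FB binf_rel n r ==> r \<in> car (free (Tr n) :: 'k::field bvs)"
proof (induction rule: opideal.induct)
 case (gen r n)
 then show ?case using binf_rel_car by blast
next
 case (compl m r q n i)
 then show ?case using bihom_car[OF FB_comp] by (simp add: FB_simps(1))
next
 case (compr n r p m i)
 then show ?case using bihom_car[OF FB_comp] by (simp add: FB_simps(1))
next
 case (scale n r c)
 then show ?case unfolding FB_simps(1) by (intro car_scl[OF vspace_free])
next
 case (perm n r \<sigma>)
 then show ?case by (intro hom_car[OF FB_act])
qed (auto simp: FB_simps(1) intro: car_0[OF vspace_free] car_add[OF vspace_free])

text \<open>The components of an operadic ideal are already subspaces, so the projection onto the
  quotient kills exactly the ideal.\<close>

lemma IB_span: "module.span psc (IB n) = IB n"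
proof -
 interpret vector_space "psc :: 'a::field => (bterm \<Rightarrow>\<^sub>0 'a) => _" by (rule vector_space_psc)
 have "opideal FB binf_rel n (psc c r)" if "opideal FB binf_rel n r" for c :: 'a and r
  using opideal.scale[OF that, of c] by (simp add: FB_simps(1) free_def)
 then have "subspace (IB n :: (bterm \<Rightarrow>\<^sub>0 'a) set)"
  by (intro subspaceI) (auto intro: opideal.zero opideal.add)
 then show ?thesis by (rule span_eq_iff[THEN iffD2])
qed

lemma bcls_eqI: "opideal FB binf_rel n (x - y) ==> bcls n x = bcls n y"
 by (rule qproj_eqI[OF vspace_free]) (simp add: free_def IB_span)

lemma bcls_diff: "opideal FB binf_rel n (x - bcls n x)"
 using qproj_diff_span[OF vspace_free, of x "Tr n" "IB n"] by (simp add: free_def IB_span)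

lemma bcls_car: "x \<in> car (free (Tr n)) ==> bcls n x \<in> car (free (Tr n))"
 by (rule qproj_car[OF vspace_free]) (auto intro: IB_car)

lemma binf_simps:
 "ocar binf n = quot (free (Tr n)) (IB n)"
 "ocomp binf m n i a b = bcls (m + n - 1) (ocomp FB m n i a b)"
 "oact binf n \<sigma> a = bcls n (oact FB n \<sigma> a)"
 "ounit binf = bcls 1 (vec (Leaf 1))"
 by (simp_all add: binf_def operad_quot_def FB_simps(1,4))

text \<open>Composition in \<open>binf\<close> composes representatives and projects. Changing a
  representative, on the left and then on the right, changes the composite by an element of the
  ideal.\<close>

lemma bcls_comp:
 assumes a: "a \<in> car (free (Tr m))" and b: "b \<in> car (free (Tr n))" and i: "1 \<le> i" "i \<le> m"
 shows "ocomp binf m n i (bcls m a) (bcls n b) = bcls (m + n - 1) (ocomp FB m n i a b)"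
proof -
 note C = FB_comp[OF i, of n]
 have "ocomp FB m n i (a - bcls m a) b = ocomp FB m n i a b - ocomp FB m n i (bcls m a) b"
  by (rule hom_diff[OF bihom_left[OF C b] vspace_free a bcls_car[OF a]])
 then have 1: "bcls (m + n - 1) (ocomp FB m n i a b) = bcls (m + n - 1) (ocomp FB m n i (bcls m a) b)"
  using opideal.compl[OF bcls_diff, of b n i m a] b i by (intro bcls_eqI) (simp add: FB_simps(1))
 have "ocomp FB m n i (bcls m a) (b - bcls n b) =
   ocomp FB m n i (bcls m a) b - ocomp FB m n i (bcls m a) (bcls n b)"
  by (rule hom_diff[OF bihom_right[OF C bcls_car[OF a]] vspace_free b bcls_car[OF b]])
 then have "bcls (m + n - 1) (ocomp FB m n i (bcls m a) b) = bcls (m + n - 1) (ocomp FB m n i (bcls m a) (bcls n b))"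
  using opideal.compr[OF bcls_diff, of "bcls m a" m i n b] bcls_car[OF a] i by (intro bcls_eqI) (simp add: FB_simps(1))
 then show ?thesis unfolding binf_simps 1 ..
qed

lemma bcls_act:
 assumes a: "a \<in> car (free (Tr n))" and s: "\<sigma> permutes {1..n}"
 shows "oact binf n \<sigma> (bcls n a) = bcls n (oact FB n \<sigma> a)"
proof -
 have "oact FB n \<sigma> (a - bcls n a) = oact FB n \<sigma> a - oact FB n \<sigma> (bcls n a)"
  by (rule hom_diff[OF FB_act[OF s] vspace_free a bcls_car[OF a]])
 then have "bcls n (oact FB n \<sigma> a) = bcls n (oact FB n \<sigma> (bcls n a))"
  using opideal.perm[OF bcls_diff s, of a] by (intro bcls_eqI) simp
 then show ?thesis by (simp add: binf_simps)
qed

section \<open>Images of bracket trees under the operad morphism\<close>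

locale binf_op = op_alg P V for P :: "('k::field, 'p::ab_group_add) operad" and V :: "('k, 'v::ab_group_add) vs" +
 fixes \<theta> :: "nat => (bterm \<Rightarrow>\<^sub>0 'k) => 'p"
 assumes mor: "operad_morphism binf P \<theta>"
begin

definition "\<tau> n t = \<theta> n (bcls n (vec t))"
definition "cc k l = \<theta> (k + l) (binf_gen k l)"

lemma cc_\<tau>: "cc k l = \<tau> (k + l) (corolla k l)"
 by (simp add: cc_def \<tau>_def binf_gen_def FB_simps(1))

lemma \<theta>_hom: "(%a. \<theta> n (bcls n a)) \<in> hom (free (Tr n)) (ocar P n)"
 using mor hom_comp[OF _ qproj_hom[OF vspace_free, of "Tr n" "IB n"], of "\<theta> n"]
 by (auto simp: operad_morphism_def binf_simps(1))

lemma \<tau>_car: "t \<in> Tr n ==> \<tau> n t \<in> car (ocar P n)"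
 unfolding \<tau>_def by (rule hom_car[OF \<theta>_hom vec_free])

lemma cc_car: "cc k l \<in> car (ocar P (k + l))"
 unfolding cc_\<tau> by (rule \<tau>_car[OF corolla_Tr])

lemma bcls_binf: "t \<in> Tr n ==> bcls n (vec t :: bterm \<Rightarrow>\<^sub>0 'k) \<in> car (ocar binf n)"
 unfolding binf_simps by (rule qproj_in_quot[OF vec_free])

lemma \<tau>_graft:
 assumes "t \<in> Tr m" "s \<in> Tr n" "1 \<le> i" "i \<le> m"
 shows "\<tau> (m + n - 1) (graft n i t s) = ocomp P m n i (\<tau> m t) (\<tau> n s)"
proof -
 have "ocomp P m n i (\<tau> m t) (\<tau> n s) = \<theta> (m + n - 1) (ocomp binf m n i (bcls m (vec t)) (bcls n (vec s)))"
  using mor bcls_binf[OF assms(1)] bcls_binf[OF assms(2)] assms(3,4) by (simp add: operad_morphism_def \<tau>_def)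
 then show ?thesis
  using bcls_comp[of "vec t :: bterm \<Rightarrow>\<^sub>0 'k" m "vec s" n i, OF vec_free[OF assms(1)] vec_free[OF assms(2)] assms(3,4)]
  by (simp add: \<tau>_def FB_simps(2) lext_vec[OF vector_space_psc])
qed

lemma \<tau>_act:
 assumes "t \<in> Tr n" "\<sigma> permutes {1..n}"
 shows "\<tau> n (subst (%j. Leaf (inv \<sigma> j)) t) = oact P n \<sigma> (\<tau> n t)"
proof -
 have "oact P n \<sigma> (\<tau> n t) = \<theta> n (oact binf n \<sigma> (bcls n (vec t)))"
  using mor bcls_binf[OF assms(1)] assms(2) by (simp add: operad_morphism_def \<tau>_def)
 then show ?thesis
  using bcls_act[of "vec t :: bterm \<Rightarrow>\<^sub>0 'k" n \<sigma>, OF vec_free[OF assms(1)] assms(2)] by (simp add: \<tau>_def FB_simps(3) lext_vec[OF vector_space_psc])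
qed

lemma \<tau>_Leaf: "\<tau> 1 (Leaf 1) = ounit P"
 using mor by (simp add: operad_morphism_def \<tau>_def binf_simps)

lemma \<theta>_rel: "r \<in> binf_rel n ==> \<theta> n (bcls n r) = 0"
 using hom_0[OF \<theta>_hom vspace_free] bcls_eqI[OF opideal.gen, of r 0] by simp

lemma \<theta>_diff:
 assumes "vec s - vec t \<in> (binf_rel n :: (bterm \<Rightarrow>\<^sub>0 'k) set)" "s \<in> Tr n" "t \<in> Tr n"
 shows "\<tau> n s = \<tau> n t"
 using \<theta>_rel[OF assms(1)] hom_diff[OF \<theta>_hom vspace_free vec_free[OF assms(2)] vec_free[OF assms(3)]] by (simp add: \<tau>_def)

lemma cc_sym: "\<sigma> permutes {1..k + l} ==> \<sigma> ` {1..k} = {1..k} ==> oact P (k + l) \<sigma> (cc k l) = cc k l"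
 unfolding cc_\<tau> \<tau>_act[OF corolla_Tr, symmetric]
 by (rule \<theta>_diff) (auto intro!: perm_Tr corolla_Tr permutes_inv simp: binf_rel_def)

lemma cc_unit: "cc 0 1 = ounit P" "cc 1 0 = ounit P"
 unfolding cc_\<tau> \<tau>_Leaf[symmetric] 
 using \<theta>_diff[of "corolla 0 1" "Leaf 1" 1] \<theta>_diff[of "corolla 1 0" "Leaf 1" 1] corolla_Tr[of 0 1] corolla_Tr[of 1 0] Leaf_Tr
 by (simp_all add: binf_rel_def)

lemma cc_other: "n \<noteq> 1 ==> cc 0 n = 0" "n \<noteq> 1 ==> cc n 0 = 0"
 unfolding cc_\<tau> \<tau>_def using \<theta>_rel[of "vec (corolla 0 n)" n] \<theta>_rel[of "vec (corolla n 0)" n] by (simp_all add: binf_rel_def)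

lemma \<tau>_assoc:
 assumes n: "n = k + l + m"
 shows "(\<Sum>\<pi> | partition_on {1..k + l} \<pi>. \<tau> n (Br (map (block k) (list_of (mset_set \<pi>))) (map Leaf [Suc (k + l)..<Suc (k + l + m)]))) =
  (\<Sum>\<pi> | partition_on {Suc k..k + l + m} \<pi>. \<tau> n (Br (map Leaf [1..<Suc k]) (map (block (k + l)) (list_of (mset_set \<pi>)))))"
proof -
 let ?a = "%\<pi>. vec (Br (map (block k) (list_of (mset_set \<pi>))) (map Leaf [Suc (k + l)..<Suc (k + l + m)])) :: bterm \<Rightarrow>\<^sub>0 'k"
 let ?b = "%\<pi>. vec (Br (map Leaf [1..<Suc k]) (map (block (k + l)) (list_of (mset_set \<pi>)))) :: bterm \<Rightarrow>\<^sub>0 'k"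
 have a: "?a \<pi> \<in> car (free (Tr n))" if "\<pi> \<in> {\<pi>. partition_on {1..k + l} \<pi>}" for \<pi>
  using vec_free[OF assoc_trees_Tr(1)[OF n]] that by blast
 have b: "?b \<pi> \<in> car (free (Tr n))" if "\<pi> \<in> {\<pi>. partition_on {Suc k..k + l + m} \<pi>}" for \<pi>
  using vec_free[OF assoc_trees_Tr(2)[OF n]] that by blast
 have "sum ?a {\<pi>. partition_on {1..k + l} \<pi>} - sum ?b {\<pi>. partition_on {Suc k..k + l + m} \<pi>} \<in> binf_rel n"
  unfolding binf_rel_def using n by blast
 note z = \<theta>_rel[OF this]
 have hs: "\<theta> n (bcls n (sum g I)) = (\<Sum>i\<in>I. \<theta> n (bcls n (g i)))" if "!!i. i \<in> I ==> g i \<in> car (free (Tr n))" for g and I :: "nat set set set"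
  by (rule hom_sum[OF \<theta>_hom vspace_free that])
 have "\<theta> n (bcls n (sum ?a {\<pi>. partition_on {1..k + l} \<pi>} - sum ?b {\<pi>. partition_on {Suc k..k + l + m} \<pi>})) =
   \<theta> n (bcls n (sum ?a {\<pi>. partition_on {1..k + l} \<pi>})) - \<theta> n (bcls n (sum ?b {\<pi>. partition_on {Suc k..k + l + m} \<pi>}))"
  by (rule hom_diff[OF \<theta>_hom vspace_free car_sum[OF vspace_free] car_sum[OF vspace_free]]) (fact a, fact b)
 moreover have "\<theta> n (bcls n (sum ?a {\<pi>. partition_on {1..k + l} \<pi>})) = (\<Sum>\<pi> | partition_on {1..k + l} \<pi>. \<theta> n (bcls n (?a \<pi>)))"
  by (rule hs) (fact a)
 moreover have "\<theta> n (bcls n (sum ?b {\<pi>. partition_on {Suc k..k + l + m} \<pi>})) = (\<Sum>\<pi> | partition_on {Suc k..k + l + m} \<pi>. \<theta> n (bcls n (?b \<pi>)))"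
  by (rule hs) (fact b)
 ultimately have "0 = (\<Sum>\<pi> | partition_on {1..k + l} \<pi>. \<theta> n (bcls n (?a \<pi>))) - (\<Sum>\<pi> | partition_on {Suc k..k + l + m} \<pi>. \<theta> n (bcls n (?b \<pi>)))"
  unfolding z by (simp only:)
 then show ?thesis
  unfolding \<tau>_def
  by (rule eq_iff_diff_eq_0[THEN iffD2, OF sym])
qed

end

section \<open>Evaluation of two-level trees in the free algebra and symmetry of the bracket\<close>

lemma mset_eq_lperm:
 assumes "mset xs = mset ys"
 shows "\<exists>\<sigma>. \<sigma> permutes {1..length ys} \<and> lperm \<sigma> ys = xs"
proof -
 obtain p where p: "p permutes {..<length ys}" and x: "permute_list p ys = xs" using mset_eq_permutation[OF assms] .
 \<comment> \<open>\<open>permute_list\<close> counts positions from 0 and \<open>lperm\<close>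
   places from 1; \<open>?s\<close> conjugates by the shift.\<close>
 let ?s = "%q a. if a \<in> {1..length ys} then Suc (q (a - 1)) else a"
 have im: "q permutes {..<length ys} ==> k < length ys ==> q k < length ys" for q k
  using permutes_in_image[of q "{..<length ys}" k] by auto
 have "bij_betw (?s p) {1..length ys} {1..length ys}"
 proof (rule bij_betw_byWitness[where f' = "?s (inv p)"])
  have "?s q ` {1..length ys} \<subseteq> {1..length ys}" if "q permutes {..<length ys}" for q
   using im[OF that] by (auto simp: Suc_le_eq)
  from this[OF p] this[OF permutes_inv[OF p]]
  show "?s p ` {1..length ys} \<subseteq> {1..length ys}" "?s (inv p) ` {1..length ys} \<subseteq> {1..length ys}" .
 qed (use im[OF p] im[OF permutes_inv[OF p]] permutes_inverses[OF p] in "auto simp: Suc_le_eq")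
 then have "?s p permutes {1..length ys}" by (rule bij_imp_permutes) auto
 moreover have "lperm (?s p) ys = xs"
  unfolding x[symmetric] by (rule nth_equalityI) (auto simp: nth_lperm permute_list_def)
 ultimately show ?thesis by blast
qed

lemma symfun2:
 assumes W: "vspace W" and C: "vspace C"
  and l: "!!N. N \<in> mcar W ==> symfun W C (%M. \<Psi> M N)" and r: "!!M. M \<in> mcar W ==> symfun W C (\<Psi> M)"
 shows "(%a b. lext (scl C) (%M. lext (scl C) (\<Psi> M) b) a) \<in> bihom (Sym W) (Sym W) C"
  and "M \<in> mcar W ==> N \<in> mcar W ==> lext (scl C) (%M. lext (scl C) (\<Psi> M) (smon W N)) (smon W M) = \<Psi> M N"
proof -
 have s: "symfun W C (%M. lext (scl C) (\<Psi> M) b)" if "b \<in> car (Sym W)" for b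
  by (intro symfunI lext_hom_fun[OF W that C] symfun_hom[OF l] lext_car[OF C] symfun_car[OF r])
   (use Sym_keys[OF W that] in auto)
 show "(%a b. lext (scl C) (%M. lext (scl C) (\<Psi> M) b) a) \<in> bihom (Sym W) (Sym W) C"
  by (rule bihomI[OF hom_Lext[OF C Sym_lext_hom[OF W C r[OF Sym_keys[OF W]]]] Sym_lext_hom[OF W C s]])
 assume "M \<in> mcar W" "N \<in> mcar W"
 then show "lext (scl C) (%M. lext (scl C) (\<Psi> M) (smon W N)) (smon W M) = \<Psi> M N"
  using Sym_lext[OF W C s[OF smon_car]] Sym_lext[OF W C r] by simp
qed

lemma TT_Leaf: "TT k (replicate (k + l) (Leaf 1)) = corolla k l"
proof -
 have "lay 0 (replicate (k + l) (Leaf 1)) = map Leaf [1..<Suc (k + l)]" using lay_Leaf[of 0 "k + l" "[]"] by (simp del: upt_Suc)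
 then show ?thesis by (simp add: TT_def corolla_def take_map drop_map drop_upt take_upt del: upt_Suc)
qed

lemma planar_Tr: "planar s ==> length (leaves s) = n ==> s \<in> Tr n"
 by (simp add: Tr_def del: upt_Suc)

context binf_op
begin

abbreviation "\<tau>l s \<equiv> \<tau> (length (leaves s)) s"

text \<open>\<open>as\<close> holds values of children already evaluated, fed into placeholder
  leaves. \<open>TT_graft\<close> splits off the next child, \<open>fop_comp\<close> evaluates it,
  and the tree has become a corolla when no child is left.\<close>

lemma fop_lay:
 assumes "k + l = length as + length css" "set as \<subseteq> car F"
  and "\<forall>(s, bs)\<in>set css. planar s \<and> bs \<in> words F (length (leaves s))"
 shows "fop P V (\<tau> (length as + length (concat (map snd css))) (TT k (replicate (length as) (Leaf 1) @ map fst css))) (as @ concat (map snd css)) =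
  fop P V (cc k l) (as @ map (%(s, bs). fop P V (\<tau>l s) bs) css)"
 using assms
proof (induction css arbitrary: as)
 case Nil
 then show ?case using TT_Leaf[of k l] by (simp add: cc_\<tau>)
next
 case (Cons c css)
 obtain s bs where c: "c = (s, bs)" by (cases c)
 let ?n = "length (leaves s)" and ?j = "length as" and ?cs = "concat (map snd css)"
 let ?N = "Suc (?j + length ?cs)" and ?t = "TT k (replicate (Suc ?j) (Leaf 1) @ map fst css)" and ?a = "fop P V (\<tau>l s) bs"
 have s: "planar s" and bs: "bs \<in> words F ?n" and css: "\<forall>(s, bs)\<in>set css. planar s \<and> bs \<in> words F (length (leaves s))"
  using Cons.prems(3) c by (simp_all add: case_prod_beta del: upt_Suc)
 have pl: "\<forall>s\<in>set (map fst css). planar s" using css by (auto simp del: upt_Suc)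
 have len: "length (concat (map leaves (map fst css))) = length ?cs" using css by (induction css) (auto simp: words_def simp del: upt_Suc)
 have csF: "set ?cs \<subseteq> car F" using css by (fastforce simp: words_def simp del: upt_Suc)
 have sT: "s \<in> Tr ?n" by (rule planar_Tr[OF s refl])
 have rep: "length (concat (map leaves (replicate i (Leaf 1)))) = i" for i by (induction i) auto
 have tT: "?t \<in> Tr ?N"
 proof (rule planar_Tr)
  have "leaves ?t = [1..<Suc (length (concat (map leaves (replicate (Suc ?j) (Leaf 1) @ map fst css))))]"
  proof (rule TT_leaves, rule ballI)
   fix u assume "u \<in> set (replicate (Suc ?j) (Leaf 1) @ map fst css)"
   then consider "u = Leaf 1" | "u \<in> set (map fst css)" by auto
   then show "planar u"
   proof cases
    case 1
    show ?thesis unfolding 1 by simp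
   qed (use pl in blast)
  qed
  moreover have "length (concat (map leaves (replicate (Suc ?j) (Leaf 1) @ map fst css))) = ?N"
   unfolding map_append concat_append length_append rep len by simp
  ultimately have l: "leaves ?t = [1..<Suc ?N]" by (simp only:)
  show "length (leaves ?t) = ?N" "planar ?t" unfolding l by (simp_all del: upt_Suc)
 qed
 have a: "?a \<in> car F" by (rule fop_car[OF \<tau>_car[OF sT] bs])
 have N: "?N + ?n - 1 = ?j + length (concat (map snd (c # css)))" using wordsD(1)[OF bs] by (simp add: c)
 have "\<tau> (?N + ?n - 1) (TT k (replicate ?j (Leaf 1) @ map fst (c # css))) = ocomp P ?N ?n (Suc ?j) (\<tau> ?N ?t) (\<tau>l s)"
  using \<tau>_graft[OF tT sT, of "Suc ?j"] TT_graft[OF s refl pl] by (simp add: c)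
 moreover have "fop P V (ocomp P ?N ?n (Suc ?j) (\<tau> ?N ?t) (\<tau>l s)) (as @ bs @ ?cs) = fop P V (\<tau> ?N ?t) (as @ ?a # ?cs)"
  by (rule fop_comp[OF \<tau>_car[OF tT] \<tau>_car[OF sT] Cons.prems(2) bs csF refl])
 moreover have "fop P V (\<tau> ?N ?t) (as @ ?a # ?cs) = fop P V (cc k l) ((as @ [?a]) @ map (%(s, bs). fop P V (\<tau>l s) bs) css)"
  using Cons.IH[of "as @ [?a]"] Cons.prems(1,2) css a by simp
 ultimately show ?case unfolding N by (simp add: c)
qed

definition "eva as u = fop P V (\<tau>l (std u)) (map (%i. as ! (i - 1)) (leaves u))"

text \<open>The tree is a relabelling, by the order in which its leaves occur, of the planar tree of
  its shape. Equivariance of \<open>\<tau>\<close> and of \<open>fop\<close> moves the relabelling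
  to the arguments, and \<open>fop_lay\<close> evaluates the planar tree.\<close>

lemma fop_tree:
 assumes t: "Br us vs \<in> Tr n" and fl: "\<forall>u\<in>set (us @ vs). flat u" and as: "as \<in> words F n"
 shows "fop P V (\<tau> n (Br us vs)) as = fop P V (cc (length us) (length vs)) (map (eva as) (us @ vs))"
proof -
 let ?L = "concat (map leaves (us @ vs))" and ?T = "TT (length us) (map std (us @ vs))"
 have L: "mset ?L = mset [1..<Suc n]" using TrD[OF t] by (simp del: upt_Suc)
 obtain \<pi> where p: "\<pi> permutes {1..n}" and pL: "lperm \<pi> [1..<Suc n] = ?L" using mset_eq_lperm[OF L] by (auto simp del: upt_Suc)
 have lL: "length ?L = n" using Tr_length[OF t] by simp
 have Lk: "?L ! k = \<pi> (Suc k)" if "k < n" for k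
 proof -
  have b: "1 \<le> \<pi> (Suc k)" "\<pi> (Suc k) \<le> n" using permutes_bounds[OF p, of "Suc k"] that by auto
  have "?L ! k = [1..<Suc n] ! (\<pi> (Suc k) - 1)" unfolding pL[symmetric] by (rule nth_lperm) (use that in simp)
  also have "\<dots> = \<pi> (Suc k)" by (subst nth_upt) (use b in auto)
  finally show ?thesis .
 qed
 have pl: "\<forall>s\<in>set (map std (us @ vs)). planar s" using flat_std(1) fl by (auto simp del: upt_Suc)
 have len: "length (concat (map leaves (map std us))) = length (concat (map leaves us))" if "\<forall>u\<in>set us. flat u" for us
  using that by (induction us) (auto simp: flat_std(2))
 have Tl: "leaves ?T = [1..<Suc n]" using TT_leaves[OF pl, of "length us"] len[OF fl] lL by simp
 have TT: "?T \<in> Tr n" using Tl by (simp add: Tr_def)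
 have "Br us vs = subst (%j. Leaf (?L ! (j - 1))) ?T"
  using lay_relabel[OF fl, of "[]" "[]"] by (simp add: TT_def flip: take_map drop_map)
 \<comment> \<open>The action of a permutation relabels leaves by its inverse, so the double inverse
   exhibits the tree as the result of acting by \<open>inv \<pi>\<close>.\<close>
 also have "\<dots> = subst (%j. Leaf (inv (inv \<pi>) j)) ?T"
 proof (rule subst_cong)
  fix a assume "a \<in> set (leaves ?T)"
  then have a: "1 \<le> a" "a \<le> n" unfolding Tl by auto
  then show "Leaf (?L ! (a - 1)) = Leaf (inv (inv \<pi>) a)" using Lk[of "a - 1"] by (simp add: inv_inv_eq[OF permutes_bij[OF p]])
 qed
 finally have "\<tau> n (Br us vs) = oact P n (inv \<pi>) (\<tau> n ?T)" using \<tau>_act[OF TT permutes_inv[OF p]] by simp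
 moreover have "as = lperm (inv \<pi>) (lperm \<pi> as)" using lperm_inv'[of \<pi> as] p wordsD(1)[OF as] by simp
 ultimately have "fop P V (\<tau> n (Br us vs)) as = fop P V (\<tau> n ?T) (lperm \<pi> as)"
  using fop_act[OF \<tau>_car[OF TT] permutes_inv[OF p] words_lperm[OF as p]] by simp
 also have "lperm \<pi> as = map (%i. as ! (i - 1)) ?L"
 proof (rule nth_equalityI)
  fix k assume "k < length (lperm \<pi> as)"
  then have k: "k < n" using wordsD(1)[OF as] by simp
  then have "map (%i. as ! (i - 1)) ?L ! k = as ! (?L ! k - 1)" by (intro nth_map) (simp only: lL)
  then show "lperm \<pi> as ! k = map (%i. as ! (i - 1)) ?L ! k"
   using Lk[OF k] nth_lperm[of k as \<pi>] k wordsD(1)[OF as] by (simp only:)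
 qed (simp only: length_lperm length_map lL wordsD(1)[OF as])
 also have "\<dots> = concat (map snd (map (%u. (std u, map (%i. as ! (i - 1)) (leaves u))) (us @ vs)))"
  by (simp add: map_concat comp_def)
 also have "fop P V (\<tau> n ?T) \<dots> = fop P V (cc (length us) (length vs)) (map (eva as) (us @ vs))"
 proof -
  let ?css = "map (%u. (std u, map (%i. as ! (i - 1)) (leaves u))) (us @ vs)"
  have w: "map (%i. as ! (i - 1)) (leaves u) \<in> words F (length (leaves (std u)))" if u: "u \<in> set (us @ vs)" for u
  proof -
   have "set (leaves u) \<subseteq> set (leaves (Br us vs))" using u by auto
   then have "1 \<le> i \<and> i \<le> n" if "i \<in> set (leaves u)" for i using Tr_ge[OF t, of i] that by blast
   then have "as ! (i - 1) \<in> car F" if "i \<in> set (leaves u)" for i using words_nth[OF as, of "i - 1"] that by fastforce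
   then show ?thesis using fl u by (auto simp: words_def flat_std(2))
  qed
  have c: "\<forall>(s, bs)\<in>set ?css. planar s \<and> bs \<in> words F (length (leaves s))"
   using w pl by (auto simp del: upt_Suc)
  have "length (concat (map snd ?css)) = n" using lL by (simp add: comp_def length_concat)
  moreover have "map fst ?css = map std (us @ vs)" by simp
  moreover have "map (%(s, bs). fop P V (\<tau>l s) bs) ?css = map (eva as) (us @ vs)" by (simp add: eva_def)
  ultimately show ?thesis using fop_lay[of "length us" "length vs" "[]" ?css, OF _ _ c] by (simp only: list.size length_map length_append add_0 append_Nil replicate_0 set_simps empty_subsetI)
 qed
 finally show ?thesis .
qed

lemma eva_Leaf: "as ! (i - 1) \<in> car F ==> eva as (Leaf i) = as ! (i - 1)"
 using \<tau>_Leaf fop_unit by (simp add: eva_def)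

lemma eva_Br: "eva as (Br (map Leaf is) (map Leaf js)) = fop P V (cc (length is) (length js)) (map (%i. as ! (i - 1)) is @ map (%i. as ! (i - 1)) js)"
proof -
 have "leaves (Br (map Leaf is) (map Leaf js)) = is @ js" by (simp only: leaves.simps concat_leaves_Leaf)
 then show ?thesis by (simp add: eva_def cc_\<tau> corolla_leaves del: upt_Suc leaves.simps)
qed

text \<open>By \<open>pp\<close> the list \<open>zs\<close> is one of the two groups of arguments,
  so the induced block permutation preserves the first \<open>k\<close> inputs and
  \<open>cc_sym\<close> applies.\<close>

lemma fop_cc_sym1:
 assumes m: "mset zs = mset zs'" and as: "set (pre @ zs @ post) \<subseteq> car F" and kl: "k + l = length (pre @ zs @ post)"
  and pp: "pre = [] \<and> length zs = k \<or> post = [] \<and> length pre = k"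
 shows "fop P V (cc k l) (pre @ zs @ post) = fop P V (cc k l) (pre @ zs' @ post)"
proof -
 obtain \<sigma> where s: "\<sigma> permutes {1..length zs}" and z: "lperm \<sigma> zs = zs'" using mset_eq_lperm[OF m[symmetric]] by auto
 let ?r = "pcomp (Suc (length pre + length post)) (length zs) (Suc (length pre)) id \<sigma>"
 have r: "?r permutes {1..k + l}" using pcomp_permutes[OF _ _ permutes_id s, of "Suc (length pre)" "Suc (length pre + length post)"] kl by (simp add: ac_simps)
 have e: "lperm ?r (pre @ zs @ post) = pre @ zs' @ post"
  using lperm_ins[of "Suc (length pre)" "pre @ undefined # post" id \<sigma> zs] s z by (simp add: ins_def permutes_id)
 have "?r ` {1..k} = {1..k}"
  using pp
 proof
  assume "pre = [] \<and> length zs = k"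
  then have "?r ` {1..k} = \<sigma> ` {1..k}" by (intro image_cong) (auto simp: pcomp_def)
  then show ?thesis using permutes_image[OF s] \<open>pre = [] \<and> length zs = k\<close> by simp
 next
  assume "post = [] \<and> length pre = k"
  then have "?r ` {1..k} = id ` {1..k}" by (intro image_cong) (auto simp: pcomp_def)
  then show ?thesis by simp
 qed
 from cc_sym[OF r this] show ?thesis
  using fop_act[OF cc_car r, of "pre @ zs @ post"] as kl unfolding e by (simp add: words_def)
qed

lemma fop_cc_sym:
 assumes "mset xs = mset xs'" "mset ys = mset ys'" "set xs \<subseteq> car F" "set ys \<subseteq> car F"
 shows "fop P V (cc (length xs) (length ys)) (xs @ ys) = fop P V (cc (length xs') (length ys')) (xs' @ ys')"
 using fop_cc_sym1[OF assms(1), of "[]" ys "length xs" "length ys"] fop_cc_sym1[OF assms(2), of xs' "[]" "length xs" "length ys"]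
  assms mset_eq_length[OF assms(1)] mset_eq_length[OF assms(2)] mset_eq_setD[OF assms(1)] by simp

abbreviation "br \<equiv> fbr P V \<theta>"

lemma
 shows br_bihom: "br \<in> bihom (Sym F) (Sym F) F"
  and br_smon: "set xs \<subseteq> car F ==> set ys \<subseteq> car F ==> br (smon F (mset xs)) (smon F (mset ys)) = fop P V (cc (length xs) (length ys)) (xs @ ys)"
proof -
 let ?\<Psi> = "%M N. fop P V (cc (size M) (size N)) (list_of M @ list_of N)"
 have m: "set (list_of M) \<subseteq> car F" if "M \<in> mcar F" for M using that by (simp add: mcar_def)
 have e: "?\<Psi> (mset xs) (mset ys) = fop P V (cc (length xs) (length ys)) (xs @ ys)" if "set xs \<subseteq> car F" "set ys \<subseteq> car F" for xs ys
  using fop_cc_sym[of "list_of (mset xs)" xs "list_of (mset ys)" ys] that by simp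
 have c: "?\<Psi> M N \<in> car F" if "M \<in> mcar F" "N \<in> mcar F" for M N
  by (rule fop_car[OF cc_car]) (use m that in "simp add: words_def mcar_def")
 have l: "symfun F F (%M. ?\<Psi> M N)" if N: "N \<in> mcar F" for N
 proof (rule symfunI[OF c[OF _ N]])
  fix M assume M: "M \<in> mcar F"
  have "(%x. fop P V (cc (Suc (size M)) (size N)) (x # list_of M @ list_of N)) \<in> hom F F"
   using mlin_app[OF vF fop_mlin[OF cc_car], of "[]" "list_of M @ list_of N"] m[OF M] m[OF N] by simp
  then show "(%x. ?\<Psi> (add_mset x M) N) \<in> hom F F"
   by (rule hom_cong) (use e[of "_ # list_of M" "list_of N"] m[OF M] m[OF N] vF in simp_all)
 qed
 have r: "symfun F F (?\<Psi> M)" if M: "M \<in> mcar F" for M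
 proof (rule symfunI[OF c[OF M]])
  fix N assume N: "N \<in> mcar F"
  have "(%x. fop P V (cc (size M) (Suc (size N))) (list_of M @ x # list_of N)) \<in> hom F F"
   by (rule mlin_app[OF vF fop_mlin[OF cc_car]]) (use m[OF M] m[OF N] in simp_all)
  then show "(%x. ?\<Psi> M (add_mset x N)) \<in> hom F F"
   by (rule hom_cong) (use e[of "list_of M" "_ # list_of N"] m[OF M] m[OF N] vF in simp_all)
 qed
 have d: "br = (%a b. lext (scl F) (%M. lext (scl F) (?\<Psi> M) b) a)"
  by (simp add: fun_eq_iff fbr_def cc_def Let_def)
 show "br \<in> bihom (Sym F) (Sym F) F" unfolding d by (rule symfun2(1)[OF vF vF l r])
 show "br (smon F (mset xs)) (smon F (mset ys)) = fop P V (cc (length xs) (length ys)) (xs @ ys)"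
  if "set xs \<subseteq> car F" "set ys \<subseteq> car F"
  using symfun2(2)[OF vF vF l r, of "mset xs" "mset ys"] e[OF that] that unfolding d by (simp add: mcar_def)
qed

sublocale B: bracket F br
 by unfold_locales (rule vF, rule br_bihom)

end

section \<open>The defining relation of the bracket on the free algebra\<close>

context binf_op
begin

text \<open>Tags the inputs up to \<open>h\<close> as letters of the left factor and the later ones
  as letters of the right factor, which matches \<open>block h\<close> with the block values of the
  star product.\<close>

definition "hh h as i = (if i \<le> h then Inl (as ! (i - 1)) else Inr (as ! (i - 1)))"

lemma hh_sides:
 assumes "finite J"
 shows "lefts (image_mset (hh h as) (mset_set J)) = mset (map (%i. as ! (i - 1)) (sorted_list_of_set {i\<in>J. i \<le> h}))"
  and "rights (image_mset (hh h as) (mset_set J)) = mset (map (%i. as ! (i - 1)) (sorted_list_of_set {i\<in>J. h < i}))"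
proof -
 have i: "isl (hh h as i) \<longleftrightarrow> i \<le> h" for i by (simp add: hh_def)
 have m: "mset (sorted_list_of_set A) = mset_set A" for A :: "nat set" by (simp flip: sorted_list_of_mset_set)
 have f: "{i \<in> J. \<not> i \<le> h} = {i \<in> J. h < i}" by auto
 show "lefts (image_mset (hh h as) (mset_set J)) = mset (map (%i. as ! (i - 1)) (sorted_list_of_set {i\<in>J. i \<le> h}))"
  unfolding lefts_def filter_mset_image_mset comp_def i filter_mset_mset_set[OF assms] mset_map m multiset.map_comp
  by (rule image_mset_cong) (use assms in "auto simp: hh_def")
 show "rights (image_mset (hh h as) (mset_set J)) = mset (map (%i. as ! (i - 1)) (sorted_list_of_set {i\<in>J. h < i}))"
  unfolding rights_def filter_mset_image_mset comp_def i filter_mset_mset_set[OF assms] mset_map m multiset.map_comp f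
  by (rule image_mset_cong) (use assms in "auto simp: hh_def")
qed

lemma block_eval:
 assumes J: "J \<subseteq> {1..n}" and as: "as \<in> words F n"
 shows "eva as (block h J) = br (smon F (lefts (image_mset (hh h as) (mset_set J)))) (smon F (rights (image_mset (hh h as) (mset_set J))))"
proof -
 have fin: "finite J" using J finite_subset by blast
 have w: "set (map (%i. as ! (i - 1)) (sorted_list_of_set A)) \<subseteq> car F" if "A \<subseteq> J" for A
 proof -
  have "as ! (i - 1) \<in> car F" if "i \<in> A" for i
  proof (rule words_nth[OF as])
   show "i - 1 < n" using J \<open>A \<subseteq> J\<close> that by force
  qed
  moreover have "finite A" using that fin finite_subset by blast
  ultimately show ?thesis by auto
 qed
 show ?thesis
  unfolding hh_sides[OF fin] block_def eva_Br
  by (subst br_smon) (use w[of "{i\<in>J. i \<le> h}"] w[of "{i\<in>J. h < i}"] in auto)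
qed

lemma flat_block: "flat (block h J)"
 by (auto simp: flat_def block_def)

lemma flat_Leaf: "flat (Leaf i)"
 by (auto simp: flat_def)

text \<open>By \<open>block_eval\<close> a block evaluates to the bracket of its left and right
  letters, so the sum over partitions is the exponential of the bracket, that is, a star
  product.\<close>

lemma part_sum:
 assumes I: "I \<subseteq> {1..n}" and as: "as \<in> words F n"
 shows "(\<Sum>\<pi> | partition_on I \<pi>. smon F (mset (map (%J. eva as (block h J)) (list_of (mset_set \<pi>))))) =
  B.St (lefts (image_mset (hh h as) (mset_set I))) (rights (image_mset (hh h as) (mset_set I)))"
  and "partition_on I \<pi> ==> set (map (%J. eva as (block h J)) (list_of (mset_set \<pi>))) \<subseteq> car F"
proof -
 have fin: "finite I" using I finite_subset by blast
 have hc: "hh h as ` I \<subseteq> lrcar F"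
 proof (rule image_subsetI)
  fix i assume "i \<in> I"
  then have "i - 1 < n" using I by force
  from words_nth[OF as this] show "hh h as i \<in> lrcar F" by (simp add: hh_def lrcar_def)
 qed
 have J: "J \<subseteq> {1..n}" "finite J" if "partition_on I \<pi>" "J \<in> \<pi>" for \<pi> J
 proof -
  have "J \<subseteq> I" using partition_onD1[OF that(1)] that(2) by blast
  then show "J \<subseteq> {1..n}" "finite J" using I fin by (blast, metis finite_subset)
 qed
 have fp: "finite \<pi>" if "partition_on I \<pi>" for \<pi> by (rule finite_elements[OF fin that])
 have sub: "set_mset (image_mset (hh h as) (mset_set J)) \<subseteq> lrcar F" if "J \<subseteq> I" for J
  using hc that finite_subset[OF that fin] by auto
 have c: "eva as (block h J) \<in> car F" if "partition_on I \<pi>" "J \<in> \<pi>" for \<pi> J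
  unfolding block_eval[OF J(1)[OF that] as]
  by (intro B.br_car smon_car) (use lrcar_lr[OF sub, of J] partition_onD1[OF that(1)] that(2) in blast)+
 show "(\<Sum>\<pi> | partition_on I \<pi>. smon F (mset (map (%J. eva as (block h J)) (list_of (mset_set \<pi>))))) =
  B.St (lefts (image_mset (hh h as) (mset_set I))) (rights (image_mset (hh h as) (mset_set I)))"
  unfolding B.partition_sum_St[OF fin hc, symmetric]
 proof (rule sum.cong[OF refl])
  fix \<pi> assume "\<pi> \<in> {\<pi>. partition_on I \<pi>}"
  then have p: "partition_on I \<pi>" by simp
  have "mset (map (%J. eva as (block h J)) (list_of (mset_set \<pi>))) = image_mset (%J. eva as (block h J)) (mset_set \<pi>)" by simp
  also have "\<dots> = image_mset (%J. br (smon F (lefts (image_mset (hh h as) (mset_set J)))) (smon F (rights (image_mset (hh h as) (mset_set J))))) (mset_set \<pi>)"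
   by (rule image_mset_cong) (use block_eval[OF J(1)[OF p] as] fp[OF p] in simp)
  finally show "smon F (mset (map (%J. eva as (block h J)) (list_of (mset_set \<pi>)))) =
   smon F (image_mset (%J. br (smon F (lefts (image_mset (hh h as) (mset_set J)))) (smon F (rights (image_mset (hh h as) (mset_set J))))) (mset_set \<pi>))"
   by (rule arg_cong)
 qed
 show "set (map (%J. eva as (block h J)) (list_of (mset_set \<pi>))) \<subseteq> car F" if "partition_on I \<pi>"
  using c[OF that] fp[OF that] by auto
qed

lemma finite_partitions: "finite A ==> finite {\<pi>. partition_on A \<pi>}"
 by (rule finite_subset[of _ "Pow (Pow A)"]) (auto dest: partition_onD1)

lemma nths_as:
 assumes "length xs = a"
 shows "map (%i. (xs @ ys @ zs) ! (i - 1)) [Suc a..<Suc (a + length ys)] = ys"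
 by (rule nth_equalityI) (simp_all add: assms nth_append del: upt_Suc)

lemma mset_map_as:
 assumes "length xs = a"
 shows "image_mset (%i. (xs @ ys @ zs) ! (i - 1)) (mset_set {Suc a..a + length ys}) = mset ys"
proof -
 have "mset_set {Suc a..a + length ys} = mset [Suc a..<Suc (a + length ys)]" by (metis atLeastLessThanSuc_atLeastAtMost mset_upt)
 then show ?thesis using nths_as[OF assms, of ys zs] by (metis mset_map)
qed

lemma hh_interval:
 assumes "length xs = a"
 shows "lefts (image_mset (hh (a + length ys) (xs @ ys @ zs @ us)) (mset_set {Suc a..a + length ys + length zs})) = mset ys"
  and "rights (image_mset (hh (a + length ys) (xs @ ys @ zs @ us)) (mset_set {Suc a..a + length ys + length zs})) = mset zs"
proof -
 have m: "mset (sorted_list_of_set A) = mset_set A" for A :: "nat set" by (simp flip: sorted_list_of_mset_set)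
 have e: "{i \<in> {Suc a..a + length ys + length zs}. i \<le> a + length ys} = {Suc a..a + length ys}"
  "{i \<in> {Suc a..a + length ys + length zs}. a + length ys < i} = {Suc (a + length ys)..a + length ys + length zs}" by auto
 show "lefts (image_mset (hh (a + length ys) (xs @ ys @ zs @ us)) (mset_set {Suc a..a + length ys + length zs})) = mset ys"
  unfolding hh_sides[OF finite_atLeastAtMost] e mset_map m by (rule mset_map_as[OF assms])
 show "rights (image_mset (hh (a + length ys) (xs @ ys @ zs @ us)) (mset_set {Suc a..a + length ys + length zs})) = mset zs"
  unfolding hh_sides[OF finite_atLeastAtMost] e mset_map m
  using mset_map_as[of "xs @ ys" "a + length ys" zs us] assms by simp
qed

text \<open>Both sides are values at \<open>xs @ ys @ zs\<close> of the two sums of trees in the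
  relation of the operad. Blocks on the left separate \<open>xs\<close> from \<open>ys\<close>,
  those on the right \<open>ys\<close> from \<open>zs\<close>.\<close>

lemma assoc_smon:
 assumes xs: "set xs \<subseteq> car F" and ys: "set ys \<subseteq> car F" and zs: "set zs \<subseteq> car F"
 shows "br (star F br (smon F (mset xs)) (smon F (mset ys))) (smon F (mset zs)) =
  br (smon F (mset xs)) (star F br (smon F (mset ys)) (smon F (mset zs)))"
proof -
 let ?k = "length xs" and ?l = "length ys" and ?m = "length zs" and ?as = "xs @ ys @ zs"
 let ?n = "?k + ?l + ?m" and ?P = "{\<pi>. partition_on {1..length xs + length ys} \<pi>}"
  and ?R = "{\<pi>. partition_on {Suc (length xs)..length xs + length ys + length zs} \<pi>}"
 have as: "?as \<in> words F ?n" using xs ys zs by (simp add: words_def)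
 have mc: "mset xs \<in> mcar F" "mset ys \<in> mcar F" "mset zs \<in> mcar F" using xs ys zs by (simp_all add: mcar_def)
 note sc = mc[THEN smon_car]
 have I: "{1..?k + ?l} \<subseteq> {1..?n}" "{Suc ?k..?k + ?l + ?m} \<subseteq> {1..?n}" by auto
 note P1 = part_sum[OF I(1) as, where h = ?k] and P2 = part_sum[OF I(2) as, where h = "?k + ?l"]
 have h1: "B.St (lefts (image_mset (hh ?k ?as) (mset_set {1..?k + ?l}))) (rights (image_mset (hh ?k ?as) (mset_set {1..?k + ?l}))) = B.St (mset xs) (mset ys)"
  using hh_interval[of "[]" 0 xs ys zs] by simp
 have h2: "B.St (lefts (image_mset (hh (?k + ?l) ?as) (mset_set {Suc ?k..?k + ?l + ?m}))) (rights (image_mset (hh (?k + ?l) ?as) (mset_set {Suc ?k..?k + ?l + ?m}))) = B.St (mset ys) (mset zs)"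
  using hh_interval[of xs ?k ys zs "[]"] by simp
 let ?e1 = "%\<pi>. map (%J. eva ?as (block ?k J)) (list_of (mset_set \<pi>))"
 let ?e2 = "%\<pi>. map (%J. eva ?as (block (?k + ?l) J)) (list_of (mset_set \<pi>))"
 let ?t1 = "%\<pi>. Br (map (block ?k) (list_of (mset_set \<pi>))) (map Leaf [Suc (?k + ?l)..<Suc (?k + ?l + ?m)])"
 let ?t2 = "%\<pi>. Br (map Leaf [1..<Suc ?k]) (map (block (?k + ?l)) (list_of (mset_set \<pi>)))"
 have lf: "map (eva ?as) (map Leaf [Suc a..<Suc b]) = map (%i. ?as ! (i - 1)) [Suc a..<Suc b]" if "b \<le> ?n" for a b
  unfolding map_map
 proof (rule map_cong[OF refl])
  fix i assume "i \<in> set [Suc a..<Suc b]"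
  then have "i - 1 < ?n" using that by auto
  then show "(eva ?as \<circ> Leaf) i = ?as ! (i - 1)" using eva_Leaf[OF words_nth[OF as]] by simp
 qed
 have lz: "map (eva ?as) (map Leaf [Suc (?k + ?l)..<Suc (?k + ?l + ?m)]) = zs"
  unfolding lf[OF order_refl] using nths_as[of "xs @ ys" "?k + ?l" zs "[]"] by (simp del: upt_Suc)
 have lx: "map (eva ?as) (map Leaf [1..<Suc ?k]) = xs"
 proof -
  have "map (%i. ?as ! (i - 1)) [Suc 0..<Suc ?k] = xs" using nths_as[of "[]" 0 xs "ys @ zs"] by (simp only: append_Nil add_0 list.size simp_thms)
  then show ?thesis using lf[of ?k 0] by (simp only: One_nat_def le_add1 add.assoc simp_thms)
 qed
 have T1: "fop P V (\<tau> ?n (?t1 \<pi>)) ?as = br (smon F (mset (?e1 \<pi>))) (smon F (mset zs))" if p: "partition_on {1..?k + ?l} \<pi>" for \<pi>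
 proof -
  have "fop P V (\<tau> ?n (?t1 \<pi>)) ?as = fop P V (cc (length (?e1 \<pi>)) ?m) (?e1 \<pi> @ map (eva ?as) (map Leaf [Suc (?k + ?l)..<Suc (?k + ?l + ?m)]))"
   using fop_tree[OF assoc_trees_Tr(1)[OF refl p] _ as] flat_block flat_Leaf by (auto simp: comp_def simp del: upt_Suc)
  then show ?thesis unfolding lz br_smon[OF P1(2)[OF p] zs] .
 qed
 have T2: "fop P V (\<tau> ?n (?t2 \<pi>)) ?as = br (smon F (mset xs)) (smon F (mset (?e2 \<pi>)))" if p: "partition_on {Suc ?k..?k + ?l + ?m} \<pi>" for \<pi>
 proof -
  have "fop P V (\<tau> ?n (?t2 \<pi>)) ?as = fop P V (cc ?k (length (?e2 \<pi>))) (map (eva ?as) (map Leaf [1..<Suc ?k]) @ ?e2 \<pi>)"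
   using fop_tree[OF assoc_trees_Tr(2)[OF refl p] _ as] flat_block flat_Leaf by (auto simp: comp_def simp del: upt_Suc)
  then show ?thesis unfolding lx br_smon[OF xs P2(2)[OF p]] .
 qed
 have hs: "fop P V (sum g A) ?as = (\<Sum>i\<in>A. fop P V (g i) ?as)" if "!!i. i \<in> A ==> g i \<in> car (ocar P ?n)" for g and A :: "nat set set set"
  by (rule hom_sum[OF fop_hom[OF as] vP that])
 have smc: "smon F (mset es) \<in> car (Sym F)" if "set es \<subseteq> car F" for es using that by (intro smon_car) (simp add: mcar_def)
 have "br (star F br (smon F (mset xs)) (smon F (mset ys))) (smon F (mset zs)) = br (\<Sum>\<pi>\<in>?P. smon F (mset (?e1 \<pi>))) (smon F (mset zs))"
  unfolding B.star_smon[OF mc(1,2)] P1(1) h1 ..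
 also have "\<dots> = (\<Sum>\<pi>\<in>?P. br (smon F (mset (?e1 \<pi>))) (smon F (mset zs)))"
  by (rule hom_sum[OF bihom_left[OF br_bihom sc(3)] vspace_Sym], rule smc, rule P1(2)) (erule CollectD)
 also have "\<dots> = (\<Sum>\<pi>\<in>?P. fop P V (\<tau> ?n (?t1 \<pi>)) ?as)"
  by (rule sum.cong[OF refl], rule T1[symmetric]) (erule CollectD)
 also have "\<dots> = fop P V (\<Sum>\<pi>\<in>?P. \<tau> ?n (?t1 \<pi>)) ?as"
  by (rule hs[symmetric], rule \<tau>_car, rule assoc_trees_Tr(1)[OF refl]) (erule CollectD)
 also have "\<dots> = fop P V (\<Sum>\<pi>\<in>?R. \<tau> ?n (?t2 \<pi>)) ?as"
  by (simp only: \<tau>_assoc[OF refl])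
 also have "\<dots> = (\<Sum>\<pi>\<in>?R. fop P V (\<tau> ?n (?t2 \<pi>)) ?as)"
  by (rule hs, rule \<tau>_car, rule assoc_trees_Tr(2)[OF refl]) (erule CollectD)
 also have "\<dots> = (\<Sum>\<pi>\<in>?R. br (smon F (mset xs)) (smon F (mset (?e2 \<pi>))))"
  by (rule sum.cong[OF refl], rule T2) (erule CollectD)
 also have "\<dots> = br (smon F (mset xs)) (\<Sum>\<pi>\<in>?R. smon F (mset (?e2 \<pi>)))"
  by (rule hom_sum[OF bihom_right[OF br_bihom sc(1)] vspace_Sym, symmetric], rule smc, rule P2(2)) (erule CollectD)
 also have "\<dots> = br (smon F (mset xs)) (star F br (smon F (mset ys)) (smon F (mset zs)))"
  unfolding B.star_smon[OF mc(2,3)] P2(1) h2 ..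
 finally show ?thesis .
qed

lemma Sym_eqI:
 assumes "f \<in> hom (Sym F) C" "g \<in> hom (Sym F) C" "!!xs. set xs \<subseteq> car F ==> f (smon F (mset xs)) = g (smon F (mset xs))" "a \<in> car (Sym F)"
 shows "f a = g a"
proof (rule Sym_hom_eqI[OF vF assms(1,2) _ assms(4)])
 fix M assume "M \<in> mcar F"
 then show "f (smon F M) = g (smon F M)" using assms(3)[of "list_of M"] by (simp add: mcar_def)
qed

lemma smc: "set es \<subseteq> car F ==> smon F (mset es) \<in> car (Sym F)"
 by (intro smon_car) (simp add: mcar_def)

sublocale A: binf_alg F br
proof
 note bl = bihom_left[OF br_bihom] and bR = bihom_right[OF br_bihom]
  and sl = bihom_left[OF B.star_bihom] and sR = bihom_right[OF B.star_bihom]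
 show "br (sone F) (smon F {#x#}) = x \<and> br (smon F {#x#}) (sone F) = x" if "x \<in> car F" for x
  using br_smon[of "[]" "[x]"] br_smon[of "[x]" "[]"] cc_unit fop_unit[OF that] that by (simp add: sone_def)
 show "br (sone F) (smon F M) = 0 \<and> br (smon F M) (sone F) = 0" if M: "M \<in> mcar F" "size M \<noteq> 1" for M
 proof -
  have m: "set (list_of M) \<subseteq> car F" using M by (simp add: mcar_def)
  then have "fop P V 0 (list_of M) = 0" by (intro hom_0[OF fop_hom vP]) (simp add: words_def)
  then show ?thesis using br_smon[of "[]" "list_of M"] br_smon[of "list_of M" "[]"] cc_other[OF M(2)] m by (simp add: sone_def)
 qed
 fix u v w assume u: "u \<in> car (Sym F)" and v: "v \<in> car (Sym F)" and w: "w \<in> car (Sym F)"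
 show "br (star F br u v) w = br u (star F br v w)"
 proof (rule Sym_eqI[OF hom_comp[OF bl[OF w] sl[OF v]] bl[OF B.star_car[OF v w]] _ u])
  fix xs assume xs: "set xs \<subseteq> car F"
  show "br (star F br (smon F (mset xs)) v) w = br (smon F (mset xs)) (star F br v w)"
  proof (rule Sym_eqI[OF hom_comp[OF bl[OF w] sR[OF smc[OF xs]]] hom_comp[OF bR[OF smc[OF xs]] sl[OF w]] _ v])
   fix ys assume ys: "set ys \<subseteq> car F"
   show "br (star F br (smon F (mset xs)) (smon F (mset ys))) w = br (smon F (mset xs)) (star F br (smon F (mset ys)) w)"
    by (rule Sym_eqI[OF bR[OF B.star_car[OF smc[OF xs] smc[OF ys]]] hom_comp[OF bR[OF smc[OF xs]] sR[OF smc[OF ys]]] assoc_smon[OF xs ys] w])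
  qed
 qed
qed

text \<open>On monomials the bracket is an operation of the operad, so \<open>fact_fop\<close>
  applies; its Leibniz sum splits into the two groups of arguments.\<close>

lemma fact_br:
 assumes w: "w \<in> car W" and a: "a \<in> car (Sym F)" and c: "c \<in> car (Sym F)"
 shows "fact P V (br a c) w = br (DD F (%x. fact P V x w) a) c + br a (DD F (%x. fact P V x w) c)"
proof -
 let ?D = "%x. fact P V x w"
 note D = bihom_left[OF fact_bihom w] and bl = bihom_left[OF br_bihom] and bR = bihom_right[OF br_bihom]
 note DD = DD_hom[OF vF D] and DDc = hom_car[OF DD_hom[OF vF D]]
 have dd: "DD F ?D (smon F (mset xs)) = (\<Sum>i<length xs. smon F (mset (xs[i := ?D (xs ! i)])))" if "set xs \<subseteq> car F" for xs
  using DD_smon[OF vF D, of "mset xs"] that sum_list_update[of "smon F" xs ?D] by (simp add: mcar_def)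
 have up: "set (xs[i := ?D (xs ! i)]) \<subseteq> car F" if "set xs \<subseteq> car F" "i < length xs" for xs i
  using words_update[of xs F "length xs" "?D (xs ! i)" i] hom_car[OF D, of "xs ! i"] that nth_mem[of i xs] by (auto simp: words_def simp del: nth_mem)
 show ?thesis
 proof (rule Sym_eqI[OF hom_comp[OF D bl[OF c]] hom_plus[OF vF hom_comp[OF bl[OF c] DD] bl[OF DDc[OF c]]] _ a])
  fix xs assume xs: "set xs \<subseteq> car F"
  note sx = smc[OF xs]
  show "?D (br (smon F (mset xs)) c) = br (DD F ?D (smon F (mset xs))) c + br (smon F (mset xs)) (DD F ?D c)"
  proof (rule Sym_eqI[OF hom_comp[OF D bR[OF sx]] hom_plus[OF vF bR[OF DDc[OF sx]] hom_comp[OF bR[OF sx] DD]] _ c])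
   fix ys assume ys: "set ys \<subseteq> car F"
   note sy = smc[OF ys]
   let ?c = "cc (length xs) (length ys)"
   have "br (DD F ?D (smon F (mset xs))) (smon F (mset ys)) = (\<Sum>i<length xs. br (smon F (mset (xs[i := ?D (xs ! i)]))) (smon F (mset ys)))"
    unfolding dd[OF xs] by (rule hom_sum[OF bl[OF sy] vspace_Sym], rule smc, rule up[OF xs]) simp
   also have "\<dots> = dsl ?D (%xs. fop P V ?c (xs @ ys)) xs"
    unfolding dsl_def by (rule sum.cong[OF refl]) (use br_smon[OF up[OF xs] ys] in simp)
   finally have 1: "br (DD F ?D (smon F (mset xs))) (smon F (mset ys)) = dsl ?D (%xs. fop P V ?c (xs @ ys)) xs" .
   have "br (smon F (mset xs)) (DD F ?D (smon F (mset ys))) = (\<Sum>i<length ys. br (smon F (mset xs)) (smon F (mset (ys[i := ?D (ys ! i)]))))"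
    unfolding dd[OF ys] by (rule hom_sum[OF bR[OF sx] vspace_Sym], rule smc, rule up[OF ys]) simp
   also have "\<dots> = dsl ?D (%ys. fop P V ?c (xs @ ys)) ys"
    unfolding dsl_def by (rule sum.cong[OF refl]) (use br_smon[OF xs up[OF ys]] in simp)
   finally have 2: "br (smon F (mset xs)) (DD F ?D (smon F (mset ys))) = dsl ?D (%ys. fop P V ?c (xs @ ys)) ys" .
   show "?D (br (smon F (mset xs)) (smon F (mset ys))) = br (DD F ?D (smon F (mset xs))) (smon F (mset ys)) + br (smon F (mset xs)) (DD F ?D (smon F (mset ys)))"
    unfolding 1 2 br_smon[OF xs ys] dsl_append[symmetric]
    by (rule fact_fop[OF cc_car _ w]) (use xs ys in "simp add: words_def")
  qed
 qed
qed

section \<open>The action on the symmetric algebra and its interaction with the star product\<close>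

lemma der_act_eq: "der_act P V a w = DD F (%x. fact P V x w) a"
 unfolding der_act_def DD_def Let_def
 by (rule lext_cong) (use sum_list_update[of "smon F" "list_of _" "%x. fact P V x w"] in simp)

text \<open>The module action \<open>act\<close> on \<open>Sym F\<close>, with \<open>W\<close>
  acting by derivations, is a witness for the choice defining \<open>D_act\<close>.\<close>

lemma D_act_spec:
 "right_action (Sym F) (D_bialg P V) (D_act P V) \<and>
  (\<forall>a\<in>car (Sym F). \<forall>w\<in>car W. D_act P V a (smon W {#w#}) = der_act P V a w)"
proof -
 interpret D: prelie_module W "Sym F" "coinv_prod Q" "%U y. DD F (%x. fact P V x y) U"
  by (rule prelie_module.DD_module[OF fact_module])
 have "D.act a (smon W {#w#}) = der_act P V a w" if "a \<in> car (Sym F)" "w \<in> car W" for a w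
  using D.act_smon[of a "{#w#}"] D.gm_add[of a w "{#}"] that by (simp add: der_act_eq)
 moreover have "right_action (Sym F) (D_bialg P V) D.act"
  using D.act_right_action by (simp add: D_bialg_def Let_def)
 ultimately have "\<exists>act. right_action (Sym F) (D_bialg P V) act \<and> (\<forall>a\<in>car (Sym F). \<forall>w\<in>car W. act a (smon W {#w#}) = der_act P V a w)"
  by blast
 from someI_ex[OF this] show ?thesis unfolding D_act_def Let_def .
qed

lemma free_alg_interaction: "binf_algebra F br \<and> in_interaction (A_bialg P V \<theta>) (D_bialg P V) (D_act P V)"
proof
 show "binf_algebra F br"
  unfolding binf_algebra_def using vF br_bihom A.unit_one A.unit_other A.assoc by (simp add: mcar_def)
 show "in_interaction (A_bialg P V \<theta>) (D_bialg P V) (D_act P V)"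
  unfolding A_bialg_def D_bialg_def Let_def
  by (rule A.interaction[OF fact_module fact_br])
   (use D_act_spec in "simp_all add: D_bialg_def Let_def der_act_eq")
qed

end

theorem theorem46:
  fixes P :: "('k::field_char_0, 'p::ab_group_add) operad"
    and V :: "('k, 'v::ab_group_add) vs"
    and \<theta> :: "nat \<Rightarrow> (bterm \<Rightarrow>\<^sub>0 'k) \<Rightarrow> 'p"
  assumes "is_operad P" and "car (ocar P 0) = {0}"
    and "vspace V"
    and "operad_morphism binf P \<theta>"
  shows "binf_algebra (free_alg P V) (fbr P V \<theta>) \<and>
    in_interaction (A_bialg P V \<theta>) (D_bialg P V) (D_act P V)"
proof -
  interpret binf_op P V \<theta> by unfold_locales (fact assms)+
  show ?thesis by (rule free_alg_interaction)
qed

end
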